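(* Let $X$ be a double cover of $\mathbb{P}^{n-1} \times \mathbb{P}^1$ (over $\mathbb{C}$) branched along a very general divisor of bi-degree $(2d,2)$. If $2d \ge n \ge 3$, then $X$ is not stably rational.
   Context: The ground field is $\mathbb{C}$. A variety $X$ of dimension $n$ is stably rational if $X \times \mathbb{P}^m$ is birational to $\mathbb{P}^{n+m}$ for some $m \ge 0$. "Very general" means outside a countable union of proper closed subsets of the parameter space of divisors of bi-degree $(2d,2)$. *)

theory Defs
  imports "HOL-Analysis.Analysis" "HOL-Library.Poly_Mapping" "HOL-Library.Extended_Nat"
begin

text \<open>
  Complex varieties are treated classically, as spaces with functions: the set of closed points
  with its Zariski topology, together with the regular functions on each open set.  The value
  \<open>regular_on X U f\<close> is only meaningful for \<open>U\<close> open, and depends only on the values of \<open>f\<close> on \<open>U\<close>.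
\<close>

record 'a fspace =
  topo :: "'a topology"
  regular_on :: "'a set \<Rightarrow> ('a \<Rightarrow> complex) \<Rightarrow> bool"

abbreviation points :: "('a, 'b) fspace_scheme \<Rightarrow> 'a set"
  where "points X \<equiv> topspace (topo X)"


section \<open>Polynomials and quasi-affine sets\<close>

type_synonym 'v monomial = "'v \<Rightarrow>\<^sub>0 nat"
type_synonym 'v polynomial = "'v monomial \<Rightarrow>\<^sub>0 complex"

definition monomial_value :: "'v monomial \<Rightarrow> ('v \<Rightarrow> complex) \<Rightarrow> complex"
  where "monomial_value m x = (\<Prod>v\<in>Poly_Mapping.keys m. x v ^ Poly_Mapping.lookup m v)"

definition poly_value :: "'v polynomial \<Rightarrow> ('v \<Rightarrow> complex) \<Rightarrow> complex"
  where "poly_value p x =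
    (\<Sum>m\<in>Poly_Mapping.keys p. Poly_Mapping.lookup p m * monomial_value m x)"

definition zariski :: "('v \<Rightarrow> complex) topology"
  where "zariski = topology_generated_by {{x. poly_value p x \<noteq> 0} | p. True}"

lemma topspace_zariski [simp]: "topspace zariski = UNIV"
proof -
  have "poly_value (Poly_Mapping.single 0 1) x = 1" for x :: "'v \<Rightarrow> complex"
    by (simp add: poly_value_def monomial_value_def)
  then have "x \<in> \<Union> {{x. poly_value p x \<noteq> 0} | p. True}" for x :: "'v \<Rightarrow> complex"
    by (metis (mono_tags, lifting) UnionI mem_Collect_eq zero_neq_one)
  then show ?thesis
    unfolding zariski_def topology_generated_by_topspace by blast
qed

text \<open>The affine space with coordinates in \<open>V\<close>: the coordinates outside \<open>V\<close> are set to zero.\<close>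

definition affine_space :: "'v set \<Rightarrow> ('v \<Rightarrow> complex) set"
  where "affine_space V = {x. \<forall>v. v \<notin> V \<longrightarrow> x v = 0}"

text \<open>Intended for sets \<open>Z\<close> that are locally closed in some \<open>affine_space V\<close> with \<open>V\<close> finite.\<close>

definition quasi_affine :: "('v \<Rightarrow> complex) set \<Rightarrow> ('v \<Rightarrow> complex) fspace"
  where "quasi_affine Z =
    \<lparr> topo = subtopology zariski Z,
      regular_on = (\<lambda>U f. \<forall>x\<in>U. \<exists>p q N. openin zariski N \<and> x \<in> N \<and>
        (\<forall>y\<in>N \<inter> U. poly_value q y \<noteq> 0 \<and> f y = poly_value p y / poly_value q y)) \<rparr>"


section \<open>Quotients, open subspaces and products\<close>

definition quotient_topology :: "('a \<Rightarrow> 'b) \<Rightarrow> 'a topology \<Rightarrow> 'b topology"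
  where "quotient_topology \<pi> T =
    topology (\<lambda>U. U \<subseteq> \<pi> ` topspace T \<and> openin T {x \<in> topspace T. \<pi> x \<in> U})"

lemma openin_quotient_topology:
  "openin (quotient_topology \<pi> T) U \<longleftrightarrow>
    U \<subseteq> \<pi> ` topspace T \<and> openin T {x \<in> topspace T. \<pi> x \<in> U}"
proof -
  have "istopology (\<lambda>U. U \<subseteq> \<pi> ` topspace T \<and> openin T {x \<in> topspace T. \<pi> x \<in> U})"
    unfolding istopology_def
  proof (intro conjI allI impI)
    fix S U
    assume S: "S \<subseteq> \<pi> ` topspace T \<and> openin T {x \<in> topspace T. \<pi> x \<in> S}"
      and U: "U \<subseteq> \<pi> ` topspace T \<and> openin T {x \<in> topspace T. \<pi> x \<in> U}"
    show "S \<inter> U \<subseteq> \<pi> ` topspace T" using S by blast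
    have "{x \<in> topspace T. \<pi> x \<in> S \<inter> U} =
        {x \<in> topspace T. \<pi> x \<in> S} \<inter> {x \<in> topspace T. \<pi> x \<in> U}" by blast
    then show "openin T {x \<in> topspace T. \<pi> x \<in> S \<inter> U}"
      using S U by (simp add: openin_Int)
  next
    fix K
    assume K: "\<forall>U\<in>K. U \<subseteq> \<pi> ` topspace T \<and> openin T {x \<in> topspace T. \<pi> x \<in> U}"
    show "\<Union> K \<subseteq> \<pi> ` topspace T" using K by blast
    have "{x \<in> topspace T. \<pi> x \<in> \<Union> K} = (\<Union>U\<in>K. {x \<in> topspace T. \<pi> x \<in> U})" by blast
    then show "openin T {x \<in> topspace T. \<pi> x \<in> \<Union> K}"
      using K by (auto intro: openin_Union)
  qed
  then show ?thesis
    unfolding quotient_topology_def by (rule fun_cong[OF topology_inverse'])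
qed

lemma topspace_quotient_topology [simp]:
  "topspace (quotient_topology \<pi> T) = \<pi> ` topspace T"
proof
  show "topspace (quotient_topology \<pi> T) \<subseteq> \<pi> ` topspace T"
    using openin_topspace[of "quotient_topology \<pi> T"] unfolding openin_quotient_topology by blast
  have "{x \<in> topspace T. \<pi> x \<in> \<pi> ` topspace T} = topspace T" by blast
  then have "openin (quotient_topology \<pi> T) (\<pi> ` topspace T)"
    unfolding openin_quotient_topology by simp
  then show "\<pi> ` topspace T \<subseteq> topspace (quotient_topology \<pi> T)"
    by (rule openin_subset)
qed

text \<open>
  When \<open>\<pi>\<close> is the orbit map of a free torus action with geometric quotient, the following is that
  quotient: its regular functions are the invariant regular functions on \<open>X\<close>.
\<close>

definition quotient_fspace :: "('a \<Rightarrow> 'b) \<Rightarrow> 'a fspace \<Rightarrow> 'b fspace"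
  where "quotient_fspace \<pi> X =
    \<lparr> topo = quotient_topology \<pi> (topo X),
      regular_on = (\<lambda>U f. regular_on X {x \<in> points X. \<pi> x \<in> U} (f \<circ> \<pi>)) \<rparr>"

definition open_subspace :: "'a fspace \<Rightarrow> 'a set \<Rightarrow> 'a fspace"
  where "open_subspace X U = \<lparr> topo = subtopology (topo X) U, regular_on = regular_on X \<rparr>"

text \<open>
  The functions on \<open>U \<times> V\<close> coming from the tensor product of the rings of regular functions on
  \<open>U\<close> and \<open>V\<close>.
\<close>

definition tensor_function ::
    "'a fspace \<Rightarrow> 'b fspace \<Rightarrow> 'a set \<Rightarrow> 'b set \<Rightarrow> ('a \<times> 'b \<Rightarrow> complex) \<Rightarrow> bool"
  where "tensor_function X Y U V h \<longleftrightarrow>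
    (\<exists>(k::nat) f g. (\<forall>i<k. regular_on X U (f i) \<and> regular_on Y V (g i)) \<and>
      h = (\<lambda>(x, y). \<Sum>i<k. f i x * g i y))"

text \<open>
  The product of varieties.  Its topology is finer than the product topology: basic open sets are
  non-vanishing loci of tensor functions, and regular functions are locally quotients of these.
\<close>

definition prod_fspace :: "'a fspace \<Rightarrow> 'b fspace \<Rightarrow> ('a \<times> 'b) fspace"
  where "prod_fspace X Y =
    \<lparr> topo = topology_generated_by
        {{z \<in> U \<times> V. h z \<noteq> 0} | U V h.
          openin (topo X) U \<and> openin (topo Y) V \<and> tensor_function X Y U V h},
      regular_on = (\<lambda>W r. \<forall>w\<in>W. \<exists>U V g h.
        openin (topo X) U \<and> openin (topo Y) V \<and>
        tensor_function X Y U V g \<and> tensor_function X Y U V h \<and>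
        w \<in> U \<times> V \<and> h w \<noteq> 0 \<and>
        (\<forall>z \<in> W \<inter> (U \<times> V). h z \<noteq> 0 \<longrightarrow> r z = g z / h z)) \<rparr>"


section \<open>Birational equivalence, dimension and stable rationality\<close>

definition fspace_iso :: "'a fspace \<Rightarrow> 'b fspace \<Rightarrow> ('a \<Rightarrow> 'b) \<Rightarrow> bool"
  where "fspace_iso X Y \<phi> \<longleftrightarrow>
    homeomorphic_map (topo X) (topo Y) \<phi> \<and>
    (\<forall>U f. openin (topo Y) U \<longrightarrow>
      (regular_on Y U f \<longleftrightarrow> regular_on X {x \<in> points X. \<phi> x \<in> U} (f \<circ> \<phi>)))"

definition birational :: "'a fspace \<Rightarrow> 'b fspace \<Rightarrow> bool"
  where "birational X Y \<longleftrightarrow>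
    (\<exists>U V \<phi>. openin (topo X) U \<and> topo X closure_of U = points X \<and>
      openin (topo Y) V \<and> topo Y closure_of V = points Y \<and>
      fspace_iso (open_subspace X U) (open_subspace Y V) \<phi>)"

definition irreducible_closed :: "'a topology \<Rightarrow> 'a set \<Rightarrow> bool"
  where "irreducible_closed T S \<longleftrightarrow> closedin T S \<and> S \<noteq> {} \<and>
    (\<forall>A B. closedin T A \<and> closedin T B \<and> S \<subseteq> A \<union> B \<longrightarrow> S \<subseteq> A \<or> S \<subseteq> B)"

definition krull_dim :: "'a topology \<Rightarrow> enat"
  where "krull_dim T = Sup {enat k | k. \<exists>Z :: nat \<Rightarrow> 'a set.
    (\<forall>i\<le>k. irreducible_closed T (Z i)) \<and> (\<forall>i<k. Z i \<subset> Z (Suc i))}"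

definition proj_space_on :: "'v set \<Rightarrow> ('v \<Rightarrow> complex) set fspace"
  where "proj_space_on V =
    quotient_fspace (\<lambda>x. {y. \<exists>c. c \<noteq> 0 \<and> y = (\<lambda>v. c * x v)})
      (quasi_affine (affine_space V - {\<lambda>_. 0}))"

abbreviation proj_space :: "nat \<Rightarrow> (nat \<Rightarrow> complex) set fspace"
  where "proj_space m \<equiv> proj_space_on {..m}"

definition stably_rational :: "'a fspace \<Rightarrow> bool"
  where "stably_rational X \<longleftrightarrow>
    (\<exists>n m. krull_dim (topo X) = enat n \<and>
      birational (prod_fspace X (proj_space m)) (proj_space (n + m)))"


section \<open>Very general points\<close>

definition for_very_general :: "'a fspace \<Rightarrow> ('a \<Rightarrow> bool) \<Rightarrow> bool"
  where "for_very_general B P \<longleftrightarrow>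
    (\<exists>C. countable C \<and> (\<forall>Z\<in>C. closedin (topo B) Z \<and> Z \<noteq> points B) \<and>
      (\<forall>b \<in> points B - \<Union>C. P b))"


section \<open>Divisors and double covers of a product of projective spaces\<close>

text \<open>
  \<open>XC i\<close> (\<open>i < n\<close>) and \<open>TC j\<close> (\<open>j < 2\<close>) are homogeneous coordinates on the factors of
  \<open>\<P>\<^sup>n\<^sup>-\<^sup>1 \<times> \<P>\<^sup>1\<close>; \<open>WC\<close> is the fibre coordinate of a line bundle over it.
\<close>

datatype coord = XC nat | TC nat | WC

definition bimonomials :: "nat \<Rightarrow> nat \<Rightarrow> nat \<Rightarrow> coord monomial set"
  where "bimonomials n a b =
    {m. Poly_Mapping.keys m \<subseteq> XC ` {..<n} \<union> TC ` {..<2} \<and>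
        (\<Sum>i<n. Poly_Mapping.lookup m (XC i)) = a \<and>
        (\<Sum>j<2. Poly_Mapping.lookup m (TC j)) = b}"

text \<open>
  The parameter space of divisors of bidegree \<open>(a, b)\<close>.  A point is the set of all nonzero multiples
  of a nonzero bihomogeneous form, given by its coefficients: the set of equations of the divisor.
\<close>

abbreviation divisor_space :: "nat \<Rightarrow> nat \<Rightarrow> nat \<Rightarrow> (coord monomial \<Rightarrow> complex) set fspace"
  where "divisor_space n a b \<equiv> proj_space_on (bimonomials n a b)"

definition form_value ::
    "nat \<Rightarrow> nat \<Rightarrow> nat \<Rightarrow> (coord monomial \<Rightarrow> complex) \<Rightarrow> (coord \<Rightarrow> complex) \<Rightarrow> complex"
  where "form_value n a b F x = (\<Sum>m\<in>bimonomials n a b. F m * monomial_value m x)"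

text \<open>
  The total space of \<open>\<O>(d, 1)\<close> on \<open>\<P>\<^sup>n\<^sup>-\<^sup>1 \<times> \<P>\<^sup>1\<close> is the quotient of the points \<open>(x, t, w)\<close> with \<open>x \<noteq> 0\<close>
  and \<open>t \<noteq> 0\<close> by \<open>(\<lambda>, \<mu>) \<cdot> (x, t, w) = (\<lambda> x, \<mu> t, \<lambda>\<^sup>d \<mu> w)\<close>.
\<close>

definition bundle_cone :: "nat \<Rightarrow> (coord \<Rightarrow> complex) set"
  where "bundle_cone n =
    {x \<in> affine_space (XC ` {..<n} \<union> TC ` {..<2} \<union> {WC}).
      (\<exists>i<n. x (XC i) \<noteq> 0) \<and> (\<exists>j<2. x (TC j) \<noteq> 0)}"

fun torus_act :: "nat \<Rightarrow> complex \<Rightarrow> complex \<Rightarrow> (coord \<Rightarrow> complex) \<Rightarrow> coord \<Rightarrow> complex"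
  where
    "torus_act d l k x (XC i) = l * x (XC i)"
  | "torus_act d l k x (TC j) = k * x (TC j)"
  | "torus_act d l k x WC = l ^ d * k * x WC"

definition torus_orbit :: "nat \<Rightarrow> (coord \<Rightarrow> complex) \<Rightarrow> (coord \<Rightarrow> complex) set"
  where "torus_orbit d x = {torus_act d l k x | l k. l \<noteq> 0 \<and> k \<noteq> 0}"

text \<open>
  The double cover of \<open>\<P>\<^sup>n\<^sup>-\<^sup>1 \<times> \<P>\<^sup>1\<close> branched along the divisor \<open>F = 0\<close> of bidegree \<open>(2d, 2)\<close>: the
  hypersurface \<open>w\<^sup>2 = F\<close> in the total space of \<open>\<O>(d, 1)\<close>, the unique square root of \<open>\<O>(2d, 2)\<close>.
  Rescaling \<open>F\<close> gives an isomorphic cover.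
\<close>

definition double_cover ::
    "nat \<Rightarrow> nat \<Rightarrow> (coord monomial \<Rightarrow> complex) \<Rightarrow> (coord \<Rightarrow> complex) set fspace"
  where "double_cover n d F =
    quotient_fspace (torus_orbit d)
      (quasi_affine {x \<in> bundle_cone n. (x WC)\<^sup>2 = form_value n (2 * d) 2 F x})"

lemma points_proj_space_on:
  "points (proj_space_on V) =
    (\<lambda>x. {\<lambda>v. c * x v | c. c \<noteq> 0}) ` (affine_space V - {\<lambda>_. 0})"
  by (simp add: proj_space_on_def quotient_fspace_def quasi_affine_def)
    (intro image_cong refl, blast)

lemma points_double_cover:
  "points (double_cover n d F) =
    torus_orbit d ` {x \<in> bundle_cone n. (x WC)\<^sup>2 = form_value n (2 * d) 2 F x}"
  by (simp add: double_cover_def quotient_fspace_def quasi_affine_def)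

end

theory Submission
  imports Defs "HOL-Computational_Algebra.Computational_Algebra" "Jordan_Normal_Form.Determinant"
    "HOL-Library.Z2" "HOL-Algebra.Algebraic_Closure_Type"
begin

text \<open>
  The branch form is specialised to characteristic 2, where it becomes
  \<open>B (t\<^sub>0\<^sup>2 + t\<^sub>0 t\<^sub>1) + A t\<^sub>1\<^sup>2\<close> with \<open>B = (\<Prod>x\<^sub>i) x\<^sub>1\<^sup>2\<^sup>d\<^sup>-\<^sup>n\<close> and \<open>A\<close> a sum of \<open>n\<close> monomials
  \<open>x\<^sub>i\<^sup>2\<^sup>d\<^sup>-\<^sup>1 x\<^sub>j\<close>.  The logarithmic form \<open>dlog (x\<^sub>0 / x\<^sub>1) \<and> \<dots> \<and> dlog (x\<^sub>n\<^sub>-\<^sub>1 / x\<^sub>1)\<close> behaves like a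
  regular form on the double cover \<open>w\<^sup>2 = B (t\<^sub>0\<^sup>2 + t\<^sub>0 t\<^sub>1) + A t\<^sub>1\<^sup>2\<close>: differentiating the equation
  shows that its pullback along a rational curve has no poles, so that its value \<open>\<omega>\<close> at a point is
  the same at all points of the curve.

  If the cover over \<open>\<complex>\<close> is stably rational, then a line in projective space joins its generic point
  to a constant point.  The coefficients of a very general form are related by so few equations that
  a place of \<open>\<complex>\<close> maps them to the form above.  Under the Gauss extension of this place, the image of
  the line in the cover degenerates to a chain of rational curves, one for each slope of a Newton
  polygon.  So \<open>\<omega>\<close> has the same value at a generic point, where it does not vanish, and at a constant
  point, where all derivatives vanish.
\<close>

no_notation Polynomials.polynomial (\<open>polynomial\<index>\<close>)
no_notation Polynomials.var (\<open>X\<index>\<close>)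
hide_const (open) up_ring.coeff up_ring.monom Polynomials.degree Polynomials.lead_coeff
  Divisibility.irreducible Divisibility.prime Polynomials.polynomial Polynomials.var
hide_fact (open) Divisibility.irreducible_def Divisibility.irreducibleI Divisibility.irreducibleD

section \<open>Derivations and the exponents of the reduced form\<close>

text \<open>The reduced cover is singular, and no resolution of it is constructed: regularity of the
  form is only tested at one prime element at a time. The form has logarithmic poles along every
  \<open>x i = 0\<close>. On a curve they cancel because, in characteristic 2, the squares of
  \<open>w\<close>, \<open>t0\<close> and \<open>t1\<close> are constants of every derivation. The
  leading terms of the equation at a prime then give a linear relation among the dlog of the
  \<open>x i\<close> alone, and this relation annihilates the residue. The product
  \<open>t0 * t1\<close> is not a square and must stay out of the leading terms, which is why the
  exponent of B is interior to the simplex of the exponents of A. The same product keeps the form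
  from being a square and lets \<open>t0\<close> be solved for by an Artin-Schreier series. The
  degree \<open>2 * d - n\<close> left over in B is put on \<open>x 1\<close>. Its positivity
  matters only for n = 3, where it follows from parity. The form and the maps of a birational
  equivalence have coefficients in a countable field, so a point generic over that field is an
  ordinary complex point at which the maps can be evaluated.\<close>

definition derivation :: "('r::comm_ring_1 \<Rightarrow> 'r) \<Rightarrow> bool"
  where "derivation D \<longleftrightarrow> (\<forall>x y. D (x + y) = D x + D y) \<and> (\<forall>x y. D (x * y) = D x * y + x * D y)"

lemma derivation_add: "derivation D \<Longrightarrow> D (x + y) = D x + D y"
  and derivation_mult: "derivation D \<Longrightarrow> D (x * y) = D x * y + x * D y"
  by (simp_all add: derivation_def)

lemma derivation_0: assumes "derivation D" shows "D 0 = 0"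
  using derivation_add[OF assms, of 0 0] by simp

lemma derivation_1: assumes "derivation D" shows "D 1 = 0"
  using derivation_mult[OF assms, of 1 1] by simp

lemma derivation_minus: assumes "derivation D" shows "D (- x) = - D x"
  using derivation_add[OF assms, of x "- x"] derivation_0[OF assms] by (simp add: eq_neg_iff_add_eq_0 add.commute)

lemma derivation_sum: assumes "derivation D" shows "D (\<Sum>i\<in>A. f i) = (\<Sum>i\<in>A. D (f i))"
  by (induction A rule: infinite_finite_induct)
     (simp_all add: derivation_0[OF assms] derivation_add[OF assms])

lemma derivation_power:
  assumes "derivation D" shows "D (x ^ Suc k) = of_nat (Suc k) * x ^ k * D x"
  by (induction k) (simp_all add: derivation_mult[OF assms] algebra_simps)

lemma derivation_power_const:
  assumes "derivation D" "D x = 0" shows "D (x ^ k) = 0"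
  using assms by (cases k) (simp_all add: derivation_1 derivation_power del: power_Suc)

lemma derivation_square_char2:
  assumes "derivation D" "(1::'r::comm_ring_1) + 1 = 0" shows "D (x\<^sup>2 :: 'r) = 0"
proof -
  have "D (x\<^sup>2) = (1 + 1) * (x * D x)"
    by (simp add: power2_eq_square derivation_mult[OF assms(1)] distrib_right mult.commute)
  then show ?thesis using assms(2) by simp
qed

lemma derivation_combination:
  assumes "derivation D" "derivation D'"
  shows "derivation (\<lambda>x. a * D x - b * D' x)"
  using assms unfolding derivation_def by (simp add: algebra_simps)

definition emon :: "nat \<Rightarrow> (nat \<Rightarrow> nat) \<Rightarrow> (nat \<Rightarrow> 'r::comm_ring_1) \<Rightarrow> 'r"
  where "emon n e y = (\<Prod>i<n. y i ^ e i)"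

lemma derivation_prod_others:
  assumes "derivation D" "finite A"
  shows "D (\<Prod>i\<in>A. f i) = (\<Sum>i\<in>A. D (f i) * (\<Prod>j\<in>A - {i}. f j))"
  using assms(2)
proof (induction A rule: finite_induct)
  case empty
  then show ?case by (simp add: derivation_1[OF assms(1)])
next
  case (insert a A)
  have "(\<Sum>i\<in>A. D (f i) * (\<Prod>j\<in>insert a A - {i}. f j)) =
      (\<Sum>i\<in>A. f a * (D (f i) * (\<Prod>j\<in>A - {i}. f j)))"
  proof (rule sum.cong[OF refl])
    fix i assume i: "i \<in> A"
    then have "insert a A - {i} = insert a (A - {i})" using insert by auto
    then have "(\<Prod>j\<in>insert a A - {i}. f j) = f a * (\<Prod>j\<in>A - {i}. f j)"
      using insert by simp
    then show "D (f i) * (\<Prod>j\<in>insert a A - {i}. f j) = f a * (D (f i) * (\<Prod>j\<in>A - {i}. f j))"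
      by (simp add: algebra_simps)
  qed
  moreover have "insert a A - {a} = A" using insert by auto
  ultimately show ?case
    using insert by (simp add: derivation_mult[OF assms(1)] sum_distrib_left)
qed

text \<open>Logarithmic differentiation of a monomial. Both sides carry the factor
  \<open>\<Prod>i<n. y i\<close>, so that no inverses are needed and D (y i) / y i turns into a
  product over the other indices.\<close>

lemma derivation_emon:
  assumes D: "derivation D"
  shows "(\<Prod>i<n. y i) * D (emon n e y) =
    emon n e y * (\<Sum>i<n. of_nat (e i) * D (y i) * (\<Prod>j\<in>{..<n} - {i}. y j))"
proof -
  have "(\<Prod>i<n. y i) * (D (y i ^ e i) * (\<Prod>j\<in>{..<n} - {i}. y j ^ e j)) =
      emon n e y * (of_nat (e i) * D (y i) * (\<Prod>j\<in>{..<n} - {i}. y j))" if i: "i < n" for i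
  proof -
    have 1: "(\<Prod>i<n. y i) = y i * (\<Prod>j\<in>{..<n} - {i}. y j)"
      using i by (simp add: prod.remove)
    have 2: "emon n e y = y i ^ e i * (\<Prod>j\<in>{..<n} - {i}. y j ^ e j)"
      using i by (simp add: emon_def prod.remove)
    have 3: "y i * D (y i ^ e i) = of_nat (e i) * y i ^ e i * D (y i)"
      using D by (cases "e i") (simp_all add: derivation_1 derivation_power algebra_simps del: power_Suc, simp add: algebra_simps)
    have "(\<Prod>i<n. y i) * (D (y i ^ e i) * (\<Prod>j\<in>{..<n} - {i}. y j ^ e j)) =
        (y i * D (y i ^ e i)) * (\<Prod>j\<in>{..<n} - {i}. y j) * (\<Prod>j\<in>{..<n} - {i}. y j ^ e j)"
      unfolding 1 by (simp add: algebra_simps)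
    then show ?thesis unfolding 2 3 by (simp add: algebra_simps)
  qed
  then show ?thesis
    unfolding emon_def[of n e y, THEN arg_cong[of _ _ D]] derivation_prod_others[OF D finite_lessThan]
    by (simp add: sum_distrib_left)
qed

lemma emon_mult: "emon n e (\<lambda>i. x i * y i) = emon n e x * emon n e y"
  by (simp add: emon_def power_mult_distrib prod.distrib)

lemma emon_power: "emon n e (\<lambda>i. x ^ m i) = x ^ (\<Sum>i<n. m i * e i)"
  by (simp add: emon_def power_mult [symmetric] power_sum)

text \<open>
  The exponents of the monomials \<open>x\<^sub>i\<^sup>2\<^sup>d\<^sup>-\<^sup>1 x\<^sub>p\<^sub>(\<^sub>i\<^sub>)\<close> for \<open>i < n\<close>, and at index \<open>n\<close> those of
  \<open>(\<Prod>i<n. x\<^sub>i) x\<^sub>1\<^sup>2\<^sup>d\<^sup>-\<^sup>n\<close>.  The former span a simplex containing the latter in its interior.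
\<close>

definition partner :: "nat \<Rightarrow> nat"
  where "partner i = (if i = 0 \<or> i = 2 then 1 else 0)"

definition exps :: "nat \<Rightarrow> nat \<Rightarrow> nat \<Rightarrow> nat \<Rightarrow> nat"
  where "exps n d j i =
    (if j = n then 1 + (if i = 1 then 2 * d - n else 0)
     else (if i = j then 2 * d - 1 else 0) + (if i = partner j then 1 else 0))"

lemma partner_less: "n \<ge> 3 \<Longrightarrow> partner j < n"
  by (simp add: partner_def)

text \<open>With \<open>m i\<close> the order of the coordinate \<open>x i\<close> at a prime, each
  of these sums is the order of a monomial of the form.\<close>

lemma sum_exps_weighted:
  assumes "n \<ge> 3"
  shows "j < n \<Longrightarrow> (\<Sum>i<n. m i * exps n d j i) = (2 * d - 1) * m j + m (partner j)"
    and "(\<Sum>i<n. m i * exps n d n i) = (\<Sum>i<n. m i) + (2 * d - n) * m 1"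
proof -
  assume j: "j < n"
  have "(\<Sum>i<n. m i * exps n d j i) =
    (\<Sum>i<n. if i = j then (2 * d - 1) * m i else 0) + (\<Sum>i<n. if i = partner j then m i else 0)"
    unfolding sum.distrib [symmetric]
    by (rule sum.cong) (use j in \<open>auto simp: exps_def algebra_simps\<close>)
  also have "\<dots> = (2 * d - 1) * m j + m (partner j)"
    using j partner_less[OF assms] by (simp add: sum.delta)
  finally show "(\<Sum>i<n. m i * exps n d j i) = (2 * d - 1) * m j + m (partner j)" .
next
  have "(\<Sum>i<n. m i * exps n d n i) = (\<Sum>i<n. m i + (if i = 1 then (2 * d - n) * m i else 0))"
    by (rule sum.cong) (auto simp: exps_def algebra_simps)
  also have "\<dots> = (\<Sum>i<n. m i) + (2 * d - n) * m 1"
    using assms by (simp add: sum.distrib sum.delta)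
  finally show "(\<Sum>i<n. m i * exps n d n i) = (\<Sum>i<n. m i) + (2 * d - n) * m 1" .
qed

lemma sum_exps:
  assumes "n \<ge> 3" "2 * d \<ge> n" "j \<le> n"
  shows "(\<Sum>i<n. exps n d j i) = 2 * d"
  using sum_exps_weighted(1)[OF assms(1), of j "\<lambda>_. 1" d] assms
    sum_exps_weighted(2)[OF assms(1), of "\<lambda>_. 1" d]
  by (cases "j = n") auto

text \<open>A linear functional that is not constant on a simplex exceeds its minimum at interior
  points, and the minimum is attained at a vertex. The partners make this checkable by hand: after
  the minimum of \<open>m\<close> is subtracted, a vertex at an index of weight zero works as soon
  as two weights are positive, since it retains only the weight of its partner.\<close>

lemma exps_interior:
  fixes m :: "nat \<Rightarrow> nat"
  assumes n: "n \<ge> 3" "2 * d \<ge> n" and nonconst: "i1 < n" "i2 < n" "m i1 \<noteq> m i2"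
  obtains j where "j < n" "(\<Sum>i<n. m i * exps n d j i) < (\<Sum>i<n. m i * exps n d n i)"
proof -
  define \<mu> where "\<mu> = Min (m ` {..<n})"
  define k where "k i = m i - \<mu>" for i
  have fin: "finite (m ` {..<n})" and ne: "m ` {..<n} \<noteq> {}" using n(1) by (auto simp: lessThan_empty_iff)
  have le: "\<mu> \<le> m i" if "i < n" for i using that fin by (simp add: \<mu>_def)
  obtain z where z: "z < n" "k z = 0"
    using Min_in[OF fin ne] unfolding k_def \<mu>_def by auto
  have mk: "m i = k i + \<mu>" if "i < n" for i using le[OF that] by (simp add: k_def)
  have sum_mk: "(\<Sum>i<n. m i * exps n d j i) = (\<Sum>i<n. k i * exps n d j i) + \<mu> * (2 * d)" if "j \<le> n" for j
  proof -
    have "(\<Sum>i<n. m i * exps n d j i) = (\<Sum>i<n. k i * exps n d j i + \<mu> * exps n d j i)"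
      by (rule sum.cong) (auto simp: mk algebra_simps)
    then show ?thesis by (simp add: sum.distrib sum_distrib_left [symmetric] sum_exps[OF n that])
  qed
  obtain l where l: "l < n" "k l > 0" using nonconst mk by (metis gr0I)
  have "\<exists>j<n. (2 * d - 1) * k j + k (partner j) < (\<Sum>i<n. k i) + (2 * d - n) * k 1"
  proof (cases "\<forall>i<n. i \<noteq> l \<longrightarrow> k i = 0")
    case True
    have S: "(\<Sum>i<n. k i) = k l"
      using sum.remove[of "{..<n}" l k] l True by simp
    \<comment> \<open>If only \<open>k l\<close> is positive, a vertex other than l is needed whose
      partner is not l either. For l = 1 and n = 3 both other indices have partner 1. Then
      \<open>2 * d > 3\<close> by parity, and the extra exponent of B on index 1 decides.\<close>
    consider "l = 0" | "l = 1" "n = 3" | "l = 1" "n \<ge> 4" | "l \<ge> 2" using n by linarith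
    then show ?thesis
    proof cases
      case 1
      then have "k 2 = 0" "k 1 = 0" using True n by auto
      then show ?thesis using n l S by (intro exI[of _ 2]) (simp add: partner_def)
    next
      case 2
      have "k 0 = 0" using True 2 by auto
      moreover have "0 < (2 * d - n) * k 1" using 2 n l by auto presburger
      ultimately show ?thesis using 2 n l S by (intro exI[of _ 0]) (simp add: partner_def)
    next
      case 3
      then have "k 3 = 0" "k 0 = 0" using True by auto
      then show ?thesis using 3 n l S by (intro exI[of _ 3]) (simp add: partner_def)
    next
      case 4
      then have "k 0 = 0" "k 1 = 0" using True n by auto
      then show ?thesis using n l S by (intro exI[of _ 0]) (simp add: partner_def)
    qed
  next
    case False
    then obtain l' where l': "l' < n" "l' \<noteq> l" "k l' > 0" by auto
    have p: "partner z < n" using partner_less[OF n(1)] .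
    obtain l'' where l'': "l'' < n" "l'' \<noteq> partner z" "k l'' > 0" using l l' by metis
    have "(\<Sum>i<n. k i) = k (partner z) + (\<Sum>i\<in>{..<n} - {partner z}. k i)"
      using p by (simp add: sum.remove)
    moreover have "k l'' \<le> (\<Sum>i\<in>{..<n} - {partner z}. k i)"
      using l'' by (intro member_le_sum) auto
    ultimately have "k (partner z) < (\<Sum>i<n. k i)" using l'' by linarith
    then show ?thesis using z by (intro exI[of _ z]) simp
  qed
  then obtain j where j: "j < n" "(2 * d - 1) * k j + k (partner j) < (\<Sum>i<n. k i) + (2 * d - n) * k 1"
    by blast
  show thesis
    using that[of j] j sum_mk[of j] sum_mk[of n] sum_exps_weighted[OF n(1), where m = k and d = d]
    by simp
qed

section \<open>Points of the reduced conic bundle over a domain\<close>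

lemma char2_neg: assumes "(1::'r::comm_ring_1) + 1 = 0" shows "- x = (x::'r)"
proof -
  have "x + x = (1 + 1) * x" by (simp add: algebra_simps)
  then show ?thesis using assms by (simp add: neg_eq_iff_add_eq_0)
qed

lemma char2_even: assumes "(1::'r::comm_ring_1) + 1 = 0" shows "even k \<Longrightarrow> (of_nat k :: 'r) = 0"
proof -
  assume "even k"
  then obtain l where "k = 2 * l" by blast
  then have "(of_nat k :: 'r) = (1 + 1) * of_nat l" by simp
  then show ?thesis using assms by simp
qed

lemma char2_odd: assumes "(1::'r::comm_ring_1) + 1 = 0" shows "odd k \<Longrightarrow> (of_nat k :: 'r) = 1"
proof -
  assume "odd k"
  then obtain l where l: "k = 2 * l + 1" by (rule oddE)
  have "(of_nat k :: 'r) = of_nat (2 * l) + 1" unfolding l by simp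
  also have "(of_nat (2 * l) :: 'r) = 0" by (rule char2_even[OF assms]) simp
  finally show ?thesis by simp
qed

lemma char2_parity:
  assumes "(1::'r::comm_ring_1) + 1 = 0" shows "even (k + l) \<Longrightarrow> (of_nat k :: 'r) = of_nat l"
  by (cases "even k") (simp_all add: char2_even[OF assms] char2_odd[OF assms])

lemma char2_frobenius:
  assumes "(1::'r::comm_ring_1) + 1 = 0" shows "(x + y :: 'r) ^ (2 ^ s) = x ^ (2 ^ s) + y ^ (2 ^ s)"
proof (induction s)
  case (Suc s)
  have sq: "(a + b)\<^sup>2 = a\<^sup>2 + b\<^sup>2" for a b :: 'r
  proof -
    have "(a + b)\<^sup>2 = a\<^sup>2 + b\<^sup>2 + (1 + 1) * (a * b)" by (simp add: power2_eq_square algebra_simps)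
    then show ?thesis using assms by simp
  qed
  have "(x + y) ^ (2 ^ Suc s) = ((x + y) ^ (2 ^ s))\<^sup>2" by (simp add: power_mult [symmetric] mult.commute)
  also have "\<dots> = (x ^ (2 ^ s))\<^sup>2 + (y ^ (2 ^ s))\<^sup>2" using Suc sq by simp
  finally show ?case by (simp add: power_mult [symmetric] mult.commute)
qed simp

text \<open>
  A point of the reduced conic bundle over a domain of characteristic 2, together with a prime
  element, relative to which \<open>x\<^sub>i = \<pi>\<^bsup>m i\<^esup> y\<^sub>i\<close>.
\<close>

locale conic_point =
  fixes \<pi> :: "'r::idom" and n d :: nat and m :: "nat \<Rightarrow> nat" and y :: "nat \<Rightarrow> 'r"
    and t0 t1 w :: 'r
  assumes char2: "(1::'r) + 1 = 0"
    and prime: "prime_elem \<pi>"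
    and n3: "n \<ge> 3" and dn: "2 * d \<ge> n"
    and y: "\<And>i. i < n \<Longrightarrow> \<not> \<pi> dvd y i"
    and nonconst: "\<exists>i<n. \<exists>j<n. m i \<noteq> m j"
    and val: "\<And>a. a \<noteq> 0 \<Longrightarrow> \<exists>k b. a = \<pi> ^ k * b \<and> \<not> \<pi> dvd b"
    and t: "t0 \<noteq> 0 \<or> t1 \<noteq> 0"
    and eqn: "w\<^sup>2 = emon n (exps n d n) (\<lambda>i. \<pi> ^ m i * y i) * (t0\<^sup>2 + t0 * t1)
      + (\<Sum>j<n. emon n (exps n d j) (\<lambda>i. \<pi> ^ m i * y i)) * t1\<^sup>2"
begin

definition wt :: "nat \<Rightarrow> nat" where "wt j = (\<Sum>i<n. m i * exps n d j i)"
definition tt :: "nat \<Rightarrow> 'r" where "tt j = (if j = n then t0 else t1)"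
text \<open>The diagonal terms of the equation, with that of B at index n. Each is a power of \<pi>
  times a square times a monomial in the \<open>y i\<close>, and a derivation that kills \<pi> sees
  only the monomial.\<close>

definition tm :: "nat \<Rightarrow> 'r"
  where "tm j = \<pi> ^ wt j * emon n (exps n d j) y * (tt j)\<^sup>2"
definition others :: "nat \<Rightarrow> 'r" where "others i = (\<Prod>j\<in>{..<n} - {i}. y j)"

lemma pi0: "\<pi> \<noteq> 0" using prime by auto

lemma prime_power: "\<pi> dvd x ^ k \<Longrightarrow> \<pi> dvd x"
  using prime by (rule prime_elem_dvd_power)

lemma prime_mult: "\<pi> dvd a * b \<longleftrightarrow> \<pi> dvd a \<or> \<pi> dvd b"
  using prime by (simp add: prime_elem_dvd_mult_iff)

lemma emon_y: "\<not> \<pi> dvd emon n e y"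
proof -
  have "\<not> \<pi> dvd (\<Prod>i\<in>A. y i ^ e i)" if "A \<subseteq> {..<n}" for A
    using finite_subset[OF that finite_lessThan] that
  proof (induction A rule: finite_induct)
    case empty
    then show ?case using prime by (simp add: prime_elem_def)
  next
    case (insert i A)
    then show ?case using y[of i] prime_power[of "y i" "e i"] by (auto simp: prime_mult)
  qed
  then show ?thesis unfolding emon_def by blast
qed

lemma pow_cancel: "\<pi> ^ a * b = \<pi> ^ a' * b' \<Longrightarrow> \<not> \<pi> dvd b \<Longrightarrow> a' \<le> a"
proof (rule ccontr)
  assume eq: "\<pi> ^ a * b = \<pi> ^ a' * b'" and b: "\<not> \<pi> dvd b" and "\<not> a' \<le> a"
  then have "a' = a + Suc (a' - a - 1)" by simp
  then have "\<pi> ^ a' = \<pi> ^ a * (\<pi> * \<pi> ^ (a' - a - 1))" by (metis power_add power_Suc)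
  then have "\<pi> ^ a * b = \<pi> ^ a * (\<pi> * (\<pi> ^ (a' - a - 1) * b'))" using eq by (simp only: mult.assoc)
  then have "b = \<pi> * (\<pi> ^ (a' - a - 1) * b')" using pi0 by simp
  then show False using b by (metis dvd_triv_left)
qed

lemma pow_unique: "\<pi> ^ a * b = \<pi> ^ a' * b' \<Longrightarrow> \<not> \<pi> dvd b \<Longrightarrow> \<not> \<pi> dvd b' \<Longrightarrow> a = a'"
  using pow_cancel[of a b a' b'] pow_cancel[of a' b' a b] by simp

lemma emon_x: "emon n (exps n d j) (\<lambda>i. \<pi> ^ m i * y i) = \<pi> ^ wt j * emon n (exps n d j) y"
  by (simp add: emon_mult emon_power wt_def)

lemma equation: "w\<^sup>2 = (\<Sum>j\<le>n. tm j) + \<pi> ^ wt n * emon n (exps n d n) y * t0 * t1"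
proof -
  have "(\<Sum>j\<le>n. tm j) = (\<Sum>j<n. tm j) + tm n" by (simp add: lessThan_Suc_atMost [symmetric])
  also have "(\<Sum>j<n. tm j) = (\<Sum>j<n. \<pi> ^ wt j * emon n (exps n d j) y) * t1\<^sup>2"
    by (simp add: tm_def tt_def sum_distrib_right)
  finally show ?thesis
    unfolding eqn emon_x by (simp add: tm_def tt_def algebra_simps)
qed

lemma tt_nz: "\<exists>j\<le>n. tt j \<noteq> 0"
proof (cases "t0 = 0")
  case True
  then have "t1 \<noteq> 0" using t by blast
  then show ?thesis using n3 unfolding tt_def by (intro exI[of _ 0]) simp
next
  case False
  then show ?thesis unfolding tt_def by (intro exI[of _ n]) simp
qed

lemma tm_nz: "tt j \<noteq> 0 \<Longrightarrow> tm j \<noteq> 0"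
  using emon_y[of "exps n d j"] pi0 by (auto simp: tm_def)

lemma leading_exponent:
  "\<exists>\<mu> T. (\<forall>j\<le>n. tm j = \<pi> ^ \<mu> * T j) \<and> (\<exists>j\<le>n. \<not> \<pi> dvd T j)"
proof -
  define P where "P k \<longleftrightarrow> (\<forall>j\<le>n. \<pi> ^ k dvd tm j)" for k
  obtain j where j: "j \<le> n" "tt j \<noteq> 0" using tt_nz by blast
  obtain k b where kb: "tm j = \<pi> ^ k * b" "\<not> \<pi> dvd b" using val[OF tm_nz[OF j(2)]] by blast
  have bound: "l \<le> k" if "P l" for l
  proof -
    have "\<pi> ^ l dvd tm j" using that j by (simp add: P_def)
    then obtain c where "tm j = \<pi> ^ l * c" by (rule dvdE)
    then show ?thesis using pow_cancel[of k b l c] kb by simp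
  qed
  have "P 0" by (simp add: P_def)
  define \<mu> where "\<mu> = Greatest P"
  have P\<mu>: "P \<mu>" unfolding \<mu>_def using GreatestI_nat[of P 0 k] \<open>P 0\<close> bound by blast
  then have "\<forall>j. \<exists>T. j \<le> n \<longrightarrow> tm j = \<pi> ^ \<mu> * T" by (auto simp: P_def dvd_def)
  then obtain T where T: "\<And>j. j \<le> n \<Longrightarrow> tm j = \<pi> ^ \<mu> * T j" by metis
  have "\<exists>j\<le>n. \<not> \<pi> dvd T j"
  proof (rule ccontr)
    assume "\<not> ?thesis"
    then have "P (Suc \<mu>)" unfolding P_def
      using T by (auto simp: power_Suc2 simp del: power_Suc)
    then have "Suc \<mu> \<le> \<mu>" unfolding \<mu>_def using Greatest_le_nat[of P "Suc \<mu>" k] bound by (simp add: \<mu>_def)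
    then show False by simp
  qed
  then show ?thesis using T by (intro exI[of _ \<mu>] exI[of _ T]) simp
qed

text \<open>The order of B t0 t1 is the mean of the orders of B t0^2 and B t1^2. The first is at
  least \<mu>. The second exceeds the order of some vertex term with t1^2, because the exponent of B
  is interior, and hence exceeds \<mu>. So the mixed term does not enter the leading form.\<close>

lemma cross_term:
  assumes T: "\<And>j. j \<le> n \<Longrightarrow> tm j = \<pi> ^ \<mu> * T j"
  shows "\<pi> ^ Suc \<mu> dvd \<pi> ^ wt n * emon n (exps n d n) y * t0 * t1"
proof (cases "t0 = 0 \<or> t1 = 0")
  case False
  obtain a \<alpha> where a: "t0 = \<pi> ^ a * \<alpha>" "\<not> \<pi> dvd \<alpha>" using val False by blast
  obtain b \<beta> where b: "t1 = \<pi> ^ b * \<beta>" "\<not> \<pi> dvd \<beta>" using val False by blast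
  obtain i1 i2 where "i1 < n" "i2 < n" "m i1 \<noteq> m i2" using nonconst by blast
  then obtain j where j: "j < n" "wt j < wt n"
    unfolding wt_def by (rule exps_interior[OF n3 dn])
  have "\<pi> ^ (wt n + 2 * a) * (emon n (exps n d n) y * \<alpha>\<^sup>2) = \<pi> ^ \<mu> * T n"
    using T[of n, unfolded tm_def tt_def] by (simp add: a(1) power_mult_distrib power_add power_mult [symmetric] algebra_simps)
  moreover have "\<not> \<pi> dvd emon n (exps n d n) y * \<alpha>\<^sup>2"
    using emon_y a(2) prime_power by (auto simp: prime_mult)
  ultimately have 1: "\<mu> \<le> wt n + 2 * a" by (rule pow_cancel)
  have "\<pi> ^ (wt j + 2 * b) * (emon n (exps n d j) y * \<beta>\<^sup>2) = \<pi> ^ \<mu> * T j"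
    using T[of j, unfolded tm_def tt_def] j by (simp add: b(1) power_mult_distrib power_add power_mult [symmetric] algebra_simps)
  moreover have "\<not> \<pi> dvd emon n (exps n d j) y * \<beta>\<^sup>2"
    using emon_y b(2) prime_power by (auto simp: prime_mult)
  ultimately have 2: "\<mu> \<le> wt j + 2 * b" by (rule pow_cancel)
  have "Suc \<mu> \<le> wt n + a + b"
    using 1 2 j by (cases "b \<le> a") auto
  then have "\<pi> ^ Suc \<mu> dvd \<pi> ^ (wt n + a + b)" by (rule le_imp_power_dvd)
  also have "\<dots> dvd \<pi> ^ wt n * emon n (exps n d n) y * t0 * t1"
    unfolding a(1) b(1) by (rule dvdI[of _ _ "emon n (exps n d n) y * \<alpha> * \<beta>"]) (simp add: power_add algebra_simps)
  finally show ?thesis .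
qed auto

text \<open>The power of \<pi> and the square of \<open>tt j\<close> are constants of D, so T has
  the same logarithmic derivative as its monomial.\<close>

lemma derivation_tm:
  assumes D: "derivation D" "D \<pi> = 0" and T: "tm j = \<pi> ^ \<mu> * T"
  shows "(\<Prod>i<n. y i) * D T = T * (\<Sum>i<n. of_nat (exps n d j i) * D (y i) * others i)"
proof -
  have pc: "D (\<pi> ^ k) = 0" for k using D by (rule derivation_power_const)
  have "\<pi> ^ \<mu> * ((\<Prod>i<n. y i) * D T) = (\<Prod>i<n. y i) * D (tm j)"
    unfolding T by (simp add: derivation_mult[OF D(1)] pc)
  also have "\<dots> = \<pi> ^ wt j * (tt j)\<^sup>2 * ((\<Prod>i<n. y i) * D (emon n (exps n d j) y))"
    unfolding tm_def by (simp add: derivation_mult[OF D(1)] pc derivation_square_char2[OF D(1) char2])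
  also have "\<dots> = tm j * (\<Sum>i<n. of_nat (exps n d j i) * D (y i) * others i)"
    unfolding derivation_emon[OF D(1)] others_def tm_def by (simp only: mult_ac)
  finally show ?thesis unfolding T using pi0 by (simp add: mult.assoc)
qed

end

lemma odd_part:
  fixes N :: nat assumes "N > 0" obtains k u where "N = 2 ^ k * u" "odd u"
  using assms
proof (induction N arbitrary: thesis rule: less_induct)
  case (less N)
  show ?case
  proof (cases "even N")
    case True
    then obtain M where M: "N = 2 * M" by blast
    then obtain k u where "M = 2 ^ k * u" "odd u" using less.IH[of M] less.prems(2) by auto
    then show ?thesis using less.prems(1)[of "Suc k" u] M by simp
  next
    case False
    then show ?thesis using less.prems(1)[of 0 N] by simp
  qed
qed

section \<open>Linear relations among the logarithmic differentials modulo \<pi>\<close>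

context conic_point
begin

text \<open>A leading term has order exactly \<mu>, and \<open>tt j\<close> enters it squared. Hence
  its weight has the parity of \<mu>, which is how the orders \<open>m i\<close> get into the
  relation.\<close>

lemma leading_parity:
  assumes T: "tm j = \<pi> ^ \<mu> * T" and "\<not> \<pi> dvd T"
  obtains a \<alpha> where "tt j = \<pi> ^ a * \<alpha>" "\<not> \<pi> dvd \<alpha>" "wt j + 2 * a = \<mu>"
proof -
  have "tm j \<noteq> 0" using assms pi0 by auto
  then have "tt j \<noteq> 0" by (auto simp: tm_def)
  then obtain a \<alpha> where a: "tt j = \<pi> ^ a * \<alpha>" "\<not> \<pi> dvd \<alpha>" using val by blast
  have "\<pi> ^ (wt j + 2 * a) * (emon n (exps n d j) y * \<alpha>\<^sup>2) = \<pi> ^ \<mu> * T"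
    using T unfolding tm_def a(1)
    by (simp add: power_mult_distrib power_add power_mult [symmetric] algebra_simps)
  moreover have "\<not> \<pi> dvd emon n (exps n d j) y * \<alpha>\<^sup>2"
    using emon_y a(2) prime_power by (auto simp: prime_mult)
  ultimately have "wt j + 2 * a = \<mu>" using assms(2) by (rule pow_unique)
  then show thesis using that a by blast
qed

text \<open>\<open>c\<close> is the coefficient vector of the logarithmic differential of the sum of
  the \<open>T j\<close> over L, and V is congruent to that sum but has no differential. The first
  conclusion holds since the total degree \<open>2 * d\<close> is even. The second is the
  coefficient of dlog \<pi>: all weights of leading terms are congruent to \<mu> modulo 2, so it
  reduces to \<mu> times V. The third is obtained by differentiating the congruence.\<close>

lemma relation_of:
  assumes T: "\<And>j. j \<le> n \<Longrightarrow> tm j = \<pi> ^ \<mu> * T j" and L: "L \<subseteq> {..n}"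
    and V: "\<pi> dvd (\<Sum>j\<in>L. T j) + V" "\<pi> dvd of_nat \<mu> * V"
      "\<forall>D. derivation D \<longrightarrow> D \<pi> = 0 \<longrightarrow> D V = 0"
  defines "c \<equiv> \<lambda>i. \<Sum>j\<in>L. T j * of_nat (exps n d j i)"
  shows "\<pi> dvd (\<Sum>i<n. c i)"
    and "\<pi> dvd (\<Sum>i<n. c i * of_nat (m i))"
    and "\<forall>D. derivation D \<longrightarrow> D \<pi> = 0 \<longrightarrow> \<pi> dvd (\<Sum>i<n. c i * D (y i) * others i)"
proof -
  have fin: "finite L" using L finite_subset by blast
  have "(\<Sum>i<n. c i) = (\<Sum>j\<in>L. T j * of_nat (\<Sum>i<n. exps n d j i))"
    unfolding c_def by (subst sum.swap) (simp add: sum_distrib_left)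
  also have "\<dots> = (\<Sum>j\<in>L. 0)"
  proof (rule sum.cong[OF refl])
    fix j assume "j \<in> L"
    then have "(\<Sum>i<n. exps n d j i) = 2 * d" using L n3 dn by (intro sum_exps) auto
    then show "T j * of_nat (\<Sum>i<n. exps n d j i) = 0" using char2_even[OF char2, of "2 * d"] by simp
  qed
  finally show "\<pi> dvd (\<Sum>i<n. c i)" by simp
  have par: "\<pi> dvd T j * of_nat (wt j) - T j * of_nat \<mu>" if "j \<in> L" for j
  proof (cases "\<pi> dvd T j")
    case False
    have jn: "j \<le> n" using L that by auto
    obtain a \<alpha> where "tt j = \<pi> ^ a * \<alpha>" "\<not> \<pi> dvd \<alpha>" "wt j + 2 * a = \<mu>"
      by (rule leading_parity[OF T[OF jn] False])
    then have "even (wt j + \<mu>)" by auto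
    then have "(of_nat (wt j) :: 'r) = of_nat \<mu>" by (rule char2_parity[OF char2])
    then show ?thesis by simp
  qed (simp add: dvd_diff)
  have "(\<Sum>i<n. c i * of_nat (m i)) = (\<Sum>j\<in>L. T j * of_nat (wt j))"
    unfolding c_def wt_def sum_distrib_right
    by (subst sum.swap) (simp add: sum_distrib_left mult_ac)
  also have "\<dots> = (\<Sum>j\<in>L. T j * of_nat (wt j) - T j * of_nat \<mu>) +
      (of_nat \<mu> * ((\<Sum>j\<in>L. T j) + V) - of_nat \<mu> * V)"
    by (simp add: sum_subtractf sum_distrib_left algebra_simps)
  finally show "\<pi> dvd (\<Sum>i<n. c i * of_nat (m i))"
    using V par by (simp add: dvd_add dvd_diff dvd_sum)
  show "\<forall>D. derivation D \<longrightarrow> D \<pi> = 0 \<longrightarrow> \<pi> dvd (\<Sum>i<n. c i * D (y i) * others i)"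
  proof (intro allI impI)
  fix D assume D: "derivation D" "D \<pi> = 0"
  obtain r where r: "(\<Sum>j\<in>L. T j) + V = \<pi> * r" using V(1) by blast
  have "(\<Sum>j\<in>L. D (T j)) = D (\<pi> * r)"
    unfolding r [symmetric] by (simp add: derivation_add[OF D(1)] derivation_sum[OF D(1)] V(3)[rule_format, OF D])
  then have e: "(\<Sum>j\<in>L. D (T j)) = \<pi> * D r" by (simp add: derivation_mult[OF D(1)] D(2))
  have "(\<Sum>i<n. c i * D (y i) * others i) =
      (\<Sum>j\<in>L. T j * (\<Sum>i<n. of_nat (exps n d j i) * D (y i) * others i))"
    unfolding c_def sum_distrib_right
    by (subst sum.swap) (simp add: sum_distrib_left mult_ac)
  also have "\<dots> = (\<Sum>j\<in>L. (\<Prod>i<n. y i) * D (T j))"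
    using L by (intro sum.cong[OF refl] derivation_tm[OF D T, symmetric]) auto
  also have "\<dots> = (\<Prod>i<n. y i) * (\<pi> * D r)" unfolding e [symmetric] by (simp add: sum_distrib_left)
  finally show "\<pi> dvd (\<Sum>i<n. c i * D (y i) * others i)" by (metis dvd_triv_left mult.left_commute)
  qed
qed

text \<open>V is the quotient of w^2 by \<open>\<pi> ^ \<mu>\<close>. Its derivatives vanish because
  those of the square do. If \<pi> does not divide V, then \<mu> is twice the order of
  \<open>w\<close>, so it is even and zero in characteristic 2.\<close>

lemma square_part:
  assumes T: "\<And>j. j \<le> n \<Longrightarrow> tm j = \<pi> ^ \<mu> * T j"
  shows "\<exists>V. \<pi> dvd (\<Sum>j\<le>n. T j) + V \<and> \<pi> dvd of_nat \<mu> * V \<and>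
      (\<forall>D. derivation D \<longrightarrow> D \<pi> = 0 \<longrightarrow> D V = 0)"
proof -
  obtain R where R: "\<pi> ^ wt n * emon n (exps n d n) y * t0 * t1 = \<pi> ^ Suc \<mu> * R"
    using cross_term[OF T] by blast
  define V where "V = (\<Sum>j\<le>n. T j) + \<pi> * R"
  have w: "w\<^sup>2 = \<pi> ^ \<mu> * V"
  proof -
    have "(\<Sum>j\<le>n. tm j) = (\<Sum>j\<le>n. \<pi> ^ \<mu> * T j)" by (rule sum.cong) (auto simp: T)
    then show ?thesis unfolding equation R V_def by (simp add: sum_distrib_left algebra_simps)
  qed
  show ?thesis
  proof (intro exI[of _ V] conjI)
    have "(\<Sum>j\<le>n. T j) + V = (1 + 1) * (\<Sum>j\<le>n. T j) + \<pi> * R" unfolding V_def by (simp add: algebra_simps)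
    then show "\<pi> dvd (\<Sum>j\<le>n. T j) + V" using char2 by simp
    show "\<pi> dvd of_nat \<mu> * V"
    proof (cases "\<pi> dvd V")
      case False
      then have "w \<noteq> 0" using w pi0 by auto
      then obtain a \<alpha> where a: "w = \<pi> ^ a * \<alpha>" "\<not> \<pi> dvd \<alpha>" using val by blast
      have "\<pi> ^ (2 * a) * \<alpha>\<^sup>2 = \<pi> ^ \<mu> * V"
        using w unfolding a(1) by (simp add: power_mult_distrib power_mult [symmetric] mult.commute)
      moreover have "\<not> \<pi> dvd \<alpha>\<^sup>2" using a(2) prime_power by blast
      ultimately have "2 * a = \<mu>" using False by (rule pow_unique)
      then show ?thesis using char2_even[OF char2, of \<mu>] by auto
    qed simp
    show "\<forall>D. derivation D \<longrightarrow> D \<pi> = 0 \<longrightarrow> D V = 0"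
    proof (intro allI impI)
    fix D assume D: "derivation D" "D \<pi> = 0"
    have "D (w\<^sup>2) = \<pi> ^ \<mu> * D V"
      unfolding w by (simp add: derivation_mult[OF D(1)] derivation_power_const[OF D])
    then show "D V = 0" using derivation_square_char2[OF D(1) char2] pi0 by simp
    qed
  qed
qed

text \<open>Up to factors prime to \<pi>, T0 + T1 is \<open>y 0 ^ N + y 1 ^ N\<close> with N = 2 d -
  2. As N is even, its differential carries no information. With u the odd part of N, the polynomial
  \<open>y 0 ^ u + y 1 ^ u\<close> is a Frobenius root of it, still divisible by \<pi>, and its
  differential shows that \<open>y 0\<close> and \<open>y 1\<close> have the same dlog modulo
  \<pi>.\<close>

lemma equal_vertices:
  assumes T: "tm 0 = \<pi> ^ \<mu> * T0" "tm 1 = \<pi> ^ \<mu> * T1"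
    and nd: "\<not> \<pi> dvd T0" "\<not> \<pi> dvd T1" and s: "\<pi> dvd T0 + T1"
  shows "m 0 = m 1"
    and "\<And>D. derivation D \<Longrightarrow> D \<pi> = 0 \<Longrightarrow> \<pi> dvd y 1 * D (y 0) + y 0 * D (y 1)"
proof -
  have n1: "0 < n" "1 < n" using n3 by auto
  obtain a \<alpha> where a: "tt 0 = \<pi> ^ a * \<alpha>" "\<not> \<pi> dvd \<alpha>" "wt 0 + 2 * a = \<mu>" using leading_parity[OF T(1) nd(1)] .
  obtain b \<beta> where b: "tt 1 = \<pi> ^ b * \<beta>" "\<not> \<pi> dvd \<beta>" "wt 1 + 2 * b = \<mu>" using leading_parity[OF T(2) nd(2)] .
  have tt: "tt 0 = t1" "tt 1 = t1" using n1 by (auto simp: tt_def)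
  have ab: "a = b" using pow_unique[of a \<alpha> b \<beta>] a b tt by simp
  then have \<alpha>\<beta>: "\<alpha> = \<beta>" using a b tt pi0 by simp
  have p: "partner 0 = 1" "partner 1 = 0" by (auto simp: partner_def)
  have w01: "wt 0 = (2 * d - 1) * m 0 + m 1" "wt 1 = (2 * d - 1) * m 1 + m 0"
    unfolding wt_def using sum_exps_weighted(1)[OF n3, of _ m d] n1 p by auto
  have "2 \<le> d" using n3 dn by linarith
  then obtain e where e: "d = Suc (Suc e)" using le_Suc_ex[of 2 d] by auto
  have "wt 0 = wt 1" using a b ab by simp
  then have eq: "(2 * d - 1) * m 0 + m 1 = (2 * d - 1) * m 1 + m 0" unfolding w01 .
  have "2 * d - 1 = Suc (2 * e + 2)" unfolding e by simp
  then have "(2 * e + 2) * m 0 = (2 * e + 2) * m 1" using eq by simp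
  then show "m 0 = m 1" by (metis add_is_0 mult_cancel1 zero_neq_numeral)
  have em: "emon n (exps n d j) y = y j ^ (2 * d - 1) * y (partner j)" if "j < n" for j
  proof -
    have "emon n (exps n d j) y = (\<Prod>i<n. (if i = j then y i ^ (2 * d - 1) else 1) * (if i = partner j then y i else 1))"
      unfolding emon_def by (rule prod.cong) (use that in \<open>auto simp: exps_def partner_def\<close>)
    then show ?thesis using that partner_less[OF n3, of j] by (simp add: prod.distrib prod.delta)
  qed
  define N where "N = 2 * d - 2"
  have N: "2 * d - 1 = Suc N" "N > 0" unfolding N_def e by auto
  have T0: "T0 = y 0 ^ Suc N * y 1 * \<alpha>\<^sup>2"
  proof -
    have "\<pi> ^ \<mu> * T0 = \<pi> ^ wt 0 * (y 0 ^ Suc N * y 1) * (\<pi> ^ a * \<alpha>)\<^sup>2"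
      unfolding T(1) [symmetric] tm_def a(1) em[OF n1(1)] N p ..
    also have "\<dots> = \<pi> ^ (wt 0 + 2 * a) * (y 0 ^ Suc N * y 1 * \<alpha>\<^sup>2)"
      by (simp add: power_mult_distrib power_add power_mult [symmetric] algebra_simps)
    finally show ?thesis unfolding a(3) using pi0 by simp
  qed
  have T1: "T1 = y 1 ^ Suc N * y 0 * \<alpha>\<^sup>2"
  proof -
    have "\<pi> ^ \<mu> * T1 = \<pi> ^ wt 1 * (y 1 ^ Suc N * y 0) * (\<pi> ^ b * \<beta>)\<^sup>2"
      unfolding T(2) [symmetric] tm_def b(1) em[OF n1(2)] N p ..
    also have "\<dots> = \<pi> ^ (wt 1 + 2 * b) * (y 1 ^ Suc N * y 0 * \<beta>\<^sup>2)"
      by (simp add: power_mult_distrib power_add power_mult [symmetric] algebra_simps)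
    finally show ?thesis unfolding b(3) \<alpha>\<beta> using pi0 by simp
  qed
  have "T0 + T1 = y 0 * y 1 * \<alpha>\<^sup>2 * (y 0 ^ N + y 1 ^ N)" unfolding T0 T1 by (simp add: algebra_simps)
  then have dN: "\<pi> dvd y 0 ^ N + y 1 ^ N"
    using s y[OF n1(1)] y[OF n1(2)] a(2) prime_power by (auto simp: prime_mult)
  obtain k u where u: "N = 2 ^ k * u" "odd u"
    using N(2) by (rule odd_part)
  have "(y 0 ^ u + y 1 ^ u) ^ (2 ^ k) = y 0 ^ N + y 1 ^ N"
    unfolding char2_frobenius[OF char2] u(1) by (simp add: power_mult [symmetric] mult.commute)
  then have "\<pi> dvd y 0 ^ u + y 1 ^ u" using dN prime_power by metis
  then obtain r where r: "y 0 ^ u + y 1 ^ u = \<pi> * r" by (rule dvdE)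
  obtain v where v: "u = Suc v" using u(2) by (cases u) auto
  fix D assume D: "derivation D" "D \<pi> = 0"
  have ou: "(of_nat u :: 'r) = 1" by (rule char2_odd[OF char2 u(2)])
  have "\<pi> * D r = D (y 0 ^ u + y 1 ^ u)" unfolding r by (simp add: derivation_mult[OF D(1)] D(2))
  also have "\<dots> = y 0 ^ v * D (y 0) + y 1 ^ v * D (y 1)"
    using ou by (simp add: derivation_add[OF D(1)] v derivation_power[OF D(1)] del: power_Suc of_nat_Suc)
  finally have 1: "y 0 ^ v * D (y 0) + y 1 ^ v * D (y 1) = \<pi> * D r" by simp
  have "y 0 ^ u * (y 1 * D (y 0) + y 0 * D (y 1)) =
      y 0 * y 1 * (y 0 ^ v * D (y 0) + y 1 ^ v * D (y 1)) + (y 0 ^ u - y 1 ^ u) * y 0 * D (y 1)"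
    unfolding v by (simp add: algebra_simps)
  also have "y 0 ^ u - y 1 ^ u = y 0 ^ u + y 1 ^ u" using char2_neg[OF char2, of "y 1 ^ u"] by (metis diff_conv_add_uminus)
  finally have "y 0 ^ u * (y 1 * D (y 0) + y 0 * D (y 1)) =
      \<pi> * (y 0 * y 1 * D r + r * y 0 * D (y 1))" unfolding 1 r by (simp add: algebra_simps)
  then have "\<pi> dvd y 0 ^ u * (y 1 * D (y 0) + y 0 * D (y 1))" by simp
  then show "\<pi> dvd y 1 * D (y 0) + y 0 * D (y 1)"
    using y[OF n1(1)] prime_power by (auto simp: prime_mult)
qed

text \<open>In general the full leading form supplies the coefficients. If these all vanish modulo
  \<pi>, then \<open>T 2\<close> and \<open>T n\<close> cancel each other. When they are nonzero,
  the two form a relation by themselves, and it is nontrivial because index 0 occurs in B but not in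
  the vertex monomial of 2. When they are zero, only \<open>T 0\<close> and \<open>T 1\<close>
  survive, and \<open>equal_vertices\<close> applies.\<close>

lemma relation:
  obtains c where "\<exists>i<n. \<not> \<pi> dvd c i" "\<pi> dvd (\<Sum>i<n. c i)" "\<pi> dvd (\<Sum>i<n. c i * of_nat (m i))"
    "\<forall>D. derivation D \<longrightarrow> D \<pi> = 0 \<longrightarrow> \<pi> dvd (\<Sum>i<n. c i * D (y i) * others i)"
proof -
  obtain \<mu> T where TL: "(\<forall>j\<le>n. tm j = \<pi> ^ \<mu> * T j) \<and> (\<exists>j\<le>n. \<not> \<pi> dvd T j)"
    using leading_exponent by (elim exE)
  then have T: "\<And>j. j \<le> n \<Longrightarrow> tm j = \<pi> ^ \<mu> * T j" and lead: "\<exists>j\<le>n. \<not> \<pi> dvd T j"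
    by simp_all
  obtain V where V: "\<pi> dvd (\<Sum>j\<le>n. T j) + V" "\<pi> dvd of_nat \<mu> * V"
      "\<forall>D. derivation D \<longrightarrow> D \<pi> = 0 \<longrightarrow> D V = 0"
  proof -
    have "\<exists>V. \<pi> dvd (\<Sum>j\<le>n. T j) + V \<and> \<pi> dvd of_nat \<mu> * V \<and>
        (\<forall>D. derivation D \<longrightarrow> D \<pi> = 0 \<longrightarrow> D V = 0)"
      by (rule square_part) (rule T)
    then show thesis using that by (elim exE conjE)
  qed
  define c where "c i = (\<Sum>j\<le>n. T j * of_nat (exps n d j i))" for i
  have D1: "(of_nat (2 * d - 1) :: 'r) = 1" by (rule char2_odd[OF char2]) (use n3 dn in auto)
  have split: "c i = T n * of_nat (exps n d n i) + (\<Sum>j<n. T j * of_nat (exps n d j i))" for i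
    unfolding c_def by (simp add: lessThan_Suc_atMost [symmetric])
  have ex: "(of_nat (exps n d j i) :: 'r) = (if i = j then 1 else 0) + (if i = partner j then 1 else 0)" if "j < n" for i j
    using that D1 by (auto simp: exps_def)
  \<comment> \<open>No index above 1 is a partner and \<open>2 * d - 1\<close> is odd, so modulo 2
    only the vertex i and B involve \<open>x i\<close>.\<close>
  have c_ge2: "c i = T n + T i" if i: "2 \<le> i" "i < n" for i
  proof -
    have "(\<Sum>j<n. T j * of_nat (exps n d j i)) = (\<Sum>j<n. if i = j then T j else 0)"
      by (rule sum.cong) (use i in \<open>auto simp: ex partner_def\<close>)
    then show ?thesis using i by (simp add: split exps_def)
  qed
  have c_0: "c 0 = T n + T 0 + (\<Sum>j\<in>{..<n} - {0, 2}. T j)"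
  proof -
    have "(\<Sum>j<n. T j * of_nat (exps n d j 0)) =
        (\<Sum>j<n. (if j = 0 then T j else 0) + (if j \<in> {..<n} - {0, 2} then T j else 0))"
      by (rule sum.cong) (auto simp: ex partner_def)
    also have "\<dots> = T 0 + (\<Sum>j\<in>{..<n} - {0, 2}. T j)"
    proof -
      have "(\<Sum>j<n. if j \<in> {..<n} - {0, 2} then T j else 0) = (\<Sum>j\<in>{..<n} - {0, 2}. T j)"
        by (rule sum.mono_neutral_cong_right) auto
      then show ?thesis using n3 by (simp only: sum.distrib sum.delta finite_lessThan) simp
    qed
    finally show ?thesis using n3 by (simp add: split exps_def)
  qed
  show thesis
  proof (cases "\<exists>i<n. \<not> \<pi> dvd c i")
    case True
    show thesis
    proof (rule that[OF True])
      show "\<pi> dvd (\<Sum>i<n. c i)"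
        unfolding c_def by (rule relation_of(1)[OF T subset_refl V])
      show "\<pi> dvd (\<Sum>i<n. c i * of_nat (m i))"
        unfolding c_def by (rule relation_of(2)[OF T subset_refl V])
      show "\<forall>D. derivation D \<longrightarrow> D \<pi> = 0 \<longrightarrow> \<pi> dvd (\<Sum>i<n. c i * D (y i) * others i)"
        unfolding c_def by (rule relation_of(3)[OF T subset_refl V])
    qed
  next
    case False
    then have cdvd: "\<pi> dvd c i" if "i < n" for i using that by blast
    have T2: "\<pi> dvd T n + T 2" using cdvd[of 2] c_ge2[of 2] n3 by simp
    show thesis
    proof (cases "\<pi> dvd T n")
      case nd: False
      define c' where "c' i = (\<Sum>j\<in>{2, n}. T j * of_nat (exps n d j i))" for i
      have "c' 0 = T n" using n3 by (simp add: c'_def exps_def partner_def)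
      then have nc: "\<exists>i<n. \<not> \<pi> dvd c' i" using nd n3 by (intro exI[of _ 0]) simp
      have sub: "{2, n} \<subseteq> {..n}" using n3 by auto
      have V0: "\<pi> dvd (\<Sum>j\<in>{2, n}. T j) + 0" "\<pi> dvd of_nat \<mu> * 0"
        using T2 n3 by (simp_all add: add.commute)
      have d0: "\<forall>D. derivation D \<longrightarrow> D \<pi> = 0 \<longrightarrow> D 0 = (0 :: 'r)"
        by (intro allI impI derivation_0)
      show thesis
      proof (rule that[OF nc])
        show "\<pi> dvd (\<Sum>i<n. c' i)"
          unfolding c'_def by (rule relation_of(1)[OF T sub V0 d0])
        show "\<pi> dvd (\<Sum>i<n. c' i * of_nat (m i))"
          unfolding c'_def by (rule relation_of(2)[OF T sub V0 d0])
        show "\<forall>D. derivation D \<longrightarrow> D \<pi> = 0 \<longrightarrow> \<pi> dvd (\<Sum>i<n. c' i * D (y i) * others i)"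
          unfolding c'_def by (rule relation_of(3)[OF T sub V0 d0])
      qed
    next
      case Tn: True
      have Tj: "\<pi> dvd T j" if "2 \<le> j" "j < n" for j
        using cdvd[OF that(2)] Tn unfolding c_ge2[OF that] by (simp add: dvd_add_right_iff)
      have "{..<n} - {0, 2} = insert 1 ({..<n} - {0, 1, 2})" using n3 by auto
      then have "c 0 = T n + (T 0 + T 1) + (\<Sum>j\<in>{..<n} - {0, 1, 2}. T j)" unfolding c_0 by simp
      moreover have "\<pi> dvd (\<Sum>j\<in>{..<n} - {0, 1, 2}. T j)" by (rule dvd_sum) (auto intro!: Tj)
      ultimately have T01: "\<pi> dvd T 0 + T 1"
        using cdvd[of 0] Tn n3 by (simp add: dvd_add_left_iff dvd_add_right_iff)
      have "\<not> \<pi> dvd T 0 \<or> \<not> \<pi> dvd T 1"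
      proof -
        obtain j where j: "j \<le> n" "\<not> \<pi> dvd T j" using lead by blast
        have "j \<noteq> n" using j Tn by blast
        moreover have "\<not> 2 \<le> j" using j Tj[of j] calculation by linarith
        ultimately have "j = 0 \<or> j = 1" by linarith
        then show ?thesis using j by blast
      qed
      then have nd: "\<not> \<pi> dvd T 0" "\<not> \<pi> dvd T 1"
        using T01 dvd_add_left_iff[of \<pi> "T 1" "T 0"] dvd_add_right_iff[of \<pi> "T 0" "T 1"] by blast+
      have n01: "0 \<le> n" "1 \<le> n" using n3 by auto
      note ev = equal_vertices[of \<mu> "T 0" "T 1", OF T[OF n01(1)] T[OF n01(2)] nd T01]
      define c' :: "nat \<Rightarrow> 'r" where "c' i = (if i \<le> 1 then 1 else 0)" for i
      have s: "(\<Sum>i<n. c' i * g i) = g 0 + g 1" for g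
      proof -
        have "(\<Sum>i<n. c' i * g i) = (\<Sum>i\<in>{0, 1}. c' i * g i)"
          by (rule sum.mono_neutral_right) (use n3 in \<open>auto simp: c'_def\<close>)
        then show ?thesis by (simp add: c'_def)
      qed
      show thesis
      proof (rule that[of c'])
        have "\<not> \<pi> dvd 1" using prime by (simp add: prime_elem_def)
        then show "\<exists>i<n. \<not> \<pi> dvd c' i" using n3
          by (intro exI[of _ 0]) (simp add: c'_def)
        show "\<pi> dvd (\<Sum>i<n. c' i)" using s[of "\<lambda>_. 1"] char2 by simp
        have "(\<Sum>i<n. c' i * of_nat (m i)) = (1 + 1) * of_nat (m 1)"
          unfolding s ev(1) by (simp add: algebra_simps)
        then show "\<pi> dvd (\<Sum>i<n. c' i * of_nat (m i))" using char2 by simp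
        show "\<forall>D. derivation D \<longrightarrow> D \<pi> = 0 \<longrightarrow> \<pi> dvd (\<Sum>i<n. c' i * D (y i) * others i)"
        proof (intro allI impI)
        fix D assume D: "derivation D" "D \<pi> = 0"
        define R where "R = (\<Prod>j\<in>{..<n} - {0, 1}. y j)"
        have "{..<n} - {0} = insert 1 ({..<n} - {0, 1})" using n3 by auto
        from arg_cong[OF this, of "prod y"] have o0: "others 0 = y 1 * R"
          unfolding others_def R_def by (simp only: prod.insert finite_Diff finite_lessThan) simp
        have "{..<n} - {1} = insert 0 ({..<n} - {0, 1})" using n3 by auto
        from arg_cong[OF this, of "prod y"] have o1: "others 1 = y 0 * R"
          unfolding others_def R_def by (simp only: prod.insert finite_Diff finite_lessThan) simp
        have "(\<Sum>i<n. c' i * D (y i) * others i) = D (y 0) * others 0 + D (y 1) * others 1"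
          using s[of "\<lambda>i. D (y i) * others i"] by (simp only: mult.assoc)
        also have "\<dots> = (y 1 * D (y 0) + y 0 * D (y 1)) * R"
          unfolding o0 o1 by (simp only: distrib_right distrib_left mult_ac)
        finally have "(\<Sum>i<n. c' i * D (y i) * others i) = (y 1 * D (y 0) + y 0 * D (y 1)) * R" .
        then show "\<pi> dvd (\<Sum>i<n. c' i * D (y i) * others i)" using ev(2)[OF D] by simp
        qed
      qed
    qed
  qed
qed

end

text \<open>
  The row with index 1 carries the functions themselves, so that \<open>wmat\<close> of \<open>n\<close> functions is the
  matrix of the logarithmic form \<open>dlog (x\<^sub>0 / x\<^sub>1) \<and> \<dots> \<and> dlog (x\<^sub>n\<^sub>-\<^sub>1 / x\<^sub>1)\<close> up to the factor \<open>\<Prod>x\<^sub>i\<close>.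
\<close>

definition wmat :: "nat \<Rightarrow> (nat \<Rightarrow> 'r \<Rightarrow> 'r) \<Rightarrow> (nat \<Rightarrow> 'r::comm_ring_1) \<Rightarrow> 'r mat"
  where "wmat n D x = Matrix.mat n n (\<lambda>(a, i). if a = 1 then x i else D a (x i))"

lemma wmat_carrier [simp]: "wmat n D x \<in> carrier_mat n n"
  by (simp add: wmat_def)

section \<open>Row operations and divisibility of determinants\<close>

definition comb_mat :: "nat \<Rightarrow> nat \<Rightarrow> (nat \<Rightarrow> 'r) \<Rightarrow> (nat \<Rightarrow> 'r) \<Rightarrow> 'r::comm_ring_1 mat"
  where "comb_mat n r f g =
    Matrix.mat n n (\<lambda>(a, b). if a = b then f a else if b = r then g a else 0) "

lemma comb_mat_carrier [simp]: "comb_mat n r f g \<in> carrier_mat n n"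
  by (simp add: comb_mat_def)

text \<open>Multiplication by this matrix from the left scales row a by \<open>f a\<close> and adds
  \<open>g a\<close> times row r. In the Leibniz sum only the identity survives, since a permutation
  that moves indices to r only cannot be injective.\<close>

lemma det_comb_mat:
  assumes "g r = 0"
  shows "Determinant.det (comb_mat n r f g) = (\<Prod>i<n. f i)"
proof -
  let ?P = "comb_mat n r f g"
  have zero: "(\<Prod>i = 0..<n. ?P $$ (i, p i)) = 0" if p: "p permutes {0..<n}" "p \<noteq> id" for p
  proof -
    have "\<exists>i<n. p i \<noteq> i \<and> p i \<noteq> r"
    proof (rule ccontr)
      assume "\<not> ?thesis"
      then have *: "p i = i \<or> p i = r" if "i < n" for i using that by blast
      obtain i where i: "i < n" "p i \<noteq> i"
        using p by (metis atLeastLessThan_iff ext id_apply permutes_not_in zero_le)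
      then have "p i = r" using * by blast
      moreover have "r < n" using i p calculation by (metis atLeastLessThan_iff permutes_in_image zero_le)
      then have "p r = r" using *[of r] by blast
      ultimately show False using p(1) i(2) by (metis permutes_inj injD)
    qed
    then obtain i where i: "i < n" "p i \<noteq> i" "p i \<noteq> r" by blast
    have "p i < n" using p(1) i(1) by (metis atLeastLessThan_iff permutes_in_image zero_le)
    then have "?P $$ (i, p i) = 0" using i by (simp add: comb_mat_def)
    then show ?thesis using i(1) by (intro prod_zero) auto
  qed
  have "Determinant.det ?P =
      (\<Sum>p\<in>{p. p permutes {0..<n}}. signof p * (\<Prod>i = 0..<n. ?P $$ (i, p i)))"
    by (rule det_def'[OF comb_mat_carrier])
  also have "\<dots> = (\<Sum>p\<in>{id}. signof p * (\<Prod>i = 0..<n. ?P $$ (i, p i)))"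
    by (rule sum.mono_neutral_right) (use zero in \<open>auto simp: permutes_id finite_permutations\<close>)
  also have "\<dots> = (\<Prod>i = 0..<n. f i)" by (auto simp: comb_mat_def intro!: prod.cong)
  finally show ?thesis by (simp add: atLeast0LessThan)
qed

lemma comb_mat_mult:
  assumes A: "A \<in> carrier_mat n n" and "r < n" "a < n" "i < n" "g r = 0"
  shows "(comb_mat n r f g * A) $$ (a, i) = f a * A $$ (a, i) + g a * A $$ (r, i)"
proof -
  have "(comb_mat n r f g * A) $$ (a, i) = (\<Sum>b = 0..<n. (if a = b then f a else if b = r then g a else 0) * A $$ (b, i))"
    using assms by (simp add: comb_mat_def scalar_prod_def)
  also have "\<dots> = (\<Sum>b = 0..<n. (if b = a then f a * A $$ (b, i) else 0) + (if b = r then g a * A $$ (b, i) else 0))"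
    by (rule sum.cong) (use assms in auto)
  finally show ?thesis using assms by (simp add: sum.distrib)
qed

lemma det_col_scale:
  assumes A: "A \<in> carrier_mat n n"
  shows "Determinant.det (Matrix.mat n n (\<lambda>(a, i). s i * A $$ (a, i))) = (\<Prod>i<n. s i) * Determinant.det (A :: 'r::comm_ring_1 mat)"
proof -
  have "Determinant.det (Matrix.mat n n (\<lambda>(a, i). s i * A $$ (a, i))) =
      (\<Sum>p\<in>{p. p permutes {0..<n}}. signof p * (\<Prod>i = 0..<n. s (p i) * A $$ (i, p i)))"
    by (subst det_def'[of _ n]) (auto intro!: sum.cong prod.cong simp: permutes_in_image[where S = "{0..<n}", simplified])
  also have "\<dots> = (\<Sum>p\<in>{p. p permutes {0..<n}}. (\<Prod>i<n. s i) * (signof p * (\<Prod>i = 0..<n. A $$ (i, p i))))"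
  proof (rule sum.cong[OF refl])
    fix p assume "p \<in> {p. p permutes {0..<n}}"
    then have "(\<Prod>i = 0..<n. s (p i)) = (\<Prod>i<n. s i)"
      using prod.permute[of p "{0..<n}" s] by (simp add: o_def atLeast0LessThan)
    then show "signof p * (\<Prod>i = 0..<n. s (p i) * A $$ (i, p i)) =
        (\<Prod>i<n. s i) * (signof p * (\<Prod>i = 0..<n. A $$ (i, p i)))"
      by (simp add: prod.distrib algebra_simps)
  qed
  finally show ?thesis by (simp add: det_def'[OF A] sum_distrib_left)
qed

text \<open>Applying the adjugate to A v = 0 modulo p shows that p divides the determinant times
  \<open>v k\<close>.\<close>

lemma dvd_det_if_kernel:
  fixes A :: "'r::idom mat"
  assumes A: "A \<in> carrier_mat n n" and p: "prime_elem p"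
    and ker: "\<And>a. a < n \<Longrightarrow> p dvd (\<Sum>i<n. A $$ (a, i) * v i)" and v: "k < n" "\<not> p dvd v k"
  shows "p dvd Determinant.det A"
proof -
  have adj: "adj_mat A \<in> carrier_mat n n" "adj_mat A * A = Determinant.det A \<cdot>\<^sub>m 1\<^sub>m n"
    using adj_mat[OF A] by auto
  have entry: "(\<Sum>a<n. adj_mat A $$ (k, a) * A $$ (a, i)) = (if i = k then Determinant.det A else 0)" if "i < n" for i
  proof -
    have "(adj_mat A * A) $$ (k, i) = (\<Sum>a<n. adj_mat A $$ (k, a) * A $$ (a, i))"
      using A adj(1) v(1) that by (simp add: scalar_prod_def atLeast0LessThan)
    then show ?thesis unfolding adj(2) using v(1) that by auto
  qed
  have "(\<Sum>a<n. adj_mat A $$ (k, a) * (\<Sum>i<n. A $$ (a, i) * v i)) =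
      (\<Sum>i<n. (\<Sum>a<n. adj_mat A $$ (k, a) * A $$ (a, i)) * v i)"
    unfolding sum_distrib_left sum_distrib_right by (subst sum.swap) (simp add: mult_ac)
  also have "\<dots> = (\<Sum>i<n. if i = k then Determinant.det A * v i else 0)"
    by (rule sum.cong) (auto simp: entry)
  also have "\<dots> = Determinant.det A * v k" using v(1) by simp
  finally have "Determinant.det A * v k = (\<Sum>a<n. adj_mat A $$ (k, a) * (\<Sum>i<n. A $$ (a, i) * v i))" ..
  also have "p dvd \<dots>" by (intro dvd_sum dvd_mult ker) auto
  finally show ?thesis using p v(2) by (simp add: prime_elem_dvd_mult_iff)
qed

lemma prime_elem_power_dvd_cancel:
  assumes p: "prime_elem (p::'r::idom)" and "\<not> p dvd z" "p ^ k dvd z ^ l * b"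
  shows "p ^ k dvd b"
  using assms(3)
proof (induction k arbitrary: b)
  case (Suc k)
  have p0: "p \<noteq> 0" using p by auto
  have "p dvd z ^ l * b" using Suc.prems by (metis dvd_mult_left power_Suc)
  then have "p dvd b" using p assms(2) by (metis prime_elem_dvd_mult_iff prime_elem_dvd_power)
  then obtain c where c: "b = p * c" by (rule dvdE)
  have "p * p ^ k dvd p * (z ^ l * c)" using Suc.prems c by (simp add: mult_ac)
  then have "p ^ k dvd z ^ l * c" using p0 by simp
  then have "p ^ k dvd c" by (rule Suc.IH)
  then show ?case unfolding c by simp
qed simp

lemma derivation_scaled:
  assumes "derivation D"
  shows "D (p ^ k * y) = p ^ k * D y + of_nat k * p ^ (k - 1) * D p * y"
proof (cases k)
  case 0
  then show ?thesis by simp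
next
  case (Suc l)
  have "D (p ^ k * y) = p ^ k * D y + D (p ^ k) * y"
    by (simp add: derivation_mult[OF assms] add.commute)
  moreover have "D (p ^ k) = of_nat k * p ^ (k - 1) * D p"
    using derivation_power[OF assms, of p l] unfolding Suc by simp
  ultimately show ?thesis by simp
qed

text \<open>By the product rule each differentiated row becomes s times the old row plus a multiple
  of row 1, which holds the functions themselves. Hence the form is well defined on projective
  points.\<close>

lemma det_wmat_scale:
  assumes n: "1 < n" and D: "\<And>a. a < n \<Longrightarrow> derivation (D a)"
  shows "Determinant.det (wmat n D (\<lambda>i. s * y i)) = s ^ n * Determinant.det (wmat n D y)"
proof -
  let ?g = "\<lambda>a. if a = 1 then 0 else D a s"
  have "wmat n D (\<lambda>i. s * y i) = comb_mat n 1 (\<lambda>_. s) ?g * wmat n D y" (is "?L = ?R")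
  proof (rule eq_matI)
    fix a i assume "a < dim_row ?R" "i < dim_col ?R"
    then have ai: "a < n" "i < n" by (auto simp: comb_mat_def wmat_def)
    have "?R $$ (a, i) = s * wmat n D y $$ (a, i) + ?g a * wmat n D y $$ (1, i)"
      by (rule comb_mat_mult) (use n ai in auto)
    then show "?L $$ (a, i) = ?R $$ (a, i)"
      using ai n by (simp add: wmat_def derivation_mult[OF D] add.commute)
  qed (auto simp: comb_mat_def wmat_def)
  then show ?thesis
    by (simp add: det_mult[OF comb_mat_carrier wmat_carrier] det_comb_mat)
qed

context conic_point
begin

abbreviation xx :: "nat \<Rightarrow> 'r" where "xx i \<equiv> \<pi> ^ m i * y i"

lemma others_mult: "i < n \<Longrightarrow> y i * others i = (\<Prod>j<n. y j)"
  unfolding others_def by (simp add: prod.remove)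

lemma not_dvd_others: "\<not> \<pi> dvd others i"
proof -
  have "\<not> \<pi> dvd (\<Prod>j\<in>A. y j)" if "A \<subseteq> {..<n}" for A
    using finite_subset[OF that finite_lessThan] that
  proof (induction A rule: finite_induct)
    case empty
    then show ?case using prime by (simp add: prime_elem_def)
  next
    case (insert i A)
    then show ?case using y[of i] by (auto simp: prime_mult)
  qed
  from this[of "{..<n} - {i}"] show ?thesis unfolding others_def by (simp add: Diff_subset)
qed

text \<open>Differentiation along the divisor \<pi> = 0. The derivation is existentially quantified
  because a row may arise from a combination of several given derivations. The coefficients from
  \<open>relation\<close> annihilate all such rows modulo \<pi>.\<close>

definition tangent :: "(nat \<Rightarrow> 'r) \<Rightarrow> bool"
  where "tangent f \<longleftrightarrow> (\<exists>D. derivation D \<and> D \<pi> = 0 \<and> (\<forall>i<n. f i = D (y i)))"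

lemma tangentI: "derivation D \<Longrightarrow> D \<pi> = 0 \<Longrightarrow> (\<And>i. i < n \<Longrightarrow> f i = D (y i)) \<Longrightarrow> tangent f"
  unfolding tangent_def by (intro exI[of _ D]) simp

text \<open>The vector \<open>c i * others i\<close>, which is c i / y i up to a common factor, lies
  in the kernel of A modulo \<pi>. Row 1 yields the sum of the \<open>c i\<close>, a tangent row the
  differential relation, and the residue row r the sum of the \<open>c i * m i\<close>.\<close>

lemma dvd_det_residue:
  assumes A: "A \<in> carrier_mat n n"
    and r: "r < n" "r \<noteq> 1"
    and row1: "\<And>i. i < n \<Longrightarrow> A $$ (1, i) = y i"
    and rowr: "(\<forall>i<n. A $$ (r, i) = \<pi> * b i + of_nat (m i) * z * y i) \<or> tangent (\<lambda>i. A $$ (r, i))"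
    and rows: "\<And>a. a < n \<Longrightarrow> a \<noteq> 1 \<Longrightarrow> a \<noteq> r \<Longrightarrow> tangent (\<lambda>i. A $$ (a, i))"
  shows "\<pi> dvd Determinant.det A"
proof -
  obtain c where c: "\<exists>i<n. \<not> \<pi> dvd c i" "\<pi> dvd (\<Sum>i<n. c i)" "\<pi> dvd (\<Sum>i<n. c i * of_nat (m i))"
    "\<forall>D. derivation D \<longrightarrow> D \<pi> = 0 \<longrightarrow> \<pi> dvd (\<Sum>i<n. c i * D (y i) * others i)"
    by (rule relation)
  obtain k where k: "k < n" "\<not> \<pi> dvd c k" using c(1) by blast
  have der: "\<pi> dvd (\<Sum>i<n. A $$ (a, i) * (c i * others i))"
    if ex: "tangent (\<lambda>i. A $$ (a, i))" for a
  proof -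
    obtain D where D: "derivation D" "D \<pi> = 0" "\<forall>i<n. A $$ (a, i) = D (y i)" using ex
      unfolding tangent_def by (elim exE conjE)
    have "(\<Sum>i<n. A $$ (a, i) * (c i * others i)) = (\<Sum>i<n. c i * D (y i) * others i)"
      by (rule sum.cong) (use D(3) in \<open>auto simp: mult_ac\<close>)
    then show ?thesis using c(4) D by simp
  qed
  show ?thesis
  proof (rule dvd_det_if_kernel[OF A prime _ k(1)])
    show "\<not> \<pi> dvd c k * others k" using k not_dvd_others by (simp add: prime_mult)
    fix a assume a: "a < n"
    consider "a = 1" | "tangent (\<lambda>i. A $$ (a, i))"
      | "a = r" "\<forall>i<n. A $$ (r, i) = \<pi> * b i + of_nat (m i) * z * y i"
      using rowr rows[OF a] by metis
    then show "\<pi> dvd (\<Sum>i<n. A $$ (a, i) * (c i * others i))"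
    proof cases
      case 1
      have "(\<Sum>i<n. A $$ (a, i) * (c i * others i)) = (\<Sum>i<n. c i * (\<Prod>j<n. y j))"
      proof (rule sum.cong[OF refl])
        fix i assume "i \<in> {..<n}"
        then have "i < n" by simp
        then show "A $$ (a, i) * (c i * others i) = c i * (\<Prod>j<n. y j)"
          unfolding 1 row1[OF \<open>i < n\<close>] others_mult[OF \<open>i < n\<close>, symmetric] by (simp only: mult_ac)
      qed
      then show ?thesis using c(2) by (simp add: sum_distrib_right [symmetric])
    next
      case 2
      then show ?thesis by (rule der)
    next
      case 3
      have "(\<Sum>i<n. A $$ (a, i) * (c i * others i)) =
          (\<Sum>i<n. \<pi> * (b i * c i * others i) + c i * of_nat (m i) * (z * (\<Prod>j<n. y j)))"
        by (rule sum.cong) (auto simp: 3 others_mult [symmetric] algebra_simps)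
      also have "\<dots> = \<pi> * (\<Sum>i<n. b i * c i * others i) + (\<Sum>i<n. c i * of_nat (m i)) * (z * (\<Prod>j<n. y j))"
        by (simp add: sum.distrib sum_distrib_left sum_distrib_right)
      finally show ?thesis using c(3) by simp
    qed
  qed
qed

text \<open>The columns account for the exponent \<open>\<Sum>i<n. m i\<close>. All rows except row
  1 are tangent, so the relation gives one factor more. Thus the form vanishes at a point where the
  coordinates have different orders.\<close>

lemma power_dvd_det_if_const:
  assumes D: "\<And>a. a < n \<Longrightarrow> derivation (D a)" and D\<pi>: "\<And>a. a < n \<Longrightarrow> D a \<pi> = 0"
  shows "\<pi> ^ Suc (\<Sum>i<n. m i) dvd Determinant.det (wmat n D xx)"
proof -
  have "wmat n D xx = Matrix.mat n n (\<lambda>(a, i). \<pi> ^ m i * wmat n D y $$ (a, i))"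
    by (rule eq_matI) (auto simp: wmat_def derivation_mult[OF D] derivation_power_const[OF D D\<pi>])
  then have "Determinant.det (wmat n D xx) = \<pi> ^ (\<Sum>i<n. m i) * Determinant.det (wmat n D y)"
    by (simp add: det_col_scale[OF wmat_carrier] power_sum)
  moreover have "\<pi> dvd Determinant.det (wmat n D y)"
  proof (rule dvd_det_residue[OF wmat_carrier, of 0])
    have der: "tangent (\<lambda>i. wmat n D y $$ (a, i))" if "a < n" "a \<noteq> 1" for a
      by (rule tangentI[of "D a"]) (use that D D\<pi> in \<open>auto simp: wmat_def\<close>)
    show "0 < n" "(0::nat) \<noteq> 1" using n3 by auto
    show "wmat n D y $$ (1, i) = y i" if "i < n" for i using n3 that by (simp add: wmat_def)
    show "(\<forall>i<n. wmat n D y $$ (0, i) = \<pi> * 0 + of_nat (m i) * 0 * y i) \<or>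
      tangent (\<lambda>i. wmat n D y $$ (0, i))"
      using der[of 0] n3 by simp
    show "tangent (\<lambda>i. wmat n D y $$ (a, i))" if "a < n" "a \<noteq> 1" for a
      using der[OF that] .
  qed
  ultimately show ?thesis by (simp add: mult_dvd_mono mult.commute)
qed

text \<open>If \<pi> divides \<open>D a \<pi>\<close> for all rows in question, the powers of \<pi>
  come out of the columns. Otherwise a row r with \<open>D r \<pi>\<close> prime to \<pi> is used to
  make the other rows tangent. This costs a factor \<pi> and a power of \<open>D r \<pi>\<close>,
  and the relation among the residues gives the factor \<pi> back.\<close>

lemma power_dvd_det:
  assumes D: "\<And>a. a < n \<Longrightarrow> derivation (D a)"
  shows "\<pi> ^ (\<Sum>i<n. m i) dvd Determinant.det (wmat n D xx)"
proof (cases "\<exists>r<n. r \<noteq> 1 \<and> \<not> \<pi> dvd D r \<pi>")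
  case False
  then have "\<exists>q. D a \<pi> = \<pi> * q" if "a < n" "a \<noteq> 1" for a using that by (auto simp: dvd_def)
  then obtain q where q: "\<And>a. a < n \<Longrightarrow> a \<noteq> 1 \<Longrightarrow> D a \<pi> = \<pi> * q a" by metis
  let ?A = "Matrix.mat n n (\<lambda>(a, i). if a = 1 then y i else D a (y i) + of_nat (m i) * q a * y i)"
  have "wmat n D xx = Matrix.mat n n (\<lambda>(a, i). \<pi> ^ m i * ?A $$ (a, i))"
  proof (rule eq_matI)
    fix a i assume "a < dim_row (Matrix.mat n n (\<lambda>(a, i). \<pi> ^ m i * ?A $$ (a, i)))"
      "i < dim_col (Matrix.mat n n (\<lambda>(a, i). \<pi> ^ m i * ?A $$ (a, i)))"
    then have ai: "a < n" "i < n" by auto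
    have "of_nat (m i) * \<pi> ^ (m i - 1) * (\<pi> * q a) = of_nat (m i) * \<pi> ^ m i * q a"
      by (cases "m i") (auto simp: algebra_simps)
    then have "D a (xx i) = \<pi> ^ m i * (D a (y i) + of_nat (m i) * q a * y i)" if "a \<noteq> 1"
      using derivation_scaled[OF D[OF ai(1)], of \<pi> "m i" "y i"] q[OF ai(1) that]
      by (simp only: distrib_left mult_ac)
    then show "wmat n D xx $$ (a, i) = Matrix.mat n n (\<lambda>(a, i). \<pi> ^ m i * ?A $$ (a, i)) $$ (a, i)"
      using ai by (simp add: wmat_def)
  qed (auto simp: wmat_def)
  then have "Determinant.det (wmat n D xx) = \<pi> ^ (\<Sum>i<n. m i) * Determinant.det ?A"
    by (simp only:) (subst det_col_scale, auto simp: power_sum)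
  then show ?thesis by simp
next
  case True
  then obtain r where r: "r < n" "r \<noteq> 1" "\<not> \<pi> dvd D r \<pi>" by blast
  define z where "z = D r \<pi>"
  \<comment> \<open>Row r is multiplied by \<pi> because \<open>D r\<close> lowers the exponent of a
    power of \<pi> by one. Every row other than r and 1 is replaced by z D a - (D a \<pi>) D r,
    which kills \<pi>.\<close>
  let ?f = "\<lambda>a. if a = 1 then 1 else if a = r then \<pi> else z"
  let ?g = "\<lambda>a. if a = 1 \<or> a = r then 0 else - D a \<pi>"
  let ?A = "Matrix.mat n n (\<lambda>(a, i). if a = 1 then y i else if a = r
     then \<pi> * D r (y i) + of_nat (m i) * z * y i else z * D a (y i) - D a \<pi> * D r (y i))"
  have eq: "comb_mat n r ?f ?g * wmat n D xx = Matrix.mat n n (\<lambda>(a, i). \<pi> ^ m i * ?A $$ (a, i))" (is "?L = ?R")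
  proof (rule eq_matI)
    fix a i assume "a < dim_row ?R" "i < dim_col ?R"
    then have ai: "a < n" "i < n" by auto
    have L: "?L $$ (a, i) = ?f a * wmat n D xx $$ (a, i) + ?g a * wmat n D xx $$ (r, i)"
      by (rule comb_mat_mult) (use r ai in auto)
    have "\<pi> * (of_nat (m i) * \<pi> ^ (m i - 1) * z * y i) = \<pi> ^ m i * (of_nat (m i) * z * y i)"
      by (cases "m i") (auto simp: algebra_simps)
    note mi = this
    have ds: "D b (xx i) = \<pi> ^ m i * D b (y i) + of_nat (m i) * \<pi> ^ (m i - 1) * D b \<pi> * y i" if "b < n" for b
      using derivation_scaled[OF D[OF that]] .
    have 1: "\<pi> * D r (xx i) = \<pi> ^ m i * (\<pi> * D r (y i) + of_nat (m i) * z * y i)"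
    proof -
      have "\<pi> * D r (xx i) = \<pi> ^ m i * (\<pi> * D r (y i)) + \<pi> * (of_nat (m i) * \<pi> ^ (m i - 1) * z * y i)"
        unfolding ds[OF r(1)] z_def by (simp only: distrib_left mult_ac)
      then show ?thesis unfolding mi by (simp only: distrib_left)
    qed
    have 2: "z * D a (xx i) + - D a \<pi> * D r (xx i) = \<pi> ^ m i * (z * D a (y i) - D a \<pi> * D r (y i))"
      unfolding ds[OF r(1)] ds[OF ai(1)] z_def by (simp add: algebra_simps)
    have W: "wmat n D xx $$ (b, i) = (if b = 1 then xx i else D b (xx i))" if "b < n" for b
      using ai that by (simp add: wmat_def)
    consider "a = 1" | "a = r" | "a \<noteq> 1" "a \<noteq> r" by blast
    then show "?L $$ (a, i) = ?R $$ (a, i)"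
    proof cases
      case 1
      then show ?thesis unfolding L W[OF ai(1)] W[OF r(1)] using ai r by simp
    next
      case 2
      then show ?thesis unfolding L W[OF ai(1)] W[OF r(1)] using ai r \<open>\<pi> * D r (xx i) = _\<close> by simp
    next
      case 3
      then show ?thesis unfolding L W[OF ai(1)] W[OF r(1)] using ai r \<open>z * D a (xx i) + _ = _\<close> by simp
    qed
  qed (auto simp: comb_mat_def wmat_def)
  have "Determinant.det (comb_mat n r ?f ?g * wmat n D xx) = \<pi> ^ (\<Sum>i<n. m i) * Determinant.det ?A"
    unfolding eq by (subst det_col_scale) (auto simp: power_sum)
  moreover have "(\<Prod>a<n. ?f a) = \<pi> * z ^ (n - 2)"
  proof -
    have "{..<n} = insert 1 (insert r ({..<n} - {1, r}))" using r n3 by auto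
    then have "(\<Prod>a<n. ?f a) = (\<Prod>a\<in>insert 1 (insert r ({..<n} - {1, r})). ?f a)" by (rule arg_cong)
    also have "\<dots> = \<pi> * (\<Prod>a\<in>{..<n} - {1, r}. ?f a)" using r by simp
    also have "(\<Prod>a\<in>{..<n} - {1, r}. ?f a) = (\<Prod>a\<in>{..<n} - {1, r}. z)" by (rule prod.cong) auto
    also have "\<dots> = z ^ (n - 2)" using r n3 by (simp add: card_Diff_subset numeral_2_eq_2)
    finally show ?thesis .
  qed
  ultimately have 1: "\<pi> * z ^ (n - 2) * Determinant.det (wmat n D xx) = \<pi> ^ (\<Sum>i<n. m i) * Determinant.det ?A"
    by (simp add: det_mult[OF comb_mat_carrier wmat_carrier] det_comb_mat)
  have "\<pi> dvd Determinant.det ?A"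
  proof (rule dvd_det_residue[OF _ r(1,2)])
    show "?A \<in> carrier_mat n n" by simp
    show "?A $$ (1, i) = y i" if "i < n" for i using n3 that by simp
    show "(\<forall>i<n. ?A $$ (r, i) = \<pi> * D r (y i) + of_nat (m i) * z * y i) \<or> tangent (\<lambda>i. ?A $$ (r, i))"
      using r by simp
    fix a assume a: "a < n" "a \<noteq> 1" "a \<noteq> r"
    show "tangent (\<lambda>i. ?A $$ (a, i))"
    proof (rule tangentI)
      show "derivation (\<lambda>u. z * D a u - D a \<pi> * D r u)"
        by (rule derivation_combination[OF D[OF a(1)] D[OF r(1)]])
      show "z * D a \<pi> - D a \<pi> * D r \<pi> = 0" unfolding z_def by simp
      show "?A $$ (a, i) = z * D a (y i) - D a \<pi> * D r (y i)" if "i < n" for i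
        using a that by simp
    qed
  qed
  then obtain u where u: "Determinant.det ?A = \<pi> * u" by (rule dvdE)
  have "\<pi> * (z ^ (n - 2) * Determinant.det (wmat n D xx)) = \<pi> * (\<pi> ^ (\<Sum>i<n. m i) * u)"
    using 1 unfolding u by (simp only: mult_ac)
  then have "z ^ (n - 2) * Determinant.det (wmat n D xx) = \<pi> ^ (\<Sum>i<n. m i) * u" using pi0 by simp
  then have "\<pi> ^ (\<Sum>i<n. m i) dvd z ^ (n - 2) * Determinant.det (wmat n D xx)" by simp
  then show ?thesis by (rule prime_elem_power_dvd_cancel[OF prime r(3)[folded z_def]])
qed

end

section \<open>Rational curves in the reduced conic bundle\<close>

lemma derivation_map_poly:
  assumes "derivation (\<delta> :: 'e::comm_ring_1 \<Rightarrow> 'e)" shows "derivation (map_poly \<delta>)"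
proof -
  have c: "coeff (map_poly \<delta> p) k = \<delta> (coeff p k)" for p k
    by (rule coeff_map_poly) (rule derivation_0[OF assms])
  have "map_poly \<delta> (p + q) = map_poly \<delta> p + map_poly \<delta> q" for p q
    by (rule poly_eqI) (simp add: c derivation_add[OF assms])
  moreover have "map_poly \<delta> (p * q) = map_poly \<delta> p * q + p * map_poly \<delta> q" for p q
    by (rule poly_eqI)
       (simp add: c coeff_mult derivation_sum[OF assms] derivation_mult[OF assms] sum.distrib)
  ultimately show ?thesis unfolding derivation_def by blast
qed

lemma map_poly_derivation_X: "derivation \<delta> \<Longrightarrow> map_poly \<delta> [:0, 1:] = 0"
  by (simp add: map_poly_pCons derivation_0 derivation_1)

lemma prime_elem_decompose:
  fixes \<pi> :: "'e::field poly"
  assumes "prime_elem \<pi>" "a \<noteq> 0"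
  shows "\<exists>k b. a = \<pi> ^ k * b \<and> \<not> \<pi> dvd b"
  using assms(2)
proof (induction "degree a" arbitrary: a rule: less_induct)
  case less
  show ?case
  proof (cases "\<pi> dvd a")
    case False
    then show ?thesis by (intro exI[of _ 0] exI[of _ a]) simp
  next
    case True
    then obtain c where c: "a = \<pi> * c" by (rule dvdE)
    have "degree \<pi> \<noteq> 0"
      using assms(1) by (metis is_unit_iff_degree prime_elem_def)
    then have "degree c < degree a" using less.prems unfolding c by (simp add: degree_mult_eq)
    moreover have "c \<noteq> 0" using less.prems c by auto
    ultimately obtain k b where "c = \<pi> ^ k * b" "\<not> \<pi> dvd b" using less.hyps by blast
    then show ?thesis unfolding c by (intro exI[of _ "Suc k"] exI[of _ b]) simp
  qed
qed

lemma prime_factor_exists: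
  fixes P :: "'e::field poly"
  assumes "degree P > 0"
  obtains \<pi> where "prime_elem \<pi>" "\<pi> dvd P"
proof -
  have "\<exists>\<pi>. prime_elem \<pi> \<and> \<pi> dvd P"
    using assms
  proof (induction "degree P" arbitrary: P rule: less_induct)
    case less
    show ?case
    proof (cases "irreducible P")
      case True
      then show ?thesis using field_poly_irreducible_imp_prime[of P] by (intro exI[of _ P]) simp
    next
      case False
      have "P \<noteq> 0" using less.prems by auto
      moreover have "\<not> is_unit P" using less.prems calculation by (simp add: is_unit_iff_degree)
      ultimately obtain a b where ab: "P = a * b" "\<not> is_unit a" "\<not> is_unit b"
        using False by (auto simp: irreducible_def)
      then have "a \<noteq> 0" "b \<noteq> 0" using \<open>P \<noteq> 0\<close> by auto
      then have "degree a > 0" "degree b > 0" "degree P = degree a + degree b"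
        using ab by (auto simp: is_unit_iff_degree degree_mult_eq)
      then obtain \<pi> where "prime_elem \<pi>" "\<pi> dvd a" using less.hyps[of a] by auto
      then show ?thesis using ab(1) by auto
    qed
  qed
  then show thesis using that by blast
qed

text \<open>Induction on the degree, removing one prime factor of P from both polynomials. For a
  prime associated with the removed one, the hypothesis is used with an exponent that is larger by
  one.\<close>

lemma dvd_if_prime_powers_dvd:
  fixes P W :: "'e::field poly"
  assumes "P \<noteq> 0" "\<And>\<pi> k. prime_elem \<pi> \<Longrightarrow> \<pi> ^ k dvd P \<Longrightarrow> \<pi> ^ k dvd W"
  shows "P dvd W"
  using assms
proof (induction "degree P" arbitrary: P W rule: less_induct)
  case less
  show ?case
  proof (cases "degree P = 0")
    case True
    then have "is_unit P" using less.prems(1) by (simp add: is_unit_iff_degree)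
    then show ?thesis by (rule unit_imp_dvd)
  next
    case False
    then obtain \<pi> where \<pi>: "prime_elem \<pi>" "\<pi> dvd P" using prime_factor_exists[of P] by auto
    have \<pi>0: "\<pi> \<noteq> 0" using \<pi>(1) by auto
    have deg: "degree \<pi> > 0" using \<pi>(1) by (metis is_unit_iff_degree prime_elem_def gr0I)
    obtain P' where P': "P = \<pi> * P'" using \<pi>(2) by (rule dvdE)
    have "\<pi> ^ 1 dvd W" by (rule less.prems(2)[OF \<pi>(1)]) (simp add: \<pi>(2))
    then obtain W' where W': "W = \<pi> * W'" by (metis dvdE power_one_right)
    have P'0: "P' \<noteq> 0" using less.prems(1) P' by auto
    have "P' dvd W'"
    proof (rule less.hyps)
      show "degree P' < degree P" using deg P'0 \<pi>0 unfolding P' by (simp add: degree_mult_eq)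
      show "P' \<noteq> 0" by (rule P'0)
      fix \<rho> :: "'e poly" and k assume \<rho>: "prime_elem \<rho>" "\<rho> ^ k dvd P'"
      show "\<rho> ^ k dvd W'"
      proof (cases "\<rho> dvd \<pi>")
        case False
        have "\<rho> ^ k dvd W" by (rule less.prems(2)[OF \<rho>(1)]) (simp add: P' \<rho>(2))
        then have "\<rho> ^ k dvd \<pi> ^ 1 * W'" unfolding W' by simp
        then show ?thesis by (rule prime_elem_power_dvd_cancel[OF \<rho>(1) False])
      next
        case True
        then obtain u where u: "\<pi> = \<rho> * u" by (rule dvdE)
        have "irreducible \<pi>" using \<pi>(1) by (rule prime_elem_imp_irreducible)
        moreover have "\<not> is_unit \<rho>" using \<rho>(1) by (simp add: prime_elem_def)
        ultimately have "is_unit u" using irreducibleD[of \<pi> \<rho> u] u by simp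
        obtain q where q: "P' = \<rho> ^ k * q" using \<rho>(2) by (rule dvdE)
        have "P = \<rho> ^ Suc k * (u * q)" unfolding P' u q by (simp add: mult_ac)
        then have "\<rho> ^ Suc k dvd P" by (rule dvdI)
        then have "\<rho> ^ Suc k dvd W" by (rule less.prems(2)[OF \<rho>(1)])
        then obtain c where "\<rho> * u * W' = \<rho> ^ Suc k * c" unfolding W' u by (rule dvdE)
        then have "\<rho> * (u * W') = \<rho> * (\<rho> ^ k * c)" by (simp add: mult.assoc)
        moreover have "\<rho> \<noteq> 0" using \<rho>(1) by auto
        ultimately have "u * W' = \<rho> ^ k * c" by simp
        then have "\<rho> ^ k dvd u * W'" by simp
        then show ?thesis using \<open>is_unit u\<close> by (simp add: dvd_mult_unit_iff')
      qed
    qed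
    then show ?thesis unfolding P' W' by simp
  qed
qed

text \<open>Derivations of the coefficients do not raise degrees. This bounds the order of the form
  at the point at infinity of the curve.\<close>

lemma degree_det_wmat:
  fixes x :: "nat \<Rightarrow> 'e::field poly"
  assumes \<delta>: "\<And>a. derivation (\<delta> a)"
  shows "degree (Determinant.det (wmat n (\<lambda>a. map_poly (\<delta> a)) x)) \<le> (\<Sum>i<n. degree (x i))"
proof -
  let ?A = "wmat n (\<lambda>a. map_poly (\<delta> a)) x"
  have entry: "degree (?A $$ (a, i)) \<le> degree (x i)" if "a < n" "i < n" for a i
  proof -
    have "degree (map_poly (\<delta> a) (x i)) \<le> degree (x i)"
      by (rule degree_le) (simp add: coeff_map_poly derivation_0[OF \<delta>] coeff_eq_0)
    then show ?thesis using that by (simp add: wmat_def)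
  qed
  have "degree (signof p * (\<Prod>i = 0..<n. ?A $$ (i, p i))) \<le> (\<Sum>i<n. degree (x i))" if p: "p permutes {0..<n}" for p
  proof -
    have "degree (\<Prod>i = 0..<n. ?A $$ (i, p i)) \<le> (\<Sum>i = 0..<n. degree (?A $$ (i, p i)))"
      by (rule degree_prod_sum_le[unfolded o_def]) simp
    also have "\<dots> \<le> (\<Sum>i = 0..<n. degree (x (p i)))"
      by (rule sum_mono, rule entry) (use permutes_in_image[OF p] in auto)
    also have "\<dots> = (\<Sum>i<n. degree (x i))"
      using sum.permute[OF p, of "\<lambda>i. degree (x i)"] by (simp add: o_def atLeast0LessThan)
    finally show ?thesis by (cases "sign p = 1") (auto simp: sign_def)
  qed
  then show ?thesis
    unfolding det_def'[OF wmat_carrier]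
    by (intro degree_sum_le) (auto simp: finite_permutations)
qed

lemma sum_pow_prod:
  "(\<Prod>i<n. (\<pi>::'r::comm_ring_1) ^ m i * y i) = \<pi> ^ (\<Sum>i<n. m i) * (\<Prod>i<n. y i)"
  by (simp add: prod.distrib power_sum)

lemma prime_not_dvd_prod:
  fixes n :: nat
  assumes "prime_elem (\<pi>::'r::idom)" "\<And>i. i < n \<Longrightarrow> \<not> \<pi> dvd y i"
  shows "\<not> \<pi> dvd (\<Prod>i<n. y i)"
proof -
  have "(\<forall>i<n. \<not> \<pi> dvd y i) \<longrightarrow> \<not> \<pi> dvd (\<Prod>i<n. y i)"
  proof (induction n)
    case 0
    then show ?case using assms(1) by (simp add: prime_elem_def)
  next
    case (Suc n)
    then show ?case using assms(1) by (simp add: prime_elem_dvd_mult_iff)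
  qed
  then show ?thesis using assms(2) by blast
qed

text \<open>
  The invariant of a point \<open>v\<close> of projective space.  Since \<open>z / 0 = 0\<close>, it is \<open>0\<close> on the coordinate
  hyperplanes.
\<close>

definition omega :: "nat \<Rightarrow> (nat \<Rightarrow> 'e \<Rightarrow> 'e) \<Rightarrow> (nat \<Rightarrow> 'e::field) \<Rightarrow> 'e"
  where "omega n \<delta> v = Determinant.det (wmat n \<delta> v) / (\<Prod>i<n. v i)"

text \<open>A rational curve in the reduced cover, in homogeneous coordinates that are polynomials
  in a parameter. The derivations of the field are extended coefficientwise, so the parameter is a
  constant for them.\<close>

locale conic_curve =
  fixes n d :: nat and x :: "nat \<Rightarrow> 'e::field poly" and t0 t1 w :: "'e poly"
    and \<delta> :: "nat \<Rightarrow> 'e \<Rightarrow> 'e"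
  assumes char2: "(1::'e) + 1 = 0"
    and n3: "n \<ge> 3" and dn: "2 * d \<ge> n"
    and t: "t0 \<noteq> 0 \<or> t1 \<noteq> 0"
    and eqn: "w\<^sup>2 = emon n (exps n d n) x * (t0\<^sup>2 + t0 * t1) + (\<Sum>j<n. emon n (exps n d j) x) * t1\<^sup>2"
    and \<delta>: "\<And>a. derivation (\<delta> a)"
begin

abbreviation "D \<equiv> \<lambda>a. map_poly (\<delta> a)"
abbreviation "wdet \<equiv> Determinant.det (wmat n D x)"

lemma D: "derivation (D a)"
  by (rule derivation_map_poly[OF \<delta>])

lemma point:
  assumes "prime_elem \<pi>" "\<And>i. i < n \<Longrightarrow> \<not> \<pi> dvd y i" "\<And>i. i < n \<Longrightarrow> x i = \<pi> ^ m i * y i"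
    "\<exists>i<n. \<exists>j<n. m i \<noteq> m j"
  shows "conic_point \<pi> n d m y t0 t1 w"
proof
  show "(1::'e poly) + 1 = 0" using char2 by (simp add: one_pCons)
  have em: "emon n e x = emon n e (\<lambda>i. \<pi> ^ m i * y i)" for e
    unfolding emon_def by (rule prod.cong) (auto simp: assms(3))
  show "w\<^sup>2 = emon n (exps n d n) (\<lambda>i. \<pi> ^ m i * y i) * (t0\<^sup>2 + t0 * t1)
      + (\<Sum>j<n. emon n (exps n d j) (\<lambda>i. \<pi> ^ m i * y i)) * t1\<^sup>2"
    using eqn unfolding em .
  show "\<exists>k b. a = \<pi> ^ k * b \<and> \<not> \<pi> dvd b" if "a \<noteq> 0" for a
    using prime_elem_decompose[OF assms(1) that] .
qed (use assms n3 dn t in auto)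

lemma wmat_eq: "(\<And>i. i < n \<Longrightarrow> x i = y i) \<Longrightarrow> wmat n D' x = wmat n D' y"
  unfolding wmat_def by (rule eq_matI) auto

lemma decompose:
  assumes "prime_elem \<pi>" "\<And>i. i < n \<Longrightarrow> x i \<noteq> 0"
  shows "\<exists>m y. \<forall>i<n. x i = \<pi> ^ m i * y i \<and> \<not> \<pi> dvd y i"
proof -
  have "\<forall>i. \<exists>k b. i < n \<longrightarrow> x i = \<pi> ^ k * b \<and> \<not> \<pi> dvd b"
    using prime_elem_decompose[OF assms(1) assms(2)] by blast
  then show ?thesis by metis
qed

text \<open>The form has no poles at finite points of the curve. At a prime where all coordinates
  have the same order, a rescaling removes it. At any other prime the curve gives a
  \<open>conic_point\<close>, for which the poles cancel.\<close>

lemma prod_dvd_wdet: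
  assumes "\<And>i. i < n \<Longrightarrow> x i \<noteq> 0"
  shows "(\<Prod>i<n. x i) dvd wdet"
proof (rule dvd_if_prime_powers_dvd)
  show "(\<Prod>i<n. x i) \<noteq> 0" using assms by simp
  fix \<pi> :: "'e poly" and k
  assume \<pi>: "prime_elem \<pi>" and k: "\<pi> ^ k dvd (\<Prod>i<n. x i)"
  have "\<exists>m y. \<forall>i<n. x i = \<pi> ^ m i * y i \<and> \<not> \<pi> dvd y i"
    by (rule decompose[OF \<pi> assms])
  then obtain m y where "\<forall>i<n. x i = \<pi> ^ m i * y i \<and> \<not> \<pi> dvd y i" by (elim exE)
  then have y: "\<And>i. i < n \<Longrightarrow> \<not> \<pi> dvd y i" "\<And>i. i < n \<Longrightarrow> x i = \<pi> ^ m i * y i"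
    by simp_all
  have "(\<Prod>i<n. x i) = \<pi> ^ (\<Sum>i<n. m i) * (\<Prod>i<n. y i)"
    unfolding sum_pow_prod [symmetric] by (rule prod.cong) (auto simp: y(2))
  then obtain c where c: "\<pi> ^ (\<Sum>i<n. m i) * (\<Prod>i<n. y i) = \<pi> ^ k * c" using k by (metis dvdE)
  have km: "k \<le> (\<Sum>i<n. m i)"
  proof (rule ccontr)
    assume "\<not> ?thesis"
    then have "k = (\<Sum>i<n. m i) + Suc (k - (\<Sum>i<n. m i) - 1)" by simp
    then have "\<pi> ^ k = \<pi> ^ (\<Sum>i<n. m i) * (\<pi> * \<pi> ^ (k - (\<Sum>i<n. m i) - 1))" by (metis power_add power_Suc)
    then have "\<pi> ^ (\<Sum>i<n. m i) * (\<Prod>i<n. y i) = \<pi> ^ (\<Sum>i<n. m i) * (\<pi> * (\<pi> ^ (k - (\<Sum>i<n. m i) - 1) * c))"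
      using c by (simp only: mult.assoc)
    moreover have "\<pi> \<noteq> 0" using \<pi> by auto
    ultimately have "(\<Prod>i<n. y i) = \<pi> * (\<pi> ^ (k - (\<Sum>i<n. m i) - 1) * c)" by simp
    then have "\<pi> dvd (\<Prod>i<n. y i)" by simp
    moreover have "\<not> \<pi> dvd (\<Prod>i<n. y i)" by (rule prime_not_dvd_prod[OF \<pi>]) (erule y(1))
    ultimately show False by blast
  qed
  have W: "wdet = Determinant.det (wmat n D (\<lambda>i. \<pi> ^ m i * y i))"
    by (rule arg_cong[where f = Determinant.det], rule wmat_eq) (erule y(2))
  have "\<pi> ^ (\<Sum>i<n. m i) dvd wdet"
  proof (cases "\<exists>i<n. \<exists>j<n. m i \<noteq> m j")
    case True
    have "conic_point \<pi> n d m y t0 t1 w"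
      by (rule point[of \<pi> y m]) (rule \<pi>, erule y(1), erule y(2), rule True)
    then show ?thesis unfolding W by (rule conic_point.power_dvd_det) (rule D)
  next
    case False
    have n0: "0 < n" "1 < n" using n3 by auto
    define k0 where "k0 = m 0"
    have mi: "m i = k0" if "i < n" for i using False that n0 unfolding k0_def by blast
    have sm: "(\<Sum>i<n. m i) = n * k0" by (simp add: mi)
    have "wdet = Determinant.det (wmat n D (\<lambda>i. \<pi> ^ k0 * y i))"
      by (rule arg_cong[where f = Determinant.det], rule wmat_eq) (simp only: y(2) mi)
    also have "\<dots> = (\<pi> ^ k0) ^ n * Determinant.det (wmat n D y)"
      by (rule det_wmat_scale[OF n0(2) D])
    also have "(\<pi> ^ k0) ^ n = \<pi> ^ (\<Sum>i<n. m i)"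
      unfolding sm by (simp add: power_mult [symmetric] mult.commute)
    finally show ?thesis by simp
  qed
  moreover have "\<pi> ^ k dvd \<pi> ^ (\<Sum>i<n. m i)" using km by (rule le_imp_power_dvd)
  ultimately show "\<pi> ^ k dvd wdet" by (rule dvd_trans[rotated])
qed

text \<open>Without finite poles, the value of the form along the curve is a polynomial in the
  parameter, and the degree bound leaves only constants.\<close>

lemma wdet_constant_multiple:
  assumes "\<And>i. i < n \<Longrightarrow> x i \<noteq> 0"
  obtains g where "wdet = [:g:] * (\<Prod>i<n. x i)"
proof -
  obtain q where q: "wdet = (\<Prod>i<n. x i) * q" using prod_dvd_wdet assms by (blast elim: dvdE)
  have P: "(\<Prod>i<n. x i) \<noteq> 0" using assms by simp
  have deg: "degree (\<Prod>i<n. x i) = (\<Sum>i<n. degree (x i))"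
    using assms by (intro degree_prod_sum_eq) auto
  have "degree q = 0"
  proof (cases "q = 0")
    case False
    have "degree (\<Prod>i<n. x i) + degree q = degree wdet" unfolding q using P False by (simp add: degree_mult_eq)
    also have "\<dots> \<le> (\<Sum>i<n. degree (x i))" by (rule degree_det_wmat[OF \<delta>])
    finally show ?thesis using deg by simp
  qed simp
  then obtain g where "q = [:g:]" by (rule degree_eq_zeroE)
  then show thesis using that[of g] q by (simp add: mult.commute)
qed

text \<open>The curve meets parameter 0 at the point with coordinates \<open>coeff (x i) l\<close>.
  If the orders at 0 differ, the additional factor X from \<open>power_dvd_det_if_const\<close>
  forces g = 0, while some coordinate of the point is 0 and \<open>omega\<close> is 0 by division by
  zero. If they agree, the common power of X is removed and the determinant is evaluated at
  0.\<close>

lemma omega_low: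
  assumes nz: "\<And>i. i < n \<Longrightarrow> x i \<noteq> 0" and g: "wdet = [:g:] * (\<Prod>i<n. x i)"
    and l: "\<And>i j. i < n \<Longrightarrow> j < l \<Longrightarrow> coeff (x i) j = 0" "\<exists>i<n. coeff (x i) l \<noteq> 0"
  shows "omega n \<delta> (\<lambda>i. coeff (x i) l) = g"
proof -
  define X where "X = [:0, 1::'e:]"
  have X: "prime_elem X" unfolding X_def
    by (intro field_poly_irreducible_imp_prime irreducible_linear_field_poly) simp_all
  have DX: "D a X = 0" for a unfolding X_def by (rule map_poly_derivation_X[OF \<delta>])
  have dvd: "X dvd p \<longleftrightarrow> coeff p 0 = 0" for p
    unfolding X_def using poly_eq_0_iff_dvd[of p 0] by (simp add: poly_0_coeff_0)
  have Xpow: "coeff (X ^ k * p) j = (if j < k then 0 else coeff p (j - k))" for k p j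
  proof -
    have "X ^ k = monom 1 k" unfolding X_def by (simp add: monom_altdef)
    then show ?thesis by (simp add: coeff_monom_mult)
  qed
  have "\<exists>m y. \<forall>i<n. x i = X ^ m i * y i \<and> \<not> X dvd y i"
    by (rule decompose[OF X nz])
  then obtain m y where "\<forall>i<n. x i = X ^ m i * y i \<and> \<not> X dvd y i" by (elim exE)
  then have y: "\<And>i. i < n \<Longrightarrow> \<not> X dvd y i" "\<And>i. i < n \<Longrightarrow> x i = X ^ m i * y i"
    by simp_all
  have lm: "l \<le> m i" if "i < n" for i
  proof (rule ccontr)
    assume "\<not> l \<le> m i"
    then have "coeff (x i) (m i) = 0" using l(1)[OF that] by simp
    then show False using y(1)[OF that] unfolding y(2)[OF that] Xpow dvd by simp
  qed
  have cl: "coeff (x i) l = (if m i = l then coeff (y i) 0 else 0)" if "i < n" for i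
    using lm[OF that] unfolding y(2)[OF that] Xpow by simp
  obtain i0 where i0: "i0 < n" "m i0 = l" using l(2) cl by metis
  have W: "wdet = Determinant.det (wmat n D (\<lambda>i. X ^ m i * y i))"
    by (rule arg_cong[where f = Determinant.det], rule wmat_eq) (erule y(2))
  have P: "(\<Prod>i<n. x i) = X ^ (\<Sum>i<n. m i) * (\<Prod>i<n. y i)"
    unfolding sum_pow_prod [symmetric] by (rule prod.cong) (auto simp: y(2))
  have ny: "\<not> X dvd (\<Prod>i<n. y i)" by (rule prime_not_dvd_prod[OF X]) (erule y(1))
  have X0: "X \<noteq> 0" using X by auto
  show ?thesis
  proof (cases "\<exists>i<n. \<exists>j<n. m i \<noteq> m j")
    case True
    have cp: "conic_point X n d m y t0 t1 w"
      by (rule point[of X y m]) (rule X, erule y(1), erule y(2), rule True)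
    have "X ^ Suc (\<Sum>i<n. m i) dvd wdet"
      unfolding W by (rule conic_point.power_dvd_det_if_const[OF cp]) (rule D, rule DX)
    then obtain c where "[:g:] * (X ^ (\<Sum>i<n. m i) * (\<Prod>i<n. y i)) = X ^ Suc (\<Sum>i<n. m i) * c"
      unfolding g P by (rule dvdE)
    then have "X ^ (\<Sum>i<n. m i) * ([:g:] * (\<Prod>i<n. y i)) = X ^ (\<Sum>i<n. m i) * (X * c)"
      by (simp only: power_Suc mult_ac)
    then have "[:g:] * (\<Prod>i<n. y i) = X * c" by (simp only: mult_left_cancel[OF power_not_zero[OF X0]])
    then have "X dvd [:g:] * (\<Prod>i<n. y i)" by simp
    then have "X dvd [:g:]" using X ny by (simp only: prime_elem_dvd_mult_iff) simp
    then have g0: "g = 0" unfolding dvd by simp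
    obtain i where "i < n" "m i \<noteq> l" using True by metis
    then have "(\<Prod>i<n. coeff (x i) l) = 0" using cl by (intro prod_zero) auto
    then show ?thesis unfolding omega_def g0 by simp
  next
    case False
    then have mi: "m i = l" if "i < n" for i using that i0 by metis
    have n1: "1 < n" using n3 by simp
    have "wdet = Determinant.det (wmat n D (\<lambda>i. X ^ l * y i))"
      by (rule arg_cong[where f = Determinant.det], rule wmat_eq) (simp only: y(2) mi)
    also have "\<dots> = (X ^ l) ^ n * Determinant.det (wmat n D y)"
      by (rule det_wmat_scale[OF n1 D])
    also have "(X ^ l) ^ n = X ^ (\<Sum>i<n. m i)" by (simp add: mi power_mult [symmetric] mult.commute)
    finally have "X ^ (\<Sum>i<n. m i) * Determinant.det (wmat n D y) = X ^ (\<Sum>i<n. m i) * ([:g:] * (\<Prod>i<n. y i))"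
      unfolding g P by (simp only: mult_ac)
    then have "Determinant.det (wmat n D y) = [:g:] * (\<Prod>i<n. y i)"
      by (simp only: mult_left_cancel[OF power_not_zero[OF X0]])
    then have "poly (Determinant.det (wmat n D y)) 0 = g * (\<Prod>i<n. poly (y i) 0)" by (simp add: poly_prod)
    also have "poly (Determinant.det (wmat n D y)) 0 = Determinant.det (wmat n \<delta> (\<lambda>i. coeff (x i) l))"
    proof -
      interpret ev: comm_ring_hom "\<lambda>p. poly p (0::'e)" by unfold_locales auto
      have "map_mat (\<lambda>p. poly p 0) (wmat n D y) = wmat n \<delta> (\<lambda>i. coeff (x i) l)"
        by (rule eq_matI)
           (auto simp: wmat_def cl mi poly_0_coeff_0 coeff_map_poly derivation_0[OF \<delta>])
      then show ?thesis using ev.hom_det[of "wmat n D y"] by simp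
    qed
    also have "(\<Prod>i<n. poly (y i) 0) = (\<Prod>i<n. coeff (x i) l)"
      by (rule prod.cong) (auto simp: cl mi poly_0_coeff_0)
    finally have "Determinant.det (wmat n \<delta> (\<lambda>i. coeff (x i) l)) = g * (\<Prod>i<n. coeff (x i) l)" .
    moreover have "(\<Prod>i<n. coeff (x i) l) \<noteq> 0" using y(1) by (auto simp: cl mi dvd)
    ultimately show ?thesis unfolding omega_def by simp
  qed
qed

end

text \<open>\<open>refl N p\<close> is \<open>u\<^sup>N p(1 / u)\<close>, for \<open>degree p \<le> N\<close>.\<close>

definition refl :: "nat \<Rightarrow> 'e::field poly \<Rightarrow> 'e poly"
  where "refl N p = monom 1 (N - degree p) * reflect_poly p"

lemma coeff_refl:
  assumes "degree p \<le> N"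
  shows "coeff (refl N p) j = (if j \<le> N then coeff p (N - j) else 0)"
proof -
  have "coeff (refl N p) j = (if j < N - degree p then 0 else coeff (reflect_poly p) (j - (N - degree p)))"
    unfolding refl_def by (simp add: coeff_monom_mult)
  moreover have "coeff p (N - j) = 0" if "j < N - degree p" using that by (intro coeff_eq_0) simp
  moreover have "degree p - (j - (N - degree p)) = N - j" if "\<not> j < N - degree p" "j \<le> N"
    using that assms by simp
  ultimately show ?thesis using assms by (auto simp: coeff_reflect_poly)
qed

lemma refl_add:
  assumes "degree p \<le> N" "degree q \<le> N" shows "refl N (p + q) = refl N p + refl N q"
  by (rule poly_eqI) (simp add: coeff_refl degree_add_le assms)

lemma refl_uminus: "degree p \<le> N \<Longrightarrow> refl N (- p) = - refl N p"
  by (rule poly_eqI) (simp add: coeff_refl)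

lemma refl_0 [simp]: "refl N 0 = 0"
  by (simp add: refl_def)

lemma refl_const: "refl 0 [:g:] = [:g:]"
  by (rule poly_eqI) (simp add: coeff_refl coeff_pCons split: nat.split)

lemma refl_mult:
  assumes "degree p \<le> N" "degree q \<le> M" shows "refl (N + M) (p * q) = refl N p * refl M q"
proof (cases "p = 0 \<or> q = 0")
  case False
  have "N + M - (degree p + degree q) = (N - degree p) + (M - degree q)" using assms by simp
  then have "monom (1::'a) (N + M - (degree p + degree q)) = monom 1 (N - degree p) * monom 1 (M - degree q)"
    by (simp add: mult_monom)
  then show ?thesis using False unfolding refl_def
    by (simp add: degree_mult_eq reflect_poly_mult mult_ac)
qed auto

lemma refl_power:
  assumes "degree p \<le> N" shows "refl (k * N) (p ^ k) = refl N p ^ k \<and> degree (p ^ k) \<le> k * N"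
proof (induction k)
  case 0
  then show ?case using refl_const[of 1] by (simp add: one_pCons [symmetric])
next
  case (Suc k)
  have "degree (p * p ^ k) \<le> N + k * N" using Suc assms by (intro order.trans[OF degree_mult_le]) simp
  then show ?case using Suc refl_mult[OF assms, of "p ^ k" "k * N"] by simp
qed

lemma refl_sum:
  assumes "finite A" "\<And>i. i \<in> A \<Longrightarrow> degree (f i) \<le> N"
  shows "refl N (\<Sum>i\<in>A. f i) = (\<Sum>i\<in>A. refl N (f i)) \<and> degree (\<Sum>i\<in>A. f i) \<le> N"
  using assms
proof (induction A rule: finite_induct)
  case (insert i A)
  have "refl N (f i + sum f A) = refl N (f i) + refl N (sum f A)"
    by (rule refl_add) (use insert in auto)
  moreover have "degree (f i + sum f A) \<le> N" by (rule degree_add_le) (use insert in auto)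
  ultimately show ?case using insert by simp
qed simp

lemma refl_prod:
  fixes n :: nat
  assumes "\<And>i. i < n \<Longrightarrow> degree (f i) \<le> N i"
  shows "refl (\<Sum>i<n. N i) (\<Prod>i<n. f i) = (\<Prod>i<n. refl (N i) (f i)) \<and> degree (\<Prod>i<n. f i) \<le> (\<Sum>i<n. N i)"
proof -
  have "(\<forall>i<k. degree (f i) \<le> N i) \<longrightarrow>
    refl (\<Sum>i<k. N i) (\<Prod>i<k. f i) = (\<Prod>i<k. refl (N i) (f i)) \<and> degree (\<Prod>i<k. f i) \<le> (\<Sum>i<k. N i)" for k
  proof (induction k)
    case 0
    then show ?case using refl_const[of 1] by (simp add: one_pCons [symmetric])
  next
    case (Suc k)
    show ?case
    proof
      assume a: "\<forall>i<Suc k. degree (f i) \<le> N i"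
      then have IH: "refl (\<Sum>i<k. N i) (\<Prod>i<k. f i) = (\<Prod>i<k. refl (N i) (f i))"
        "degree (\<Prod>i<k. f i) \<le> (\<Sum>i<k. N i)" and fk: "degree (f k) \<le> N k" using Suc by auto
      have "degree ((\<Prod>i<k. f i) * f k) \<le> (\<Sum>i<k. N i) + N k"
        using IH(2) fk by (intro order.trans[OF degree_mult_le]) simp
      then show "refl (\<Sum>i<Suc k. N i) (\<Prod>i<Suc k. f i) = (\<Prod>i<Suc k. refl (N i) (f i)) \<and>
          degree (\<Prod>i<Suc k. f i) \<le> (\<Sum>i<Suc k. N i)"
        using refl_mult[OF IH(2) fk] IH(1) by simp
    qed
  qed
  then show ?thesis using assms by blast
qed

lemma refl_map_poly:
  assumes "derivation \<delta>" "degree p \<le> N"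
  shows "map_poly \<delta> (refl N p) = refl N (map_poly \<delta> p)" "degree (map_poly \<delta> p) \<le> N"
proof -
  show d: "degree (map_poly \<delta> p) \<le> N"
  proof (rule degree_le, intro allI impI)
    fix i assume "N < i"
    then have "coeff p i = 0" using assms(2) by (intro coeff_eq_0) simp
    then show "coeff (map_poly \<delta> p) i = 0" by (simp add: coeff_map_poly derivation_0[OF assms(1)])
  qed
  show "map_poly \<delta> (refl N p) = refl N (map_poly \<delta> p)"
    by (rule poly_eqI) (simp add: coeff_map_poly derivation_0[OF assms(1)] coeff_refl[OF d] coeff_refl[OF assms(2)])
qed

lemma refl_det_wmat:
  assumes \<delta>: "\<And>a. derivation (\<delta> a)" and N: "\<And>i. i < n \<Longrightarrow> degree (x i) \<le> N"
  shows "Determinant.det (wmat n (\<lambda>a. map_poly (\<delta> a)) (\<lambda>i. refl N (x i))) =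
    refl (n * N) (Determinant.det (wmat n (\<lambda>a. map_poly (\<delta> a)) x))"
proof -
  let ?A = "wmat n (\<lambda>a. map_poly (\<delta> a)) x" and ?B = "wmat n (\<lambda>a. map_poly (\<delta> a)) (\<lambda>i. refl N (x i))"
  have deg: "degree (?A $$ (a, i)) \<le> N" and ent: "?B $$ (a, i) = refl N (?A $$ (a, i))" if "a < n" "i < n" for a i
    using that N refl_map_poly[OF \<delta> N] by (auto simp: wmat_def)
  have pr: "refl (n * N) (\<Prod>i = 0..<n. ?A $$ (i, p i)) = (\<Prod>i = 0..<n. ?B $$ (i, p i))"
    and pd: "degree (\<Prod>i = 0..<n. ?A $$ (i, p i)) \<le> n * N" if p: "p permutes {0..<n}" for p
  proof -
    have pi: "p i < n" if "i < n" for i using permutes_in_image[OF p, of i] that by simp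
    have "degree (?A $$ (i, p i)) \<le> N" if "i < n" for i using deg[OF that pi[OF that]] .
    from refl_prod[of n "\<lambda>i. ?A $$ (i, p i)" "\<lambda>_. N", OF this]
    have "refl (n * N) (\<Prod>i<n. ?A $$ (i, p i)) = (\<Prod>i<n. refl N (?A $$ (i, p i)))"
      and d: "degree (\<Prod>i<n. ?A $$ (i, p i)) \<le> n * N" by auto
    then show "refl (n * N) (\<Prod>i = 0..<n. ?A $$ (i, p i)) = (\<Prod>i = 0..<n. ?B $$ (i, p i))"
      using ent pi by (simp add: atLeast0LessThan)
    show "degree (\<Prod>i = 0..<n. ?A $$ (i, p i)) \<le> n * N" using d by (simp add: atLeast0LessThan)
  qed
  have sg: "refl (n * N) (signof p * q) = signof p * refl (n * N) q \<and> degree (signof p * q) \<le> n * N"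
    if "degree q \<le> n * N" for p :: "nat \<Rightarrow> nat" and q :: "'a poly"
    using that by (auto simp: sign_def refl_uminus)
  let ?P = "{p. p permutes {0..<n}}"
  have "refl (n * N) (\<Sum>p\<in>?P. signof p * (\<Prod>i = 0..<n. ?A $$ (i, p i))) =
      (\<Sum>p\<in>?P. refl (n * N) (signof p * (\<Prod>i = 0..<n. ?A $$ (i, p i))))"
    using refl_sum[of ?P "\<lambda>p. signof p * (\<Prod>i = 0..<n. ?A $$ (i, p i))" "n * N"] sg pd
    by (simp add: finite_permutations)
  also have "\<dots> = (\<Sum>p\<in>?P. signof p * (\<Prod>i = 0..<n. ?B $$ (i, p i)))"
    by (rule sum.cong) (use sg pd pr in auto)
  finally show ?thesis by (simp add: det_def'[OF wmat_carrier])
qed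

lemma refl_emon:
  assumes "\<And>i. i < n \<Longrightarrow> degree (x i) \<le> N" "(\<Sum>i<n. e i) = k"
  shows "refl (k * N) (emon n e x) = emon n e (\<lambda>i. refl N (x i)) \<and> degree (emon n e x) \<le> k * N"
proof -
  have "degree (x i ^ e i) \<le> e i * N" "refl (e i * N) (x i ^ e i) = refl N (x i) ^ e i" if "i < n" for i
    using refl_power[OF assms(1)[OF that], of "e i"] by auto
  then show ?thesis
    using refl_prod[of n "\<lambda>i. x i ^ e i" "\<lambda>i. e i * N"]
    unfolding emon_def assms(2) [symmetric] by (simp add: sum_distrib_right)
qed

context conic_curve
begin

text \<open>The same curve in the inverse parameter. Since the equation is bihomogeneous of bidegree
  (2 d, 2), bounds N for the \<open>x i\<close> and M for \<open>t0\<close> and \<open>t1\<close>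
  imply the bound d N + M for \<open>w\<close>.\<close>

lemma conic_curve_refl:
  assumes N: "\<And>i. i < n \<Longrightarrow> degree (x i) \<le> N" and M: "degree t0 \<le> M" "degree t1 \<le> M"
  shows "conic_curve n d (\<lambda>i. refl N (x i)) (refl M t0) (refl M t1) (refl (d * N + M) w) \<delta>"
proof
  have nz: "refl M p \<noteq> 0" if "p \<noteq> 0" "degree p \<le> M" for p :: "'e poly"
  proof
    assume "refl M p = 0"
    then have "coeff (refl M p) (M - degree p) = 0" by simp
    then show False using that coeff_refl[OF that(2), of "M - degree p"] by (simp add: leading_coeff_0_iff)
  qed
  show "refl M t0 \<noteq> 0 \<or> refl M t1 \<noteq> 0" using nz t M by blast
  have em: "refl (2 * d * N) (emon n (exps n d j) x) = emon n (exps n d j) (\<lambda>i. refl N (x i))"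
    "degree (emon n (exps n d j) x) \<le> 2 * d * N" if "j \<le> n" for j
    using refl_emon[where e = "exps n d j", OF N sum_exps[OF n3 dn that]] by auto
  define C where "C = (\<Sum>j<n. emon n (exps n d j) x)"
  have "refl (2 * d * N) C = (\<Sum>j<n. refl (2 * d * N) (emon n (exps n d j) x)) \<and> degree C \<le> 2 * d * N"
    unfolding C_def by (rule refl_sum) (use em in auto)
  then have C: "refl (2 * d * N) C = (\<Sum>j<n. emon n (exps n d j) (\<lambda>i. refl N (x i)))" "degree C \<le> 2 * d * N"
    using em(1) by simp_all
  have q: "refl (M + M) (t0\<^sup>2 + t0 * t1) = (refl M t0)\<^sup>2 + refl M t0 * refl M t1"
    "degree (t0\<^sup>2 + t0 * t1) \<le> M + M" "refl (M + M) (t1\<^sup>2) = (refl M t1)\<^sup>2" "degree (t1\<^sup>2) \<le> M + M"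
  proof -
    have d: "degree (t0\<^sup>2) \<le> M + M" "degree (t0 * t1) \<le> M + M" "degree (t1\<^sup>2) \<le> M + M"
      unfolding power2_eq_square using M by (auto intro!: order.trans[OF degree_mult_le])
    show "degree (t0\<^sup>2 + t0 * t1) \<le> M + M" "degree (t1\<^sup>2) \<le> M + M"
      using d by (auto intro: degree_add_le)
    show "refl (M + M) (t1\<^sup>2) = (refl M t1)\<^sup>2"
      unfolding power2_eq_square by (rule refl_mult[OF M(2) M(2)])
    show "refl (M + M) (t0\<^sup>2 + t0 * t1) = (refl M t0)\<^sup>2 + refl M t0 * refl M t1"
      unfolding refl_add[OF d(1,2)] unfolding power2_eq_square refl_mult[OF M(1) M(1)] refl_mult[OF M] ..
  qed
  let ?K = "2 * d * N + (M + M)"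
  define E1 where "E1 = emon n (exps n d n) x * (t0\<^sup>2 + t0 * t1)"
  define E2 where "E2 = C * t1\<^sup>2"
  have E1: "refl ?K E1 = emon n (exps n d n) (\<lambda>i. refl N (x i)) * ((refl M t0)\<^sup>2 + refl M t0 * refl M t1)"
    unfolding E1_def refl_mult[OF em(2)[OF order.refl] q(2)] q(1) em(1)[OF order.refl] ..
  have E2: "refl ?K E2 = (\<Sum>j<n. emon n (exps n d j) (\<lambda>i. refl N (x i))) * (refl M t1)\<^sup>2"
    unfolding E2_def refl_mult[OF C(2) q(4)] q(3) C(1) ..
  have dE: "degree E1 \<le> ?K" "degree E2 \<le> ?K"
    unfolding E1_def E2_def using em(2)[OF order.refl] q(2,4) C(2)
    by (auto intro!: order.trans[OF degree_mult_le])
  have w: "w\<^sup>2 = E1 + E2" using eqn unfolding E1_def E2_def C_def .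
  have dw: "degree w \<le> d * N + M"
  proof (cases "w = 0")
    case False
    have "degree (w\<^sup>2) \<le> ?K" unfolding w using dE by (rule degree_add_le)
    then show ?thesis using False by (simp add: power2_eq_square degree_mult_eq)
  qed simp
  have "(refl (d * N + M) w)\<^sup>2 = refl ((d * N + M) + (d * N + M)) (w\<^sup>2)"
    unfolding power2_eq_square refl_mult[OF dw dw] ..
  also have "(d * N + M) + (d * N + M) = ?K" by simp
  also have "refl ?K (w\<^sup>2) = refl ?K E1 + refl ?K E2" unfolding w by (rule refl_add[OF dE])
  finally show "(refl (d * N + M) w)\<^sup>2 =
      emon n (exps n d n) (\<lambda>i. refl N (x i)) * ((refl M t0)\<^sup>2 + refl M t0 * refl M t1)
      + (\<Sum>j<n. emon n (exps n d j) (\<lambda>i. refl N (x i))) * (refl M t1)\<^sup>2"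
    unfolding E1 E2 .
qed (use char2 n3 dn \<delta> in auto)

text \<open>Both values equal the constant g of the curve. Passing to the inverse parameter reflects
  the determinant and the product of the coordinates with the same bound n N, so g does not change.
  If a coordinate vanishes identically, both values are 0 by convention.\<close>

theorem omega_low_eq_top:
  assumes l: "\<And>i j. i < n \<Longrightarrow> j < l \<Longrightarrow> coeff (x i) j = 0" "\<exists>i<n. coeff (x i) l \<noteq> 0"
    and N: "\<And>i. i < n \<Longrightarrow> degree (x i) \<le> N" "\<exists>i<n. coeff (x i) N \<noteq> 0"
  shows "omega n \<delta> (\<lambda>i. coeff (x i) l) = omega n \<delta> (\<lambda>i. coeff (x i) N)"
proof (cases "\<exists>i<n. x i = 0")
  case True
  then obtain i where i: "i < n" "x i = 0" by blast
  have "(\<Prod>i<n. coeff (x i) k) = 0" for k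
    using prod_zero[OF finite_lessThan, of n "\<lambda>i. coeff (x i) k"] i by (metis coeff_0 lessThan_iff)
  from this[of l] this[of N] show ?thesis unfolding omega_def by (simp only: div_by_0)
next
  case False
  then have nz: "x i \<noteq> 0" if "i < n" for i using that by blast
  have "\<exists>g. wdet = [:g:] * (\<Prod>i<n. x i)"
    by (rule wdet_constant_multiple[OF nz]) blast+
  then obtain g where g: "wdet = [:g:] * (\<Prod>i<n. x i)" by (elim exE)
  have low: "omega n \<delta> (\<lambda>i. coeff (x i) l) = g"
    by (rule omega_low[OF nz g]) (use l in auto)
  define M where "M = max (degree t0) (degree t1)"
  have M: "degree t0 \<le> M" "degree t1 \<le> M" by (auto simp: M_def)
  interpret r: conic_curve n d "\<lambda>i. refl N (x i)" "refl M t0" "refl M t1" "refl (d * N + M) w" \<delta>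
    by (rule conic_curve_refl[OF N(1) M])
  have rnz: "refl N (x i) \<noteq> 0" if i: "i < n" for i
  proof
    assume "refl N (x i) = 0"
    then have "coeff (refl N (x i)) (N - degree (x i)) = 0" by simp
    then show False using nz[OF i] N(1)[OF i] coeff_refl[OF N(1)[OF i], of "N - degree (x i)"]
      by (simp add: leading_coeff_0_iff)
  qed
  have P: "refl (n * N) (\<Prod>i<n. x i) = (\<Prod>i<n. refl N (x i))" "degree (\<Prod>i<n. x i) \<le> n * N"
    using refl_prod[of n x "\<lambda>_. N"] N(1) by auto
  have "r.wdet = refl (n * N) wdet" by (rule refl_det_wmat[OF \<delta> N(1)])
  also have "\<dots> = refl (0 + n * N) ([:g:] * (\<Prod>i<n. x i))" unfolding g by simp
  also have "\<dots> = [:g:] * (\<Prod>i<n. refl N (x i))"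
    by (subst refl_mult) (use P in \<open>auto simp: refl_const\<close>)
  finally have rg: "r.wdet = [:g:] * (\<Prod>i<n. refl N (x i))" .
  have c: "coeff (refl N (x i)) 0 = coeff (x i) N" if "i < n" for i
    using coeff_refl[OF N(1)[OF that], of 0] by simp
  have "omega n \<delta> (\<lambda>i. coeff (refl N (x i)) 0) = g"
    by (rule r.omega_low[OF rnz rg]) (use N(2) c in auto)
  moreover have "wmat n \<delta> (\<lambda>i. coeff (refl N (x i)) 0) = wmat n \<delta> (\<lambda>i. coeff (x i) N)"
    unfolding wmat_def by (rule eq_matI) (auto simp: c)
  moreover have "(\<Prod>i<n. coeff (refl N (x i)) 0) = (\<Prod>i<n. coeff (x i) N)"
    by (rule prod.cong) (auto simp: c)
  ultimately show ?thesis using low by (simp add: omega_def)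
qed

end

section \<open>The generic point of the reduced conic bundle\<close>

definition mon_eval :: "('v \<Rightarrow>\<^sub>0 nat) \<Rightarrow> ('v \<Rightarrow> 'r) \<Rightarrow> 'r::comm_semiring_1"
  where "mon_eval m a = (\<Prod>v\<in>Poly_Mapping.keys m. a v ^ Poly_Mapping.lookup m v)"

lemma mon_eval_superset:
  assumes "finite S" "Poly_Mapping.keys m \<subseteq> S"
  shows "mon_eval m a = (\<Prod>v\<in>S. a v ^ Poly_Mapping.lookup m v)"
  unfolding mon_eval_def
  by (rule prod.mono_neutral_left) (use assms in \<open>auto simp: in_keys_iff\<close>)

lemma mon_eval_add: "mon_eval (m + m') a = mon_eval m a * mon_eval m' a"
proof -
  let ?S = "Poly_Mapping.keys m \<union> Poly_Mapping.keys m'"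
  have "Poly_Mapping.keys (m + m') \<subseteq> ?S" by (rule Poly_Mapping.keys_add)
  then show ?thesis
    by (simp add: mon_eval_superset[of ?S] lookup_add power_add prod.distrib)
qed

lemma mon_eval_0 [simp]: "mon_eval 0 a = 1"
  by (simp add: mon_eval_def)

lemma mon_eval_single [simp]: "mon_eval (Poly_Mapping.single v k) a = a v ^ k"
  by (simp add: mon_eval_superset[of "{v}"])

definition poly_eval :: "('c \<Rightarrow> 'r) \<Rightarrow> ('v \<Rightarrow> 'r) \<Rightarrow> (('v \<Rightarrow>\<^sub>0 nat) \<Rightarrow>\<^sub>0 'c::comm_semiring_1) \<Rightarrow> 'r::comm_semiring_1"
  where "poly_eval h a P = (\<Sum>m\<in>Poly_Mapping.keys P. h (Poly_Mapping.lookup P m) * mon_eval m a)"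

lemma poly_mapping_sum_singles:
  assumes "finite S" "Poly_Mapping.keys P \<subseteq> S"
  shows "P = (\<Sum>m\<in>S. Poly_Mapping.single m (Poly_Mapping.lookup P m))"
proof (rule poly_mapping_eqI)
  fix k
  have "Poly_Mapping.lookup (\<Sum>m\<in>S. Poly_Mapping.single m (Poly_Mapping.lookup P m)) k =
      (\<Sum>m\<in>S. if m = k then Poly_Mapping.lookup P k else 0)"
    unfolding lookup_sum by (rule sum.cong) (auto simp: lookup_single when_def)
  also have "\<dots> = Poly_Mapping.lookup P k"
    using assms by (auto simp: sum.delta in_keys_iff)
  finally show "Poly_Mapping.lookup P k = Poly_Mapping.lookup (\<Sum>m\<in>S. Poly_Mapping.single m (Poly_Mapping.lookup P m)) k" ..
qed

lemma poly_eval_superset: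
  assumes "h 0 = 0" "finite S" "Poly_Mapping.keys P \<subseteq> S"
  shows "poly_eval h a P = (\<Sum>m\<in>S. h (Poly_Mapping.lookup P m) * mon_eval m a)"
  unfolding poly_eval_def
  by (rule sum.mono_neutral_left) (use assms in \<open>auto simp: in_keys_iff\<close>)

lemma poly_eval_add:
  assumes "h 0 = 0" "\<And>x y. h (x + y) = h x + h y"
  shows "poly_eval h a (P + Q) = poly_eval h a P + poly_eval h a Q"
proof -
  let ?S = "Poly_Mapping.keys P \<union> Poly_Mapping.keys Q"
  have "Poly_Mapping.keys (P + Q) \<subseteq> ?S" by (rule Poly_Mapping.keys_add)
  then show ?thesis
    by (simp add: poly_eval_superset[of h ?S, OF assms(1)] lookup_add assms(2) sum.distrib distrib_right)
qed

lemma poly_eval_0 [simp]: "poly_eval h a 0 = 0"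
  by (simp add: poly_eval_def)

lemma poly_eval_sum:
  assumes "h 0 = 0" "\<And>x y. h (x + y) = h x + h y"
  shows "poly_eval h a (\<Sum>i\<in>S. f i) = (\<Sum>i\<in>S. poly_eval h a (f i))"
  by (induction S rule: infinite_finite_induct) (simp_all add: poly_eval_add[OF assms])

lemma poly_eval_single: "h 0 = 0 \<Longrightarrow> poly_eval h a (Poly_Mapping.single m c) = h c * mon_eval m a"
  by (simp add: poly_eval_superset[of h "{m}"])

lemma poly_eval_mult:
  assumes "h 0 = 0" "\<And>x y. h (x + y) = h x + h y" "\<And>x y. h (x * y) = h x * h y"
  shows "poly_eval h a (P * Q) = poly_eval h a P * poly_eval h a Q"
proof -
  let ?s = "\<lambda>P m. Poly_Mapping.single m (Poly_Mapping.lookup P m)"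
  have "P * Q = (\<Sum>m\<in>Poly_Mapping.keys P. ?s P m) * (\<Sum>m\<in>Poly_Mapping.keys Q. ?s Q m)"
    using poly_mapping_sum_singles[of "Poly_Mapping.keys P" P] poly_mapping_sum_singles[of "Poly_Mapping.keys Q" Q]
    by simp
  also have "poly_eval h a \<dots> = (\<Sum>m\<in>Poly_Mapping.keys P. \<Sum>m'\<in>Poly_Mapping.keys Q. poly_eval h a (?s P m * ?s Q m'))"
    unfolding sum_product by (simp add: poly_eval_sum[OF assms(1,2)])
  also have "\<dots> = (\<Sum>m\<in>Poly_Mapping.keys P. \<Sum>m'\<in>Poly_Mapping.keys Q.
      (h (Poly_Mapping.lookup P m) * mon_eval m a) * (h (Poly_Mapping.lookup Q m') * mon_eval m' a))"
    by (simp add: mult_single poly_eval_single[of h, OF assms(1)] assms(3) mon_eval_add mult_ac)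
  finally show ?thesis by (simp add: poly_eval_def sum_product)
qed

text \<open>The subtraction of exponents is truncated, which is harmless: a monomial without v gets
  the coefficient 0.\<close>

definition pder :: "'v \<Rightarrow> (('v \<Rightarrow>\<^sub>0 nat) \<Rightarrow>\<^sub>0 'c::comm_ring_1) \<Rightarrow> ('v \<Rightarrow>\<^sub>0 nat) \<Rightarrow>\<^sub>0 'c"
  where "pder v P = (\<Sum>m\<in>Poly_Mapping.keys P. Poly_Mapping.single (m - Poly_Mapping.single v 1)
    (of_nat (Poly_Mapping.lookup m v) * Poly_Mapping.lookup P m))"

lemma pder_superset:
  assumes "finite S" "Poly_Mapping.keys P \<subseteq> S"
  shows "pder v P = (\<Sum>m\<in>S. Poly_Mapping.single (m - Poly_Mapping.single v 1)
    (of_nat (Poly_Mapping.lookup m v) * Poly_Mapping.lookup P m))"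
  unfolding pder_def
  by (rule sum.mono_neutral_left) (use assms in \<open>auto simp: in_keys_iff\<close>)

lemma pder_add: "pder v (P + Q) = pder v P + pder v Q"
proof -
  let ?S = "Poly_Mapping.keys P \<union> Poly_Mapping.keys Q"
  have "Poly_Mapping.keys (P + Q) \<subseteq> ?S" by (rule Poly_Mapping.keys_add)
  then show ?thesis
    by (simp add: pder_superset[of ?S] lookup_add sum.distrib distrib_left single_add)
qed

lemma pder_0: "pder v 0 = 0"
  by (simp add: pder_def)

lemma pder_sum: "pder v (\<Sum>i\<in>S. f i) = (\<Sum>i\<in>S. pder v (f i))"
  by (induction S rule: infinite_finite_induct) (simp_all add: pder_add pder_0)

lemma pder_single:
  "pder v (Poly_Mapping.single m c) =
    Poly_Mapping.single (m - Poly_Mapping.single v 1) (of_nat (Poly_Mapping.lookup m v) * c)"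
  by (simp add: pder_superset[of "{m}"])

lemma pder_single_mult:
  "pder v (Poly_Mapping.single m c * Poly_Mapping.single m' c') =
    pder v (Poly_Mapping.single m c) * Poly_Mapping.single m' c' +
    Poly_Mapping.single m c * pder v (Poly_Mapping.single m' c')"
proof -
  let ?e = "Poly_Mapping.single v (1::nat)"
  have shift: "m - ?e + m' = m + m' - ?e" if "Poly_Mapping.lookup m v \<noteq> 0" for m m' :: "'a \<Rightarrow>\<^sub>0 nat"
    by (rule poly_mapping_eqI) (use that in \<open>auto simp: lookup_add lookup_minus lookup_single when_def\<close>)
  have 1: "Poly_Mapping.single (m - ?e + m') (of_nat (Poly_Mapping.lookup m v) * c * c') =
      Poly_Mapping.single (m + m' - ?e) (of_nat (Poly_Mapping.lookup m v) * c * c')"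
    using shift[of m m'] by (cases "Poly_Mapping.lookup m v = 0") auto
  have 2: "Poly_Mapping.single (m + (m' - ?e)) (c * (of_nat (Poly_Mapping.lookup m' v) * c')) =
      Poly_Mapping.single (m + m' - ?e) (of_nat (Poly_Mapping.lookup m' v) * c * c')"
    using shift[of m' m] by (cases "Poly_Mapping.lookup m' v = 0") (auto simp: add.commute mult_ac)
  show ?thesis
    unfolding mult_single pder_single 1 2 single_add [symmetric]
    by (simp add: lookup_add algebra_simps)
qed

lemma derivation_pder: "derivation (pder v)"
proof -
  have "pder v (P * Q) = pder v P * Q + P * pder v Q" for P Q :: "('a \<Rightarrow>\<^sub>0 nat) \<Rightarrow>\<^sub>0 'b"
  proof -
    let ?s = "\<lambda>P m. Poly_Mapping.single m (Poly_Mapping.lookup P m)"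
    define SP where "SP = (\<Sum>m\<in>Poly_Mapping.keys P. ?s P m)"
    define SQ where "SQ = (\<Sum>m\<in>Poly_Mapping.keys Q. ?s Q m)"
    have P: "P = SP" unfolding SP_def by (rule poly_mapping_sum_singles) auto
    have Q: "Q = SQ" unfolding SQ_def by (rule poly_mapping_sum_singles) auto
    have "pder v (SP * SQ) = (\<Sum>m\<in>Poly_Mapping.keys P. \<Sum>m'\<in>Poly_Mapping.keys Q.
        pder v (?s P m) * ?s Q m' + ?s P m * pder v (?s Q m'))"
      unfolding SP_def SQ_def sum_product pder_sum pder_single_mult ..
    also have "\<dots> = pder v SP * SQ + SP * pder v SQ"
      unfolding SP_def SQ_def pder_sum sum_product sum.distrib ..
    finally show ?thesis using P Q by simp
  qed
  then show ?thesis by (simp add: derivation_def pder_add)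
qed

section \<open>Derivations of fraction fields and power series, and Artin-Schreier equations\<close>

definition dfract :: "('r \<Rightarrow> 'r) \<Rightarrow> 'r::idom fract \<Rightarrow> 'r fract"
  where "dfract D q = (let (a, b) = (SOME (a, b). b \<noteq> 0 \<and> q = Fract a b) in
    Fract (D a * b - a * D b) (b * b))"

lemma dfract_Fract:
  assumes D: "derivation D" and b: "b \<noteq> 0"
  shows "dfract D (Fract a b) = Fract (D a * b - a * D b) (b * b)"
proof -
  define p where "p = (SOME (c, d). d \<noteq> 0 \<and> Fract a b = Fract c d)"
  have "case p of (c, d) \<Rightarrow> d \<noteq> 0 \<and> Fract a b = Fract c d"
    unfolding p_def by (rule someI[of _ "(a, b)"]) (use b in simp)
  then obtain c d where p: "p = (c, d)" and d: "d \<noteq> 0" and eq: "Fract a b = Fract c d"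
    by (cases p) auto
  have e: "a * d = c * b" using eq b d by (simp add: eq_fract)
  have De: "D a * d + a * D d = D c * b + c * D b"
    using arg_cong[OF e, of D] by (simp add: derivation_mult[OF D])
  have "(D a * b - a * D b) * (d * d) = b * d * (D a * d + a * D d) - b * (a * d) * D d - (a * d) * (D b * d)"
    by (simp add: algebra_simps)
  also have "\<dots> = (D c * d - c * D d) * (b * b)"
    unfolding De unfolding e by (simp add: algebra_simps)
  finally have "Fract (D a * b - a * D b) (b * b) = Fract (D c * d - c * D d) (d * d)"
    using b d by (simp add: eq_fract)
  then show ?thesis unfolding dfract_def p_def [symmetric] p by simp
qed

lemma derivation_dfract:
  assumes D: "derivation D" shows "derivation (dfract D)"
proof -
  have "dfract D (p + q) = dfract D p + dfract D q \<and> dfract D (p * q) = dfract D p * q + p * dfract D q" for p q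
  proof -
    obtain a b where p: "p = Fract a b" "b \<noteq> 0" by (cases p)
    obtain c d where q: "q = Fract c d" "d \<noteq> 0" by (cases q)
    have "dfract D (p + q) = dfract D p + dfract D q"
      unfolding p q using p(2) q(2)
      by (simp add: dfract_Fract[OF D] eq_fract derivation_mult[OF D] derivation_add[OF D]) (simp add: algebra_simps)
    moreover have "dfract D (p * q) = dfract D p * q + p * dfract D q"
      unfolding p q using p(2) q(2)
      by (simp add: dfract_Fract[OF D] eq_fract derivation_mult[OF D] derivation_add[OF D]) (simp add: algebra_simps)
    ultimately show ?thesis ..
  qed
  then show ?thesis unfolding derivation_def by blast
qed

lemma dfract_to_fract: "derivation D \<Longrightarrow> dfract D (to_fract a) = to_fract (D a)"
  by (simp add: to_fract_def dfract_Fract derivation_1)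

definition dfps :: "('r \<Rightarrow> 'r) \<Rightarrow> 'r::comm_ring_1 fps \<Rightarrow> 'r fps"
  where "dfps D f = Abs_fps (\<lambda>n. D (fps_nth f n))"

lemma derivation_dfps:
  assumes D: "derivation D" shows "derivation (dfps D)"
proof -
  have "dfps D (f + g) = dfps D f + dfps D g" for f g
    by (rule fps_ext) (simp add: dfps_def derivation_add[OF D])
  moreover have "dfps D (f * g) = dfps D f * g + f * dfps D g" for f g
    by (rule fps_ext)
       (simp add: dfps_def fps_mult_nth derivation_sum[OF D] derivation_mult[OF D] sum.distrib)
  ultimately show ?thesis unfolding derivation_def by blast
qed

text \<open>Coefficients of the solution g of g^2 + g = f with constant term c. In a positive
  degree, the two products in g^2 that involve c add up to 0 in characteristic 2, so that the new
  coefficient is determined by the earlier ones.\<close>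

fun as_coeff :: "'r \<Rightarrow> 'r fps \<Rightarrow> nat \<Rightarrow> 'r::comm_ring_1"
  where
    "as_coeff c f 0 = c"
  | "as_coeff c f (Suc n) = fps_nth f (Suc n) - (\<Sum>i\<in>{1..n}. as_coeff c f i * as_coeff c f (Suc n - i))"

lemma artin_schreier_fps:
  fixes f :: "'r::comm_ring_1 fps"
  assumes "(1::'r) + 1 = 0" "fps_nth f 0 = c\<^sup>2 + c"
  obtains g where "g\<^sup>2 + g = f" "fps_nth g 0 = c"
proof -
  define g where "g = Abs_fps (as_coeff c f)"
  have "fps_nth (g\<^sup>2 + g) n = fps_nth f n" for n
  proof (cases n)
    case 0
    then show ?thesis using assms(2) by (simp add: g_def power2_eq_square)
  next
    case (Suc k)
    have "{0..Suc k} = insert 0 (insert (Suc k) {1..k})" by auto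
    then have "fps_nth (g * g) (Suc k) = (1 + 1) * (c * as_coeff c f (Suc k))
        + (\<Sum>i\<in>{1..k}. as_coeff c f i * as_coeff c f (Suc k - i))"
      by (simp add: g_def fps_mult_nth algebra_simps del: as_coeff.simps(2))
    then show ?thesis using Suc assms(1) by (simp add: g_def power2_eq_square)
  qed
  then show thesis using that[of g] by (simp add: fps_eq_iff g_def)
qed

type_synonym 'k cpoly = "(nat \<Rightarrow>\<^sub>0 nat) \<Rightarrow>\<^sub>0 'k"

definition var :: "nat \<Rightarrow> 'k::comm_ring_1 cpoly"
  where "var i = Poly_Mapping.single (Poly_Mapping.single i 1) 1"

text \<open>The variables of the inner polynomials are those of the Frobenius twist, and the power
  series variable is the deformation parameter of the generic point.\<close>

type_synonym 'k laurent = "'k cpoly fract fps fract"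

definition kconst :: "'k::field \<Rightarrow> 'k laurent"
  where "kconst c = to_fract (fps_const (to_fract (Poly_Mapping.single 0 c)))"

definition dlaurent :: "nat \<Rightarrow> 'k::field laurent \<Rightarrow> 'k laurent"
  where "dlaurent i = dfract (dfps (dfract (pder i)))"

lemma derivation_dlaurent: "derivation (dlaurent i)"
  unfolding dlaurent_def by (intro derivation_dfract derivation_dfps derivation_pder)

lemma dlaurent_to_fract: "dlaurent i (to_fract f) = to_fract (Abs_fps (\<lambda>k. dfract (pder i) (fps_nth f k)))"
  unfolding dlaurent_def dfract_to_fract[OF derivation_dfps[OF derivation_dfract[OF derivation_pder]]] dfps_def ..

lemma dlaurent_kconst: "dlaurent i (kconst c) = 0"
proof -
  have z: "dfract (pder i) 0 = (0 :: 'a cpoly fract)" by (rule derivation_0[OF derivation_dfract[OF derivation_pder]])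
  have "dfract (pder i) (to_fract (Poly_Mapping.single 0 c)) = to_fract (pder i (Poly_Mapping.single 0 c))"
    by (rule dfract_to_fract[OF derivation_pder])
  also have "pder i (Poly_Mapping.single 0 c) = 0" by (simp add: pder_single)
  finally have "Abs_fps (\<lambda>k. dfract (pder i) (fps_nth (fps_const (to_fract (Poly_Mapping.single 0 c))) k)) = 0"
    by (intro fps_ext) (simp add: z)
  then show ?thesis unfolding kconst_def dlaurent_to_fract by simp
qed

lemma kconst_0 [simp]: "kconst 0 = 0"
  by (simp add: kconst_def)

lemma kconst_1 [simp]: "kconst 1 = 1"
  by (simp add: kconst_def)

lemma kconst_add: "kconst (x + y) = kconst x + kconst y"
  by (simp only: kconst_def single_add to_fract_add fps_const_add [symmetric])

lemma kconst_mult: "kconst (x * y) = kconst x * kconst y"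
proof -
  have "Poly_Mapping.single 0 (x * y) = (Poly_Mapping.single 0 x * Poly_Mapping.single 0 y :: 'a cpoly)"
    by (simp add: mult_single)
  then show ?thesis by (simp only: kconst_def to_fract_mult fps_const_mult [symmetric])
qed

lemma char2_cpoly: "(1::'k::field) + 1 = 0 \<Longrightarrow> (1::'k cpoly) + 1 = 0"
  by (metis single_add single_one single_zero)

lemma char2_laurent: "(1::'k::field) + 1 = 0 \<Longrightarrow> (1::'k laurent) + 1 = 0"
  by (metis kconst_0 kconst_1 kconst_add)

lemma poly_eval_hom:
  assumes "comm_ring_hom g"
  shows "g (poly_eval h a P) = poly_eval (\<lambda>c. g (h c)) (\<lambda>v. g (a v)) P"
proof -
  interpret g: comm_ring_hom g by (rule assms)
  show ?thesis by (simp add: poly_eval_def mon_eval_def g.hom_sum g.hom_prod g.hom_mult g.hom_power)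
qed

lemma mon_eval_var: "mon_eval m var = (Poly_Mapping.single m 1 :: 'k::comm_ring_1 cpoly)"
proof -
  have pw: "var i ^ k = (Poly_Mapping.single (Poly_Mapping.single i k) 1 :: 'k cpoly)" for i k
    by (induction k) (auto simp: var_def mult_single single_add [symmetric] simp flip: single_one)
  have "(\<Prod>i\<in>S. Poly_Mapping.single (f i) 1) = (Poly_Mapping.single (\<Sum>i\<in>S. f i) 1 :: 'k cpoly)"
    for S :: "nat set" and f
    by (induction S rule: infinite_finite_induct) (auto simp: mult_single)
  then show ?thesis unfolding mon_eval_def pw
    using poly_mapping_sum_singles[of "Poly_Mapping.keys m" m] by simp
qed

text \<open>Substituting squares of the variables doubles all exponents, which maps distinct
  monomials to distinct monomials.\<close>

lemma poly_eval_var_squares: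
  fixes A :: "'k::field cpoly"
  assumes "poly_eval (Poly_Mapping.single 0) (\<lambda>i. (var i)\<^sup>2) A = (0 :: 'k cpoly)"
  shows "A = 0"
proof (rule poly_mapping_eqI)
  fix m0
  have m: "mon_eval m (\<lambda>i. (var i)\<^sup>2) = (Poly_Mapping.single (m + m) 1 :: 'k cpoly)" for m
  proof -
    have "mon_eval m (\<lambda>i. (var i)\<^sup>2) = (mon_eval m var :: 'k cpoly)\<^sup>2"
      by (simp add: mon_eval_def prod_power_distrib power_mult [symmetric] mult.commute)
    then show ?thesis by (simp add: mon_eval_var power2_eq_square mult_single)
  qed
  have inj: "m + m = m0 + m0 \<longleftrightarrow> m = m0" for m :: "nat \<Rightarrow>\<^sub>0 nat"
  proof
    assume "m + m = m0 + m0"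
    then have "Poly_Mapping.lookup (m + m) k = Poly_Mapping.lookup (m0 + m0) k" for k by simp
    then have "Poly_Mapping.lookup m k = Poly_Mapping.lookup m0 k" for k unfolding lookup_add by (metis add_self_div_2)
    then show "m = m0" by (rule poly_mapping_eqI)
  qed simp
  have "poly_eval (Poly_Mapping.single 0) (\<lambda>i. (var i)\<^sup>2) A =
      (\<Sum>m\<in>Poly_Mapping.keys A. Poly_Mapping.single (m + m) (Poly_Mapping.lookup A m))"
    unfolding poly_eval_def m by (simp add: mult_single)
  then have "Poly_Mapping.lookup (poly_eval (Poly_Mapping.single 0) (\<lambda>i. (var i)\<^sup>2) A) (m0 + m0) =
      (\<Sum>m\<in>Poly_Mapping.keys A. if m = m0 then Poly_Mapping.lookup A m0 else 0)"
    by (simp add: lookup_sum lookup_single when_def inj)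
  also have "\<dots> = Poly_Mapping.lookup A m0" by (auto simp: sum.delta in_keys_iff)
  finally show "Poly_Mapping.lookup A m0 = Poly_Mapping.lookup 0 m0" using assms by simp
qed

lemma comm_ring_hom_to_fract: "comm_ring_hom (to_fract :: 'r::idom \<Rightarrow> 'r fract)"
  by unfold_locales (simp_all add: to_fract_add to_fract_mult)

lemma comm_ring_hom_fps_nth_0: "comm_ring_hom (\<lambda>f :: 'r::comm_ring_1 fps. fps_nth f 0)"
  by unfold_locales (simp_all add: fps_mult_nth)

lemma comm_ring_hom_fps_const: "comm_ring_hom (fps_const :: 'r::comm_ring_1 \<Rightarrow> 'r fps)"
  by unfold_locales simp_all

lemma comm_ring_hom_poly_eval_kconst: "comm_ring_hom (poly_eval kconst a)"
proof
  show "poly_eval kconst a 1 = 1"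
    using poly_eval_single[of kconst a 0 1] by simp
qed (simp_all add: poly_eval_add poly_eval_mult kconst_add kconst_mult)

lemma comm_ring_hom_emon: "comm_ring_hom g \<Longrightarrow> g (emon n e x) = emon n e (\<lambda>i. g (x i))"
proof -
  assume "comm_ring_hom g"
  then interpret g: comm_ring_hom g .
  show ?thesis by (simp add: emon_def g.hom_prod g.hom_power)
qed

lemma char2_power2_add:
  assumes "(1::'r::comm_ring_1) + 1 = 0" shows "(x + y :: 'r)\<^sup>2 = x\<^sup>2 + y\<^sup>2"
  using char2_frobenius[OF assms, of x y 1] by simp

lemma char2_power2_sum:
  assumes "(1::'r::comm_ring_1) + 1 = 0" shows "(\<Sum>i\<in>S. f i :: 'r)\<^sup>2 = (\<Sum>i\<in>S. (f i)\<^sup>2)"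
  by (induction S rule: infinite_finite_induct) (simp_all add: char2_power2_add[OF assms])

lemma emon_power2: "emon n e (\<lambda>i. (x i)\<^sup>2) = (emon n e x)\<^sup>2"
  by (simp add: emon_def prod_power_distrib power_mult [symmetric] mult.commute)

lemma derivation_emon_0:
  fixes y :: "nat \<Rightarrow> 'r::idom"
  assumes "derivation D" "\<And>i. i < n \<Longrightarrow> D (y i) = 0" "\<And>i. i < n \<Longrightarrow> y i \<noteq> 0"
  shows "D (emon n e y) = 0"
proof -
  have "(\<Prod>i<n. y i) * D (emon n e y) = 0"
    unfolding derivation_emon[OF assms(1)] by (simp add: assms(2))
  moreover have "(\<Prod>i<n. y i) \<noteq> 0" using assms(3) by simp
  ultimately show ?thesis by simp
qed

definition conic_form :: "nat \<Rightarrow> nat \<Rightarrow> (nat \<Rightarrow> 'r) \<Rightarrow> 'r \<Rightarrow> 'r \<Rightarrow> 'r::comm_ring_1"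
  where "conic_form n d x t0 t1 = emon n (exps n d n) x * (t0\<^sup>2 + t0 * t1) + (\<Sum>j<n. emon n (exps n d j) x) * t1\<^sup>2"

lemma comm_ring_hom_conic_form:
  assumes "comm_ring_hom g"
  shows "g (conic_form n d x t0 t1) = conic_form n d (\<lambda>i. g (x i)) (g t0) (g t1)"
proof -
  interpret g: comm_ring_hom g by (rule assms)
  show ?thesis
    by (simp add: conic_form_def g.hom_add g.hom_mult g.hom_sum g.hom_power comm_ring_hom_emon[OF assms])
qed

text \<open>
  A generic point of the reduced conic bundle, in the affine chart \<open>x\<^sub>1 = 1\<close>, \<open>t\<^sub>1 = 1\<close>; the coordinate
  \<open>a 1\<close> is used for \<open>t\<^sub>0\<close>.  It is a first order deformation of the Frobenius twist of a generic
  point, so that its fibre coordinate exists.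
\<close>

lemma generic_point:
  assumes char2: "(1::'k::field) + 1 = 0" and n3: "n \<ge> 3" and dn: "2 * d \<ge> n"
  obtains a :: "nat \<Rightarrow> 'k::field laurent" and w :: "'k::field laurent"
  where "w\<^sup>2 = conic_form n d (a(1 := 1)) (a 1) 1"
    and "\<And>A B. poly_eval kconst a A + poly_eval kconst a B * w = 0 \<Longrightarrow> A = 0 \<and> B = 0"
    and "\<And>c. c \<noteq> 0 \<Longrightarrow> omega n dlaurent (\<lambda>i. c * (a(1 := 1)) i) \<noteq> 0"
proof -
  define z where "z i = (to_fract (var i) :: 'k cpoly fract)" for i
  define z1 where "z1 = z(1 := 1)"
  have c2R: "(1::'k cpoly) + 1 = 0" using char2 by (rule char2_cpoly)
  interpret tf: comm_ring_hom "to_fract :: 'k cpoly \<Rightarrow> 'k cpoly fract" by (rule comm_ring_hom_to_fract)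
  interpret tE: comm_ring_hom "to_fract :: 'k cpoly fract fps \<Rightarrow> 'k laurent" by (rule comm_ring_hom_to_fract)
  interpret fc: comm_ring_hom "fps_const :: 'k cpoly fract \<Rightarrow> 'k cpoly fract fps" by (rule comm_ring_hom_fps_const)
  interpret ct: comm_ring_hom "\<lambda>f :: 'k cpoly fract fps. fps_nth f 0" by (rule comm_ring_hom_fps_nth_0)
  have c2Q: "(1::'k cpoly fract) + 1 = 0" using c2R by (metis tf.hom_zero tf.hom_one tf.hom_add)
  have c2S: "(1::'k cpoly fract fps) + 1 = 0" using c2Q by (metis fc.hom_zero fc.hom_one fc.hom_add)
  have c2E: "(1::'k laurent) + 1 = 0" using char2 by (rule char2_laurent)
  have var0: "var i \<noteq> (0 :: 'k cpoly)" for i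
  proof
    assume "var i = (0 :: 'k cpoly)"
    then have "Poly_Mapping.lookup (var i :: 'k cpoly) (Poly_Mapping.single i 1) = 0" by simp
    then show False by (simp add: var_def)
  qed
  have z0: "z i \<noteq> 0" for i using var0 by (simp add: z_def)
  have z10: "z1 i \<noteq> 0" for i using z0 by (simp add: z1_def)

  \<comment> \<open>At parameter 0 all coordinates are squares, which makes the form a square there,
    but squares have no differentials. The linear term in \<open>z i\<close> restores them.\<close>
  define xs where "xs i = (if i = 1 then 1 else fps_const ((z i)\<^sup>2) + fps_X * fps_const (z i))" for i
  \<comment> \<open>A square root of the form at parameter 0, where \<open>x i\<close> and
    \<open>t0\<close> are the squares of \<open>z1 i\<close> and \<open>z 1\<close>. It is kept as
    fibre coordinate along the deformation, and \<open>t0\<close> is adjusted instead.\<close>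
  define wq where "wq = emon n (exps n d n) z1 * ((z 1)\<^sup>2 + z 1) + (\<Sum>j<n. emon n (exps n d j) z1)"
  define Bs where "Bs = emon n (exps n d n) xs"
  define Cs where "Cs = (\<Sum>j<n. emon n (exps n d j) xs)"
  have xs0: "fps_nth (xs i) 0 = (z1 i)\<^sup>2" for i by (simp add: xs_def z1_def)
  have em0: "fps_nth (emon n e xs) 0 = (emon n e z1)\<^sup>2" for e
    unfolding comm_ring_hom_emon[OF comm_ring_hom_fps_nth_0] xs0 emon_power2 ..
  have Bs0: "fps_nth Bs 0 = (emon n (exps n d n) z1)\<^sup>2" unfolding Bs_def by (rule em0)
  have em_nz: "emon n e z1 \<noteq> 0" for e using z10 by (simp add: emon_def)
  have Bs_unit: "fps_nth Bs 0 \<noteq> 0" unfolding Bs0 using em_nz by simp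
  have Cs0: "fps_nth Cs 0 = (\<Sum>j<n. emon n (exps n d j) z1)\<^sup>2"
    unfolding Cs_def ct.hom_sum em0 char2_power2_sum[OF c2Q] ..
  have wq2: "wq\<^sup>2 = fps_nth Bs 0 * (((z 1)\<^sup>2)\<^sup>2 + (z 1)\<^sup>2) + fps_nth Cs 0"
    unfolding wq_def char2_power2_add[OF c2Q] power_mult_distrib Bs0 Cs0 ..
  \<comment> \<open>The equation divided by B, so that it reads \<tau>^2 + \<tau> = \<theta>. The
    series B is invertible because its constant term is the square of a nonzero monomial.\<close>
  define \<theta> where "\<theta> = ((fps_const wq)\<^sup>2 - Cs) * inverse Bs"
  have "fps_nth \<theta> 0 = ((z 1)\<^sup>2)\<^sup>2 + (z 1)\<^sup>2"
    unfolding \<theta>_def using Bs_unit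
    by (simp add: ct.hom_mult ct.hom_minus ct.hom_power wq2)
  then obtain \<tau> where \<tau>: "\<tau>\<^sup>2 + \<tau> = \<theta>" "fps_nth \<tau> 0 = (z 1)\<^sup>2"
    by (rule artin_schreier_fps[OF c2Q])
  have eqS: "(fps_const wq)\<^sup>2 = conic_form n d xs \<tau> 1"
  proof -
    have "Bs * \<theta> = (fps_const wq)\<^sup>2 - Cs"
      unfolding \<theta>_def using inverse_mult_eq_1[OF Bs_unit] by (simp add: mult_ac)
    then show ?thesis unfolding conic_form_def Bs_def [symmetric] Cs_def [symmetric]
      using \<tau>(1) by (simp add: algebra_simps)
  qed

  define as where "as i = (if i = 1 then \<tau> else xs i)" for i
  define a where "a i = to_fract (as i)" for i
  define w where "w = to_fract (fps_const wq)"
  have a1: "a(1 := 1) = (\<lambda>i. to_fract (xs i))"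
    by (auto simp: fun_eq_iff a_def as_def xs_def)
  have aa1: "a 1 = to_fract \<tau>" by (simp add: a_def as_def)
  have eqE: "w\<^sup>2 = conic_form n d (a(1 := 1)) (a 1) 1"
    unfolding a1 aa1 w_def tE.hom_power [symmetric] eqS
    by (simp add: comm_ring_hom_conic_form[OF comm_ring_hom_to_fract])

  \<comment> \<open>Taking constant terms turns an algebraic relation among the coordinates into one
    among the squares of independent variables.\<close>
  have indep: "A = 0" if "poly_eval kconst a A = 0" for A
  proof -
    let ?h = "\<lambda>c. fps_const (to_fract (Poly_Mapping.single 0 c)) :: 'k cpoly fract fps"
    have "poly_eval kconst a A = to_fract (poly_eval ?h as A)"
      unfolding poly_eval_hom[OF comm_ring_hom_to_fract] kconst_def a_def ..
    then have "poly_eval ?h as A = 0" using that by simp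
    then have "fps_nth (poly_eval ?h as A) 0 = 0" by simp
    moreover have "fps_nth (poly_eval ?h as A) 0 =
        poly_eval (\<lambda>c. to_fract (Poly_Mapping.single 0 c)) (\<lambda>i. fps_nth (as i) 0) A"
      unfolding poly_eval_hom[OF comm_ring_hom_fps_nth_0] by simp
    moreover have "fps_nth (as i) 0 = to_fract ((var i)\<^sup>2)" for i
      unfolding as_def using xs0[of i] \<tau>(2) by (simp add: z1_def z_def tf.hom_power)
    ultimately have "poly_eval (\<lambda>c. to_fract (Poly_Mapping.single 0 c)) (\<lambda>i. to_fract ((var i)\<^sup>2)) A = (0 :: 'k cpoly fract)"
      by simp
    then have "to_fract (poly_eval (Poly_Mapping.single 0) (\<lambda>i. (var i)\<^sup>2) A) = (0 :: 'k cpoly fract)"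
      unfolding poly_eval_hom[OF comm_ring_hom_to_fract] .
    then have "poly_eval (Poly_Mapping.single 0) (\<lambda>i. (var i)\<^sup>2) A = (0 :: 'k cpoly)" by simp
    then show "A = 0" by (rule poly_eval_var_squares)
  qed

  interpret ev: comm_ring_hom "poly_eval kconst a" by (rule comm_ring_hom_poly_eval_kconst)
  define F where "F = conic_form n d (var(1 := 1)) (var 1) (1 :: 'k cpoly)"
  have ev_var: "poly_eval kconst a (var i) = a i" for i
    unfolding var_def by (simp add: poly_eval_single)
  have evF: "poly_eval kconst a F = w\<^sup>2"
  proof -
    have "(\<lambda>i. poly_eval kconst a ((var(1 := 1)) i)) = a(1 := 1)"
      using ev_var ev.hom_one by (auto simp: fun_eq_iff)
    then show ?thesis
      unfolding F_def comm_ring_hom_conic_form[OF comm_ring_hom_poly_eval_kconst] eqE ev_var ev.hom_one by simp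
  qed
  have dF: "pder 1 F = emon n (exps n d n) (var(1 := 1))"
  proof -
    have D: "derivation (pder 1 :: 'k cpoly \<Rightarrow> _)" by (rule derivation_pder)
    have dv: "pder 1 (var i) = (if i = 1 then 1 else (0 :: 'k cpoly))" for i
      unfolding var_def pder_single by (auto simp: lookup_single when_def)
    have de: "pder 1 (emon n e (var(1 := 1))) = (0 :: 'k cpoly)" for e
      by (rule derivation_emon_0[OF D]) (auto simp: dv[unfolded One_nat_def] derivation_1[OF D, unfolded One_nat_def] var0)
    have sq: "pder 1 ((x::'k cpoly)\<^sup>2) = 0" for x by (rule derivation_square_char2[OF D c2R])
    show ?thesis unfolding F_def conic_form_def
      by (simp only: derivation_add[OF D] derivation_mult[OF D] derivation_sum[OF D] de sq dv derivation_1[OF D] sum.neutral_const) simp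
  qed
  \<comment> \<open>A relation would give A^2 = B^2 F. The partial derivative in the variable of
    \<open>t0\<close> kills all squares, so it leaves B^2 times a nonzero monomial, the coefficient
    of the mixed term of F.\<close>
  have gen: "A = 0 \<and> B = 0" if AB: "poly_eval kconst a A + poly_eval kconst a B * w = 0" for A B
  proof -
    have D: "derivation (pder 1 :: 'k cpoly \<Rightarrow> _)" by (rule derivation_pder)
    have "poly_eval kconst a A = poly_eval kconst a B * w"
      using AB char2_neg[OF c2E, of "poly_eval kconst a B * w"] by (metis eq_neg_iff_add_eq_0)
    then have "(poly_eval kconst a A)\<^sup>2 = (poly_eval kconst a B)\<^sup>2 * w\<^sup>2" by (simp add: power_mult_distrib)
    then have "poly_eval kconst a (A\<^sup>2 - B\<^sup>2 * F) = 0"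
      by (simp add: ev.hom_minus ev.hom_mult ev.hom_power evF)
    then have eq: "A\<^sup>2 = B\<^sup>2 * F" using indep[of "A\<^sup>2 - B\<^sup>2 * F"] by simp
    have "pder 1 (A\<^sup>2) = pder 1 (B\<^sup>2 * F)" unfolding eq ..
    then have "0 = B\<^sup>2 * emon n (exps n d n) (var(1 := 1))"
      by (simp only: derivation_mult[OF D] derivation_square_char2[OF D c2R] dF mult_zero_left add_0)
    moreover have "emon n (exps n d n) (var(1 := 1)) \<noteq> (0 :: 'k cpoly)"
      unfolding emon_def using var0 by simp
    ultimately have "B = 0" by simp
    then show ?thesis using eq by simp
  qed

  have om: "omega n dlaurent (\<lambda>i. c * (a(1 := 1)) i) \<noteq> 0" if c: "c \<noteq> 0" for c
  proof -
    let ?x = "a(1 := 1)"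
    define s where "s = (to_fract fps_X :: 'k laurent)"
    have s0: "s \<noteq> 0" by (simp add: s_def)
    have D0: "derivation (dfract (pder i) :: 'k cpoly fract \<Rightarrow> _)" for i by (rule derivation_dfract[OF derivation_pder])
    have dz: "dfract (pder i) (z j) = (if i = j then 1 else 0)" for i j
    proof -
      have "pder i (var j) = (if i = j then 1 else (0 :: 'k cpoly))"
        unfolding var_def pder_single by (auto simp: lookup_single when_def)
      then show ?thesis unfolding z_def dfract_to_fract[OF derivation_pder] by simp
    qed
    have dx: "dlaurent r (?x i) = (if i = r then s else 0)" if "r \<noteq> 1" for r i
    proof -
      have "Abs_fps (\<lambda>k. dfract (pder r) (fps_nth (xs i) k)) = (if i = r then fps_X else 0)"
      proof (rule fps_ext)
        fix k
        have X: "fps_nth (fps_X * fps_const (z i)) k = (if k = 1 then z i else 0)"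
          by (simp add: fps_X_def fps_mult_right_const_nth)
        show "fps_nth (Abs_fps (\<lambda>k. dfract (pder r) (fps_nth (xs i) k))) k = fps_nth (if i = r then fps_X else 0) k"
          using that by (cases "k = 0"; cases "k = 1")
            (auto simp: xs_def X dz derivation_0[OF D0] derivation_1[OF D0] derivation_add[OF D0]
              derivation_square_char2[OF D0 c2Q])
      qed
      then show ?thesis unfolding a1 dlaurent_to_fract s_def by (auto simp: if_distrib)
    qed
    \<comment> \<open>The derivation with index r other than 1 sees only the coordinate r, where its
      value is the deformation parameter s. The transposed matrix is therefore of the form whose
      determinant is the product of its diagonal.\<close>
    have T: "transpose_mat (wmat n dlaurent ?x) =
        comb_mat n 1 (\<lambda>i. if i = 1 then 1 else s) (\<lambda>i. if i = 1 then 0 else ?x i)"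
    proof -
      define X where "X = ?x"
      have X1: "X 1 = 1" by (simp add: X_def)
      show ?thesis unfolding X_def [symmetric]
        by (rule eq_matI) (auto simp: wmat_def comb_mat_def dx[folded X_def, unfolded One_nat_def] X1[unfolded One_nat_def])
    qed
    have "Determinant.det (wmat n dlaurent ?x) = (\<Prod>i<n. if i = 1 then 1 else s)"
      unfolding det_transpose[OF wmat_carrier, symmetric] T by (rule det_comb_mat) simp
    then have d: "Determinant.det (wmat n dlaurent ?x) \<noteq> 0" using s0 by simp
    have x0: "?x i \<noteq> 0" for i
    proof -
      have "fps_nth (xs i) 0 \<noteq> 0" unfolding xs0 using z10 by simp
      then have "xs i \<noteq> 0" by auto
      then show ?thesis unfolding a1 by simp
    qed
    have "Determinant.det (wmat n dlaurent (\<lambda>i. c * ?x i)) = c ^ n * Determinant.det (wmat n dlaurent ?x)"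
      by (rule det_wmat_scale) (use n3 derivation_dlaurent in auto)
    then show ?thesis unfolding omega_def using c d x0 by simp
  qed
  show thesis by (rule that[OF eqE gen om])
qed

section \<open>Places\<close>

text \<open>A homomorphism from a subring to a field, given by its graph.\<close>

definition part_hom :: "('a::field \<times> 'b::field) set \<Rightarrow> bool"
  where "part_hom S \<longleftrightarrow> (1, 1) \<in> S \<and>
    (\<forall>a b a' b'. (a, b) \<in> S \<longrightarrow> (a', b') \<in> S \<longrightarrow> (a - a', b - b') \<in> S \<and> (a * a', b * b') \<in> S) \<and>
    (\<forall>b. (0, b) \<in> S \<longrightarrow> b = 0)"

definition is_place :: "('a::field \<times> 'b::field) set \<Rightarrow> bool"
  where "is_place S \<longleftrightarrow> part_hom S \<and> (\<forall>z. (\<exists>b. (z, b) \<in> S) \<or> (inverse z, 0) \<in> S)"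

lemma part_hom_one: "part_hom S \<Longrightarrow> (1, 1) \<in> S"
  and part_hom_diff: "part_hom S \<Longrightarrow> (a, b) \<in> S \<Longrightarrow> (a', b') \<in> S \<Longrightarrow> (a - a', b - b') \<in> S"
  and part_hom_mult: "part_hom S \<Longrightarrow> (a, b) \<in> S \<Longrightarrow> (a', b') \<in> S \<Longrightarrow> (a * a', b * b') \<in> S"
  and part_hom_zeroD: "part_hom S \<Longrightarrow> (0, b) \<in> S \<Longrightarrow> b = 0"
  unfolding part_hom_def by blast+

lemma part_hom_zero: "part_hom S \<Longrightarrow> (0, 0) \<in> S"
  using part_hom_diff[of S 1 1 1 1] part_hom_one[of S] by simp

lemma part_hom_uminus: "part_hom S \<Longrightarrow> (a, b) \<in> S \<Longrightarrow> (- a, - b) \<in> S"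
  using part_hom_diff[of S 0 0 a b] part_hom_zero[of S] by simp

lemma part_hom_add: "part_hom S \<Longrightarrow> (a, b) \<in> S \<Longrightarrow> (a', b') \<in> S \<Longrightarrow> (a + a', b + b') \<in> S"
  using part_hom_diff[of S a b "- a'" "- b'"] part_hom_uminus[of S a' b'] by simp

lemma part_hom_unique: "part_hom S \<Longrightarrow> (a, b) \<in> S \<Longrightarrow> (a, b') \<in> S \<Longrightarrow> b = b'"
  using part_hom_diff[of S a b a b'] part_hom_zeroD[of S "b - b'"] by simp

lemma part_hom_power: "part_hom S \<Longrightarrow> (a, b) \<in> S \<Longrightarrow> (a ^ k, b ^ k) \<in> S"
  by (induction k) (auto intro: part_hom_one part_hom_mult)

lemma part_hom_sum:
  assumes "part_hom S" "\<And>i. i \<in> A \<Longrightarrow> (f i, g i) \<in> S"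
  shows "((\<Sum>i\<in>A. f i), (\<Sum>i\<in>A. g i)) \<in> S"
  using assms(2)
  by (induction A rule: infinite_finite_induct)
     (auto intro: part_hom_zero[OF assms(1)] part_hom_add[OF assms(1)])

lemma part_hom_prod:
  assumes "part_hom S" "\<And>i. i \<in> A \<Longrightarrow> (f i, g i) \<in> S"
  shows "((\<Prod>i\<in>A. f i), (\<Prod>i\<in>A. g i)) \<in> S"
  using assms(2)
  by (induction A rule: infinite_finite_induct)
     (auto intro: part_hom_one[OF assms(1)] part_hom_mult[OF assms(1)])

definition poly_rel :: "('a::zero \<times> 'b::zero) set \<Rightarrow> 'a poly \<Rightarrow> 'b poly \<Rightarrow> bool"
  where "poly_rel S p q \<longleftrightarrow> (\<forall>i. (coeff p i, coeff q i) \<in> S)"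

lemma poly_rel_const: "part_hom S \<Longrightarrow> (a, b) \<in> S \<Longrightarrow> poly_rel S [:a:] [:b:]"
  by (auto simp: poly_rel_def coeff_pCons part_hom_zero split: nat.split)

lemma poly_rel_add: "part_hom S \<Longrightarrow> poly_rel S p q \<Longrightarrow> poly_rel S p' q' \<Longrightarrow> poly_rel S (p + p') (q + q')"
  and poly_rel_diff: "part_hom S \<Longrightarrow> poly_rel S p q \<Longrightarrow> poly_rel S p' q' \<Longrightarrow> poly_rel S (p - p') (q - q')"
  and poly_rel_smult: "part_hom S \<Longrightarrow> (a, b) \<in> S \<Longrightarrow> poly_rel S p q \<Longrightarrow> poly_rel S (Polynomial.smult a p) (Polynomial.smult b q)"
  by (simp_all add: poly_rel_def part_hom_add part_hom_diff part_hom_mult)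

lemma poly_rel_mult: "part_hom S \<Longrightarrow> poly_rel S p q \<Longrightarrow> poly_rel S p' q' \<Longrightarrow> poly_rel S (p * p') (q * q')"
  by (auto simp: poly_rel_def coeff_mult intro!: part_hom_sum part_hom_mult)

lemma poly_rel_one: "part_hom S \<Longrightarrow> poly_rel S 1 1"
  using poly_rel_const[of S 1 1] by (simp add: part_hom_one one_pCons)

lemma poly_rel_monom: "part_hom S \<Longrightarrow> poly_rel S (monom 1 k) (monom 1 k)"
  by (simp add: poly_rel_def part_hom_zero part_hom_one)

lemma poly_rel_power: "part_hom S \<Longrightarrow> poly_rel S p q \<Longrightarrow> poly_rel S (p ^ k) (q ^ k)"
  by (induction k) (auto intro: poly_rel_one poly_rel_mult)

lemma poly_rel_sum:
  assumes "part_hom S" "\<And>i. i \<in> A \<Longrightarrow> poly_rel S (f i) (g i)"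
  shows "poly_rel S (\<Sum>i\<in>A. f i) (\<Sum>i\<in>A. g i)"
  using assms by (auto simp: poly_rel_def coeff_sum intro: part_hom_sum)

lemma poly_rel_prod:
  assumes "part_hom S" "\<And>i. i \<in> A \<Longrightarrow> poly_rel S (f i) (g i)"
  shows "poly_rel S (\<Prod>i\<in>A. f i) (\<Prod>i\<in>A. g i)"
  using assms(2)
  by (induction A rule: infinite_finite_induct)
     (auto intro: poly_rel_one[OF assms(1)] poly_rel_mult[OF assms(1)])

lemma part_hom_localize:
  assumes S: "part_hom S" and ab: "(a, b) \<in> S" "b \<noteq> 0"
  defines "T \<equiv> {(x * inverse a ^ k, y * inverse b ^ k) | x y k. (x, y) \<in> S}"
  shows "part_hom T" "S \<subseteq> T" "(inverse a, inverse b) \<in> T"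
proof -
  have a: "a \<noteq> 0" using ab part_hom_zeroD[OF S, of b] by auto
  have TI: "(x * inverse a ^ k, y * inverse b ^ k) \<in> T" if "(x, y) \<in> S" for x y k
    unfolding T_def using that by blast
  have one: "(1, 1) \<in> S" by (rule part_hom_one[OF S])
  show "S \<subseteq> T" using TI[where k = 0] by auto
  show "(inverse a, inverse b) \<in> T" using TI[OF one, of 1] by simp
  have pw: "(a ^ k, b ^ k) \<in> S" for k by (rule part_hom_power[OF S ab(1)])
  have "(p - p', q - q') \<in> T \<and> (p * p', q * q') \<in> T" if T: "(p, q) \<in> T" "(p', q') \<in> T" for p q p' q'
  proof -
    obtain x y k where 1: "p = x * inverse a ^ k" "q = y * inverse b ^ k" "(x, y) \<in> S"
      using T(1) unfolding T_def by blast
    obtain x' y' l where 2: "p' = x' * inverse a ^ l" "q' = y' * inverse b ^ l" "(x', y') \<in> S"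
      using T(2) unfolding T_def by blast
    have e: "p - p' = (x * a ^ l - x' * a ^ k) * inverse a ^ (k + l)"
      "q - q' = (y * b ^ l - y' * b ^ k) * inverse b ^ (k + l)"
      unfolding 1 2 using a ab(2) by (simp_all add: power_add field_simps)
    have "(x * a ^ l - x' * a ^ k, y * b ^ l - y' * b ^ k) \<in> S"
      by (intro part_hom_diff[OF S] part_hom_mult[OF S] 1 2 pw)
    then have "(p - p', q - q') \<in> T" unfolding e by (rule TI)
    moreover have e': "p * p' = x * x' * inverse a ^ (k + l)" "q * q' = y * y' * inverse b ^ (k + l)"
      unfolding 1 2 by (simp_all add: power_add)
    have "(x * x', y * y') \<in> S" by (intro part_hom_mult[OF S] 1 2)
    then have "(p * p', q * q') \<in> T" unfolding e' by (rule TI)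
    ultimately show ?thesis ..
  qed
  moreover have "q = 0" if T: "(0, q) \<in> T" for q
  proof -
    obtain x y k where 1: "0 = x * inverse a ^ k" "q = y * inverse b ^ k" "(x, y) \<in> S"
      using T unfolding T_def by blast
    then have "x = 0" using a by simp
    then have "y = 0" using part_hom_zeroD[OF S] 1(3) by blast
    then show ?thesis using 1(2) by simp
  qed
  moreover have "(1, 1) \<in> T" using TI[OF one, of 0] by simp
  ultimately show "part_hom T" unfolding part_hom_def by blast
qed

lemma part_hom_adjoin:
  assumes S: "part_hom S" and root: "\<And>p q. poly_rel S p q \<Longrightarrow> poly p z = 0 \<Longrightarrow> poly q c = 0"
  defines "T \<equiv> {(poly p z, poly q c) | p q. poly_rel S p q}"
  shows "part_hom T" "S \<subseteq> T" "(z, c) \<in> T"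
proof -
  have TI: "(poly p z, poly q c) \<in> T" if "poly_rel S p q" for p q
    unfolding T_def using that by blast
  show "S \<subseteq> T"
  proof
    fix x assume "x \<in> S"
    then have "(poly [:fst x:] z, poly [:snd x:] c) \<in> T" by (intro TI poly_rel_const[OF S]) simp
    then show "x \<in> T" by simp
  qed
  have "(poly (monom 1 1) z, poly (monom 1 1) c) \<in> T" by (intro TI poly_rel_monom[OF S])
  then show "(z, c) \<in> T" by (simp add: poly_monom)
  have "(a - a', b - b') \<in> T \<and> (a * a', b * b') \<in> T" if T: "(a, b) \<in> T" "(a', b') \<in> T" for a b a' b'
  proof -
    obtain p q where 1: "a = poly p z" "b = poly q c" "poly_rel S p q" using T(1) unfolding T_def by blast
    obtain p' q' where 2: "a' = poly p' z" "b' = poly q' c" "poly_rel S p' q'" using T(2) unfolding T_def by blast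
    show ?thesis unfolding 1 2
      using TI[OF poly_rel_diff[OF S 1(3) 2(3)]] TI[OF poly_rel_mult[OF S 1(3) 2(3)]] by simp
  qed
  moreover have "b = 0" if "(0, b) \<in> T" for b
  proof -
    obtain p q where "0 = poly p z" "b = poly q c" "poly_rel S p q" using \<open>(0, b) \<in> T\<close> unfolding T_def by blast
    then show ?thesis using root by simp
  qed
  moreover have "(1, 1) \<in> T" using part_hom_one[OF S] \<open>S \<subseteq> T\<close> by blast
  ultimately show "part_hom T" unfolding part_hom_def by blast
qed

text \<open>Let J consist of the reductions of polynomials that vanish at z. Cancelling leading
  terms against a nonzero g of least degree in J stays inside J, so a root of g is a root of all of
  J. By assumption g is not constant, so it has a root.\<close>

lemma common_root:
  fixes S :: "('a::field \<times> 'b::alg_closed_field) set"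
  assumes S: "part_hom S" and nc: "\<And>p c. poly_rel S p [:c:] \<Longrightarrow> poly p z = 0 \<Longrightarrow> c = 0"
  shows "\<exists>b. \<forall>p q. poly_rel S p q \<longrightarrow> poly p z = 0 \<longrightarrow> poly q b = 0"
proof (cases "\<exists>p q. poly_rel S p q \<and> poly p z = 0 \<and> q \<noteq> 0")
  case False
  have "poly q 0 = 0" if "poly_rel S p q" "poly p z = 0" for p q
  proof -
    have "q = 0" using False that by blast
    then show ?thesis by simp
  qed
  then show ?thesis by blast
next
  case True
  define J where "J q \<longleftrightarrow> (\<exists>p. poly_rel S p q \<and> poly p z = 0)" for q
  have "\<exists>q. J q \<and> q \<noteq> 0" using True by (auto simp: J_def)
  then obtain g where g: "J g" "g \<noteq> 0" and min: "\<And>q. J q \<Longrightarrow> q \<noteq> 0 \<Longrightarrow> degree g \<le> degree q"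
    using ex_has_least_nat[of "\<lambda>q. J q \<and> q \<noteq> 0" _ degree] by metis
  have "degree g > 0"
  proof (rule ccontr)
    assume "\<not> ?thesis"
    then obtain c where c: "g = [:c:]" by (metis degree_eq_zeroE gr0I)
    then have "c = 0" using g(1) nc unfolding J_def by blast
    then show False using g(2) c by simp
  qed
  then obtain b where b: "poly g b = 0" using alg_closed_imp_poly_has_root[of g] by blast
  have "poly q b = 0" if "J q" for q
    using that
  proof (induction "degree q" arbitrary: q rule: less_induct)
    case less
    show ?case
    proof (cases "q = 0")
      case False
      have dg: "degree g \<le> degree q" using min less.prems False by blast
      define e where "e = degree q - degree g"
      define q' where "q' = Polynomial.smult (lead_coeff g) q - Polynomial.smult (lead_coeff q) (monom 1 e * g)"
      obtain p where p: "poly_rel S p q" "poly p z = 0" using less.prems unfolding J_def by blast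
      obtain f where f: "poly_rel S f g" "poly f z = 0" using g(1) unfolding J_def by blast
      have "poly_rel S (Polynomial.smult (coeff f (degree g)) p - Polynomial.smult (coeff p (degree q)) (monom 1 e * f)) q'"
        unfolding q'_def
        by (intro poly_rel_diff[OF S] poly_rel_smult[OF S] poly_rel_mult[OF S] poly_rel_monom[OF S] p f)
           (use p f in \<open>auto simp: poly_rel_def\<close>)
      moreover have "poly (Polynomial.smult (coeff f (degree g)) p - Polynomial.smult (coeff p (degree q)) (monom 1 e * f)) z = 0"
        using p f by simp
      ultimately have J': "J q'" unfolding J_def by blast
      have "poly q' b = 0"
      proof (cases "q' = 0")
        case nz: False
        have "degree q' \<le> degree q"
        proof -
          have "degree (monom 1 e * g) \<le> degree q"
            using dg unfolding e_def by (intro order.trans[OF degree_mult_le]) (simp add: degree_monom_eq)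
          then show ?thesis unfolding q'_def by (intro degree_diff_le) (auto intro: order.trans[OF degree_smult_le])
        qed
        moreover have "coeff q' (degree q) = 0"
        proof -
          have "coeff (monom 1 e * g) (degree q) = lead_coeff g"
            using dg by (simp add: coeff_monom_mult e_def)
          then show ?thesis unfolding q'_def by simp
        qed
        then have "degree q' \<noteq> degree q" using nz by (metis leading_coeff_0_iff)
        ultimately show ?thesis using less.hyps J' by simp
      qed simp
      then have "lead_coeff g * poly q b = 0" unfolding q'_def using b by simp
      then show ?thesis using g(2) by simp
    qed simp
  qed
  then show ?thesis unfolding J_def by blast
qed

text \<open>Chevalley's extension theorem. By Zorn there is a maximal partial homomorphism, and
  maximality makes its domain a local ring. If z is outside the domain, \<open>common_root\<close>
  gives an equation of z whose reduction is a nonzero constant. Such equations for z and its inverse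
  at the same time contradict each other by a descent on their degrees.\<close>

theorem place_extension:
  fixes S0 :: "('a::field \<times> 'b::alg_closed_field) set"
  assumes "part_hom S0"
  obtains S where "S0 \<subseteq> S" "is_place S"
proof -
  let ?A = "{S. part_hom S \<and> S0 \<subseteq> S}"
  have "\<exists>M\<in>?A. \<forall>X\<in>?A. M \<subseteq> X \<longrightarrow> X = M"
  proof (rule subset_Zorn_nonempty)
    show "?A \<noteq> {}" using assms by blast
    fix C assume C: "C \<noteq> {}" "subset.chain ?A C"
    then have ph: "part_hom S" "S0 \<subseteq> S" if "S \<in> C" for S
      using that by (auto simp: subset.chain_def)
    obtain S1 where S1: "S1 \<in> C" using C(1) by blast
    have "(a - a', b - b') \<in> \<Union>C \<and> (a * a', b * b') \<in> \<Union>C"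
      if ab: "(a, b) \<in> \<Union>C" "(a', b') \<in> \<Union>C" for a b a' b'
    proof -
      obtain X where X: "X \<in> C" "(a, b) \<in> X" using ab by blast
      obtain Y where Y: "Y \<in> C" "(a', b') \<in> Y" using ab by blast
      have "X \<subseteq> Y \<or> Y \<subseteq> X" using subset_chain_def[of ?A C] C(2) X(1) Y(1) by auto
      then obtain Z where Z: "Z \<in> C" "(a, b) \<in> Z" "(a', b') \<in> Z" using X Y by blast
      show ?thesis
        using part_hom_diff[OF ph(1)[OF Z(1)] Z(2,3)] part_hom_mult[OF ph(1)[OF Z(1)] Z(2,3)] Z(1) by blast
    qed
    moreover have "(1, 1) \<in> \<Union>C" using S1 part_hom_one[OF ph(1)[OF S1]] by blast
    moreover have "b = 0" if b: "(0, b) \<in> \<Union>C" for b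
    proof -
      obtain X where X: "X \<in> C" "(0, b) \<in> X" using b by blast
      show ?thesis by (rule part_hom_zeroD[OF ph(1)[OF X(1)] X(2)])
    qed
    ultimately have "part_hom (\<Union>C)" unfolding part_hom_def by blast
    then show "\<Union>C \<in> ?A" using S1 ph(2) by blast
  qed
  then obtain M where M: "part_hom M" "S0 \<subseteq> M" and max: "\<And>X. part_hom X \<Longrightarrow> M \<subseteq> X \<Longrightarrow> X = M"
    by (auto dest: order.trans)
  \<comment> \<open>An element with nonzero image is invertible in the domain, for otherwise
    localisation would enlarge the maximal M.\<close>
  have inv: "(inverse a, inverse b) \<in> M" if "(a, b) \<in> M" "b \<noteq> 0" for a b
    using max[OF part_hom_localize(1,2)[OF M(1) that]] part_hom_localize(3)[OF M(1) that] by simp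
  define R where "R z N \<longleftrightarrow> (\<exists>p. degree p \<le> N \<and> poly p z = 0 \<and> poly_rel M p [:1:])" for z N
  have exR: "\<exists>N. R z N" if z: "\<nexists>b. (z, b) \<in> M" for z
  proof -
    have "\<exists>p c. poly_rel M p [:c:] \<and> poly p z = 0 \<and> c \<noteq> 0"
    proof (rule ccontr)
      assume "\<not> ?thesis"
      then have "\<exists>b. \<forall>p q. poly_rel M p q \<longrightarrow> poly p z = 0 \<longrightarrow> poly q b = 0"
        by (intro common_root[OF M(1)]) blast
      then obtain b where b: "\<And>p q. poly_rel M p q \<Longrightarrow> poly p z = 0 \<Longrightarrow> poly q b = 0" by blast
      define T where "T = {(poly p z, poly q b) | p q. poly_rel M p q}"
      have "part_hom T" unfolding T_def by (rule part_hom_adjoin(1)[OF M(1)]) (rule b)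
      moreover have "M \<subseteq> T" unfolding T_def by (rule part_hom_adjoin(2)[OF M(1)]) (rule b)
      moreover have "(z, b) \<in> T" unfolding T_def by (rule part_hom_adjoin(3)[OF M(1)]) (rule b)
      ultimately have "(z, b) \<in> M" using max[of T] by simp
      then show False using z by blast
    qed
    then obtain p c where p: "poly_rel M p [:c:]" "poly p z = 0" "c \<noteq> 0" by blast
    have "(coeff p 0, c) \<in> M" using p(1) unfolding poly_rel_def by (metis coeff_pCons_0)
    then have "poly_rel M (Polynomial.smult (inverse (coeff p 0)) p) (Polynomial.smult (inverse c) [:c:])"
      by (intro poly_rel_smult[OF M(1)] inv p)
    then have "poly_rel M (Polynomial.smult (inverse (coeff p 0)) p) [:1:]" using p(3) by simp
    then have "R z (degree p)" unfolding R_def using p(2) by (intro exI[of _ "Polynomial.smult (inverse (coeff p 0)) p"]) (simp add: degree_smult_le)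
    then show ?thesis ..
  qed
  \<comment> \<open>The equation q of the inverse, multiplied by \<open>z ^ N\<close>, becomes an
    equation r of z with top coefficient \<open>coeff q 0\<close>, which reduces to 1. Subtracting a
    multiple of r from p cancels the top coefficient. The constant coefficient still reduces to 1,
    because the multiplier \<open>coeff p N\<close> reduces to 0 for N > 0.\<close>
  have step: "R z (N - 1)" if z: "z \<noteq> 0" and N: "R z N" "R (inverse z) N'" "N' \<le> N" for z N N'
  proof -
    obtain p where p: "degree p \<le> N" "poly p z = 0" "poly_rel M p [:1:]" using N(1) unfolding R_def by blast
    obtain q where q: "degree q \<le> N'" "poly q (inverse z) = 0" "poly_rel M q [:1:]" using N(2) unfolding R_def by blast
    have N0: "N \<noteq> 0"
    proof
      assume "N = 0"
      then obtain a where a: "p = [:a:]" using p(1) by (metis degree_eq_zeroE le_zero_eq)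
      then have "a = 0" using p(2) by simp
      then have "(0, 1) \<in> M" using p(3) a unfolding poly_rel_def by (metis coeff_pCons_0)
      then show False using part_hom_zeroD[OF M(1)] by fastforce
    qed
    define r where "r = (\<Sum>j\<le>N. monom (coeff q j) (N - j))"
    have cr: "coeff r i = (if i \<le> N then coeff q (N - i) else 0)" for i
    proof -
      have "coeff r i = (\<Sum>j\<le>N. if j = N - i \<and> i \<le> N then coeff q j else 0)"
        unfolding r_def coeff_sum by (rule sum.cong) auto
      then show ?thesis by (auto simp: sum.delta)
    qed
    have "poly r z = z ^ N * poly q (inverse z)"
    proof -
      have "poly q (inverse z) = (\<Sum>j\<le>N. coeff q j * inverse z ^ j)"
        unfolding poly_altdef by (rule sum.mono_neutral_left) (use q N(3) in \<open>auto simp: coeff_eq_0\<close>)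
      moreover have "z ^ N * (coeff q j * inverse z ^ j) = coeff q j * z ^ (N - j)" if "j \<le> N" for j
        using z that by (simp add: power_diff field_simps)
      then have "(\<Sum>j\<le>N. z ^ N * (coeff q j * inverse z ^ j)) = (\<Sum>j\<le>N. coeff q j * z ^ (N - j))"
        by (intro sum.cong refl) simp
      ultimately show ?thesis unfolding r_def by (simp only: poly_sum poly_monom sum_distrib_left)
    qed
    then have rz: "poly r z = 0" using q(2) by simp
    define s where "s = Polynomial.smult (coeff q 0) p - Polynomial.smult (coeff p N) r"
    have Mp: "(coeff p i, if i = 0 then 1 else 0) \<in> M" for i
      using p(3)[unfolded poly_rel_def, rule_format, of i] by (cases i) simp_all
    have Mq: "(coeff q i, if i = 0 then 1 else 0) \<in> M" for i
      using q(3)[unfolded poly_rel_def, rule_format, of i] by (cases i) simp_all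
    have "degree s \<le> N - 1"
    proof (rule degree_le, intro allI impI)
      fix i assume "N - 1 < i"
      then consider "i = N" | "i > N" by linarith
      then show "coeff s i = 0"
      proof cases
        case 2
        then show ?thesis using p(1) by (simp add: s_def cr coeff_eq_0)
      qed (simp add: s_def cr)
    qed
    moreover have "poly s z = 0" by (simp add: s_def p(2) rz)
    moreover have "poly_rel M s [:1:]"
      unfolding poly_rel_def
    proof
      fix i
      have Mr: "(coeff r i, if i = N then 1 else 0) \<in> M"
        using Mq[of "N - i"] part_hom_zero[OF M(1)] by (auto simp: cr split: if_splits)
      have "(coeff q 0 * coeff p i - coeff p N * coeff r i,
          1 * (if i = 0 then 1 else 0) - 0 * (if i = N then 1 else 0)) \<in> M"
        by (intro part_hom_diff[OF M(1)] part_hom_mult[OF M(1)] Mr Mp) (use Mq[of 0] Mp[of N] N0 in auto)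
      then show "(coeff s i, coeff [:1:] i) \<in> M"
        by (cases i) (auto simp: s_def)
    qed
    ultimately show ?thesis unfolding R_def by blast
  qed
  have dom: "(\<exists>b. (z, b) \<in> M) \<or> (\<exists>b. (inverse z, b) \<in> M)" for z
  proof (rule ccontr)
    assume neg: "\<not> ?thesis"
    have z0: "z \<noteq> 0" using neg part_hom_zero[OF M(1)] by auto
    define N where "N = (LEAST N. R z N)"
    define N' where "N' = (LEAST N. R (inverse z) N)"
    have R: "R z N" "R (inverse z) N'"
      unfolding N_def N'_def using exR[of z] exR[of "inverse z"] neg by (auto intro: LeastI_ex)
    have R0: "\<not> R x 0" for x
    proof
      assume "R x 0"
      then obtain p where p: "degree p \<le> 0" "poly p x = 0" "poly_rel M p [:1:]" unfolding R_def by blast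
      then obtain a where a: "p = [:a:]" by (metis degree_eq_zeroE le_zero_eq)
      then have "a = 0" using p(2) by simp
      then have "(0, 1) \<in> M" using p(3) a unfolding poly_rel_def by (metis coeff_pCons_0)
      then show False using part_hom_zeroD[OF M(1)] by fastforce
    qed
    have pos: "N \<noteq> 0" "N' \<noteq> 0" using R R0 by metis+
    show False
    proof (cases "N' \<le> N")
      case True
      then have "R z (N - 1)" using step[OF z0 R] by blast
      then have "N \<le> N - 1" unfolding N_def by (rule Least_le)
      then show False using pos by simp
    next
      case False
      then have "R (inverse z) (N' - 1)" using step[of "inverse z" N' N] z0 R by simp
      then have "N' \<le> N' - 1" unfolding N'_def by (rule Least_le)
      then show False using pos by simp
    qed
  qed
  have "(\<exists>b. (z, b) \<in> M) \<or> (inverse z, 0) \<in> M" for z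
  proof (cases "\<exists>b. (z, b) \<in> M")
    case False
    then obtain b where b: "(inverse z, b) \<in> M" using dom by blast
    have "b = 0"
    proof (rule ccontr)
      assume "b \<noteq> 0"
      then have "(inverse (inverse z), inverse b) \<in> M" by (rule inv[OF b])
      then show False using False by simp
    qed
    then show ?thesis using b by blast
  qed blast
  then have "is_place M" unfolding is_place_def using M(1) by blast
  then show thesis using that M(2) by blast
qed

section \<open>Countable algebraically closed subfields of the complex numbers\<close>

text \<open>Closed under roots inside the complex numbers, hence an algebraically closed field. It
  serves as a field of constants that is closed under all constructions below.\<close>

definition acl_field :: "complex set \<Rightarrow> bool"
  where "acl_field K \<longleftrightarrow> 0 \<in> K \<and> 1 \<in> K \<and> (\<forall>a\<in>K. \<forall>b\<in>K. a - b \<in> K \<and> a * b \<in> K) \<and>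
    (\<forall>a\<in>K. inverse a \<in> K) \<and>
    (\<forall>p z. p \<noteq> 0 \<longrightarrow> set (coeffs p) \<subseteq> K \<longrightarrow> poly p z = 0 \<longrightarrow> z \<in> K)"

definition acl_step :: "complex set \<Rightarrow> complex set"
  where "acl_step S = S \<union> {0, 1} \<union> (\<lambda>(a, b). a - b) ` (S \<times> S) \<union> (\<lambda>(a, b). a * b) ` (S \<times> S) \<union> inverse ` S \<union>
    (\<Union>p\<in>Poly ` lists S - {0}. {z. poly p z = 0})"

lemma countable_acl_step: "countable S \<Longrightarrow> countable (acl_step S)"
  unfolding acl_step_def
  by (intro countable_Un countable_UN countable_image countable_SIGMA countable_Diff countable_lists)
     (auto intro: countable_finite poly_roots_finite)

lemma acl_step_root:
  assumes "p \<noteq> 0" "set (coeffs p) \<subseteq> S" "poly p z = 0" shows "z \<in> acl_step S"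
proof -
  have "Poly (coeffs p) \<in> Poly ` lists S" using assms(2) by (intro imageI) auto
  then have "z \<in> (\<Union>p\<in>Poly ` lists S - {0}. {z. poly p z = 0})" using assms(1,3) by (metis (mono_tags, lifting) Diff_iff Poly_coeffs UN_I mem_Collect_eq singletonD)
  then show ?thesis unfolding acl_step_def by (rule UnI2)
qed

lemma countable_acl_field_exists:
  assumes "countable S"
  obtains K where "acl_field K" "countable K" "S \<subseteq> K"
proof -
  define L where "L n = (acl_step ^^ n) S" for n
  have L_Suc: "L (Suc n) = acl_step (L n)" for n by (simp add: L_def)
  have "L n \<subseteq> L (Suc n)" for n unfolding L_Suc by (auto simp: acl_step_def)
  then have mono: "L n \<subseteq> L m" if "n \<le> m" for n m using that by (rule lift_Suc_mono_le)
  have cn: "countable (L n)" for n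
    by (induction n) (simp_all add: L_Suc countable_acl_step, simp add: L_def assms)
  define K where "K = (\<Union>n. L n)"
  have KI: "x \<in> K" if "x \<in> L n" for x n using that by (auto simp: K_def)
  have two: "\<exists>n. a \<in> L n \<and> b \<in> L n" if ab: "a \<in> K" "b \<in> K" for a b
  proof -
    obtain n m where "a \<in> L n" "b \<in> L m" using ab unfolding K_def by blast
    then show ?thesis using mono[of n "max n m"] mono[of m "max n m"] by (intro exI[of _ "max n m"]) auto
  qed
  have fin: "\<exists>n. A \<subseteq> L n" if "finite A" "A \<subseteq> K" for A
    using that
  proof (induction A rule: finite_induct)
    case (insert x A)
    then obtain n m where "A \<subseteq> L n" "x \<in> L m" by (auto simp: K_def)
    then show ?case using mono[of n "max n m"] mono[of m "max n m"] by (intro exI[of _ "max n m"]) auto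
  qed auto
  have "acl_field K"
    unfolding acl_field_def
  proof (intro conjI ballI allI impI)
    show "0 \<in> K" "1 \<in> K" by (rule KI[of _ "Suc 0"], simp add: L_Suc acl_step_def)+
    fix a b assume ab: "a \<in> K" "b \<in> K"
    then obtain n where n: "a \<in> L n" "b \<in> L n" using two by blast
    have "a - b \<in> (\<lambda>(a, b). a - b) ` (L n \<times> L n)" "a * b \<in> (\<lambda>(a, b). a * b) ` (L n \<times> L n)"
      using n by (auto intro!: image_eqI[of _ _ "(a, b)"])
    then have "a - b \<in> L (Suc n)" "a * b \<in> L (Suc n)" unfolding L_Suc acl_step_def by blast+
    then show "a - b \<in> K" "a * b \<in> K" by (auto intro: KI)
  next
    fix a assume "a \<in> K"
    then obtain n where "a \<in> L n" by (auto simp: K_def)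
    then have "inverse a \<in> L (Suc n)" unfolding L_Suc acl_step_def by blast
    then show "inverse a \<in> K" by (rule KI)
  next
    fix p z assume p: "p \<noteq> 0" "set (coeffs p) \<subseteq> K" "poly p z = 0"
    obtain n where "set (coeffs p) \<subseteq> L n" using fin[OF _ p(2)] by auto
    then have "z \<in> L (Suc n)" unfolding L_Suc using p by (intro acl_step_root)
    then show "z \<in> K" by (rule KI)
  qed
  moreover have "countable K" unfolding K_def using cn by auto
  moreover have "S \<subseteq> K" using KI[of _ 0] by (auto simp: L_def)
  ultimately show thesis using that by blast
qed

lemma acl_field_0: "acl_field K \<Longrightarrow> 0 \<in> K"
  and acl_field_1: "acl_field K \<Longrightarrow> 1 \<in> K"
  and acl_field_diff: "acl_field K \<Longrightarrow> a \<in> K \<Longrightarrow> b \<in> K \<Longrightarrow> a - b \<in> K"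
  and acl_field_mult: "acl_field K \<Longrightarrow> a \<in> K \<Longrightarrow> b \<in> K \<Longrightarrow> a * b \<in> K"
  and acl_field_inverse: "acl_field K \<Longrightarrow> a \<in> K \<Longrightarrow> inverse a \<in> K"
  by (simp_all add: acl_field_def)

lemma acl_field_divide: "acl_field K \<Longrightarrow> a \<in> K \<Longrightarrow> b \<in> K \<Longrightarrow> a / b \<in> K"
  unfolding divide_inverse by (intro acl_field_mult acl_field_inverse)

lemma acl_field_add: "acl_field K \<Longrightarrow> a \<in> K \<Longrightarrow> b \<in> K \<Longrightarrow> a + b \<in> K"
  using acl_field_diff[of K a "0 - b"] acl_field_diff[of K 0 b] acl_field_0[of K] by simp

lemma acl_field_sum: "acl_field K \<Longrightarrow> (\<And>i. i \<in> A \<Longrightarrow> f i \<in> K) \<Longrightarrow> (\<Sum>i\<in>A. f i) \<in> K"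
  by (induction A rule: infinite_finite_induct) (auto intro: acl_field_0 acl_field_add)

lemma acl_field_power: "acl_field K \<Longrightarrow> a \<in> K \<Longrightarrow> a ^ k \<in> K"
  by (induction k) (auto intro: acl_field_1 acl_field_mult)

lemma acl_field_prod: "acl_field K \<Longrightarrow> (\<And>i. i \<in> A \<Longrightarrow> f i \<in> K) \<Longrightarrow> (\<Prod>i\<in>A. f i) \<in> K"
  by (induction A rule: infinite_finite_induct) (auto intro: acl_field_1 acl_field_mult)

lemma acl_field_root:
  assumes K: "acl_field K" and "a \<in> K" "k > 0" "z ^ k = a" shows "z \<in> K"
proof -
  define p where "p = monom 1 k - [:a:]"
  have c: "coeff p i = (if i = k then 1 else 0) - (if i = 0 then a else 0)" for i
    by (simp add: p_def coeff_pCons split: nat.split)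
  have "coeff p i \<in> K" for i
    unfolding c using assms by (intro acl_field_diff) (auto intro: acl_field_0 acl_field_1)
  then have "set (coeffs p) \<subseteq> K" by (auto simp: coeffs_def)
  moreover have "coeff p k \<noteq> 0" unfolding c using assms(3) by simp
  then have "p \<noteq> 0" by auto
  moreover have "poly p z = 0" using assms(4) by (simp add: p_def poly_monom)
  ultimately show ?thesis using K unfolding acl_field_def by blast
qed

section \<open>Algebraically independent complex numbers over a countable field\<close>

definition alg_indep :: "nat \<Rightarrow> complex set \<Rightarrow> (nat \<Rightarrow> complex) \<Rightarrow> bool"
  where "alg_indep n K a \<longleftrightarrow> (\<forall>P. range (Poly_Mapping.lookup P) \<subseteq> K \<longrightarrow>
    (\<forall>m\<in>Poly_Mapping.keys P. Poly_Mapping.keys m \<subseteq> {..<n}) \<longrightarrow> poly_eval (\<lambda>c. c) a P = 0 \<longrightarrow> P = 0)"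

text \<open>P is collected by powers of the last variable. After substitution of a it becomes a
  polynomial over K with root b. As K is relatively algebraically closed and does not contain b, all
  its coefficients vanish, and the independence of a kills each collected part
  \<open>Q j\<close>.\<close>

lemma alg_indep_Suc:
  assumes K0: "acl_field K" and ai: "alg_indep n K0' a" and sub: "K0' \<subseteq> K" and K0': "acl_field K0'"
    and aK: "\<And>i. i < n \<Longrightarrow> a i \<in> K" and b: "b \<notin> K"
  shows "alg_indep (Suc n) K0' (a(n := b))"
  unfolding alg_indep_def
proof (intro allI impI)
  fix P :: "(nat \<Rightarrow>\<^sub>0 nat) \<Rightarrow>\<^sub>0 complex"
  assume P: "range (Poly_Mapping.lookup P) \<subseteq> K0'" "\<forall>m\<in>Poly_Mapping.keys P. Poly_Mapping.keys m \<subseteq> {..<Suc n}"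
    and ev: "poly_eval (\<lambda>c. c) (a(n := b)) P = 0"
  define rest where "rest m = m - Poly_Mapping.single n (Poly_Mapping.lookup m n)" for m :: "nat \<Rightarrow>\<^sub>0 nat"
  have lr: "Poly_Mapping.lookup (rest m) i = (if i = n then 0 else Poly_Mapping.lookup m i)" for m i
    by (simp add: rest_def lookup_minus lookup_single when_def)
  have split: "m = rest m + Poly_Mapping.single n (Poly_Mapping.lookup m n)" for m
    by (rule poly_mapping_eqI) (simp add: lookup_add lr lookup_single when_def)
  have kr: "n \<notin> Poly_Mapping.keys (rest m)" for m by (simp add: in_keys_iff lr)
  have krn: "Poly_Mapping.keys (rest m) \<subseteq> {..<n}" if "m \<in> Poly_Mapping.keys P" for m
  proof
    fix i assume i: "i \<in> Poly_Mapping.keys (rest m)"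
    then have "i \<noteq> n" using kr by metis
    moreover have "i \<in> Poly_Mapping.keys m" using i by (auto simp: in_keys_iff lr split: if_splits)
    then have "i < Suc n" using P(2) that by blast
    ultimately show "i \<in> {..<n}" by simp
  qed
  have mr: "mon_eval (rest m) (a(n := b)) = mon_eval (rest m) a" for m
    unfolding mon_eval_def by (rule prod.cong) (use kr[of m] in auto)
  have me: "mon_eval m (a(n := b)) = mon_eval (rest m) a * b ^ Poly_Mapping.lookup m n" for m
  proof -
    have "mon_eval m (a(n := b)) = mon_eval (rest m + Poly_Mapping.single n (Poly_Mapping.lookup m n)) (a(n := b))"
      by (rule arg_cong[where f = "\<lambda>m. mon_eval m (a(n := b))"]) (rule split)
    then show ?thesis by (simp only: mon_eval_add mon_eval_single mr fun_upd_same)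
  qed
  let ?c = "\<lambda>m. Poly_Mapping.lookup P m * mon_eval (rest m) a"
  define p where "p = (\<Sum>m\<in>Poly_Mapping.keys P. monom (?c m) (Poly_Mapping.lookup m n))"
  have cp: "coeff p j = (\<Sum>m\<in>Poly_Mapping.keys P. if Poly_Mapping.lookup m n = j then ?c m else 0)" for j
    by (simp add: p_def coeff_sum)
  have "poly p b = 0"
    using ev unfolding p_def poly_eval_def me by (simp add: poly_sum poly_monom mult.assoc)
  moreover have "set (coeffs p) \<subseteq> K"
  proof -
    have "coeff p j \<in> K" for j
      unfolding cp
    proof (rule acl_field_sum[OF K0])
      fix m assume m: "m \<in> Poly_Mapping.keys P"
      have "mon_eval (rest m) a \<in> K"
        unfolding mon_eval_def by (intro acl_field_prod[OF K0] acl_field_power[OF K0] aK) (use krn[OF m] in auto)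
      moreover have "Poly_Mapping.lookup P m \<in> K" using P(1) sub by auto
      ultimately show "(if Poly_Mapping.lookup m n = j then ?c m else 0) \<in> K"
        by (simp add: acl_field_mult[OF K0] acl_field_0[OF K0])
    qed
    then show ?thesis by (auto simp: coeffs_def)
  qed
  ultimately have "p = 0" using b K0 unfolding acl_field_def by blast
  define Q where "Q j = (\<Sum>m\<in>Poly_Mapping.keys P. if Poly_Mapping.lookup m n = j
    then Poly_Mapping.single (rest m) (Poly_Mapping.lookup P m) else 0)" for j
  have lQ: "Poly_Mapping.lookup (Q j) r = (\<Sum>m\<in>Poly_Mapping.keys P.
      if Poly_Mapping.lookup m n = j \<and> rest m = r then Poly_Mapping.lookup P m else 0)" for j r
    unfolding Q_def lookup_sum by (rule sum.cong) (auto simp: lookup_single when_def)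
  have Q0: "Q j = 0" for j
  proof -
    have "range (Poly_Mapping.lookup (Q j)) \<subseteq> K0'"
    proof
      fix x assume "x \<in> range (Poly_Mapping.lookup (Q j))"
      then obtain r where x: "x = Poly_Mapping.lookup (Q j) r" by blast
      have "Poly_Mapping.lookup P m \<in> K0'" for m using P(1) by auto
      then show "x \<in> K0'"
        unfolding x lQ by (intro acl_field_sum[OF K0']) (simp add: acl_field_0[OF K0'])
    qed
    moreover have "Poly_Mapping.keys r \<subseteq> {..<n}" if "r \<in> Poly_Mapping.keys (Q j)" for r
    proof -
      have "Poly_Mapping.lookup (Q j) r \<noteq> 0" using that by (simp add: in_keys_iff)
      have "\<exists>m\<in>Poly_Mapping.keys P. rest m = r"
      proof (rule ccontr)
        assume "\<not> ?thesis"
        then have "Poly_Mapping.lookup (Q j) r = 0" unfolding lQ by (intro sum.neutral) auto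
        then show False using \<open>Poly_Mapping.lookup (Q j) r \<noteq> 0\<close> by simp
      qed
      then show ?thesis using krn by blast
    qed
    moreover have "poly_eval (\<lambda>c. c) a (Q j) = 0"
    proof -
      have "poly_eval (\<lambda>c. c) a (Q j) = coeff p j"
        unfolding Q_def cp
        by (subst poly_eval_sum) (auto simp: poly_eval_single if_distrib intro!: sum.cong)
      then show ?thesis using \<open>p = 0\<close> by simp
    qed
    ultimately show ?thesis using ai unfolding alg_indep_def by blast
  qed
  show "P = 0"
  proof (rule poly_mapping_eqI)
    fix m0
    have "m = m0" if "Poly_Mapping.lookup m n = Poly_Mapping.lookup m0 n" "rest m = rest m0" for m
    proof -
      have "m = rest m + Poly_Mapping.single n (Poly_Mapping.lookup m n)" by (rule split)
      also have "\<dots> = rest m0 + Poly_Mapping.single n (Poly_Mapping.lookup m0 n)" by (simp only: that)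
      also have "\<dots> = m0" by (rule split [symmetric])
      finally show ?thesis .
    qed
    then have "(\<Sum>m\<in>Poly_Mapping.keys P. if Poly_Mapping.lookup m n = Poly_Mapping.lookup m0 n \<and> rest m = rest m0
        then Poly_Mapping.lookup P m else 0) = (\<Sum>m\<in>Poly_Mapping.keys P. if m = m0 then Poly_Mapping.lookup P m0 else 0)"
      by (intro sum.cong) auto
    also have "\<dots> = Poly_Mapping.lookup P m0" by (auto simp: in_keys_iff)
    finally show "Poly_Mapping.lookup P m0 = Poly_Mapping.lookup 0 m0"
      using lQ[of "Poly_Mapping.lookup m0 n" "rest m0"] Q0 by simp
  qed
qed

text \<open>Each new element is taken outside a countable algebraically closed field that contains
  the earlier ones, which exists since \<complex> is uncountable.\<close>

lemma alg_indep_exists: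
  assumes K: "acl_field K" "countable K"
  obtains a where "alg_indep n K a"
proof -
  have "\<exists>a L. acl_field L \<and> countable L \<and> K \<subseteq> L \<and> (\<forall>i<n. a i \<in> L) \<and> alg_indep n K a"
  proof (induction n)
    case 0
    have "alg_indep 0 K a" for a
      unfolding alg_indep_def
    proof (intro allI impI)
      fix P :: "(nat \<Rightarrow>\<^sub>0 nat) \<Rightarrow>\<^sub>0 complex"
      assume k: "\<forall>m\<in>Poly_Mapping.keys P. Poly_Mapping.keys m \<subseteq> {..<0}" and ev: "poly_eval (\<lambda>c. c) a P = 0"
      have s: "Poly_Mapping.keys P \<subseteq> {0}" using k by auto
      then have "Poly_Mapping.lookup P 0 = 0" using ev by (subst (asm) poly_eval_superset[of _ "{0}"]) auto
      then have "Poly_Mapping.lookup P k = 0" for k using s by (cases "k = 0") (auto simp: in_keys_iff)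
      then show "P = 0" by (intro poly_mapping_eqI) simp
    qed
    then show ?case using K by blast
  next
    case (Suc n)
    then obtain a L where L: "acl_field L" "countable L" "K \<subseteq> L" "\<forall>i<n. a i \<in> L" "alg_indep n K a" by blast
    have "uncountable (UNIV :: complex set)"
    proof
      assume "countable (UNIV :: complex set)"
      then have "countable (range complex_of_real)" by (rule countable_subset[rotated]) simp
      then have "countable (UNIV :: real set)" by (rule countable_image_inj_on) (simp add: inj_on_def)
      then show False using uncountable_UNIV_real by blast
    qed
    then obtain b where b: "b \<notin> L" using L(2) by (metis UNIV_I countable_subset subsetI)
    obtain L' where L': "acl_field L'" "countable L'" "insert b L \<subseteq> L'"
      using countable_acl_field_exists[of "insert b L"] L(2) by auto
    have "alg_indep (Suc n) K (a(n := b))"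
      by (rule alg_indep_Suc[OF L(1) L(5) L(3) K(1) _ b]) (use L(4) in auto)
    moreover have "\<forall>i<Suc n. (a(n := b)) i \<in> L'" using L(4) L'(3) by auto
    moreover have "K \<subseteq> L'" using L(3) L'(3) by blast
    ultimately show ?case using L'(1,2) by blast
  qed
  then show thesis using that by blast
qed

section \<open>Chains of reduced curves\<close>

lemma poly_rel_unique:
  assumes "part_hom S" "poly_rel S p q" "poly_rel S p q'" shows "q = q'"
  using assms by (auto simp: poly_rel_def poly_eq_iff intro: part_hom_unique)

lemma poly_rel_emon:
  assumes "part_hom S" "\<And>i. i < n \<Longrightarrow> poly_rel S (x i) (y i)"
  shows "poly_rel S (emon n e x) (emon n e y)"
  unfolding emon_def by (intro poly_rel_prod[OF assms(1)] poly_rel_power[OF assms(1)] assms(2)) simp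

lemma omega_scale:
  assumes "1 < n" "\<And>a. derivation (\<delta> a)" "c \<noteq> 0"
  shows "omega n \<delta> (\<lambda>i. c * v i) = omega n \<delta> v"
proof -
  have "Determinant.det (wmat n \<delta> (\<lambda>i. c * v i)) = c ^ n * Determinant.det (wmat n \<delta> v)"
    by (rule det_wmat_scale) (use assms in auto)
  then show ?thesis using assms(3) by (simp add: omega_def prod.distrib)
qed

lemma omega_cong: "(\<And>i. i < n \<Longrightarrow> v i = v' i) \<Longrightarrow> omega n \<delta> v = omega n \<delta> v'"
proof -
  assume v: "\<And>i. i < n \<Longrightarrow> v i = v' i"
  have "wmat n \<delta> v = wmat n \<delta> v'" unfolding wmat_def by (rule eq_matI) (auto simp: v)
  moreover have "(\<Prod>i<n. v i) = (\<Prod>i<n. v' i)" by (rule prod.cong) (auto simp: v)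
  ultimately show ?thesis by (simp add: omega_def)
qed

text \<open>Exponents and coefficients are separate arguments, so that a form over \<complex> and
  its reduction over another field differ in the coefficients only.\<close>

definition biform ::
    "nat \<Rightarrow> 'm set \<Rightarrow> ('m \<Rightarrow> nat \<Rightarrow> nat) \<Rightarrow> ('m \<Rightarrow> nat) \<Rightarrow> ('m \<Rightarrow> nat) \<Rightarrow> ('m \<Rightarrow> 'r) \<Rightarrow> (nat \<Rightarrow> 'r) \<Rightarrow> 'r \<Rightarrow> 'r \<Rightarrow> 'r::comm_ring_1"
  where "biform n I ex e0 e1 g x t0 t1 = (\<Sum>m\<in>I. g m * emon n (ex m) x * t0 ^ e0 m * t1 ^ e1 m)"

lemma biform_scale:
  assumes "\<And>m. m \<in> I \<Longrightarrow> (\<Sum>i<n. ex m i) = 2 * d" "\<And>m. m \<in> I \<Longrightarrow> e0 m + e1 m = 2"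
  shows "biform n I ex e0 e1 g (\<lambda>i. a * x i) (b * t0) (b * t1) = (a ^ d * b)\<^sup>2 * biform n I ex e0 e1 g x t0 t1"
proof -
  have "g m * emon n (ex m) (\<lambda>i. a * x i) * (b * t0) ^ e0 m * (b * t1) ^ e1 m =
      (a ^ d * b)\<^sup>2 * (g m * emon n (ex m) x * t0 ^ e0 m * t1 ^ e1 m)" if "m \<in> I" for m
  proof -
    have "emon n (ex m) (\<lambda>i. a * x i) = a ^ (2 * d) * emon n (ex m) x"
      using emon_power[of n "ex m" a "\<lambda>_. 1"] assms(1)[OF that] by (simp add: emon_mult)
    moreover have "b ^ e0 m * b ^ e1 m = b\<^sup>2" using assms(2)[OF that] by (simp flip: power_add)
    moreover have "a ^ (2 * d) = (a ^ d)\<^sup>2" by (simp add: power_mult [symmetric] mult.commute)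
    moreover have "g m * (a ^ (2 * d) * emon n (ex m) x) * (b * t0) ^ e0 m * (b * t1) ^ e1 m =
        a ^ (2 * d) * (b ^ e0 m * b ^ e1 m) * (g m * emon n (ex m) x * t0 ^ e0 m * t1 ^ e1 m)"
      by (simp only: power_mult_distrib mult_ac)
    ultimately show ?thesis by (simp only: power_mult_distrib)
  qed
  then show ?thesis by (simp add: biform_def sum_distrib_left)
qed

lemma pcompose_power: "pcompose (p ^ k) q = pcompose p q ^ k"
  by (induction k) (simp_all add: pcompose_mult pcompose_1)

text \<open>What is needed of a Gauss extension S of a place of K. By \<open>content\<close>, a
  finite family from R becomes integral with nonzero reduction after division by a single element of
  K, so all radii and normalising factors can be taken from K, where roots exist. The index pairs in
  \<open>content\<close> number the coefficients of a family of polynomials.\<close>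

locale val_model =
  fixes K R :: "complex set" and S :: "(complex \<times> 'e::field) set"
    and n d :: nat and \<delta> :: "nat \<Rightarrow> 'e \<Rightarrow> 'e"
    and I :: "'m set" and ex :: "'m \<Rightarrow> nat \<Rightarrow> nat" and e0 e1 :: "'m \<Rightarrow> nat" and g :: "'m \<Rightarrow> complex" and g' :: "'m \<Rightarrow> 'e"
  assumes S: "part_hom S" and K: "acl_field K"
    and R_mult: "\<And>c r. c \<in> K \<Longrightarrow> r \<in> R \<Longrightarrow> c * r \<in> R"
    and content: "\<And>(J :: (nat \<times> nat) set) r. finite J \<Longrightarrow> (\<forall>i\<in>J. r i \<in> R) \<Longrightarrow> (\<exists>i\<in>J. r i \<noteq> 0) \<Longrightarrow>
      \<exists>\<alpha> e. \<alpha> \<in> K \<and> \<alpha> \<noteq> 0 \<and> (\<forall>i\<in>J. (r i / \<alpha>, e i) \<in> S) \<and> (\<exists>i\<in>J. e i \<noteq> 0)"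
    and K_val: "\<And>c. c \<in> K \<Longrightarrow> (\<exists>b. (c, b) \<in> S) \<or> (inverse c, 0) \<in> S"
    and n3: "n \<ge> 3" and dn: "2 * d \<ge> n" and char2: "(1::'e) + 1 = 0"
    and \<delta>: "\<And>a. derivation (\<delta> a)"
    and I: "\<And>m. m \<in> I \<Longrightarrow> (\<Sum>i<n. ex m i) = 2 * d" "\<And>m. m \<in> I \<Longrightarrow> e0 m + e1 m = 2"
    and g: "\<And>m. m \<in> I \<Longrightarrow> (g m, g' m) \<in> S"
    and reduction: "\<And>x t0 t1. biform n I ex e0 e1 (\<lambda>m. [:g' m:]) x t0 t1 = conic_form n d x t0 t1"
begin

lemma poly_rel_biform:
  assumes "\<And>i. i < n \<Longrightarrow> poly_rel S (x i) (y i)" "poly_rel S t0 u0" "poly_rel S t1 u1"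
  shows "poly_rel S (biform n I ex e0 e1 (\<lambda>m. [:g m:]) x t0 t1) (conic_form n d y u0 u1)"
  unfolding reduction [symmetric] biform_def
  by (intro poly_rel_sum[OF S] poly_rel_mult[OF S] poly_rel_power[OF S] poly_rel_emon[OF S] poly_rel_const[OF S] assms g)

lemma content_polys:
  fixes k :: nat and p :: "nat \<Rightarrow> complex poly"
  assumes "\<And>i j. i < k \<Longrightarrow> coeff (p i) j \<in> R" and "\<exists>i<k. p i \<noteq> 0"
  shows "\<exists>\<alpha> q. \<alpha> \<in> K \<and> \<alpha> \<noteq> 0 \<and> (\<forall>i<k. poly_rel S (Polynomial.smult (1 / \<alpha>) (p i)) (q i)) \<and> (\<exists>i<k. q i \<noteq> 0)"
proof -
  define J where "J = (SIGMA i:{..<k}. {..degree (p i)})"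
  have "finite J" by (simp add: J_def)
  moreover have "\<forall>ij\<in>J. coeff (p (fst ij)) (snd ij) \<in> R" using assms(1) by (auto simp: J_def)
  moreover have "\<exists>ij\<in>J. coeff (p (fst ij)) (snd ij) \<noteq> 0"
  proof -
    obtain i where "i < k" "p i \<noteq> 0" using assms(2) by blast
    then show ?thesis by (intro bexI[of _ "(i, degree (p i))"]) (auto simp: J_def)
  qed
  ultimately obtain \<alpha> e where \<alpha>: "\<alpha> \<in> K" "\<alpha> \<noteq> 0"
    and e: "\<forall>ij\<in>J. (coeff (p (fst ij)) (snd ij) / \<alpha>, e ij) \<in> S" "\<exists>ij\<in>J. e ij \<noteq> 0"
    using content[of J "\<lambda>ij. coeff (p (fst ij)) (snd ij)"] by blast
  define q where "q i = (\<Sum>j\<le>degree (p i). monom (e (i, j)) j)" for i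
  have cq: "coeff (q i) j = (if j \<le> degree (p i) then e (i, j) else 0)" for i j
    by (simp add: q_def coeff_sum)
  have "poly_rel S (Polynomial.smult (1 / \<alpha>) (p i)) (q i)" if "i < k" for i
    unfolding poly_rel_def
  proof
    fix j
    show "(coeff (Polynomial.smult (1 / \<alpha>) (p i)) j, coeff (q i) j) \<in> S"
    proof (cases "j \<le> degree (p i)")
      case True
      then have "(i, j) \<in> J" using that by (simp add: J_def)
      then show ?thesis using bspec[OF e(1), of "(i, j)"] True by (simp add: cq)
    next
      case False
      then show ?thesis by (simp add: cq coeff_eq_0 part_hom_zero[OF S])
    qed
  qed
  moreover have "\<exists>i<k. q i \<noteq> 0"
  proof -
    obtain i j where ij: "(i, j) \<in> J" "e (i, j) \<noteq> 0" using e(2) by auto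
    then have "coeff (q i) j \<noteq> 0" by (simp add: cq J_def)
    then have "q i \<noteq> 0" by auto
    then show ?thesis using ij by (auto simp: J_def)
  qed
  ultimately show ?thesis using \<alpha> by blast
qed

text \<open>\<open>T0\<close> and \<open>T1\<close> are divided by their content, so that they do
  not both reduce to 0. The content \<gamma> of the accordingly scaled \<open>W'\<close> is then
  integral: otherwise the square of W' / \<gamma> would reduce to 0, although W' / \<gamma> does
  not. Hence the reduction of the right-hand side is a square.\<close>

lemma conic_curve_reduction:
  fixes X :: "nat \<Rightarrow> complex poly"
  assumes X: "\<And>i. i < n \<Longrightarrow> poly_rel S (X i) (x i)"
    and T: "\<And>j. coeff T0 j \<in> R" "\<And>j. coeff T1 j \<in> R" "T0 \<noteq> 0 \<or> T1 \<noteq> 0"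
    and W: "\<And>j. coeff W j \<in> R" "W\<^sup>2 = biform n I ex e0 e1 (\<lambda>m. [:g m:]) X T0 T1"
  obtains t0 t1 w where "conic_curve n d x t0 t1 w \<delta>"
proof -
  let ?p = "\<lambda>i::nat. if i = 0 then T0 else T1"
  have "\<exists>\<beta> q. \<beta> \<in> K \<and> \<beta> \<noteq> 0 \<and> (\<forall>i<2. poly_rel S (Polynomial.smult (1 / \<beta>) (?p i)) (q i)) \<and> (\<exists>i<2. q i \<noteq> 0)"
    by (rule content_polys) (use T in \<open>auto intro: exI[of _ 0] exI[of _ 1]\<close>)
  then obtain \<beta> q where \<beta>: "\<beta> \<in> K" "\<beta> \<noteq> 0" and q: "\<forall>i<2. poly_rel S (Polynomial.smult (1 / \<beta>) (?p i)) (q i)" "\<exists>i<2. q i \<noteq> 0"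
    by blast
  define t0 where "t0 = q 0"
  define t1 where "t1 = q 1"
  have t: "poly_rel S (Polynomial.smult (1 / \<beta>) T0) t0" "poly_rel S (Polynomial.smult (1 / \<beta>) T1) t1"
    using q(1)[rule_format, of 0] q(1)[rule_format, of 1] by (simp_all add: t0_def t1_def)
  have tnz: "t0 \<noteq> 0 \<or> t1 \<noteq> 0"
  proof -
    obtain i where "i < 2" "q i \<noteq> 0" using q(2) by blast
    then show ?thesis unfolding t0_def t1_def by (cases i) (auto simp: less_2_cases_iff)
  qed
  define Q where "Q = conic_form n d x t0 t1"
  define W' where "W' = Polynomial.smult (1 / \<beta>) W"
  have "biform n I ex e0 e1 (\<lambda>m. [:g m:]) (\<lambda>i. 1 * X i) ([:1 / \<beta>:] * T0) ([:1 / \<beta>:] * T1) =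
      (1 ^ d * [:1 / \<beta>:])\<^sup>2 * biform n I ex e0 e1 (\<lambda>m. [:g m:]) X T0 T1"
    by (rule biform_scale) (rule I, assumption)+
  then have "W'\<^sup>2 = biform n I ex e0 e1 (\<lambda>m. [:g m:]) X (Polynomial.smult (1 / \<beta>) T0) (Polynomial.smult (1 / \<beta>) T1)"
    unfolding W(2) [symmetric] by (simp add: W'_def power2_eq_square)
  then have W'Q: "poly_rel S (W'\<^sup>2) Q"
    unfolding Q_def using poly_rel_biform[OF X t] by simp
  have "\<exists>w. w\<^sup>2 = Q"
  proof (cases "W' = 0")
    case True
    have "poly_rel S 0 Q" using W'Q True by simp
    then have "Q = 0" using poly_rel_unique[OF S _ poly_rel_const[OF S part_hom_zero[OF S]]] by simp
    then show ?thesis by (intro exI[of _ 0]) simp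
  next
    case False
    have cW: "coeff W' j \<in> R" for j
      unfolding W'_def using R_mult[OF _ W(1)] acl_field_inverse[OF K \<beta>(1)] by (simp add: divide_inverse)
    have "\<exists>\<gamma> q. \<gamma> \<in> K \<and> \<gamma> \<noteq> 0 \<and> (\<forall>i<1. poly_rel S (Polynomial.smult (1 / \<gamma>) W') (q i)) \<and> (\<exists>i<1::nat. q i \<noteq> 0)"
      by (rule content_polys) (use cW False in auto)
    then obtain \<gamma> q where \<gamma>: "\<gamma> \<in> K" "\<gamma> \<noteq> 0" and q: "poly_rel S (Polynomial.smult (1 / \<gamma>) W') (q (0::nat))" "q (0::nat) \<noteq> 0"
      by auto
    define v where "v = q 0"
    have v: "poly_rel S (Polynomial.smult (1 / \<gamma>) W') v" "v \<noteq> 0" using q by (simp_all add: v_def)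
    show ?thesis
    proof (cases "\<exists>b. (\<gamma>, b) \<in> S")
      case True
      then obtain b where b: "(\<gamma>, b) \<in> S" by blast
      have "poly_rel S (Polynomial.smult \<gamma> (Polynomial.smult (1 / \<gamma>) W')) (Polynomial.smult b v)"
        by (rule poly_rel_smult[OF S b v(1)])
      then have "poly_rel S W' (Polynomial.smult b v)" using \<gamma>(2) by simp
      then have "poly_rel S (W'\<^sup>2) ((Polynomial.smult b v)\<^sup>2)" by (rule poly_rel_power[OF S])
      then have "(Polynomial.smult b v)\<^sup>2 = Q" by (rule poly_rel_unique[OF S _ W'Q])
      then show ?thesis by blast
    next
      case nb: False
      then have iv: "(inverse \<gamma>, 0) \<in> S" using K_val[OF \<gamma>(1)] by blast
      have "poly_rel S (Polynomial.smult ((inverse \<gamma>)\<^sup>2) (W'\<^sup>2)) (Polynomial.smult (0\<^sup>2) Q)"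
        by (rule poly_rel_smult[OF S part_hom_power[OF S iv] W'Q])
      moreover have "Polynomial.smult ((inverse \<gamma>)\<^sup>2) (W'\<^sup>2) = (Polynomial.smult (1 / \<gamma>) W')\<^sup>2"
        by (simp add: smult_power divide_inverse)
      ultimately have "v\<^sup>2 = Polynomial.smult (0\<^sup>2) Q"
        using poly_rel_unique[OF S poly_rel_power[OF S v(1), of 2]] by simp
      then have "v = 0" by simp
      then show ?thesis using v(2) by simp
    qed
  qed
  then obtain w where w: "w\<^sup>2 = Q" by blast
  have "conic_curve n d x t0 t1 w \<delta>"
    by unfold_locales (use char2 n3 dn tnz w \<delta> in \<open>auto simp: Q_def conic_form_def\<close>)
  then show thesis by (rule that)
qed

text \<open>For nonzero b, these are the relations |a| \<le> |b| and |a| < |b| for the absolute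
  value of the place.\<close>

definition le :: "complex \<Rightarrow> complex \<Rightarrow> bool" where "le a b \<longleftrightarrow> (\<exists>c. (a / b, c) \<in> S)"
definition lt :: "complex \<Rightarrow> complex \<Rightarrow> bool" where "lt a b \<longleftrightarrow> (a / b, 0) \<in> S"

lemma lt_imp_le: "lt a b \<Longrightarrow> le a b"
  unfolding le_def lt_def by blast

lemma le_total: "a \<in> K \<Longrightarrow> b \<in> K \<Longrightarrow> le a b \<or> lt b a"
  using K_val[of "a / b"] acl_field_divide[OF K] by (auto simp: le_def lt_def)

lemma le_refl: "a \<noteq> 0 \<Longrightarrow> le a a"
  unfolding le_def using part_hom_one[OF S] by auto

lemma le_trans: "le a b \<Longrightarrow> le b c \<Longrightarrow> b \<noteq> 0 \<Longrightarrow> le a c"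
  unfolding le_def using part_hom_mult[OF S, of "a / b" _ "b / c"] by fastforce

lemma min_exists:
  assumes "finite A" "A \<noteq> {}" "A \<subseteq> K" "0 \<notin> A"
  shows "\<exists>a\<in>A. \<forall>b\<in>A. le a b"
  using assms
proof (induction A rule: finite_ne_induct)
  case (singleton x)
  then show ?case using le_refl by simp
next
  case (insert x A)
  then obtain a where a: "a \<in> A" "\<forall>b\<in>A. le a b" by auto
  have nz: "a \<noteq> 0" "x \<noteq> 0" and inK: "a \<in> K" "x \<in> K" using insert a by auto
  show ?case
  proof (cases "le a x")
    case True
    then show ?thesis using a by blast
  next
    case False
    then have "le x a" using le_total[OF inK] lt_imp_le by blast
    then have "\<forall>b\<in>insert x A. le x b" using a(2) le_trans[OF _ _ nz(1)] le_refl[OF nz(2)] by blast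
    then show ?thesis by blast
  qed
qed

lemma residue_exists: "a \<in> K \<Longrightarrow> a \<noteq> 0 \<Longrightarrow> (a, b) \<in> S \<Longrightarrow> b \<noteq> 0 \<Longrightarrow> \<exists>c. (inverse a, c) \<in> S"
  using K_val[of "inverse a"] acl_field_inverse[OF K, of a] part_hom_unique[OF S, of a b 0] by auto

text \<open>The points are joined by a chain of curves, one for each slope of the Newton polygon of \<open>X\<close>.\<close>

theorem omega_along_curve:
  fixes X :: "nat \<Rightarrow> complex poly"
  assumes X: "\<And>i j. i < n \<Longrightarrow> coeff (X i) j \<in> R"
    and T: "\<And>j. coeff T0 j \<in> R" "\<And>j. coeff T1 j \<in> R" "T0 \<noteq> 0 \<or> T1 \<noteq> 0"
    and W: "\<And>j. coeff W j \<in> R" "W\<^sup>2 = biform n I ex e0 e1 (\<lambda>m. [:g m:]) X T0 T1"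
    and v0: "\<alpha>0 \<in> K" "\<alpha>0 \<noteq> 0" "\<And>i. i < n \<Longrightarrow> (coeff (X i) 0 / \<alpha>0, v0 i) \<in> S" "\<exists>i<n. v0 i \<noteq> 0"
    and N: "\<And>i. i < n \<Longrightarrow> degree (X i) \<le> N"
    and vN: "\<alpha>N \<in> K" "\<alpha>N \<noteq> 0" "\<And>i. i < n \<Longrightarrow> (coeff (X i) N / \<alpha>N, vN i) \<in> S" "\<exists>i<n. vN i \<noteq> 0"
  shows "omega n \<delta> v0 = omega n \<delta> vN"
proof -
  define J where "J = {j. j \<le> N \<and> (\<exists>i<n. coeff (X i) j \<noteq> 0)}"
  have finJ: "finite J" by (simp add: J_def)
  have notJ: "coeff (X i) j = 0" if "j \<notin> J" "i < n" for i j
    using that N by (auto simp: J_def coeff_eq_0 not_le) (metis coeff_eq_0 le_less_trans not_le)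
  have nzJ: "j \<in> J" if jN: "j \<le> N" and ju: "\<And>i. i < n \<Longrightarrow> (coeff (X i) j / \<alpha>, v i) \<in> S"
    and jn: "\<exists>i<n. v i \<noteq> 0" for j \<alpha> v
  proof -
    obtain i where i: "i < n" "v i \<noteq> 0" using jn by blast
    have "coeff (X i) j \<noteq> 0"
    proof
      assume "coeff (X i) j = 0"
      then have "(0, v i) \<in> S" using ju[OF i(1)] by simp
      then show False using i(2) part_hom_zeroD[OF S] by blast
    qed
    then show ?thesis using jN i(1) by (auto simp: J_def)
  qed
  have J0: "0 \<in> J" by (rule nzJ[OF _ v0(3,4)]) simp
  have JN: "N \<in> J" by (rule nzJ[OF _ vN(3,4)]) simp
  \<comment> \<open>\<open>\<alpha> j\<close> is the content of the coefficient vector of degree j,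
    whose size is the height of the Newton polygon data at j, and \<open>v j\<close> is its
    reduction, a point of the reduced projective space.\<close>
  have "\<exists>\<alpha> v. j \<in> J \<longrightarrow> \<alpha> \<in> K \<and> \<alpha> \<noteq> 0 \<and> (\<forall>i<n. (coeff (X i) j / \<alpha>, v i) \<in> S) \<and> (\<exists>i<n. v i \<noteq> 0)" for j
  proof (cases "j \<in> J")
    case True
    have "\<exists>\<alpha> e. \<alpha> \<in> K \<and> \<alpha> \<noteq> 0 \<and> (\<forall>i\<in>{..<n} \<times> {0::nat}. (coeff (X (fst i)) j / \<alpha>, e i) \<in> S) \<and> (\<exists>i\<in>{..<n} \<times> {0::nat}. e i \<noteq> 0)"
      by (rule content[where r = "\<lambda>i. coeff (X (fst i)) j"]) (use True X in \<open>auto simp: J_def\<close>)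
    then obtain \<alpha> e where "\<alpha> \<in> K" "\<alpha> \<noteq> 0" "\<forall>i\<in>{..<n} \<times> {0::nat}. (coeff (X (fst i)) j / \<alpha>, e i) \<in> S"
      "\<exists>i\<in>{..<n} \<times> {0::nat}. e i \<noteq> 0" by blast
    then show ?thesis by (intro exI[of _ \<alpha>] exI[of _ "\<lambda>i. e (i, 0)"]) auto
  qed auto
  then obtain \<alpha> v where \<alpha>v: "\<And>j. j \<in> J \<Longrightarrow> \<alpha> j \<in> K \<and> \<alpha> j \<noteq> 0 \<and> (\<forall>i<n. (coeff (X i) j / \<alpha> j, v j i) \<in> S) \<and> (\<exists>i<n. v j i \<noteq> 0)"
    by metis
  have \<alpha>: "\<alpha> j \<in> K" "\<alpha> j \<noteq> 0" if "j \<in> J" for j using \<alpha>v[OF that] by auto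
  have v: "(coeff (X i) j / \<alpha> j, v j i) \<in> S" if "j \<in> J" "i < n" for i j using \<alpha>v[OF that(1)] that(2) by blast
  have vnz: "\<exists>i<n. v j i \<noteq> 0" if "j \<in> J" for j using \<alpha>v[OF that] by blast

  \<comment> \<open>j is a vertex of the Newton polygon: for a parameter of size |s| the term of
    degree j strictly dominates all later terms and is not smaller than the earlier ones. The index
    0 is the starting vertex and needs no witness s.\<close>
  define Inv where "Inv j \<longleftrightarrow> j = 0 \<or> (\<exists>s\<in>K. s \<noteq> 0 \<and>
    (\<forall>l\<in>J. l < j \<longrightarrow> le (\<alpha> l * s ^ l) (\<alpha> j * s ^ j)) \<and> (\<forall>l\<in>J. l > j \<longrightarrow> lt (\<alpha> l * s ^ l) (\<alpha> j * s ^ j)))" for j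
  have step: "\<exists>j'\<in>J. j < j' \<and> Inv j' \<and> omega n \<delta> (v j) = omega n \<delta> (v j')"
    if j: "j \<in> J" "j < N" "Inv j" for j
  proof -
    \<comment> \<open>A parameter z for which the terms of degrees j and l have equal size. The
      smallest of these for l > j gives the next slope, and it lies in K because K is algebraically
      closed.\<close>
    have "\<exists>z. z ^ (l - j) = \<alpha> j / \<alpha> l" if "l \<in> J" "j < l" for l
    proof -
      have "degree (monom 1 (l - j) - [:\<alpha> j / \<alpha> l:]) > 0"
      proof -
        have "coeff (monom 1 (l - j) - [:\<alpha> j / \<alpha> l:]) (l - j) \<noteq> 0"
          using that(2) by (simp add: coeff_pCons split: nat.split)
        then have "l - j \<le> degree (monom 1 (l - j) - [:\<alpha> j / \<alpha> l:])" by (rule le_degree)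
        then show ?thesis using that(2) by simp
      qed
      then obtain z where "poly (monom 1 (l - j) - [:\<alpha> j / \<alpha> l:]) z = 0"
        using alg_closed_imp_poly_has_root by blast
      then show ?thesis by (intro exI[of _ z]) (simp add: poly_monom)
    qed
    then obtain z where z: "\<And>l. l \<in> J \<Longrightarrow> j < l \<Longrightarrow> z l ^ (l - j) = \<alpha> j / \<alpha> l" by metis
    have zK: "z l \<in> K" and z0: "z l \<noteq> 0" if "l \<in> J" "j < l" for l
    proof -
      show "z l \<in> K"
        by (rule acl_field_root[OF K _ _ z[OF that]])
           (use that \<alpha>[OF that(1)] \<alpha>[OF j(1)] in \<open>auto intro: acl_field_divide[OF K]\<close>)
      show "z l \<noteq> 0"
      proof
        assume "z l = 0"
        then have "\<alpha> j / \<alpha> l = 0" using z[OF that] that(2) by (simp add: power_0_left)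
        then show False using \<alpha>[OF that(1)] \<alpha>[OF j(1)] by simp
      qed
    qed
    define A where "A = z ` {l \<in> J. j < l}"
    have "finite A" "A \<noteq> {}" "A \<subseteq> K" "0 \<notin> A"
      using finJ JN j(2) zK z0 by (auto simp: A_def)
    then obtain s where s: "s \<in> A" "\<forall>b\<in>A. le s b" using min_exists by blast
    obtain l1 where l1: "l1 \<in> J" "j < l1" "s = z l1" using s(1) by (auto simp: A_def)
    have sK: "s \<in> K" "s \<noteq> 0" using zK[OF l1(1,2)] z0[OF l1(1,2)] l1(3) by simp_all
    define r where "r l = \<alpha> l * s ^ l / (\<alpha> j * s ^ j)" for l
    have rK: "r l \<in> K" "r l \<noteq> 0" if "l \<in> J" for l
      unfolding r_def using \<alpha>[OF that] \<alpha>[OF j(1)] sK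
      by (auto intro!: acl_field_divide[OF K] acl_field_mult[OF K] acl_field_power[OF K])
    have r_above: "r l = (s / z l) ^ (l - j)" if "l \<in> J" "j < l" for l
    proof -
      have "s ^ l = s ^ j * s ^ (l - j)" using that(2) by (simp flip: power_add)
      then have "r l = s ^ (l - j) * (\<alpha> l / \<alpha> j)" unfolding r_def using sK(2) by simp
      also have "\<alpha> l / \<alpha> j = 1 / z l ^ (l - j)" unfolding z[OF that] by simp
      finally show ?thesis by (simp add: power_divide)
    qed
    have rj: "r j = 1" unfolding r_def using \<alpha>[OF j(1)] sK by simp
    have rl1: "r l1 = 1" unfolding r_above[OF l1(1,2)] l1(3) [symmetric] using sK by simp
    \<comment> \<open>At sp the term l1 is strictly smaller than the term j, and at s they have
      equal size. So |sp| < |s|, and terms of degree below j, which are at most as large as the term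
      j at sp, become negligible at s.\<close>
    have below: "(r l, 0) \<in> S" if l: "l \<in> J" "l < j" for l
    proof -
      have "j \<noteq> 0" using l by simp
      then obtain sp where sp: "sp \<in> K" "sp \<noteq> 0"
        "\<forall>l\<in>J. l < j \<longrightarrow> le (\<alpha> l * sp ^ l) (\<alpha> j * sp ^ j)" "\<forall>l\<in>J. l > j \<longrightarrow> lt (\<alpha> l * sp ^ l) (\<alpha> j * sp ^ j)"
        using j(3) unfolding Inv_def by blast
      have "\<alpha> l1 * sp ^ l1 / (\<alpha> j * sp ^ j) = (sp / s) ^ (l1 - j)"
      proof -
        have "sp ^ l1 = sp ^ j * sp ^ (l1 - j)" using l1(2) by (simp flip: power_add)
        then have "\<alpha> l1 * sp ^ l1 / (\<alpha> j * sp ^ j) = sp ^ (l1 - j) * (\<alpha> l1 / \<alpha> j)" using sp(2) by simp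
        also have "\<alpha> l1 / \<alpha> j = 1 / s ^ (l1 - j)" unfolding l1(3) z[OF l1(1,2)] by simp
        finally show ?thesis by (simp add: power_divide)
      qed
      then have p0: "((sp / s) ^ (l1 - j), 0) \<in> S" using sp(4) l1 unfolding lt_def by auto
      have pos: "0 < l1 - j" using l1 by simp
      have q0: "(sp / s, 0) \<in> S"
      proof (cases "\<exists>b. (sp / s, b) \<in> S")
        case True
        then obtain b where b: "(sp / s, b) \<in> S" by blast
        have "b ^ (l1 - j) = 0" by (rule part_hom_unique[OF S part_hom_power[OF S b] p0])
        then show ?thesis using b by simp
      next
        case False
        then have "(inverse (sp / s), 0) \<in> S" using K_val[of "sp / s"] acl_field_divide[OF K sp(1) sK(1)] by blast
        then have "((sp / s) ^ (l1 - j) * inverse (sp / s) ^ (l1 - j), 0 * 0 ^ (l1 - j)) \<in> S"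
          by (intro part_hom_mult[OF S p0] part_hom_power[OF S])
        then have "(1, 0) \<in> S" using sp(2) sK(2) by (simp add: power_divide)
        then have "(1::'e) = 0" using part_hom_unique[OF S part_hom_one[OF S]] by blast
        then show ?thesis by simp
      qed
      obtain c where c: "(\<alpha> l * sp ^ l / (\<alpha> j * sp ^ j), c) \<in> S" using sp(3) l unfolding le_def by blast
      have "(\<alpha> l * sp ^ l / (\<alpha> j * sp ^ j) * (sp / s) ^ (j - l), c * 0 ^ (j - l)) \<in> S"
        by (intro part_hom_mult[OF S c] part_hom_power[OF S q0])
      moreover have "\<alpha> l * sp ^ l / (\<alpha> j * sp ^ j) * (sp / s) ^ (j - l) = r l"
      proof -
        have "sp ^ j = sp ^ l * sp ^ (j - l)" "s ^ j = s ^ l * s ^ (j - l)" using l(2) by (simp_all flip: power_add)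
        then show ?thesis unfolding r_def using sp(2) sK(2) \<alpha>[OF j(1)] by (simp add: power_divide)
      qed
      ultimately have "(r l, c * 0 ^ (j - l)) \<in> S" by (simp only:)
      then show ?thesis using l(2) by (simp add: power_0_left)
    qed
    have "\<exists>c. (r l, c) \<in> S" if l: "l \<in> J" for l
    proof -
      consider "l < j" | "l = j" | "j < l" by linarith
      then show ?thesis
      proof cases
        case 1
        then show ?thesis using below[OF l] by blast
      next
        case 2
        then show ?thesis using rj part_hom_one[OF S] by auto
      next
        case 3
        have "le s (z l)" using s(2) l 3 by (auto simp: A_def)
        then obtain c where "(s / z l, c) \<in> S" unfolding le_def by blast
        then show ?thesis unfolding r_above[OF l 3] using part_hom_power[OF S] by blast
      qed
    qed
    then obtain \<rho> where \<rho>: "\<And>l. l \<in> J \<Longrightarrow> (r l, \<rho> l) \<in> S" by metis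
    have \<rho>j: "\<rho> j = 1" using part_hom_unique[OF S \<rho>[OF j(1)]] part_hom_one[OF S] rj by metis
    have \<rho>l1: "\<rho> l1 = 1" using part_hom_unique[OF S \<rho>[OF l1(1)]] part_hom_one[OF S] rl1 by metis
    have \<rho>below: "\<rho> l = 0" if "l \<in> J" "l < j" for l
      by (rule part_hom_unique[OF S \<rho>[OF that(1)] below[OF that]])
    \<comment> \<open>The last term that is still of maximal size for the parameter s, which is the
      next vertex.\<close>
    define j' where "j' = Max {l \<in> J. \<rho> l \<noteq> 0}"
    have finL: "finite {l \<in> J. \<rho> l \<noteq> 0}" using finJ by simp
    have "l1 \<in> {l \<in> J. \<rho> l \<noteq> 0}" using l1 \<rho>l1 by simp
    then have j': "j' \<in> J" "\<rho> j' \<noteq> 0" "l1 \<le> j'"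
      using Max_in[OF finL] Max_ge[OF finL] unfolding j'_def by auto
    have \<rho>above: "\<rho> l = 0" if "l \<in> J" "j' < l" for l
      using Max_ge[OF finL, of l] that unfolding j'_def by fastforce
    have jj': "j < j'" using l1 j' by simp

    define x where "x i = (\<Sum>l\<in>J. monom (\<rho> l * v l i) l)" for i
    have cx: "coeff (x i) l = (if l \<in> J then \<rho> l * v l i else 0)" for i l
      unfolding x_def coeff_sum using finJ by (simp add: sum.delta)
    \<comment> \<open>The curve with its parameter rescaled by s, divided by the size of its term of
      degree j. Its reduction \<open>x\<close> starts with the term \<open>v j\<close> and ends with
      a nonzero multiple of \<open>v j'\<close>.\<close>
    define X' where "X' i = Polynomial.smult (1 / (\<alpha> j * s ^ j)) (pcompose (X i) [:0, s:])" for i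
    have cX': "coeff (X' i) l = coeff (X i) l * s ^ l / (\<alpha> j * s ^ j)" for i l
      by (simp add: X'_def coeff_pcompose_linear)
    have relX: "poly_rel S (X' i) (x i)" if "i < n" for i
      unfolding poly_rel_def
    proof
      fix l
      show "(coeff (X' i) l, coeff (x i) l) \<in> S"
      proof (cases "l \<in> J")
        case True
        have "coeff (X' i) l = r l * (coeff (X i) l / \<alpha> l)"
          unfolding cX' r_def using \<alpha>[OF True] by simp
        then show ?thesis using part_hom_mult[OF S \<rho>[OF True] v[OF True that]] True by (simp add: cx)
      next
        case False
        then show ?thesis using notJ[OF False that] by (simp add: cX' cx part_hom_zero[OF S])
      qed
    qed
    define T0' where "T0' = pcompose T0 [:0, s:]"
    define T1' where "T1' = pcompose T1 [:0, s:]"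
    define c where "c = 1 / (\<alpha> j * s ^ j)"
    define W' where "W' = Polynomial.smult (c ^ d) (pcompose W [:0, s:])"
    have cK: "c \<in> K" unfolding c_def
      by (intro acl_field_divide[OF K] acl_field_mult[OF K] acl_field_power[OF K] acl_field_1[OF K] \<alpha> sK j)
    have coR: "coeff (pcompose p [:0, s:]) l \<in> R" if "\<And>l. coeff p l \<in> R" for p l
      using R_mult[OF acl_field_power[OF K sK(1)] that] by (simp add: coeff_pcompose_linear mult.commute)
    have eqW: "W'\<^sup>2 = biform n I ex e0 e1 (\<lambda>m. [:g m:]) X' T0' T1'"
    proof -
      have pc: "pcompose (biform n I ex e0 e1 (\<lambda>m. [:g m:]) X T0 T1) [:0, s:] =
          biform n I ex e0 e1 (\<lambda>m. [:g m:]) (\<lambda>i. pcompose (X i) [:0, s:]) T0' T1'"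
        by (simp add: biform_def emon_def pcompose_sum pcompose_smult pcompose_mult pcompose_prod pcompose_power T0'_def T1'_def)
      have "(pcompose W [:0, s:])\<^sup>2 = pcompose (W\<^sup>2) [:0, s:]" by (simp add: power2_eq_square pcompose_mult)
      then have pw: "(pcompose W [:0, s:])\<^sup>2 = biform n I ex e0 e1 (\<lambda>m. [:g m:]) (\<lambda>i. pcompose (X i) [:0, s:]) T0' T1'"
        unfolding W(2) pc .
      have "biform n I ex e0 e1 (\<lambda>m. [:g m:]) X' T0' T1' =
          ([:c:] ^ d * 1)\<^sup>2 * biform n I ex e0 e1 (\<lambda>m. [:g m:]) (\<lambda>i. pcompose (X i) [:0, s:]) T0' T1'"
      proof -
        have "biform n I ex e0 e1 (\<lambda>m. [:g m:]) (\<lambda>i. [:c:] * pcompose (X i) [:0, s:]) (1 * T0') (1 * T1') =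
            ([:c:] ^ d * 1)\<^sup>2 * biform n I ex e0 e1 (\<lambda>m. [:g m:]) (\<lambda>i. pcompose (X i) [:0, s:]) T0' T1'"
          by (rule biform_scale) (rule I, assumption)+
        moreover have "X' = (\<lambda>i. [:c:] * pcompose (X i) [:0, s:])" by (rule ext) (simp add: X'_def c_def)
        ultimately show ?thesis by simp
      qed
      then show ?thesis unfolding pw [symmetric] W'_def
        by (simp add: smult_power poly_const_pow power2_eq_square)
    qed
    have Tnz: "T0' \<noteq> 0 \<or> T1' \<noteq> 0"
      using T(3) sK(2) by (auto simp: T0'_def T1'_def pcompose_eq_0_iff)
    obtain t0 t1 w where "conic_curve n d x t0 t1 w \<delta>"
    proof (rule conic_curve_reduction[OF relX _ _ Tnz _ eqW])
      show "coeff T0' l \<in> R" "coeff T1' l \<in> R" for l unfolding T0'_def T1'_def by (intro coR T)+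
      show "coeff W' l \<in> R" for l
        unfolding W'_def using R_mult[OF acl_field_power[OF K cK] coR[OF W(1)]] by simp
    qed
    then interpret conic_curve n d x t0 t1 w \<delta> .
    have "omega n \<delta> (\<lambda>i. coeff (x i) j) = omega n \<delta> (\<lambda>i. coeff (x i) j')"
    proof (rule omega_low_eq_top)
      show "coeff (x i) l = 0" if "i < n" "l < j" for i l using \<rho>below that by (simp add: cx)
      show "\<exists>i<n. coeff (x i) j \<noteq> 0" using vnz[OF j(1)] j(1) \<rho>j by (simp add: cx)
      show "\<exists>i<n. coeff (x i) j' \<noteq> 0" using vnz[OF j'(1)] j' by (simp add: cx)
      show "degree (x i) \<le> j'" if "i < n" for i
        by (rule degree_le) (use \<rho>above in \<open>auto simp: cx\<close>)
    qed
    moreover have "omega n \<delta> (\<lambda>i. coeff (x i) j) = omega n \<delta> (v j)"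
      by (rule omega_cong) (simp add: cx j(1) \<rho>j)
    moreover have "omega n \<delta> (\<lambda>i. coeff (x i) j') = omega n \<delta> (\<lambda>i. \<rho> j' * v j' i)"
      by (rule omega_cong) (simp add: cx j'(1))
    moreover have "omega n \<delta> (\<lambda>i. \<rho> j' * v j' i) = omega n \<delta> (v j')"
      by (rule omega_scale) (use n3 \<delta> j' in auto)
    ultimately have om: "omega n \<delta> (v j) = omega n \<delta> (v j')" by simp
    obtain c' where c': "(inverse (r j'), c') \<in> S"
      using residue_exists[OF rK[OF j'(1)] \<rho>[OF j'(1)] j'(2)] by blast
    have ratio: "\<alpha> l * s ^ l / (\<alpha> j' * s ^ j') = r l * inverse (r j')" if "l \<in> J" for l
      unfolding r_def using \<alpha>[OF j(1)] \<alpha>[OF j'(1)] sK by (simp add: field_simps)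
    have "Inv j'"
      unfolding Inv_def
    proof (intro disjI2 bexI[of _ s] conjI ballI impI)
      fix l assume l: "l \<in> J"
      have p: "(r l * inverse (r j'), \<rho> l * c') \<in> S" by (rule part_hom_mult[OF S \<rho>[OF l] c'])
      show "le (\<alpha> l * s ^ l) (\<alpha> j' * s ^ j')" unfolding le_def ratio[OF l] using p by blast
      assume "l > j'"
      then show "lt (\<alpha> l * s ^ l) (\<alpha> j' * s ^ j')" unfolding lt_def ratio[OF l] using p \<rho>above[OF l] by simp
    qed (use sK in auto)
    then show ?thesis using j' jj' om by blast
  qed
  have "omega n \<delta> (v j) = omega n \<delta> (v N)" if "j \<in> J" "Inv j" for j
    using that
  proof (induction "N - j" arbitrary: j rule: less_induct)
    case less
    show ?case
    proof (cases "j = N")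
      case False
      then have "j < N" using less.prems(1) by (simp add: J_def)
      then obtain j' where "j' \<in> J" "j < j'" "Inv j'" "omega n \<delta> (v j) = omega n \<delta> (v j')"
        using step less.prems by blast
      moreover have "N - j' < N - j" using \<open>j < N\<close> \<open>j < j'\<close> by simp
      ultimately show ?thesis using less.hyps by simp
    qed simp
  qed
  then have 0: "omega n \<delta> (v 0) = omega n \<delta> (v N)" using J0 by (simp add: Inv_def)
  \<comment> \<open>Another normalising factor changes the reduced vector by a nonzero scalar, to
    which \<open>omega\<close> is insensitive.\<close>
  have same: "omega n \<delta> u = omega n \<delta> (v j)"
    if j: "j \<in> J" and \<beta>: "\<beta> \<in> K" "\<beta> \<noteq> 0" and u: "\<And>i. i < n \<Longrightarrow> (coeff (X i) j / \<beta>, u i) \<in> S" "\<exists>i<n. u i \<noteq> 0" for j \<beta> u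
  proof -
    have "\<exists>c. c \<noteq> 0 \<and> (\<forall>i<n. u i = c * v j i)"
    proof -
      have q: "\<alpha> j / \<beta> \<in> K" using \<alpha>[OF j] \<beta> by (intro acl_field_divide[OF K])
      have e: "coeff (X i) j / \<beta> = \<alpha> j / \<beta> * (coeff (X i) j / \<alpha> j)" for i using \<alpha>[OF j] by simp
      have "\<exists>c. (\<alpha> j / \<beta>, c) \<in> S"
      proof (rule ccontr)
        assume "\<not> ?thesis"
        then have "(inverse (\<alpha> j / \<beta>), 0) \<in> S" using K_val[OF q] by blast
        then have "(inverse (\<alpha> j / \<beta>) * (coeff (X i) j / \<beta>), 0 * u i) \<in> S" if "i < n" for i
          by (rule part_hom_mult[OF S _ u(1)[OF that]])
        then have "(coeff (X i) j / \<alpha> j, 0) \<in> S" if "i < n" for i using that \<alpha>[OF j] \<beta> by simp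
        then have "v j i = 0" if "i < n" for i using part_hom_unique[OF S v[OF j that]] that by blast
        then show False using vnz[OF j] by blast
      qed
      then obtain c where c: "(\<alpha> j / \<beta>, c) \<in> S" by blast
      have uc: "u i = c * v j i" if "i < n" for i
        using part_hom_unique[OF S u(1)[OF that]] part_hom_mult[OF S c v[OF j that]] e by metis
      moreover have "c \<noteq> 0" using uc u(2) by auto
      ultimately show ?thesis by blast
    qed
    then obtain c where c: "c \<noteq> 0" "\<forall>i<n. u i = c * v j i" by blast
    have "omega n \<delta> u = omega n \<delta> (\<lambda>i. c * v j i)" by (rule omega_cong) (use c in auto)
    also have "\<dots> = omega n \<delta> (v j)" by (rule omega_scale) (use n3 \<delta> c in auto)
    finally show ?thesis .
  qed
  show ?thesis
    using same[OF J0 v0] same[OF JN vN] 0 by simp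
qed

end

section \<open>The Gauss extension of a place\<close>

text \<open>For Q the graph of a place, B is a reduction of A. For Q the diagonal of K, taken with A
  = B, the relation only says that A has coefficients in K.\<close>

definition coefrel :: "nat \<Rightarrow> ('a::zero \<times> 'b::zero) set \<Rightarrow> 'a cpoly \<Rightarrow> 'b cpoly \<Rightarrow> bool"
  where "coefrel n Q A B \<longleftrightarrow> (\<forall>m. (Poly_Mapping.lookup A m, Poly_Mapping.lookup B m) \<in> Q) \<and>
    (\<forall>m\<in>Poly_Mapping.keys A. Poly_Mapping.keys m \<subseteq> {..<n})"

lemma lookup_mult_superset:
  assumes "finite S" "Poly_Mapping.keys A \<subseteq> S" "finite T" "Poly_Mapping.keys B \<subseteq> T"
  shows "Poly_Mapping.lookup (A * B :: 'v::monoid_add \<Rightarrow>\<^sub>0 'b::semiring_0) m =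
    (\<Sum>i\<in>S. \<Sum>j\<in>T. if i + j = m then Poly_Mapping.lookup A i * Poly_Mapping.lookup B j else 0)"
proof -
  let ?s = "\<lambda>P m. Poly_Mapping.single m (Poly_Mapping.lookup P m)"
  define SA where "SA = (\<Sum>m\<in>S. ?s A m)"
  define SB where "SB = (\<Sum>m\<in>T. ?s B m)"
  have sum: "P = (\<Sum>m\<in>U. ?s P m)" if "finite U" "Poly_Mapping.keys P \<subseteq> U" for P :: "'v \<Rightarrow>\<^sub>0 'b" and U
  proof (rule poly_mapping_eqI)
    fix k
    have "Poly_Mapping.lookup (\<Sum>m\<in>U. ?s P m) k = (\<Sum>m\<in>U. if m = k then Poly_Mapping.lookup P k else 0)"
      unfolding lookup_sum by (rule sum.cong) (auto simp: lookup_single when_def)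
    also have "\<dots> = Poly_Mapping.lookup P k" using that by (auto simp: sum.delta in_keys_iff)
    finally show "Poly_Mapping.lookup P k = Poly_Mapping.lookup (\<Sum>m\<in>U. ?s P m) k" ..
  qed
  have A: "A = SA" unfolding SA_def by (rule sum[OF assms(1,2)])
  have B: "B = SB" unfolding SB_def by (rule sum[OF assms(3,4)])
  have "Poly_Mapping.lookup (SA * SB) m =
      (\<Sum>i\<in>S. \<Sum>j\<in>T. Poly_Mapping.lookup (?s A i * ?s B j) m)"
    unfolding SA_def SB_def sum_product lookup_sum ..
  also have "\<dots> = (\<Sum>i\<in>S. \<Sum>j\<in>T. if i + j = m then Poly_Mapping.lookup A i * Poly_Mapping.lookup B j else 0)"
    by (intro sum.cong refl) (simp add: mult_single lookup_single when_def)
  finally show ?thesis using A B by simp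
qed

lemma coefrel_diff:
  assumes Q: "part_hom Q" and "coefrel n Q A B" "coefrel n Q A' B'"
  shows "coefrel n Q (A - A') (B - B')"
proof -
  have "Poly_Mapping.keys (A - A') \<subseteq> Poly_Mapping.keys A \<union> Poly_Mapping.keys A'" by (rule keys_diff)
  then have "Poly_Mapping.keys m \<subseteq> {..<n}" if "m \<in> Poly_Mapping.keys (A - A')" for m
    using that assms(2,3) unfolding coefrel_def by blast
  then show ?thesis
    using assms unfolding coefrel_def by (simp add: lookup_minus part_hom_diff[OF Q])
qed

lemma coefrel_mult:
  assumes Q: "part_hom Q" and AB: "coefrel n Q A B" and AB': "coefrel n Q A' B'"
  shows "coefrel n Q (A * A') (B * B')"
proof -
  define S where "S = Poly_Mapping.keys A \<union> Poly_Mapping.keys B"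
  define T where "T = Poly_Mapping.keys A' \<union> Poly_Mapping.keys B'"
  have ST: "finite S" "finite T" by (simp_all add: S_def T_def)
  have "(Poly_Mapping.lookup (A * A') m, Poly_Mapping.lookup (B * B') m) \<in> Q" for m
  proof -
    have "(\<Sum>i\<in>S. \<Sum>j\<in>T. if i + j = m then Poly_Mapping.lookup A i * Poly_Mapping.lookup A' j else 0,
        \<Sum>i\<in>S. \<Sum>j\<in>T. if i + j = m then Poly_Mapping.lookup B i * Poly_Mapping.lookup B' j else 0) \<in> Q"
      by (intro part_hom_sum[OF Q])
         (use AB AB' in \<open>auto simp: coefrel_def intro!: part_hom_mult[OF Q] part_hom_zero[OF Q]\<close>)
    moreover have "Poly_Mapping.lookup (A * A') m =
        (\<Sum>i\<in>S. \<Sum>j\<in>T. if i + j = m then Poly_Mapping.lookup A i * Poly_Mapping.lookup A' j else 0)"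
      by (rule lookup_mult_superset) (use ST in \<open>auto simp: S_def T_def\<close>)
    moreover have "Poly_Mapping.lookup (B * B') m =
        (\<Sum>i\<in>S. \<Sum>j\<in>T. if i + j = m then Poly_Mapping.lookup B i * Poly_Mapping.lookup B' j else 0)"
      by (rule lookup_mult_superset) (use ST in \<open>auto simp: S_def T_def\<close>)
    ultimately show ?thesis by simp
  qed
  moreover have "Poly_Mapping.keys m \<subseteq> {..<n}" if "m \<in> Poly_Mapping.keys (A * A')" for m
  proof -
    obtain i j where ij: "m = i + j" "i \<in> Poly_Mapping.keys A" "j \<in> Poly_Mapping.keys A'"
      using keys_mult[of A A'] \<open>m \<in> Poly_Mapping.keys (A * A')\<close> by blast
    have "Poly_Mapping.keys m \<subseteq> Poly_Mapping.keys i \<union> Poly_Mapping.keys j" unfolding ij(1) by (rule Poly_Mapping.keys_add)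
    then show ?thesis using ij AB AB' unfolding coefrel_def by blast
  qed
  ultimately show ?thesis unfolding coefrel_def by blast
qed

lemma coefrel_single:
  assumes Q: "part_hom Q" and "(c, b) \<in> Q" "Poly_Mapping.keys m \<subseteq> {..<n}"
  shows "coefrel n Q (Poly_Mapping.single m c) (Poly_Mapping.single m b)"
  using assms(2,3) part_hom_zero[OF Q] by (auto simp: coefrel_def lookup_single when_def)

lemma comm_ring_hom_poly_eval_id: "comm_ring_hom (poly_eval (\<lambda>c :: 'r::comm_ring_1. c) a)"
proof
  show "poly_eval (\<lambda>c. c) a 1 = 1" using poly_eval_single[of "\<lambda>c. c" a 0 1] by simp
qed (simp_all add: poly_eval_add poly_eval_mult)

text \<open>
  The Gauss extension of a place of \<open>K\<close> to the function field of a conic bundle over \<open>K\<close> with good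
  reduction, with values in the Laurent series field that contains the generic point of the reduction.
\<close>

locale gauss_setup =
  fixes K :: "complex set" and P :: "(complex \<times> 'k::field) set" and n d :: nat
    and I :: "'m set" and ex :: "'m \<Rightarrow> nat \<Rightarrow> nat" and e0 e1 :: "'m \<Rightarrow> nat" and g :: "'m \<Rightarrow> complex" and gk :: "'m \<Rightarrow> 'k"
    and a :: "nat \<Rightarrow> complex" and w :: complex
    and b :: "nat \<Rightarrow> 'k laurent" and v :: "'k laurent"
  assumes K: "acl_field K" and P: "is_place P" and char2: "(1::'k) + 1 = 0"
    and n3: "n \<ge> 3" and dn: "2 * d \<ge> n"
    and finI: "finite I"
    and I: "\<And>m. m \<in> I \<Longrightarrow> (\<Sum>i<n. ex m i) = 2 * d" "\<And>m. m \<in> I \<Longrightarrow> e0 m + e1 m = 2"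
    and g: "\<And>m. m \<in> I \<Longrightarrow> g m \<in> K \<and> (g m, gk m) \<in> P"
    and reduction: "\<And>(x :: nat \<Rightarrow> 'k laurent poly) t0 t1. biform n I ex e0 e1 (\<lambda>m. [:kconst (gk m):]) x t0 t1 = conic_form n d x t0 t1"
    and reduction': "\<And>(x :: nat \<Rightarrow> 'k laurent) t0 t1. biform n I ex e0 e1 (\<lambda>m. kconst (gk m)) x t0 t1 = conic_form n d x t0 t1"
    and a: "alg_indep n K a"
    and w: "w\<^sup>2 = biform n I ex e0 e1 g (a(1 := 1)) (a 1) 1"
    and v: "v\<^sup>2 = conic_form n d (b(1 := 1)) (b 1) 1"
    and gen: "\<And>A B. poly_eval kconst b A + poly_eval kconst b B * v = 0 \<Longrightarrow> A = 0 \<and> B = 0"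
begin

definition PK where "PK = {(c, e) \<in> P. c \<in> K}"
definition KK where "KK = {(c, c) | c. c \<in> K}"
definition S1 where "S1 = {(poly_eval (\<lambda>c. c) a A, poly_eval kconst b B) | A B. coefrel n PK A B}"
definition R1 where "R1 = {poly_eval (\<lambda>c. c) a A | A. coefrel n KK A A}"
text \<open>Only polynomials in a with integral coefficients, and \<open>w\<close> times such
  polynomials, are put into the graph, not the whole valuation ring. Other elements of R become
  integral through division by elements of K.\<close>

definition S where "S = {(p + q * w, r + s * v) | p q r s. (p, r) \<in> S1 \<and> (q, s) \<in> S1}"
definition R where "R = {p + q * w | p q. p \<in> R1 \<and> q \<in> R1}"

lemma ph: "part_hom P"
  using P unfolding is_place_def by blast

lemma PK: "part_hom PK"
  unfolding part_hom_def
proof (intro conjI allI impI)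
  show "(1, 1) \<in> PK" using part_hom_one[OF ph] acl_field_1[OF K] by (simp add: PK_def)
next
  fix c e c' e' assume "(c, e) \<in> PK" "(c', e') \<in> PK"
  then show "(c - c', e - e') \<in> PK" "(c * c', e * e') \<in> PK"
    by (simp_all add: PK_def part_hom_diff[OF ph] part_hom_mult[OF ph] acl_field_diff[OF K] acl_field_mult[OF K])
next
  fix e assume "(0, e) \<in> PK"
  then show "e = 0" using part_hom_zeroD[OF ph] by (simp add: PK_def)
qed

lemma KK: "part_hom KK"
  unfolding part_hom_def
proof (intro conjI allI impI)
  show "(1, 1) \<in> KK" using acl_field_1[OF K] by (simp add: KK_def)
next
  fix c e c' e' assume "(c, e) \<in> KK" "(c', e') \<in> KK"
  then show "(c - c', e - e') \<in> KK" "(c * c', e * e') \<in> KK"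
    by (simp_all add: KK_def acl_field_diff[OF K] acl_field_mult[OF K])
qed (simp add: KK_def)

sublocale eva: comm_ring_hom "poly_eval (\<lambda>c. c) a" by (rule comm_ring_hom_poly_eval_id)
sublocale evb: comm_ring_hom "poly_eval kconst b" by (rule comm_ring_hom_poly_eval_kconst)

lemma char2_E: "(1::'k laurent) + 1 = 0"
  by (rule char2_laurent[OF char2])

lemma S1_I: "coefrel n PK A B \<Longrightarrow> (poly_eval (\<lambda>c. c) a A, poly_eval kconst b B) \<in> S1"
  unfolding S1_def by blast

lemma S1_const: "(c, e) \<in> PK \<Longrightarrow> (c, kconst e) \<in> S1"
  using S1_I[OF coefrel_single[OF PK, of c e 0]] by (simp add: poly_eval_single)

lemma S1_var: "i < n \<Longrightarrow> (a i, b i) \<in> S1"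
  using S1_I[OF coefrel_single[OF PK part_hom_one[OF PK], of "Poly_Mapping.single i 1"]]
  by (simp add: poly_eval_single)

text \<open>The reduction is well defined because a is algebraically independent over K: a value 0
  comes from the zero polynomial, which reduces to 0.\<close>

lemma S1: "part_hom S1"
proof -
  have "(p - p', r - r') \<in> S1 \<and> (p * p', r * r') \<in> S1" if S: "(p, r) \<in> S1" "(p', r') \<in> S1" for p r p' r'
  proof -
    obtain A B where 1: "p = poly_eval (\<lambda>c. c) a A" "r = poly_eval kconst b B" "coefrel n PK A B"
      using S(1) unfolding S1_def by blast
    obtain A' B' where 2: "p' = poly_eval (\<lambda>c. c) a A'" "r' = poly_eval kconst b B'" "coefrel n PK A' B'"
      using S(2) unfolding S1_def by blast
    show ?thesis
      using S1_I[OF coefrel_diff[OF PK 1(3) 2(3)]] S1_I[OF coefrel_mult[OF PK 1(3) 2(3)]]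
      unfolding 1 2 by (simp add: eva.hom_minus eva.hom_mult evb.hom_minus evb.hom_mult)
  qed
  moreover have "(1, 1) \<in> S1" using S1_const[OF part_hom_one[OF PK]] by simp
  moreover have "r = 0" if S: "(0, r) \<in> S1" for r
  proof -
    obtain A B where 1: "0 = poly_eval (\<lambda>c. c) a A" "r = poly_eval kconst b B" "coefrel n PK A B"
      using S unfolding S1_def by blast
    have "range (Poly_Mapping.lookup A) \<subseteq> K" using 1(3) by (auto simp: coefrel_def PK_def)
    then have "A = 0" using a 1 unfolding alg_indep_def coefrel_def by metis
    then have "(0, Poly_Mapping.lookup B m) \<in> PK" for m
      using 1(3) by (metis coefrel_def lookup_zero)
    then have "Poly_Mapping.lookup B m = 0" for m using part_hom_zeroD[OF PK] by blast
    then have "B = 0" by (intro poly_mapping_eqI) simp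
    then show ?thesis using 1(2) by simp
  qed
  ultimately show ?thesis unfolding part_hom_def by blast
qed

lemma x_S1: "i < n \<Longrightarrow> ((a(1 := 1)) i, (b(1 := 1)) i) \<in> S1"
  using S1_var part_hom_one[OF S1] by simp

lemma emon_S1: "(emon n e (a(1 := 1)), emon n e (b(1 := 1))) \<in> S1"
  unfolding emon_def by (intro part_hom_prod[OF S1] part_hom_power[OF S1] x_S1) simp

lemma w2_S1: "(w\<^sup>2, v\<^sup>2) \<in> S1"
proof -
  have n1: "1 < n" using n3 by simp
  have "(g m, kconst (gk m)) \<in> S1" if "m \<in> I" for m using g[OF that] by (intro S1_const) (simp add: PK_def)
  then have "(biform n I ex e0 e1 g (a(1 := 1)) (a 1) 1, biform n I ex e0 e1 (\<lambda>m. kconst (gk m)) (b(1 := 1)) (b 1) 1) \<in> S1"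
    unfolding biform_def
    by (intro part_hom_sum[OF S1] part_hom_mult[OF S1] part_hom_power[OF S1] emon_S1 S1_var[OF n1] part_hom_one[OF S1])
  then show ?thesis unfolding w v reduction' .
qed

lemma S_I: "(p, r) \<in> S1 \<Longrightarrow> (q, s) \<in> S1 \<Longrightarrow> (p + q * w, r + s * v) \<in> S"
  unfolding S_def by blast

lemma S1_S: "(p, r) \<in> S1 \<Longrightarrow> (p, r) \<in> S"
  using S_I[OF _ part_hom_zero[OF S1]] by simp

text \<open>If p + q w = 0, then the norm p^2 - q^2 w^2 is 0, and so is its reduction. In
  characteristic 2 that reduction is the square of r + s v.\<close>

lemma S: "part_hom S"
proof -
  have "(x - x', y - y') \<in> S \<and> (x * x', y * y') \<in> S" if xS: "(x, y) \<in> S" "(x', y') \<in> S" for x y x' y'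
  proof -
    obtain p q r s where 1: "x = p + q * w" "y = r + s * v" "(p, r) \<in> S1" "(q, s) \<in> S1"
      using xS(1) unfolding S_def by blast
    obtain p' q' r' s' where 2: "x' = p' + q' * w" "y' = r' + s' * v" "(p', r') \<in> S1" "(q', s') \<in> S1"
      using xS(2) unfolding S_def by blast
    have e: "x - x' = (p - p') + (q - q') * w" "y - y' = (r - r') + (s - s') * v"
      unfolding 1 2 by (simp_all add: algebra_simps)
    have e': "x * x' = (p * p' + q * q' * w\<^sup>2) + (p * q' + q * p') * w"
      "y * y' = (r * r' + s * s' * v\<^sup>2) + (r * s' + s * r') * v"
      unfolding 1 2 by (simp_all add: algebra_simps power2_eq_square)
    show ?thesis unfolding e e'
      by (intro conjI S_I part_hom_diff[OF S1] part_hom_add[OF S1] part_hom_mult[OF S1] w2_S1 1 2)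
  qed
  moreover have "(1, 1) \<in> S" by (rule S1_S[OF part_hom_one[OF S1]])
  moreover have "y = 0" if yS: "(0, y) \<in> S" for y
  proof -
    obtain p q r s where 1: "0 = p + q * w" "y = r + s * v" "(p, r) \<in> S1" "(q, s) \<in> S1"
      using yS unfolding S_def by blast
    have "p = - (q * w)" using 1(1) by (simp add: eq_neg_iff_add_eq_0)
    then have "p * p - q * q * w\<^sup>2 = 0" by (simp add: power2_eq_square)
    moreover have "(p * p - q * q * w\<^sup>2, r * r - s * s * v\<^sup>2) \<in> S1"
      by (intro part_hom_diff[OF S1] part_hom_mult[OF S1] w2_S1 1)
    ultimately have "r * r - s * s * v\<^sup>2 = 0" by (intro part_hom_zeroD[OF S1]) (simp only:)
    then have "(r + s * v) * (r - s * v) = 0" by (simp add: algebra_simps power2_eq_square)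
    moreover have "r - s * v = r + s * v" using char2_neg[OF char2_E, of "s * v"] by (metis diff_conv_add_uminus)
    ultimately show ?thesis using 1(2) by simp
  qed
  ultimately show ?thesis unfolding part_hom_def by blast
qed

lemma R1_ring: "p \<in> R1 \<Longrightarrow> q \<in> R1 \<Longrightarrow> p - q \<in> R1" "p \<in> R1 \<Longrightarrow> q \<in> R1 \<Longrightarrow> p * q \<in> R1"
proof -
  assume "p \<in> R1" "q \<in> R1"
  then obtain A B where 1: "p = poly_eval (\<lambda>c. c) a A" "coefrel n KK A A" "q = poly_eval (\<lambda>c. c) a B" "coefrel n KK B B"
    unfolding R1_def by blast
  have "poly_eval (\<lambda>c. c) a (A - B) \<in> R1" "poly_eval (\<lambda>c. c) a (A * B) \<in> R1"
    unfolding R1_def using coefrel_diff[OF KK 1(2,4)] coefrel_mult[OF KK 1(2,4)] by blast+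
  then show "p - q \<in> R1" "p * q \<in> R1" unfolding 1 by (simp_all add: eva.hom_minus eva.hom_mult)
qed

lemma R1_const: "c \<in> K \<Longrightarrow> c \<in> R1"
proof -
  assume "c \<in> K"
  then have "coefrel n KK (Poly_Mapping.single 0 c) (Poly_Mapping.single 0 c)"
    by (intro coefrel_single[OF KK]) (auto simp: KK_def)
  then have "poly_eval (\<lambda>c. c) a (Poly_Mapping.single 0 c) \<in> R1" unfolding R1_def by blast
  then show ?thesis by (simp add: poly_eval_single)
qed

lemma R1_var: "i < n \<Longrightarrow> a i \<in> R1"
proof -
  assume "i < n"
  then have "coefrel n KK (Poly_Mapping.single (Poly_Mapping.single i 1) 1) (Poly_Mapping.single (Poly_Mapping.single i 1) 1)"
    by (intro coefrel_single[OF KK]) (auto simp: KK_def acl_field_1[OF K])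
  then have "poly_eval (\<lambda>c. c) a (Poly_Mapping.single (Poly_Mapping.single i 1) 1) \<in> R1" unfolding R1_def by blast
  then show ?thesis by (simp add: poly_eval_single)
qed

lemma R1_add: "p \<in> R1 \<Longrightarrow> q \<in> R1 \<Longrightarrow> p + q \<in> R1"
  using R1_ring(1)[of p "0 - q"] R1_ring(1)[of 0 q] R1_const[OF acl_field_0[OF K]] by simp

lemma R1_sum: "(\<And>i. i \<in> A \<Longrightarrow> f i \<in> R1) \<Longrightarrow> (\<Sum>i\<in>A. f i) \<in> R1"
  by (induction A rule: infinite_finite_induct) (auto intro: R1_add R1_const[OF acl_field_0[OF K]])

lemma R1_power: "p \<in> R1 \<Longrightarrow> p ^ k \<in> R1"
  by (induction k) (auto intro: R1_ring R1_const[OF acl_field_1[OF K]])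

lemma R1_prod: "(\<And>i. i \<in> A \<Longrightarrow> f i \<in> R1) \<Longrightarrow> (\<Prod>i\<in>A. f i) \<in> R1"
  by (induction A rule: infinite_finite_induct) (auto intro: R1_ring R1_const[OF acl_field_1[OF K]])

lemma w2_R1: "w\<^sup>2 \<in> R1"
proof -
  have n1: "1 < n" using n3 by simp
  have "(a(1 := 1)) i \<in> R1" if "i < n" for i using R1_var[OF that] R1_const[OF acl_field_1[OF K]] by simp
  then show ?thesis unfolding w biform_def emon_def
    using g by (intro R1_sum R1_ring(2) R1_power R1_prod R1_var[OF n1] R1_const[OF acl_field_1[OF K]])
      (auto intro: R1_const)
qed

lemma R_I: "p \<in> R1 \<Longrightarrow> q \<in> R1 \<Longrightarrow> p + q * w \<in> R"
  unfolding R_def by blast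

lemma R1_R: "p \<in> R1 \<Longrightarrow> p \<in> R"
  using R_I[OF _ R1_const[OF acl_field_0[OF K]]] by simp

lemma R_ring: "x \<in> R \<Longrightarrow> y \<in> R \<Longrightarrow> x - y \<in> R" "x \<in> R \<Longrightarrow> y \<in> R \<Longrightarrow> x * y \<in> R"
proof -
  assume "x \<in> R" "y \<in> R"
  then obtain p q r s where 1: "x = p + q * w" "y = r + s * w" "p \<in> R1" "q \<in> R1" "r \<in> R1" "s \<in> R1"
    unfolding R_def by blast
  have e: "x - y = (p - r) + (q - s) * w" "x * y = (p * r + q * s * w\<^sup>2) + (p * s + q * r) * w"
    unfolding 1 by (simp_all add: algebra_simps power2_eq_square)
  show "x - y \<in> R" "x * y \<in> R"
    unfolding e by (intro R_I R1_ring R1_add w2_R1 1)+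
qed

lemma R_add: "x \<in> R \<Longrightarrow> y \<in> R \<Longrightarrow> x + y \<in> R"
  using R_ring(1)[of x "0 - y"] R_ring(1)[of 0 y] R1_R[OF R1_const[OF acl_field_0[OF K]]] by simp

lemma R_sum: "(\<And>i. i \<in> A \<Longrightarrow> f i \<in> R) \<Longrightarrow> (\<Sum>i\<in>A. f i) \<in> R"
  by (induction A rule: infinite_finite_induct) (auto intro: R_add R1_R R1_const[OF acl_field_0[OF K]])

lemma K_R: "c \<in> K \<Longrightarrow> c \<in> R"
  by (rule R1_R[OF R1_const])

lemma K_S: "c \<in> K \<Longrightarrow> (c, e) \<in> P \<Longrightarrow> (c, kconst e) \<in> S"
  by (rule S1_S[OF S1_const]) (simp add: PK_def)

lemma K_val: "c \<in> K \<Longrightarrow> (\<exists>e. (c, e) \<in> S) \<or> (inverse c, 0) \<in> S"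
proof -
  assume c: "c \<in> K"
  have "(\<exists>e. (c, e) \<in> P) \<or> (inverse c, 0) \<in> P" using P unfolding is_place_def by blast
  then show ?thesis
    using K_S[OF c] K_S[OF acl_field_inverse[OF K c], of 0] by auto
qed

text \<open>Elements of K reduce to constants of all \<open>dlaurent i\<close>, which makes
  \<open>omega\<close> vanish at points with coordinates in K.\<close>

lemma residue_kconst: "c \<in> K \<Longrightarrow> (c, e) \<in> S \<Longrightarrow> \<exists>e'. e = kconst e'"
proof -
  assume c: "c \<in> K" and ce: "(c, e) \<in> S"
  have "(\<exists>e. (c, e) \<in> P) \<or> (inverse c, 0) \<in> P" using P unfolding is_place_def by blast
  then show ?thesis
  proof
    assume "\<exists>e. (c, e) \<in> P"
    then obtain e' where "(c, kconst e') \<in> S" using K_S[OF c] by blast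
    then show ?thesis using part_hom_unique[OF S ce] by blast
  next
    assume "(inverse c, 0) \<in> P"
    then have i: "(inverse c, 0) \<in> S" using K_S[OF acl_field_inverse[OF K c], of 0] by simp
    show ?thesis
    proof (cases "c = 0")
      case True
      then have "e = 0" using ce part_hom_zeroD[OF S] by simp
      then show ?thesis using kconst_0 by metis
    next
      case False
      then have "(1, 0) \<in> S" using part_hom_mult[OF S ce i] by simp
      then show ?thesis using part_hom_unique[OF S part_hom_one[OF S]] by force
    qed
  qed
qed

lemma max_exists:
  assumes "finite C" "C \<noteq> {}" "C \<subseteq> K" "0 \<notin> C"
  shows "\<exists>\<alpha>\<in>C. \<forall>c\<in>C. \<exists>e. (c / \<alpha>, e) \<in> P"
  using assms
proof (induction C rule: finite_ne_induct)
  case (singleton x)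
  then show ?case using part_hom_one[OF ph] by auto
next
  case (insert x C)
  then obtain \<alpha> where \<alpha>: "\<alpha> \<in> C" "\<forall>c\<in>C. \<exists>e. (c / \<alpha>, e) \<in> P" by auto
  have nz: "\<alpha> \<noteq> 0" "x \<noteq> 0" using insert \<alpha>(1) by auto
  consider "\<exists>e. (x / \<alpha>, e) \<in> P" | "(inverse (x / \<alpha>), 0) \<in> P" using P unfolding is_place_def by blast
  then show ?case
  proof cases
    case 1
    then show ?thesis using \<alpha> by blast
  next
    case 2
    have "\<exists>e. (c / x, e) \<in> P" if c: "c \<in> insert x C" for c
    proof (cases "c = x")
      case True
      then show ?thesis using part_hom_one[OF ph] nz by auto
    next
      case False
      then obtain e where "(c / \<alpha>, e) \<in> P" using c \<alpha> by blast
      then have "(c / \<alpha> * inverse (x / \<alpha>), e * 0) \<in> P" using 2 by (rule part_hom_mult[OF ph])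
      moreover have "c / \<alpha> * inverse (x / \<alpha>) = c / x" using nz by simp
      ultimately show ?thesis by auto
    qed
    then show ?thesis by blast
  qed
qed

text \<open>Divide by a coefficient of largest absolute value. Some coefficient of the family then
  reduces to 1, and the assumption \<open>gen\<close> on the generic point keeps the reduction of
  the corresponding member away from 0.\<close>

lemma content:
  fixes J :: "'j set"
  assumes J: "finite J" "\<forall>i\<in>J. r i \<in> R" "\<exists>i\<in>J. r i \<noteq> 0"
  shows "\<exists>\<alpha> e. \<alpha> \<in> K \<and> \<alpha> \<noteq> 0 \<and> (\<forall>i\<in>J. (r i / \<alpha>, e i) \<in> S) \<and> (\<exists>i\<in>J. e i \<noteq> 0)"
proof -
  have "\<exists>A B. i \<in> J \<longrightarrow> r i = poly_eval (\<lambda>c. c) a A + poly_eval (\<lambda>c. c) a B * w \<and> coefrel n KK A A \<and> coefrel n KK B B" for i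
    using J(2) unfolding R_def R1_def by blast
  then obtain A B where AB: "\<And>i. i \<in> J \<Longrightarrow> r i = poly_eval (\<lambda>c. c) a (A i) + poly_eval (\<lambda>c. c) a (B i) * w"
      "\<And>i. i \<in> J \<Longrightarrow> coefrel n KK (A i) (A i)" "\<And>i. i \<in> J \<Longrightarrow> coefrel n KK (B i) (B i)"
    by metis
  define C where "C = (\<Union>i\<in>J. Poly_Mapping.lookup (A i) ` Poly_Mapping.keys (A i) \<union> Poly_Mapping.lookup (B i) ` Poly_Mapping.keys (B i))"
  have inC: "Poly_Mapping.lookup (A i) m \<in> insert 0 C" "Poly_Mapping.lookup (B i) m \<in> insert 0 C" if "i \<in> J" for i m
  proof -
    have "Poly_Mapping.lookup (A i) m \<in> C" if "m \<in> Poly_Mapping.keys (A i)"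
      using \<open>i \<in> J\<close> that unfolding C_def by blast
    then show "Poly_Mapping.lookup (A i) m \<in> insert 0 C" by (cases "m \<in> Poly_Mapping.keys (A i)") (auto simp: in_keys_iff)
    have "Poly_Mapping.lookup (B i) m \<in> C" if "m \<in> Poly_Mapping.keys (B i)"
      using \<open>i \<in> J\<close> that unfolding C_def by blast
    then show "Poly_Mapping.lookup (B i) m \<in> insert 0 C" by (cases "m \<in> Poly_Mapping.keys (B i)") (auto simp: in_keys_iff)
  qed
  have "finite C" using J(1) by (simp add: C_def)
  moreover have "C \<noteq> {}"
  proof
    assume "C = {}"
    then have "A i = 0" "B i = 0" if "i \<in> J" for i
      using inC[OF that] by (auto intro!: poly_mapping_eqI)
    then have "r i = 0" if "i \<in> J" for i using AB(1)[OF that] that by simp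
    then show False using J(3) by blast
  qed
  moreover have CK: "C \<subseteq> K"
    using AB(2,3) unfolding C_def coefrel_def KK_def by blast
  moreover have "0 \<notin> C" by (auto simp: C_def in_keys_iff)
  ultimately obtain \<alpha> where \<alpha>: "\<alpha> \<in> C" "\<forall>c\<in>C. \<exists>e. (c / \<alpha>, e) \<in> P" using max_exists[of C] by blast
  have \<alpha>0: "\<alpha> \<noteq> 0" and \<alpha>K: "\<alpha> \<in> K" using \<alpha>(1) \<open>0 \<notin> C\<close> CK by auto
  define val where "val c = (if c = 0 then 0 else SOME e. (c / \<alpha>, e) \<in> P)" for c
  have val: "(c / \<alpha>, val c) \<in> P" if "c \<in> insert 0 C" for c
    using that \<alpha>(2) part_hom_zero[OF ph] unfolding val_def by (auto intro: someI_ex)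
  have val_\<alpha>: "val \<alpha> = 1"
    using part_hom_unique[OF ph val[of \<alpha>]] part_hom_one[OF ph] \<alpha>(1) \<alpha>0 by auto
  define dv where "dv D = Poly_Mapping.map (\<lambda>c. c / \<alpha>) D" for D :: "complex cpoly"
  define rd where "rd D = Poly_Mapping.map val D" for D :: "complex cpoly"
  have l: "Poly_Mapping.lookup (dv D) m = Poly_Mapping.lookup D m / \<alpha>"
      "Poly_Mapping.lookup (rd D) m = val (Poly_Mapping.lookup D m)" for D m
    by (simp_all add: dv_def rd_def Poly_Mapping.map.rep_eq when_def val_def)
  have rel: "coefrel n PK (dv D) (rd D)"
    if D: "coefrel n KK D D" "\<And>m. Poly_Mapping.lookup D m \<in> insert 0 C" for D
    unfolding coefrel_def
  proof (intro conjI allI ballI)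
    fix m
    have "Poly_Mapping.lookup D m \<in> K" using D(1) by (auto simp: coefrel_def KK_def)
    then show "(Poly_Mapping.lookup (dv D) m, Poly_Mapping.lookup (rd D) m) \<in> PK"
      unfolding l PK_def using val[OF D(2)] acl_field_divide[OF K _ \<alpha>K] by simp
  next
    fix m assume "m \<in> Poly_Mapping.keys (dv D)"
    then have "m \<in> Poly_Mapping.keys D" by (auto simp: in_keys_iff l)
    then show "Poly_Mapping.keys m \<subseteq> {..<n}" using D(1) by (simp add: coefrel_def)
  qed
  have ev: "poly_eval (\<lambda>c. c) a (dv D) = poly_eval (\<lambda>c. c) a D / \<alpha>" for D
  proof -
    have "Poly_Mapping.keys (dv D) \<subseteq> Poly_Mapping.keys D" by (auto simp: in_keys_iff l)
    then have "poly_eval (\<lambda>c. c) a (dv D) = (\<Sum>m\<in>Poly_Mapping.keys D. Poly_Mapping.lookup (dv D) m * mon_eval m a)"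
      by (intro poly_eval_superset) auto
    then show ?thesis by (simp add: poly_eval_def l sum_divide_distrib)
  qed
  define e where "e i = poly_eval kconst b (rd (A i)) + poly_eval kconst b (rd (B i)) * v" for i
  have "(r i / \<alpha>, e i) \<in> S" if i: "i \<in> J" for i
  proof -
    have "(poly_eval (\<lambda>c. c) a (dv (A i)) + poly_eval (\<lambda>c. c) a (dv (B i)) * w, e i) \<in> S"
      unfolding e_def by (intro S_I S1_I rel AB(2,3)[OF i] inC[OF i])
    then show ?thesis unfolding ev AB(1)[OF i] by (simp add: add_divide_distrib)
  qed
  moreover have "\<exists>i\<in>J. e i \<noteq> 0"
  proof -
    obtain i m where i: "i \<in> J" and m: "\<alpha> = Poly_Mapping.lookup (A i) m \<or> \<alpha> = Poly_Mapping.lookup (B i) m"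
      using \<alpha>(1) unfolding C_def by blast
    have "Poly_Mapping.lookup (rd (A i)) m = 1 \<or> Poly_Mapping.lookup (rd (B i)) m = 1"
      using m val_\<alpha> by (auto simp: l)
    then have "rd (A i) \<noteq> 0 \<or> rd (B i) \<noteq> 0" by auto
    then have "e i \<noteq> 0" unfolding e_def using gen by blast
    then show ?thesis using i by blast
  qed
  ultimately show ?thesis using \<alpha>K \<alpha>0 by blast
qed

sublocale val_model K R S n d dlaurent I ex e0 e1 g "\<lambda>m. kconst (gk m)"
proof
  show "part_hom S" by (rule S)
  show "acl_field K" by (rule K)
  show "c * r \<in> R" if "c \<in> K" "r \<in> R" for c r using R_ring(2)[OF K_R[OF that(1)] that(2)] .
  show "\<exists>\<alpha> e. \<alpha> \<in> K \<and> \<alpha> \<noteq> 0 \<and> (\<forall>i\<in>J. (r i / \<alpha>, e i) \<in> S) \<and> (\<exists>i\<in>J. e i \<noteq> 0)"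
    if "finite J" "\<forall>i\<in>J. r i \<in> R" "\<exists>i\<in>J. r i \<noteq> 0" for J :: "(nat \<times> nat) set" and r
    using that by (rule content)
  show "(\<exists>b. (c, b) \<in> S) \<or> (inverse c, 0) \<in> S" if "c \<in> K" for c using that by (rule K_val)
  show "(1::'k laurent) + 1 = 0" by (rule char2_E)
  show "derivation (dlaurent i :: 'k laurent \<Rightarrow> _)" for i by (rule derivation_dlaurent)
  show "(g m, kconst (gk m)) \<in> S" if "m \<in> I" for m using g[OF that] K_S by blast
  show "biform n I ex e0 e1 (\<lambda>m. [:kconst (gk m):]) x t0 t1 = conic_form n d x t0 t1" for x t0 t1
    by (rule reduction)
qed (use n3 dn I in auto)

end

lemma comm_ring_hom_biform:
  assumes "comm_ring_hom h"
  shows "h (biform n I ex e0 e1 g x t0 t1) = biform n I ex e0 e1 (\<lambda>m. h (g m)) (\<lambda>i. h (x i)) (h t0) (h t1)"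
proof -
  interpret comm_ring_hom h by fact
  show ?thesis by (simp add: biform_def hom_sum hom_mult hom_power comm_ring_hom_emon[OF assms])
qed

lemma comm_ring_hom_pcompose: "comm_ring_hom (\<lambda>p :: 'r::comm_ring_1 poly. pcompose p q)"
  by unfold_locales (simp_all add: pcompose_add pcompose_mult pcompose_1)

lemma coeff_pcompose_shift:
  fixes p :: "'r::idom poly"
  assumes "degree p \<le> N" shows "coeff (pcompose p [:1, 1:]) N = coeff p N"
proof (cases "degree p = N")
  case True
  then show ?thesis using lead_coeff_comp[of "[:1, 1:]" p] by (simp add: degree_pcompose)
next
  case False
  then show ?thesis using assms by (simp add: coeff_eq_0 degree_pcompose)
qed

context gauss_setup
begin

lemma coeff_R_add: "(\<And>j. coeff p j \<in> R) \<Longrightarrow> (\<And>j. coeff q j \<in> R) \<Longrightarrow> coeff (p + q) j \<in> R"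
  by (simp add: R_add)

lemma coeff_R_mult: "(\<And>j. coeff p j \<in> R) \<Longrightarrow> (\<And>j. coeff q j \<in> R) \<Longrightarrow> coeff (p * q) j \<in> R"
  unfolding coeff_mult by (intro R_sum R_ring(2))

lemma coeff_R_const: "c \<in> R \<Longrightarrow> coeff [:c:] j \<in> R"
  by (cases j) (simp_all add: K_R acl_field_0[OF K])

lemma coeff_R_pcompose: "(\<And>j. coeff p j \<in> R) \<Longrightarrow> (\<And>j. coeff q j \<in> R) \<Longrightarrow> coeff (pcompose p q) j \<in> R"
proof (induction p arbitrary: j)
  case 0
  then show ?case by simp
next
  case (pCons c p)
  have c: "c \<in> R" using pCons.prems(1)[of 0] by simp
  have p: "coeff p j \<in> R" for j using pCons.prems(1)[of "Suc j"] by simp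
  show ?case unfolding pcompose_pCons
    by (intro coeff_R_add coeff_R_mult coeff_R_const c pCons.IH p pCons.prems(2))
qed

text \<open>
  \<open>\<omega>\<close> takes the same value at both ends of the curve \<open>X\<close> and of its translate; the
  two curves share the point at infinity.
\<close>

lemma no_curve_to_K:
  assumes gen_omega: "\<And>c. c \<noteq> 0 \<Longrightarrow> omega n dlaurent (\<lambda>i. c * (b(1 := 1)) i) \<noteq> 0"
    and X: "\<And>i j. i < n \<Longrightarrow> coeff (X i) j \<in> R"
    and T: "\<And>j. coeff T0 j \<in> R" "\<And>j. coeff T1 j \<in> R" "T0 \<noteq> 0 \<or> T1 \<noteq> 0"
    and W: "\<And>j. coeff W j \<in> R" "W\<^sup>2 = biform n I ex e0 e1 (\<lambda>m. [:g m:]) X T0 T1"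
    and X0: "l \<noteq> 0" "\<And>i. i < n \<Longrightarrow> coeff (X i) 0 = l * (a(1 := 1)) i"
    and X1: "\<And>i. i < n \<Longrightarrow> poly (X i) 1 \<in> K" "\<exists>i<n. poly (X i) 1 \<noteq> 0"
  shows False
proof -
  have n1: "1 < n" using n3 by simp
  define N where "N = Max (degree ` X ` {..<n})"
  have N: "degree (X i) \<le> N" if "i < n" for i unfolding N_def using that by (intro Max_ge) auto
  have "N \<in> degree ` X ` {..<n}" unfolding N_def using n1 by (intro Max_in) (auto simp: lessThan_empty_iff)
  then obtain i0 where i0: "i0 < n" "degree (X i0) = N" by blast
  have topnz: "\<exists>i\<in>{..<n}. coeff (X i) N \<noteq> 0"
  proof (cases "X i0 = 0")
    case True
    then have N0: "N = 0" using i0 by simp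
    have "coeff (X 1) 0 \<noteq> 0" using X0(1) X0(2)[OF n1] by simp
    then show ?thesis using n1 N0 by blast
  next
    case False
    then show ?thesis using i0 leading_coeff_neq_0[of "X i0"] by auto
  qed
  obtain \<alpha>N vN where vN: "\<alpha>N \<in> K" "\<alpha>N \<noteq> 0" "\<forall>i\<in>{..<n}. (coeff (X i) N / \<alpha>N, vN i) \<in> S" "\<exists>i\<in>{..<n}. vN i \<noteq> 0"
    using content[of "{..<n}" "\<lambda>i. coeff (X i) N"] topnz X by auto
  have vN': "\<And>i. i < n \<Longrightarrow> (coeff (X i) N / \<alpha>N, vN i) \<in> S" "\<exists>i<n. vN i \<noteq> 0" using vN(3,4) by auto
  have "l \<in> R" using X[OF n1, of 0] X0(2)[OF n1] by simp
  then obtain \<alpha>0 f where f: "\<alpha>0 \<in> K" "\<alpha>0 \<noteq> 0" "(l / \<alpha>0, f) \<in> S" "f \<noteq> 0"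
    using content[of "{()}" "\<lambda>_. l"] X0(1) by auto
  \<comment> \<open>The factor l is an element of R and need not lie in K. Only its content is
    divided out, so that the starting point reduces to f times the generic point.\<close>
  define v0 where "v0 i = f * (b(1 := 1)) i" for i
  have v0: "(coeff (X i) 0 / \<alpha>0, v0 i) \<in> S" if "i < n" for i
    using part_hom_mult[OF S f(3) S1_S[OF x_S1[OF that]]] unfolding X0(2)[OF that] v0_def by simp
  have v0nz: "\<exists>i<n. v0 i \<noteq> 0" using f(4) n1 by (intro exI[of _ 1]) (simp add: v0_def)
  have e1: "omega n dlaurent v0 = omega n dlaurent vN"
    by (rule omega_along_curve[OF X T W f(1,2) v0 v0nz N vN(1,2) vN'])
  define sh where "sh p = pcompose p [:1, 1:]" for p :: "complex poly"
  interpret sh: comm_ring_hom sh unfolding sh_def by (rule comm_ring_hom_pcompose)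
  have one: "coeff [:1, 1:] j \<in> R" for j
    by (simp add: coeff_pCons K_R acl_field_0[OF K] acl_field_1[OF K] split: nat.split)
  have shR: "coeff (sh p) j \<in> R" if "\<And>j. coeff p j \<in> R" for p j
    unfolding sh_def by (rule coeff_R_pcompose[OF that one])
  have shnz: "sh p \<noteq> 0" if "p \<noteq> 0" for p unfolding sh_def using that by (simp add: pcompose_eq_0_iff)
  have sh0: "coeff (sh p) 0 = poly p 1" for p
    unfolding sh_def by (metis add.right_neutral mult_zero_left poly_0_coeff_0 poly_pCons poly_pcompose)
  have shc: "sh [:c:] = [:c:]" for c by (simp add: sh_def)
  have shW: "(sh W)\<^sup>2 = biform n I ex e0 e1 (\<lambda>m. [:g m:]) (\<lambda>i. sh (X i)) (sh T0) (sh T1)"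
  proof -
    have "(sh W)\<^sup>2 = sh (W\<^sup>2)" by (rule sh.hom_power[symmetric])
    also have "\<dots> = sh (biform n I ex e0 e1 (\<lambda>m. [:g m:]) X T0 T1)" by (simp only: W(2))
    also have "\<dots> = biform n I ex e0 e1 (\<lambda>m. sh [:g m:]) (\<lambda>i. sh (X i)) (sh T0) (sh T1)"
      by (rule comm_ring_hom_biform[OF sh.comm_ring_hom_axioms])
    finally show ?thesis by (simp only: shc)
  qed
  have shN: "coeff (sh (X i)) N = coeff (X i) N" "degree (sh (X i)) \<le> N" if "i < n" for i
    unfolding sh_def using coeff_pcompose_shift[OF N[OF that]] N[OF that] by (simp_all add: degree_pcompose)
  have "\<forall>i\<in>{..<n}. poly (X i) 1 \<in> R" using X1(1) K_R by simp
  then obtain \<alpha>1 v1 where v1: "\<alpha>1 \<in> K" "\<alpha>1 \<noteq> 0" "\<forall>i\<in>{..<n}. (poly (X i) 1 / \<alpha>1, v1 i) \<in> S" "\<exists>i\<in>{..<n}. v1 i \<noteq> 0"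
    using content[of "{..<n}" "\<lambda>i. poly (X i) 1"] X1(2) by auto
  have v1': "(coeff (sh (X i)) 0 / \<alpha>1, v1 i) \<in> S" if "i < n" for i using v1(3) that by (simp add: sh0)
  have vN'': "(coeff (sh (X i)) N / \<alpha>N, vN i) \<in> S" if "i < n" for i using vN'(1)[OF that] by (simp add: shN(1)[OF that])
  have v1nz: "\<exists>i<n. v1 i \<noteq> 0" using v1(4) by auto
  have shT: "sh T0 \<noteq> 0 \<or> sh T1 \<noteq> 0" using T(3) shnz by blast
  have e2: "omega n dlaurent v1 = omega n dlaurent vN"
    by (rule omega_along_curve[OF shR[OF X] shR[OF T(1)] shR[OF T(2)] shT shR[OF W(1)] shW v1(1,2) v1' v1nz shN(2) vN(1,2) vN'' vN'(2)])
  have "dlaurent i (v1 j) = 0" if "j < n" for i j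
  proof -
    have "poly (X j) 1 / \<alpha>1 \<in> K" by (rule acl_field_divide[OF K X1(1)[OF that] v1(1)])
    moreover have "(poly (X j) 1 / \<alpha>1, v1 j) \<in> S" using v1(3) that by simp
    ultimately have "\<exists>e. v1 j = kconst e" by (rule residue_kconst)
    then obtain e where "v1 j = kconst e" ..
    then show ?thesis by (simp add: dlaurent_kconst)
  qed
  then have "wmat n dlaurent v1 $$ (0, j) = 0" if "j < n" for j
    using that n3 by (simp add: wmat_def)
  then have "Determinant.det (wmat n dlaurent v1) = 0"
    using laplace_expansion_row[of "wmat n dlaurent v1" n 0] n3 by simp
  then have "omega n dlaurent v1 = 0" by (simp add: omega_def)
  then show False using e1 e2 gen_omega[OF f(4)] unfolding v0_def by simp
qed

end

section \<open>Reduction of the branch divisor to characteristic 2\<close>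

lemma finite_bimonomials: "finite (bimonomials n a b)"
proof -
  let ?V = "XC ` {..<n} \<union> TC ` {..<2}"
  have "finite {f :: coord \<Rightarrow> nat. \<forall>v. (v \<in> ?V \<longrightarrow> f v \<in> {..a + b}) \<and> (v \<notin> ?V \<longrightarrow> f v = 0)}"
    by (rule finite_set_of_finite_funs) auto
  moreover have "Poly_Mapping.lookup ` bimonomials n a b \<subseteq>
      {f. \<forall>v. (v \<in> ?V \<longrightarrow> f v \<in> {..a + b}) \<and> (v \<notin> ?V \<longrightarrow> f v = 0)}"
  proof (intro subsetI CollectI allI conjI impI, elim imageE)
    fix f v m assume m: "f = Poly_Mapping.lookup m" "m \<in> bimonomials n a b" and v: "v \<in> ?V"
    have X: "Poly_Mapping.lookup m (XC i) \<le> a" if "i < n" for i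
      using member_le_sum[of i "{..<n}" "\<lambda>i. Poly_Mapping.lookup m (XC i)"] m(2) that
      by (simp add: bimonomials_def)
    have T: "Poly_Mapping.lookup m (TC j) \<le> b" if "j < 2" for j
      using member_le_sum[of j "{..<2}" "\<lambda>j. Poly_Mapping.lookup m (TC j)"] m(2) that
      by (simp add: bimonomials_def)
    show "f v \<in> {..a + b}" unfolding m(1) using v X T by (auto intro: trans_le_add1 trans_le_add2)
  next
    fix f v assume "f \<in> Poly_Mapping.lookup ` bimonomials n a b" "v \<notin> ?V"
    then show "f v = 0" by (auto simp: bimonomials_def in_keys_iff)
  qed
  ultimately have "finite (Poly_Mapping.lookup ` bimonomials n a b)" by (rule rev_finite_subset)
  then show ?thesis by (rule finite_imageD) (auto intro: inj_onI poly_mapping_eqI)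
qed

lemma sum_less_2: "(\<Sum>j<2. f j) = f 0 + f (1::nat)"
  by (simp add: numeral_2_eq_2)

lemma poly_value_eq_poly_eval: "poly_value p x = poly_eval (\<lambda>c. c) x p"
  by (simp add: poly_value_def poly_eval_def monomial_value_def mon_eval_def)

lemma monomial_value_bimonomial:
  assumes "m \<in> bimonomials n a b"
  shows "monomial_value m x = emon n (\<lambda>i. Poly_Mapping.lookup m (XC i)) (\<lambda>i. x (XC i)) *
    x (TC 0) ^ Poly_Mapping.lookup m (TC 0) * x (TC 1) ^ Poly_Mapping.lookup m (TC 1)"
proof -
  have "monomial_value m x = mon_eval m x" by (simp add: monomial_value_def mon_eval_def)
  also have "\<dots> = (\<Prod>v\<in>XC ` {..<n} \<union> TC ` {..<2}. x v ^ Poly_Mapping.lookup m v)"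
    using assms by (intro mon_eval_superset) (auto simp: bimonomials_def)
  also have "\<dots> = (\<Prod>v\<in>XC ` {..<n}. x v ^ Poly_Mapping.lookup m v) * (\<Prod>v\<in>TC ` {..<2}. x v ^ Poly_Mapping.lookup m v)"
    by (rule prod.union_disjoint) auto
  also have "(\<Prod>v\<in>XC ` {..<n}. x v ^ Poly_Mapping.lookup m v) = emon n (\<lambda>i. Poly_Mapping.lookup m (XC i)) (\<lambda>i. x (XC i))"
    unfolding emon_def by (subst prod.reindex) (auto simp: inj_on_def)
  also have "(\<Prod>v\<in>TC ` {..<2}. x v ^ Poly_Mapping.lookup m v) = (\<Prod>j<2. x (TC j) ^ Poly_Mapping.lookup m (TC j))"
    by (subst prod.reindex) (auto simp: inj_on_def)
  finally show ?thesis by (simp add: numeral_2_eq_2 mult.assoc)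
qed

abbreviation expX :: "coord monomial \<Rightarrow> nat \<Rightarrow> nat" where "expX m i \<equiv> Poly_Mapping.lookup m (XC i)"
abbreviation expT :: "nat \<Rightarrow> coord monomial \<Rightarrow> nat" where "expT j m \<equiv> Poly_Mapping.lookup m (TC j)"

abbreviation cform :: "nat \<Rightarrow> nat \<Rightarrow> (coord monomial \<Rightarrow> 'r) \<Rightarrow> (nat \<Rightarrow> 'r) \<Rightarrow> 'r \<Rightarrow> 'r \<Rightarrow> 'r::comm_ring_1"
  where "cform n d \<equiv> biform n (bimonomials n (2 * d) 2) expX (expT 0) (expT 1)"

lemma form_value_eq: "form_value n (2 * d) 2 F x = cform n d F (\<lambda>i. x (XC i)) (x (TC 0)) (x (TC 1))"
  unfolding form_value_def biform_def
  by (intro sum.cong refl) (simp add: monomial_value_bimonomial mult.assoc)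

lemma bimonomials_sums:
  assumes "m \<in> bimonomials n a b"
  shows "(\<Sum>i<n. expX m i) = a" "expT 0 m + expT 1 m = b"
  using assms by (simp_all add: bimonomials_def sum_less_2)

definition bimon :: "nat \<Rightarrow> (nat \<Rightarrow> nat) \<Rightarrow> nat \<Rightarrow> nat \<Rightarrow> coord monomial"
  where "bimon n e p q = (\<Sum>i<n. Poly_Mapping.single (XC i) (e i)) + Poly_Mapping.single (TC 0) p + Poly_Mapping.single (TC 1) q"

lemma lookup_bimon:
  "Poly_Mapping.lookup (bimon n e p q) (XC i) = (if i < n then e i else 0)"
  "Poly_Mapping.lookup (bimon n e p q) (TC 0) = p"
  "Poly_Mapping.lookup (bimon n e p q) (TC (Suc 0)) = q"
  "j \<ge> 2 \<Longrightarrow> Poly_Mapping.lookup (bimon n e p q) (TC j) = 0"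
  "Poly_Mapping.lookup (bimon n e p q) WC = 0"
proof -
  have "(\<Sum>k<n. if k = i then e k else 0) = (if i < n then e i else 0)" by (simp add: sum.delta)
  then show "Poly_Mapping.lookup (bimon n e p q) (XC i) = (if i < n then e i else 0)"
    by (simp add: bimon_def lookup_add lookup_sum lookup_single when_def)
qed (simp_all add: bimon_def lookup_add lookup_sum lookup_single when_def)

lemma bimon_in_bimonomials:
  assumes "(\<Sum>i<n. e i) = a" "p + q = b" shows "bimon n e p q \<in> bimonomials n a b"
proof -
  have "v \<in> XC ` {..<n} \<union> TC ` {..<2}" if "Poly_Mapping.lookup (bimon n e p q) v \<noteq> 0" for v
  proof (cases v)
    case (XC i)
    then show ?thesis using that by (simp add: lookup_bimon split: if_splits)
  next
    case (TC j)
    then have "\<not> j \<ge> 2" using that lookup_bimon(4) by metis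
    then show ?thesis using TC by simp
  next
    case WC
    then show ?thesis using that by (simp add: lookup_bimon)
  qed
  then have "Poly_Mapping.keys (bimon n e p q) \<subseteq> XC ` {..<n} \<union> TC ` {..<2}" by (auto simp: in_keys_iff)
  then show ?thesis using assms by (simp add: bimonomials_def lookup_bimon sum_less_2)
qed

text \<open>Coefficients of a lift of the reduced form to characteristic zero.\<close>

definition target :: "nat \<Rightarrow> nat \<Rightarrow> coord monomial \<Rightarrow> int"
  where "target n d m = of_bool (m = bimon n (exps n d n) 2 0) + of_bool (m = bimon n (exps n d n) 1 1) +
    (\<Sum>j<n. of_bool (m = bimon n (exps n d j) 0 2))"

text \<open>The coefficient of this monomial normalises the form. Its target value is 1, so the
  normalisation is compatible with the reduction.\<close>

definition lead_mon :: "nat \<Rightarrow> nat \<Rightarrow> coord monomial"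
  where "lead_mon n d = bimon n (exps n d n) 2 0"

lemma target_lead: "target n d (lead_mon n d) = 1"
proof -
  have ne: "bimon n e 2 0 \<noteq> bimon n e' p q" if "p < 2" for e e' p q
    using that lookup_bimon(2)[of n e 2 0] lookup_bimon(2)[of n e' p q] by auto
  show ?thesis unfolding target_def lead_mon_def using ne by simp
qed

lemma biform_target:
  fixes x :: "nat \<Rightarrow> 'r::comm_ring_1"
  assumes "n \<ge> 3" "2 * d \<ge> n"
  shows "cform n d (\<lambda>m. of_int (target n d m)) x t0 t1 = conic_form n d x t0 t1"
proof -
  let ?I = "bimonomials n (2 * d) 2"
  define T where "T m = emon n (expX m) x * t0 ^ expT 0 m * t1 ^ expT 1 m" for m
  have mem: "bimon n (exps n d j) p q \<in> ?I" if "j \<le> n" "p + q = 2" for j p q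
    using that sum_exps[OF assms] by (intro bimon_in_bimonomials) auto
  have T: "T (bimon n e p q) = emon n e x * t0 ^ p * t1 ^ q" for e p q
    unfolding T_def emon_def by (auto simp: lookup_bimon intro!: arg_cong2[of _ _ _ _ "(*)"] prod.cong)
  have pick: "(\<Sum>m\<in>?I. of_bool (m = b) * T m) = T b" if "b \<in> ?I" for b
  proof -
    have "(\<Sum>m\<in>?I. of_bool (m = b) * T m) = (\<Sum>m\<in>?I. if m = b then T b else 0)"
      by (rule sum.cong) auto
    then show ?thesis using that finite_bimonomials by (simp add: sum.delta)
  qed
  have "cform n d (\<lambda>m. of_int (target n d m)) x t0 t1 = (\<Sum>m\<in>?I. of_int (target n d m) * T m)"
    by (simp add: biform_def T_def mult.assoc)
  also have "\<dots> = (\<Sum>m\<in>?I. of_bool (m = bimon n (exps n d n) 2 0) * T m) +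
      (\<Sum>m\<in>?I. of_bool (m = bimon n (exps n d n) 1 1) * T m) +
      (\<Sum>m\<in>?I. \<Sum>j<n. of_bool (m = bimon n (exps n d j) 0 2) * T m)"
    by (simp add: target_def distrib_right sum.distrib sum_distrib_right
        del: sum_of_bool_eq sum_of_bool_mult_eq sum_mult_of_bool_eq)
  also have "(\<Sum>m\<in>?I. \<Sum>j<n. of_bool (m = bimon n (exps n d j) 0 2) * T m) =
      (\<Sum>j<n. \<Sum>m\<in>?I. of_bool (m = bimon n (exps n d j) 0 2) * T m)"
    by (rule sum.swap)
  also have "\<dots> = (\<Sum>j<n. T (bimon n (exps n d j) 0 2))"
    by (intro sum.cong refl pick mem) auto
  also have "(\<Sum>m\<in>?I. of_bool (m = bimon n (exps n d n) 2 0) * T m) = T (bimon n (exps n d n) 2 0)"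
    by (intro pick mem) auto
  also have "(\<Sum>m\<in>?I. of_bool (m = bimon n (exps n d n) 1 1) * T m) = T (bimon n (exps n d n) 1 1)"
    by (intro pick mem) auto
  finally show ?thesis
    by (simp add: T conic_form_def algebra_simps sum_distrib_left power2_eq_square)
qed

lemma comm_ring_hom_of_int:
  assumes "comm_ring_hom h" shows "h (of_int z) = of_int z"
proof -
  interpret comm_ring_hom h by fact
  have "h (of_nat k) = of_nat k" for k by (induction k) (simp_all add: hom_add)
  then show ?thesis by (cases z) (simp_all only: of_int_of_nat_eq of_int_minus hom_uminus)
qed

lemma char2_alg_closure_bit: "(1 :: bit alg_closure) + 1 = 0"
proof -
  have "(1 :: bit alg_closure) + 1 = to_ac (1 + 1)" by (simp only: to_ac_add to_ac_1)
  also have "(1::bit) + 1 = 0" by simp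
  finally show ?thesis by simp
qed

lemma of_int_alg_closure_bit: "(of_int z :: bit alg_closure) = 0 \<longleftrightarrow> even z"
proof -
  have "(of_int z :: bit) = 0 \<longleftrightarrow> even z"
  proof -
    have "(of_int (2 * k) :: bit) = 0" for k by simp
    moreover have "(of_int (2 * k + 1) :: bit) = 1" for k by simp
    ultimately show ?thesis by (metis evenE oddE zero_neq_one)
  qed
  then show ?thesis using to_ac_eq_0_iff[of "of_int z :: bit"] by simp
qed

text \<open>
  Every integral polynomial relation between the coefficient ratios of \<open>F\<close> survives in
  characteristic 2, so the ratios specialise to \<open>target\<close>.
\<close>

definition good_form :: "nat \<Rightarrow> nat \<Rightarrow> (coord monomial \<Rightarrow> complex) \<Rightarrow> bool"
  where "good_form n d F \<longleftrightarrow> F (lead_mon n d) \<noteq> 0 \<and>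
    (\<forall>p :: (coord monomial \<Rightarrow>\<^sub>0 nat) \<Rightarrow>\<^sub>0 int. odd (poly_eval (\<lambda>c. c) (target n d) p) \<longrightarrow>
      poly_eval of_int (\<lambda>m. F m / F (lead_mon n d)) p \<noteq> 0)"

text \<open>Evaluate integral polynomials at the coefficient ratios and at the target values modulo
  2. By \<open>good_form\<close>, a relation among the ratios has an even value at the target, so
  the pairs form the graph of a ring homomorphism, which extends to a place of \<complex>.\<close>

lemma good_form_place:
  assumes "good_form n d F"
  obtains P :: "(complex \<times> bit alg_closure) set"
  where "is_place P" "\<And>m. (F m / F (lead_mon n d), of_int (target n d m)) \<in> P"
proof -
  define G where "G m = F m / F (lead_mon n d)" for m
  let ?ev = "\<lambda>p :: (coord monomial \<Rightarrow>\<^sub>0 nat) \<Rightarrow>\<^sub>0 int. poly_eval of_int G p"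
  let ?et = "\<lambda>p :: (coord monomial \<Rightarrow>\<^sub>0 nat) \<Rightarrow>\<^sub>0 int. poly_eval of_int (\<lambda>m. of_int (target n d m)) p :: bit alg_closure"
  have hom: "comm_ring_hom (poly_eval of_int x :: ((coord monomial \<Rightarrow>\<^sub>0 nat) \<Rightarrow>\<^sub>0 int) \<Rightarrow> 'r::comm_ring_1)" for x
    by unfold_locales
      (use poly_eval_single[of "of_int :: int \<Rightarrow> 'r" x 0 1] in \<open>simp_all add: poly_eval_add poly_eval_mult\<close>)
  interpret ev: comm_ring_hom ?ev by (rule hom)
  interpret et: comm_ring_hom ?et by (rule hom)
  have et: "?et p = of_int (poly_eval (\<lambda>c. c) (target n d) p)" for p
  proof -
    have "comm_ring_hom (of_int :: int \<Rightarrow> bit alg_closure)" by unfold_locales auto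
    from poly_eval_hom[OF this, of "\<lambda>c. c" "target n d" p] show ?thesis by simp
  qed
  define S0 where "S0 = {(?ev p, ?et p) | p. True}"
  have "part_hom S0"
    unfolding part_hom_def
  proof (intro conjI allI impI)
    have "(?ev 1, ?et 1) \<in> S0" unfolding S0_def by blast
    then show "(1, 1) \<in> S0" by (simp only: ev.hom_one et.hom_one)
  next
    fix a b a' b' assume "(a, b) \<in> S0" "(a', b') \<in> S0"
    then obtain p q where pq: "a = ?ev p" "b = ?et p" "a' = ?ev q" "b' = ?et q" unfolding S0_def by blast
    have "(?ev (p - q), ?et (p - q)) \<in> S0" "(?ev (p * q), ?et (p * q)) \<in> S0" unfolding S0_def by blast+
    then show "(a - a', b - b') \<in> S0" "(a * a', b * b') \<in> S0"
      unfolding pq by (simp_all only: ev.hom_minus et.hom_minus ev.hom_mult et.hom_mult)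
  next
    fix b assume "(0, b) \<in> S0"
    then obtain p where p: "?ev p = 0" "b = ?et p" unfolding S0_def by force
    then have "even (poly_eval (\<lambda>c. c) (target n d) p)"
      using assms unfolding good_form_def G_def by blast
    then show "b = 0" unfolding p(2) et by (simp only: of_int_alg_closure_bit)
  qed
  then obtain P where P: "S0 \<subseteq> P" "is_place P" by (rule place_extension)
  have "(G m, of_int (target n d m)) \<in> P" for m
  proof -
    have "(?ev (Poly_Mapping.single (Poly_Mapping.single m 1) 1), ?et (Poly_Mapping.single (Poly_Mapping.single m 1) 1)) \<in> S0"
      unfolding S0_def by blast
    then show ?thesis using P(1) by (auto simp: poly_eval_single)
  qed
  then show thesis using that P(2) unfolding G_def by blast
qed

section \<open>Curves that join the generic point to a constant point\<close>

lemma poly_eval_closed: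
  assumes "0 \<in> C" "1 \<in> C" "\<And>x y. x \<in> C \<Longrightarrow> y \<in> C \<Longrightarrow> x + y \<in> C" "\<And>x y. x \<in> C \<Longrightarrow> y \<in> C \<Longrightarrow> x * y \<in> C"
    and "\<And>m. h (Poly_Mapping.lookup P m) \<in> C" "\<And>v. a v \<in> C"
  shows "poly_eval h a P \<in> C"
proof -
  have "a v ^ k \<in> C" for v k by (induction k) (simp_all add: assms)
  then have "(\<Prod>v\<in>A. a v ^ k v) \<in> C" for A k
    by (induction A rule: infinite_finite_induct) (simp_all add: assms)
  then have "mon_eval m a \<in> C" for m by (simp add: mon_eval_def)
  then have "(\<Sum>m\<in>A. h (Poly_Mapping.lookup P m) * mon_eval m a) \<in> C" for A
    by (induction A rule: infinite_finite_induct) (simp_all add: assms)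
  then show ?thesis by (simp add: poly_eval_def)
qed

definition fun_ring :: "complex set \<Rightarrow> ('x \<Rightarrow> complex) set \<Rightarrow> bool"
  where "fun_ring K C \<longleftrightarrow> (\<forall>c\<in>K. (\<lambda>_. c) \<in> C) \<and>
    (\<forall>f\<in>C. \<forall>g\<in>C. (\<lambda>x. f x + g x) \<in> C \<and> (\<lambda>x. f x * g x) \<in> C)"

lemma fun_ring_const: "fun_ring K C \<Longrightarrow> c \<in> K \<Longrightarrow> (\<lambda>_. c) \<in> C"
  and fun_ring_add: "fun_ring K C \<Longrightarrow> f \<in> C \<Longrightarrow> g \<in> C \<Longrightarrow> (\<lambda>x. f x + g x) \<in> C"
  and fun_ring_mult: "fun_ring K C \<Longrightarrow> f \<in> C \<Longrightarrow> g \<in> C \<Longrightarrow> (\<lambda>x. f x * g x) \<in> C"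
  unfolding fun_ring_def by blast+

lemma fun_ring_sum:
  "fun_ring K C \<Longrightarrow> 0 \<in> K \<Longrightarrow> (\<And>i. i \<in> A \<Longrightarrow> f i \<in> C) \<Longrightarrow> (\<lambda>x. \<Sum>i\<in>A. f i x) \<in> C"
  by (induction A rule: infinite_finite_induct) (simp_all add: fun_ring_const fun_ring_add)

lemma fun_ring_prod:
  "fun_ring K C \<Longrightarrow> 1 \<in> K \<Longrightarrow> (\<And>i. i \<in> A \<Longrightarrow> f i \<in> C) \<Longrightarrow> (\<lambda>x. \<Prod>i\<in>A. f i x) \<in> C"
  by (induction A rule: infinite_finite_induct) (simp_all add: fun_ring_const fun_ring_mult)

lemma fun_ring_power: "fun_ring K C \<Longrightarrow> 1 \<in> K \<Longrightarrow> f \<in> C \<Longrightarrow> (\<lambda>x. f x ^ k) \<in> C"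
  by (induction k) (simp_all add: fun_ring_const fun_ring_mult)

lemma fun_ring_poly_value:
  assumes C: "fun_ring K C" and K: "0 \<in> K" "1 \<in> K"
    and "\<And>m. Poly_Mapping.lookup P m \<in> K" "\<And>v. (\<lambda>x. y x v) \<in> C"
  shows "(\<lambda>x. poly_value P (y x)) \<in> C"
  unfolding poly_value_def monomial_value_def
  by (intro fun_ring_sum[OF C K(1)] fun_ring_mult[OF C] fun_ring_prod[OF C K(2)]
      fun_ring_power[OF C K(2)] fun_ring_const[OF C] assms)

context gauss_setup
begin

definition base_funs :: "((nat \<Rightarrow> complex) \<Rightarrow> complex) set"
  where "base_funs = {f. \<exists>A. coefrel n KK A A \<and> (\<forall>z. f z = poly_eval (\<lambda>c. c) z A)}"

text \<open>Regular functions over K on the affine chart of the cover where \<open>x 1\<close> and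
  \<open>t1\<close> are 1, with \<open>z 1\<close> in the role of \<open>t0\<close>. The
  representation p + q u is required on the cover only, where u^2 can be eliminated from
  products.\<close>

definition cover_funs :: "((nat \<Rightarrow> complex) \<times> complex \<Rightarrow> complex) set"
  where "cover_funs = {f. \<exists>p\<in>base_funs. \<exists>q\<in>base_funs. \<forall>z u. u\<^sup>2 = biform n I ex e0 e1 g (z(1 := 1)) (z 1) 1 \<longrightarrow>
    f (z, u) = p z + q z * u}"

lemma base_funs_I: "coefrel n KK A A \<Longrightarrow> (\<lambda>z. poly_eval (\<lambda>c. c) z A) \<in> base_funs"
  unfolding base_funs_def by blast

lemma base_funs_var: "i < n \<Longrightarrow> (\<lambda>z. z i) \<in> base_funs"
  using base_funs_I[OF coefrel_single[OF KK part_hom_one[OF KK], of "Poly_Mapping.single i 1"]]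
  by (simp add: poly_eval_single)

lemma fun_ring_base_funs: "fun_ring K base_funs"
  unfolding fun_ring_def
proof (intro conjI ballI)
  fix c assume "c \<in> K"
  then have "coefrel n KK (Poly_Mapping.single 0 c) (Poly_Mapping.single 0 c)"
    by (intro coefrel_single[OF KK]) (auto simp: KK_def)
  from base_funs_I[OF this] show "(\<lambda>_. c) \<in> base_funs" by (simp add: poly_eval_single)
next
  fix f h assume "f \<in> base_funs" "h \<in> base_funs"
  then obtain A B where A: "coefrel n KK A A" "f = (\<lambda>z. poly_eval (\<lambda>c. c) z A)"
    and B: "coefrel n KK B B" "h = (\<lambda>z. poly_eval (\<lambda>c. c) z B)"
    unfolding base_funs_def by blast
  have "coefrel n KK (A - (0 - B)) (A - (0 - B))"
    by (intro coefrel_diff[OF KK] A B) (simp add: coefrel_def part_hom_zero[OF KK])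
  from base_funs_I[OF this] show "(\<lambda>x. f x + h x) \<in> base_funs" unfolding A(2) B(2) by (simp add: poly_eval_add)
  from base_funs_I[OF coefrel_mult[OF KK A(1) B(1)]] show "(\<lambda>x. f x * h x) \<in> base_funs"
    unfolding A(2) B(2) by (simp add: poly_eval_mult)
qed

lemma cover_funs_I: "p \<in> base_funs \<Longrightarrow> q \<in> base_funs \<Longrightarrow> (\<lambda>x. p (fst x) + q (fst x) * snd x) \<in> cover_funs"
  unfolding cover_funs_def by auto

lemma cover_funs_base: "p \<in> base_funs \<Longrightarrow> (\<lambda>x. p (fst x)) \<in> cover_funs"
  using cover_funs_I[OF _ fun_ring_const[OF fun_ring_base_funs acl_field_0[OF K]]] by simp

lemma cover_funs_snd: "snd \<in> cover_funs"
  using cover_funs_I[OF fun_ring_const[OF fun_ring_base_funs acl_field_0[OF K]]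
    fun_ring_const[OF fun_ring_base_funs acl_field_1[OF K]]] by simp

lemma fun_ring_cover_funs: "fun_ring K cover_funs"
  unfolding fun_ring_def
proof (intro conjI ballI)
  fix c assume "c \<in> K"
  then show "(\<lambda>_. c) \<in> cover_funs"
    by (intro cover_funs_base[OF fun_ring_const[OF fun_ring_base_funs]])
next
  let ?Q = "\<lambda>z. biform n I ex e0 e1 g (z(1 := 1)) (z 1) 1"
  note F = fun_ring_base_funs
  have n1: "1 < n" using n3 by simp
  have var: "(\<lambda>z. (z(1 := 1)) i) \<in> base_funs" if "i < n" for i
    using base_funs_var[OF that] fun_ring_const[OF F acl_field_1[OF K]] by (cases "i = 1") simp_all
  have Q: "?Q \<in> base_funs"
    unfolding biform_def emon_def
    by (intro fun_ring_sum[OF F acl_field_0[OF K]] fun_ring_mult[OF F] fun_ring_prod[OF F acl_field_1[OF K]]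
        fun_ring_power[OF F acl_field_1[OF K]] fun_ring_const[OF F] acl_field_1[OF K] var base_funs_var[OF n1])
      (use g in auto)
  fix f h assume "f \<in> cover_funs" "h \<in> cover_funs"
  then obtain p q r s where pq: "p \<in> base_funs" "q \<in> base_funs" "\<And>z u. u\<^sup>2 = ?Q z \<Longrightarrow> f (z, u) = p z + q z * u"
    and rs: "r \<in> base_funs" "s \<in> base_funs" "\<And>z u. u\<^sup>2 = ?Q z \<Longrightarrow> h (z, u) = r z + s z * u"
    unfolding cover_funs_def by blast
  have "(\<lambda>z. p z + r z) \<in> base_funs" "(\<lambda>z. q z + s z) \<in> base_funs"
    by (intro fun_ring_add[OF F] pq rs)+
  moreover have "f (z, u) + h (z, u) = (p z + r z) + (q z + s z) * u" if "u\<^sup>2 = ?Q z" for z u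
    unfolding pq(3)[OF that] rs(3)[OF that] by (simp add: algebra_simps)
  ultimately show "(\<lambda>x. f x + h x) \<in> cover_funs"
    unfolding cover_funs_def mem_Collect_eq
    by (intro bexI[of _ "\<lambda>z. p z + r z"] bexI[of _ "\<lambda>z. q z + s z"]) blast+
  have "(\<lambda>z. p z * r z + q z * s z * ?Q z) \<in> base_funs" "(\<lambda>z. p z * s z + q z * r z) \<in> base_funs"
    by (intro fun_ring_add[OF F] fun_ring_mult[OF F] pq rs Q)+
  moreover have "f (z, u) * h (z, u) = (p z * r z + q z * s z * ?Q z) + (p z * s z + q z * r z) * u" if "u\<^sup>2 = ?Q z" for z u
    unfolding pq(3)[OF that] rs(3)[OF that] that[symmetric] by (simp add: algebra_simps power2_eq_square)
  ultimately show "(\<lambda>x. f x * h x) \<in> cover_funs"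
    unfolding cover_funs_def mem_Collect_eq
    by (intro bexI[of _ "\<lambda>z. p z * r z + q z * s z * ?Q z"] bexI[of _ "\<lambda>z. p z * s z + q z * r z"]) blast+
qed

text \<open>If \<open>w\<close> were 0, then v would be 0 as well, which is a relation excluded by
  \<open>gen\<close>.\<close>

lemma w_neq_0: "w \<noteq> 0"
proof
  assume "w = 0"
  then have "(0, v\<^sup>2) \<in> S1" using w2_S1 by simp
  then have "v\<^sup>2 = 0" by (rule part_hom_zeroD[OF S1])
  then have "poly_eval kconst b 0 + poly_eval kconst b 1 * v = 0" by simp
  then have "(1 :: 'k cpoly) = 0" using gen by blast
  then show False by simp
qed

lemma cover_funs_R: "f \<in> cover_funs \<Longrightarrow> f (a, w) \<in> R"
  using w unfolding cover_funs_def base_funs_def R_def R1_def by blast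

text \<open>The points (a, w) and (a, - w) lie over a generic point of the base. Vanishing at both
  gives p = q = 0 at a, since \<open>w\<close> is not 0, and then everywhere, since a is
  algebraically independent.\<close>

lemma cover_funs_vanish:
  assumes f: "f \<in> cover_funs" and "f (a, w) = 0" "f (a, - w) = 0"
    and u: "u\<^sup>2 = biform n I ex e0 e1 g (z(1 := 1)) (z 1) 1"
  shows "f (z, u) = 0"
proof -
  obtain A B where A: "coefrel n KK A A" and B: "coefrel n KK B B"
    and fe: "\<And>z u. u\<^sup>2 = biform n I ex e0 e1 g (z(1 := 1)) (z 1) 1 \<Longrightarrow>
      f (z, u) = poly_eval (\<lambda>c. c) z A + poly_eval (\<lambda>c. c) z B * u"
    using f unfolding cover_funs_def base_funs_def by auto
  have 1: "poly_eval (\<lambda>c. c) a A + poly_eval (\<lambda>c. c) a B * w = 0"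
    using fe[OF w] assms(2) by simp
  have 2: "poly_eval (\<lambda>c. c) a A - poly_eval (\<lambda>c. c) a B * w = 0"
    using fe[of "- w" a] w assms(3) by simp
  have "x = 0 \<and> y = 0" if "x + y = 0" "x - y = 0" for x y :: complex
    using that by (simp add: add_eq_0_iff)
  from this[OF 1 2] have "poly_eval (\<lambda>c. c) a A = 0" "poly_eval (\<lambda>c. c) a B = 0"
    using w_neq_0 by (simp_all only: mult_eq_0_iff simp_thms)
  moreover have "D = 0" if "coefrel n KK D D" "poly_eval (\<lambda>c. c) a D = 0" for D
  proof -
    have "range (Poly_Mapping.lookup D) \<subseteq> K" using that(1) by (auto simp: coefrel_def KK_def)
    then show ?thesis using a that unfolding alg_indep_def coefrel_def by metis
  qed
  ultimately have "A = 0" "B = 0" using A B by blast+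
  then show ?thesis using fe[OF u] by simp
qed

end

section \<open>Restriction of the maps of a parametrisation to a line\<close>

definition cover_cone :: "nat \<Rightarrow> nat \<Rightarrow> (coord monomial \<Rightarrow> complex) \<Rightarrow> (coord \<Rightarrow> complex) set"
  where "cover_cone n d F = {x \<in> bundle_cone n. (x WC)\<^sup>2 = form_value n (2 * d) 2 F x}"

lemma biform_coeff_mult: "biform n I ex e0 e1 (\<lambda>m. c * g m) x t0 t1 = c * biform n I ex e0 e1 g x t0 t1"
  by (simp add: biform_def sum_distrib_left mult.assoc)

lemma biform_cong: "(\<And>i. i < n \<Longrightarrow> x i = y i) \<Longrightarrow> biform n I ex e0 e1 g x t0 t1 = biform n I ex e0 e1 g y t0 t1"
  by (simp add: biform_def emon_def)

lemma comm_ring_hom_eval: "comm_ring_hom (\<lambda>p :: 'r::comm_ring_1 poly. poly p t)"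
  by unfold_locales auto

lemma comm_ring_hom_const_poly: "comm_ring_hom (\<lambda>c :: 'r::comm_ring_1. [:c:])"
  by unfold_locales (auto simp: one_pCons)

lemma comm_ring_hom_kconst: "comm_ring_hom (kconst :: 'k::field \<Rightarrow> 'k laurent)"
  by unfold_locales (simp_all add: kconst_add kconst_mult)

text \<open>\<Psi> is a left inverse of \<Phi> up to the torus. The line through the images under
  \<Phi> of a generic point and of the constant point a0 is sent by \<Psi> to a curve in the cover
  that joins these points, which \<open>no_curve_to_K\<close> excludes.\<close>

lemma no_parametrisation:
  fixes \<Phi> :: "nat \<Rightarrow> coord Defs.polynomial" and \<Psi> :: "coord \<Rightarrow> nat Defs.polynomial"
  assumes n3: "n \<ge> 3" and dn: "2 * d \<ge> n" and good: "good_form n d F"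
    and N: "\<And>j. j > N \<Longrightarrow> \<Phi> j = 0"
    and a0: "a0 \<in> cover_cone n d F" "poly_value P0 a0 \<noteq> 0" "a0 (XC 1) \<noteq> 0" "a0 (TC 1) \<noteq> 0"
    and fwd: "\<And>y. y \<in> cover_cone n d F \<Longrightarrow> poly_value P0 y \<noteq> 0 \<Longrightarrow>
      (\<lambda>j. poly_value (\<Phi> j) y) \<noteq> (\<lambda>_. 0) \<and> poly_value Q0 (\<lambda>j. poly_value (\<Phi> j) y) \<noteq> 0 \<and>
      (\<lambda>c. poly_value (\<Psi> c) (\<lambda>j. poly_value (\<Phi> j) y)) \<in> torus_orbit d y"
    and bwd: "\<And>z. z \<in> affine_space {..N} \<Longrightarrow> z \<noteq> (\<lambda>_. 0) \<Longrightarrow> poly_value Q0 z \<noteq> 0 \<Longrightarrow>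
      (\<lambda>c. poly_value (\<Psi> c) z) \<in> cover_cone n d F"
  shows False
proof -
  define I where "I = bimonomials n (2 * d) 2"
  define V where "V = XC ` {..<n} \<union> {TC 0, TC 1, WC}"
  define G where "G m = F m / F (lead_mon n d)" for m
  have F0: "F (lead_mon n d) \<noteq> 0" using good by (simp add: good_form_def)
  have n1: "1 < n" using n3 by simp
  obtain P :: "(complex \<times> bit alg_closure) set" where P: "is_place P" "\<And>m. (G m, of_int (target n d m)) \<in> P"
    using good_form_place[OF good] unfolding G_def by blast
  \<comment> \<open>K is to contain the coefficients of the form and of the maps and the coordinates
    of a0, so that a0 and its image are constant points.\<close>
  define S0 where "S0 = F ` I \<union> a0 ` V \<union> Poly_Mapping.lookup P0 ` Poly_Mapping.keys P0 \<union>
    (\<Union>j. Poly_Mapping.lookup (\<Phi> j) ` Poly_Mapping.keys (\<Phi> j)) \<union>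
    (\<Union>c\<in>V. Poly_Mapping.lookup (\<Psi> c) ` Poly_Mapping.keys (\<Psi> c))"
  have "countable S0"
    unfolding S0_def I_def V_def by (intro countable_Un countable_UN) (simp_all add: countable_finite finite_bimonomials)
  then obtain K where K: "acl_field K" "countable K" "S0 \<subseteq> K" by (rule countable_acl_field_exists)
  note K01 = acl_field_0[OF K(1)] acl_field_1[OF K(1)]
  have lookupK: "Poly_Mapping.lookup p m \<in> K" if "Poly_Mapping.lookup p ` Poly_Mapping.keys p \<subseteq> S0"
    for p :: "'x \<Rightarrow>\<^sub>0 complex" and m
  proof (cases "m \<in> Poly_Mapping.keys p")
    case True
    then show ?thesis using that K(3) by blast
  next
    case False
    then show ?thesis using K01 by (simp add: in_keys_iff)
  qed
  have P0K: "Poly_Mapping.lookup P0 m \<in> K" for m by (rule lookupK) (auto simp: S0_def)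
  have \<Phi>K: "Poly_Mapping.lookup (\<Phi> j) m \<in> K" for j m by (rule lookupK) (auto simp: S0_def)
  have \<Psi>K: "Poly_Mapping.lookup (\<Psi> c) m \<in> K" if "c \<in> V" for c m by (rule lookupK) (use that in \<open>auto simp: S0_def\<close>)
  have FK: "F m \<in> K" if "m \<in> I" for m using that K(3) by (auto simp: S0_def)
  have lead: "lead_mon n d \<in> I"
    unfolding lead_mon_def I_def using sum_exps[OF n3 dn, of n] by (intro bimon_in_bimonomials) auto
  have GK: "G m \<in> K" if "m \<in> I" for m unfolding G_def by (rule acl_field_divide[OF K(1) FK[OF that] FK[OF lead]])
  have a0V: "v \<in> V \<or> a0 v = 0" for v
  proof -
    have "V = XC ` {..<n} \<union> TC ` {..<2} \<union> {WC}" by (auto simp: V_def numeral_2_eq_2 lessThan_Suc)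
    then show ?thesis using a0(1) by (auto simp: cover_cone_def bundle_cone_def affine_space_def)
  qed
  have a0K: "a0 v \<in> K" for v
  proof (cases "v \<in> V")
    case True
    then have "a0 v \<in> S0" unfolding S0_def by blast
    then show ?thesis using K(3) by blast
  next
    case False
    then show ?thesis using a0V[of v] K01(1) by simp
  qed
  \<comment> \<open>Dividing F by its leading coefficient, which makes the coefficients integral for
    P, rescales the fibre coordinate by this root.\<close>
  define s where "s = csqrt (F (lead_mon n d))"
  have s2: "s\<^sup>2 = F (lead_mon n d)" by (simp add: s_def)
  have s0: "s \<noteq> 0" using s2 F0 by auto
  have sK: "s \<in> K" by (rule acl_field_root[OF K(1) FK[OF lead] _ s2]) simp
  have FG: "F = (\<lambda>m. s\<^sup>2 * G m)" using F0 by (simp add: G_def s2)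
  obtain a where a: "alg_indep n K a" using alg_indep_exists[OF K(1,2)] .
  obtain b :: "nat \<Rightarrow> bit alg_closure laurent" and v where gp: "v\<^sup>2 = conic_form n d (b(1 := 1)) (b 1) 1"
      "\<forall>A B. poly_eval kconst b A + poly_eval kconst b B * v = 0 \<longrightarrow> A = 0 \<and> B = 0"
      "\<forall>c. c \<noteq> 0 \<longrightarrow> omega n dlaurent (\<lambda>i. c * (b(1 := 1)) i) \<noteq> 0"
    using generic_point[OF char2_alg_closure_bit n3 dn] by metis
  define gk where "gk m = (of_int (target n d m) :: bit alg_closure)" for m
  have gk1: "kconst (gk m) = of_int (target n d m)" for m
    unfolding gk_def by (rule comm_ring_hom_of_int[OF comm_ring_hom_kconst])
  have gk2: "[:kconst (gk m):] = of_int (target n d m)" for m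
    unfolding gk1 by (rule comm_ring_hom_of_int[OF comm_ring_hom_const_poly])
  let ?Q = "\<lambda>z. cform n d G (z(1 := 1)) (z 1) 1"
  have gs: "gauss_setup K P n d I expX (expT 0) (expT 1) G gk a w b v" if "w\<^sup>2 = ?Q a" for w
  proof
    show "biform n I expX (expT 0) (expT 1) (\<lambda>m. [:kconst (gk m):]) x t0 t1 = conic_form n d x t0 t1" for x t0 t1
      unfolding gk2 I_def by (rule biform_target[OF n3 dn])
    show "biform n I expX (expT 0) (expT 1) (\<lambda>m. kconst (gk m)) x t0 t1 = conic_form n d x t0 t1" for x t0 t1
      unfolding gk1 I_def by (rule biform_target[OF n3 dn])
    show "A = 0 \<and> B = 0" if "poly_eval kconst b A + poly_eval kconst b B * v = 0" for A B
      using gp(2) that by blast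
    show "G m \<in> K \<and> (G m, gk m) \<in> P" if "m \<in> I" for m using GK[OF that] P(2) by (simp add: gk_def)
    show "w\<^sup>2 = biform n I expX (expT 0) (expT 1) G (a(1 := 1)) (a 1) 1" using \<open>w\<^sup>2 = ?Q a\<close> by (simp add: I_def)
    show "finite I" unfolding I_def by (rule finite_bimonomials)
  qed (use K P n3 dn a gp(1) char2_alg_closure_bit bimonomials_sums in \<open>auto simp: I_def\<close>)
  \<comment> \<open>The chart is rescaled so that a0 itself, and not only a point of its orbit,
    becomes a value of \<open>pt\<close>. The polynomial \<open>P0\<close> need not be invariant
    under the torus.\<close>
  define l1 k1 where "l1 = a0 (XC 1)" and "k1 = a0 (TC 1)"
  have lk: "l1 \<noteq> 0" "k1 \<noteq> 0" "l1 \<in> K" "k1 \<in> K" using a0(3,4) a0K by (auto simp: l1_def k1_def)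
  define pt :: "(nat \<Rightarrow> complex) \<times> complex \<Rightarrow> coord \<Rightarrow> complex"
    where "pt x c = (case c of XC i \<Rightarrow> if i < n then l1 * ((fst x)(1 := 1)) i else 0
      | TC j \<Rightarrow> if j = 0 then k1 * fst x 1 else if j = 1 then k1 else 0
      | WC \<Rightarrow> l1 ^ d * k1 * s * snd x)" for x c
  have pt_F: "form_value n (2 * d) 2 F (pt x) = (l1 ^ d * k1 * s)\<^sup>2 * ?Q (fst x)" for x
  proof -
    have "form_value n (2 * d) 2 F (pt x) = cform n d F (\<lambda>i. l1 * ((fst x)(1 := 1)) i) (k1 * fst x 1) (k1 * 1)"
    proof -
      have T: "pt x (TC 0) = k1 * fst x 1" "pt x (TC 1) = k1 * 1" by (simp_all add: pt_def)
      have X: "pt x (XC i) = l1 * ((fst x)(1 := 1)) i" if "i < n" for i using that by (simp add: pt_def)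
      show ?thesis unfolding form_value_eq T by (rule biform_cong) (rule X)
    qed
    also have "\<dots> = (l1 ^ d * k1)\<^sup>2 * cform n d F ((fst x)(1 := 1)) (fst x 1) 1"
      using bimonomials_sums by (rule biform_scale)
    also have "cform n d F ((fst x)(1 := 1)) (fst x 1) 1 = s\<^sup>2 * ?Q (fst x)"
      by (subst FG) (rule biform_coeff_mult)
    finally show ?thesis by (simp add: power_mult_distrib)
  qed
  have pt_cone: "pt (z, u) \<in> cover_cone n d F" if "u\<^sup>2 = ?Q z" for z u
  proof -
    have "pt (z, u) \<in> bundle_cone n"
    proof -
      have "pt (z, u) (XC 1) \<noteq> 0" "pt (z, u) (TC 1) \<noteq> 0" using lk n1 by (simp_all add: pt_def)
      moreover have "pt (z, u) \<in> affine_space (XC ` {..<n} \<union> TC ` {..<2} \<union> {WC})"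
        unfolding affine_space_def pt_def by (auto split: coord.split)
      ultimately show ?thesis unfolding bundle_cone_def using n1 by (auto intro: exI[of _ "1::nat"])
    qed
    moreover have "(pt (z, u) WC)\<^sup>2 = (l1 ^ d * k1 * s)\<^sup>2 * u\<^sup>2" by (simp add: pt_def power_mult_distrib)
    ultimately show ?thesis unfolding cover_cone_def using that by (simp add: pt_F)
  qed
  have pt_coord: "(\<lambda>x. pt x c) \<in> gauss_setup.cover_funs K n I expX (expT 0) (expT 1) G" if "w\<^sup>2 = ?Q a" for w c
  proof -
    interpret gauss_setup K P n d I expX "expT 0" "expT 1" G gk a w b v by (rule gs[OF that])
    note C = fun_ring_cover_funs
    have base: "(\<lambda>x. fst x i) \<in> cover_funs" if "i < n" for i by (rule cover_funs_base[OF base_funs_var[OF that]])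
    show ?thesis
    proof (cases c)
      case (XC i)
      have "(\<lambda>x. l1 * fst x i) \<in> cover_funs" if "i < n"
        by (intro fun_ring_mult[OF C] fun_ring_const[OF C] lk base that)
      then show ?thesis using XC fun_ring_const[OF C K01(1)] fun_ring_const[OF C lk(3)]
        by (cases "i < n"; cases "i = 1") (simp_all add: pt_def)
    next
      case (TC j)
      have "(\<lambda>x. k1 * fst x 1) \<in> cover_funs" by (intro fun_ring_mult[OF C] fun_ring_const[OF C] lk base n1)
      then show ?thesis using TC fun_ring_const[OF C K01(1)] fun_ring_const[OF C lk(4)]
        by (cases "j = 0"; cases "j = 1") (simp_all add: pt_def)
    next
      case WC
      have "(\<lambda>x. l1 ^ d * k1 * s * snd x) \<in> cover_funs"
        by (intro fun_ring_mult[OF C] fun_ring_const[OF C] cover_funs_snd acl_field_mult[OF K(1)] acl_field_power[OF K(1)] lk sK)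
      then show ?thesis using WC by (simp add: pt_def)
    qed
  qed
  \<comment> \<open>The cover has two points over a, and \<open>P0\<close> might vanish at one of
    them. If it vanished at both, it would vanish on the whole chart and hence at a0.\<close>
  have "\<exists>w. w\<^sup>2 = ?Q a \<and> poly_value P0 (pt (a, w)) \<noteq> 0"
  proof (rule ccontr)
    assume no: "\<nexists>w. w\<^sup>2 = ?Q a \<and> poly_value P0 (pt (a, w)) \<noteq> 0"
    define w where "w = csqrt (?Q a)"
    have hw: "w\<^sup>2 = ?Q a" unfolding w_def by (rule power2_csqrt)
    interpret gauss_setup K P n d I expX "expT 0" "expT 1" G gk a w b v by (rule gs[OF hw])
    define z where "z i = (if i = 1 then a0 (TC 0) / k1 else a0 (XC i) / l1)" for i
    define u where "u = a0 WC / (l1 ^ d * k1 * s)"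
    have "a0 \<in> affine_space (XC ` {..<n} \<union> TC ` {..<2} \<union> {WC})" using a0(1) by (simp add: cover_cone_def bundle_cone_def)
    then have out: "a0 c = 0" if "c \<notin> XC ` {..<n} \<union> TC ` {..<2} \<union> {WC}" for c
      using that unfolding affine_space_def by blast
    have ptz: "pt (z, u) = a0"
    proof
      fix c show "pt (z, u) c = a0 c"
      proof (cases c)
        case (XC i)
        then show ?thesis using out[of c] lk by (auto simp: pt_def z_def l1_def)
      next
        case (TC j)
        have "TC j \<notin> XC ` {..<n} \<union> TC ` {..<2} \<union> {WC}" if "j \<noteq> 0" "j \<noteq> 1" using that by auto
        then show ?thesis using out[of c] TC lk by (cases "j = 0"; cases "j = 1") (simp_all add: pt_def z_def k1_def)
      next
        case WC
        then show ?thesis using lk s0 by (simp add: pt_def u_def)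
      qed
    qed
    have "(l1 ^ d * k1 * s * u)\<^sup>2 = (l1 ^ d * k1 * s)\<^sup>2 * ?Q z"
      using a0(1) pt_F[of "(z, u)"] ptz by (simp add: cover_cone_def u_def)
    then have uz: "u\<^sup>2 = ?Q z" using lk s0 by (simp add: power_mult_distrib)
    have "(- w)\<^sup>2 = ?Q a" using hw by simp
    then have "poly_value P0 (pt (a, w)) = 0" "poly_value P0 (pt (a, - w)) = 0" using no hw by blast+
    moreover have "(\<lambda>x. poly_value P0 (pt x)) \<in> cover_funs"
      by (rule fun_ring_poly_value[OF fun_ring_cover_funs K01 P0K pt_coord[OF hw]])
    ultimately have "poly_value P0 (pt (z, u)) = 0"
      using cover_funs_vanish[of "\<lambda>x. poly_value P0 (pt x)" u z] uz by (simp add: I_def)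
    then show False using a0(2) ptz by simp
  qed
  then obtain w where hw: "w\<^sup>2 = ?Q a" and P0w: "poly_value P0 (pt (a, w)) \<noteq> 0" by blast
  interpret gauss_setup K P n d I expX "expT 0" "expT 1" G gk a w b v by (rule gs[OF hw])
  define y where "y = pt (a, w)"
  have y: "y \<in> cover_cone n d F" unfolding y_def by (rule pt_cone[OF hw])
  define Z Y where "Z j = poly_value (\<Phi> j) y" and "Y j = poly_value (\<Phi> j) a0" for j
  have Z: "Z \<noteq> (\<lambda>_. 0)" "poly_value Q0 Z \<noteq> 0" "(\<lambda>c. poly_value (\<Psi> c) Z) \<in> torus_orbit d y"
    using fwd[OF y] P0w unfolding y_def Z_def by simp_all
  have Y: "Y \<noteq> (\<lambda>_. 0)" "poly_value Q0 Y \<noteq> 0"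
    using fwd[OF a0(1,2)] unfolding Y_def by simp_all
  have ZN: "Z j = 0" "Y j = 0" if "j > N" for j using N[OF that] by (simp_all add: Z_def Y_def poly_value_def)
  have KC: "poly_value p x \<in> K" if "\<And>m. Poly_Mapping.lookup p m \<in> K" "\<And>v. x v \<in> K" for p :: "'v Defs.polynomial" and x
    unfolding poly_value_eq_poly_eval
  proof (rule poly_eval_closed)
    show "u + u' \<in> K" "u * u' \<in> K" if "u \<in> K" "u' \<in> K" for u u'
      using that by (rule acl_field_add[OF K(1)], rule acl_field_mult[OF K(1)])
  qed (rule K01 that)+
  have YK: "Y j \<in> K" for j unfolding Y_def by (rule KC[OF \<Phi>K a0K])
  have ZR: "Z j \<in> R" for j
    using cover_funs_R[OF fun_ring_poly_value[OF fun_ring_cover_funs K01 \<Phi>K pt_coord[OF hw]]]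
    unfolding Z_def y_def .
  \<comment> \<open>The line from the image Z of the generic point, at parameter 0, to the image Y
    of a0, at parameter 1.\<close>
  define L where "L j = [:Z j, Y j - Z j:]" for j
  have LR: "coeff (L j) i \<in> R" for i j
    unfolding L_def using ZR R_ring(1)[OF K_R[OF YK] ZR] K_R[OF K01(1)] by (simp add: coeff_pCons split: nat.split)
  define H where "H p = poly_eval (\<lambda>c. [:c:]) L p" for p
  have HR: "coeff (H p) i \<in> R" if "\<And>m. Poly_Mapping.lookup p m \<in> K" for p i
  proof -
    have "H p \<in> {q. \<forall>i. coeff q i \<in> R}"
      unfolding H_def
    proof (rule poly_eval_closed)
      show "1 \<in> {q. \<forall>i. coeff q i \<in> R}" using coeff_R_const[OF K_R[OF K01(2)]] by (simp add: one_pCons)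
      show "[:Poly_Mapping.lookup p m:] \<in> {q. \<forall>i. coeff q i \<in> R}" for m
        using coeff_R_const[OF K_R[OF that]] by blast
    qed (use LR K_R[OF K01(1)] coeff_R_add coeff_R_mult in auto)
    then show ?thesis by blast
  qed
  have Hev: "poly (H p) t = poly_value p (\<lambda>j. poly (L j) t)" for p t
    unfolding H_def poly_value_eq_poly_eval using poly_eval_hom[OF comm_ring_hom_eval[of t], of "\<lambda>c. [:c:]" L p] by simp
  have L0: "(\<lambda>j. poly (L j) 0) = Z" and L1: "(\<lambda>j. poly (L j) 1) = Y" by (simp_all add: L_def)
  have aff: "(\<lambda>j. poly (L j) t) \<in> affine_space {..N}" for t
    unfolding affine_space_def L_def using ZN by simp
  have cone: "(\<lambda>c. poly (H (\<Psi> c)) t) \<in> cover_cone n d F" if "(\<lambda>j. poly (L j) t) \<noteq> (\<lambda>_. 0)" "poly (H Q0) t \<noteq> 0" for t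
    unfolding Hev by (rule bwd[OF aff that(1)]) (use that(2) in \<open>simp add: Hev\<close>)
  define X T0 T1 W where "X i = H (\<Psi> (XC i))" and "T0 = H (\<Psi> (TC 0))" and "T1 = H (\<Psi> (TC 1))"
    and "W = Polynomial.smult (1 / s) (H (\<Psi> WC))" for i
  obtain l k where lk': "l \<noteq> 0" "k \<noteq> 0" "(\<lambda>c. poly_value (\<Psi> c) Z) = torus_act d l k y"
    using Z(3) unfolding torus_orbit_def by blast
  have H0: "poly (H (\<Psi> c)) 0 = torus_act d l k y c" for c
    unfolding Hev L0 using fun_cong[OF lk'(3)] by simp
  have V: "XC i \<in> V" "TC 0 \<in> V" "TC 1 \<in> V" "WC \<in> V" if "i < n" for i using that by (auto simp: V_def)
  have XR: "coeff (X i) j \<in> R" if "i < n" for i j unfolding X_def by (rule HR[OF \<Psi>K[OF V(1)[OF that]]])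
  have T0R: "coeff T0 j \<in> R" for j unfolding T0_def by (rule HR[OF \<Psi>K[OF V(2)[OF n1]]])
  have T1R: "coeff T1 j \<in> R" for j unfolding T1_def by (rule HR[OF \<Psi>K[OF V(3)[OF n1]]])
  have WR: "coeff W j \<in> R" for j
    unfolding W_def coeff_smult by (rule R_ring(2)[OF K_R[OF acl_field_divide[OF K(1) K01(2) sK]] HR[OF \<Psi>K[OF V(4)[OF n1]]]])
  have "poly T1 0 \<noteq> 0" unfolding T1_def H0 using lk' lk by (simp add: y_def pt_def)
  then have T: "T0 \<noteq> 0 \<or> T1 \<noteq> 0" by auto
  have X0: "coeff (X i) 0 = (l * l1) * (a(1 := 1)) i" if "i < n" for i
    using H0[of "XC i"] that unfolding X_def by (simp add: poly_0_coeff_0 y_def pt_def)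
  have X1: "poly (X i) 1 \<in> K" if "i < n" for i
    unfolding X_def Hev L1 by (rule KC[OF \<Psi>K[OF V(1)[OF that]] YK])
  have "(\<lambda>c. poly (H (\<Psi> c)) 1) \<in> cover_cone n d F" by (rule cone) (use Y in \<open>simp_all add: L1 Hev\<close>)
  then have X1nz: "\<exists>i<n. poly (X i) 1 \<noteq> 0" by (simp add: cover_cone_def bundle_cone_def X_def)
  \<comment> \<open>The equation is known at parameters where the line avoids the origin and the
    zeros of \<open>Q0\<close>. A nonzero polynomial that vanishes at all other parameters turns it
    into an identity of polynomials.\<close>
  have WH: "(H (\<Psi> WC))\<^sup>2 = cform n d (\<lambda>m. [:F m:]) X T0 T1"
  proof -
    define E where "E = (H (\<Psi> WC))\<^sup>2 - cform n d (\<lambda>m. [:F m:]) X T0 T1"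
    obtain j where j: "Z j \<noteq> 0" using Z(1) by blast
    have nz: "L j \<noteq> 0" "H Q0 \<noteq> 0"
      using j Z(2) Hev[of Q0 0] unfolding L0 by (auto simp: L_def)
    have "poly (E * (L j * H Q0)) t = 0" for t
    proof (cases "poly (L j) t = 0 \<or> poly (H Q0) t = 0")
      case True
      then show ?thesis by auto
    next
      case False
      then have "(\<lambda>j. poly (L j) t) \<noteq> (\<lambda>_. 0)" "poly (H Q0) t \<noteq> 0" by (auto dest: fun_cong)
      from cone[OF this] have "(poly (H (\<Psi> WC)) t)\<^sup>2 = cform n d F (\<lambda>i. poly (X i) t) (poly T0 t) (poly T1 t)"
        by (simp add: cover_cone_def form_value_eq X_def T0_def T1_def)
      also have "\<dots> = poly (cform n d (\<lambda>m. [:F m:]) X T0 T1) t"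
        by (subst comm_ring_hom_biform[OF comm_ring_hom_eval[of t]]) simp
      finally have "poly E t = 0" by (simp add: E_def)
      then show ?thesis by simp
    qed
    then have "E * (L j * H Q0) = 0" using poly_all_0_iff_0 by blast
    then have "E = 0" using nz by (simp only: mult_eq_0_iff simp_thms)
    then show ?thesis by (simp add: E_def)
  qed
  have "W\<^sup>2 = [:1 / s\<^sup>2:] * (H (\<Psi> WC))\<^sup>2"
    by (simp add: W_def power2_eq_square)
  also have "\<dots> = [:1 / s\<^sup>2:] * ([:s\<^sup>2:] * cform n d (\<lambda>m. [:G m:]) X T0 T1)"
    unfolding WH biform_coeff_mult[symmetric] by (subst FG) simp
  also have "\<dots> = biform n I expX (expT 0) (expT 1) (\<lambda>m. [:G m:]) X T0 T1" using s0 by (simp add: I_def)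
  finally have W2: "W\<^sup>2 = biform n I expX (expT 0) (expT 1) (\<lambda>m. [:G m:]) X T0 T1" .
  have ll1: "l * l1 \<noteq> 0" using lk' lk by simp
  have om: "omega n dlaurent (\<lambda>i. c * (b(1 := 1)) i) \<noteq> 0" if "c \<noteq> 0" for c using gp(3) that by blast
  show False
    by (rule no_curve_to_K[OF om XR T0R T1R T WR W2 ll1 X0 X1 X1nz])
qed

section \<open>Local rational functions on quotients and products\<close>

lemma poly_value_add [simp]: "poly_value (p + q) x = poly_value p x + poly_value q x"
  by (simp add: poly_value_eq_poly_eval poly_eval_add)

lemma poly_value_mult [simp]: "poly_value (p * q) x = poly_value p x * poly_value q x"
  by (simp add: poly_value_eq_poly_eval poly_eval_mult)

lemma poly_value_const [simp]: "poly_value (Poly_Mapping.single 0 c) x = c"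
  by (simp add: poly_value_eq_poly_eval poly_eval_single)

lemma poly_value_1 [simp]: "poly_value 1 x = 1"
  using poly_value_const[of 1 x] by simp

lemma poly_value_0 [simp]: "poly_value 0 x = 0"
  by (simp add: poly_value_def)

lemma poly_value_power [simp]: "poly_value (p ^ k) x = poly_value p x ^ k"
  by (induction k) simp_all

lemma poly_value_prod [simp]: "poly_value (\<Prod>i\<in>A. p i) x = (\<Prod>i\<in>A. poly_value (p i) x)"
  by (induction A rule: infinite_finite_induct) simp_all

lemma poly_value_var: "poly_value (Poly_Mapping.single (Poly_Mapping.single v 1) 1) x = x v"
  by (simp add: poly_value_eq_poly_eval poly_eval_single)

text \<open>A germ of a rational function at a: one polynomial is both the denominator and the
  equation of the complement of the neighbourhood.\<close>

definition loc_rat :: "('v \<Rightarrow> complex) set \<Rightarrow> ('v \<Rightarrow> complex) \<Rightarrow> (('v \<Rightarrow> complex) \<Rightarrow> complex) \<Rightarrow> bool"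
  where "loc_rat S a f \<longleftrightarrow> (\<exists>p q. poly_value q a \<noteq> 0 \<and> (\<forall>x\<in>S. poly_value q x \<noteq> 0 \<longrightarrow> f x = poly_value p x / poly_value q x))"

definition loc_open :: "('v \<Rightarrow> complex) set \<Rightarrow> ('v \<Rightarrow> complex) \<Rightarrow> ('v \<Rightarrow> complex) set \<Rightarrow> bool"
  where "loc_open S a T \<longleftrightarrow> (\<exists>q. poly_value q a \<noteq> 0 \<and> (\<forall>x\<in>S. poly_value q x \<noteq> 0 \<longrightarrow> x \<in> T))"

lemma loc_openI: "poly_value q a \<noteq> 0 \<Longrightarrow> (\<And>x. x \<in> S \<Longrightarrow> poly_value q x \<noteq> 0 \<Longrightarrow> x \<in> T) \<Longrightarrow> loc_open S a T"
  unfolding loc_open_def by blast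

lemma loc_open_mono: "loc_open S a T \<Longrightarrow> (\<And>x. x \<in> S \<Longrightarrow> x \<in> T \<Longrightarrow> x \<in> T') \<Longrightarrow> loc_open S a T'"
  unfolding loc_open_def by meson

lemma loc_open_Int:
  assumes "loc_open S a T" "loc_open S a T'" shows "loc_open S a (T \<inter> T')"
proof -
  obtain q where q: "poly_value q a \<noteq> 0" "\<forall>x\<in>S. poly_value q x \<noteq> 0 \<longrightarrow> x \<in> T"
    using assms(1) unfolding loc_open_def by blast
  obtain q' where q': "poly_value q' a \<noteq> 0" "\<forall>x\<in>S. poly_value q' x \<noteq> 0 \<longrightarrow> x \<in> T'"
    using assms(2) unfolding loc_open_def by blast
  show ?thesis by (rule loc_openI[of "q * q'"]) (use q q' in simp_all)
qed

lemma loc_ratI: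
  assumes T: "loc_open S a T" and q: "poly_value q a \<noteq> 0"
    and f: "\<And>x. x \<in> S \<Longrightarrow> x \<in> T \<Longrightarrow> poly_value q x \<noteq> 0 \<Longrightarrow> f x = poly_value p x / poly_value q x"
  shows "loc_rat S a f"
proof -
  obtain r where r: "poly_value r a \<noteq> 0" "\<forall>x\<in>S. poly_value r x \<noteq> 0 \<longrightarrow> x \<in> T"
    using T unfolding loc_open_def by blast
  have "f x = poly_value (p * r) x / poly_value (q * r) x" if "x \<in> S" "poly_value (q * r) x \<noteq> 0" for x
    using f[OF that(1)] r(2) that by simp
  moreover have "poly_value (q * r) a \<noteq> 0" using q r by simp
  ultimately show ?thesis unfolding loc_rat_def by blast
qed

lemma loc_open_UNIV: "loc_open S a UNIV"
  by (rule loc_openI[of 1]) simp_all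

lemma loc_rat_const: "loc_rat S a (\<lambda>_. c)"
  by (rule loc_ratI[OF loc_open_UNIV, where q = 1 and p = "Poly_Mapping.single 0 c"]) simp_all

lemma loc_rat_cong:
  assumes f: "loc_rat S a f" and T: "loc_open S a T" and fg: "\<And>x. x \<in> S \<Longrightarrow> x \<in> T \<Longrightarrow> g x = f x"
  shows "loc_rat S a g"
proof -
  obtain p q where q: "poly_value q a \<noteq> 0" "\<forall>x\<in>S. poly_value q x \<noteq> 0 \<longrightarrow> f x = poly_value p x / poly_value q x"
    using f unfolding loc_rat_def by blast
  show ?thesis by (rule loc_ratI[OF T q(1), where p = p]) (use q(2) fg in simp)
qed

lemma loc_rat_add:
  assumes "loc_rat S a f" "loc_rat S a g" shows "loc_rat S a (\<lambda>x. f x + g x)"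
proof -
  obtain p q where q: "poly_value q a \<noteq> 0" "\<forall>x\<in>S. poly_value q x \<noteq> 0 \<longrightarrow> f x = poly_value p x / poly_value q x"
    using assms(1) unfolding loc_rat_def by blast
  obtain p' q' where q': "poly_value q' a \<noteq> 0" "\<forall>x\<in>S. poly_value q' x \<noteq> 0 \<longrightarrow> g x = poly_value p' x / poly_value q' x"
    using assms(2) unfolding loc_rat_def by blast
  show ?thesis
    by (rule loc_ratI[OF loc_open_UNIV, where q = "q * q'" and p = "p * q' + p' * q"]) (use q q' in \<open>simp_all add: field_simps\<close>)
qed

lemma loc_rat_mult:
  assumes "loc_rat S a f" "loc_rat S a g" shows "loc_rat S a (\<lambda>x. f x * g x)"
proof -
  obtain p q where q: "poly_value q a \<noteq> 0" "\<forall>x\<in>S. poly_value q x \<noteq> 0 \<longrightarrow> f x = poly_value p x / poly_value q x"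
    using assms(1) unfolding loc_rat_def by blast
  obtain p' q' where q': "poly_value q' a \<noteq> 0" "\<forall>x\<in>S. poly_value q' x \<noteq> 0 \<longrightarrow> g x = poly_value p' x / poly_value q' x"
    using assms(2) unfolding loc_rat_def by blast
  show ?thesis
    by (rule loc_ratI[OF loc_open_UNIV, where q = "q * q'" and p = "p * p'"]) (use q q' in simp_all)
qed

lemma loc_rat_sum: "(\<And>i. i \<in> I \<Longrightarrow> loc_rat S a (f i)) \<Longrightarrow> loc_rat S a (\<lambda>x. \<Sum>i\<in>I. f i x)"
  by (induction I rule: infinite_finite_induct) (simp_all add: loc_rat_const loc_rat_add)

lemma loc_open_nonzero:
  assumes "a \<in> S" "loc_rat S a f" "f a \<noteq> 0" shows "loc_open S a {x. f x \<noteq> 0}"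
proof -
  obtain p q where q: "poly_value q a \<noteq> 0" "\<forall>x\<in>S. poly_value q x \<noteq> 0 \<longrightarrow> f x = poly_value p x / poly_value q x"
    using assms(2) unfolding loc_rat_def by blast
  have "poly_value p a \<noteq> 0" using assms(1,3) q by auto
  then show ?thesis by (intro loc_openI[of "p * q"]) (use q in simp_all)
qed

lemma loc_rat_divide:
  assumes "a \<in> S" "loc_rat S a f" "loc_rat S a g" "g a \<noteq> 0" shows "loc_rat S a (\<lambda>x. f x / g x)"
proof -
  obtain p q where q: "poly_value q a \<noteq> 0" "\<forall>x\<in>S. poly_value q x \<noteq> 0 \<longrightarrow> f x = poly_value p x / poly_value q x"
    using assms(2) unfolding loc_rat_def by blast
  obtain p' q' where q': "poly_value q' a \<noteq> 0" "\<forall>x\<in>S. poly_value q' x \<noteq> 0 \<longrightarrow> g x = poly_value p' x / poly_value q' x"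
    using assms(3) unfolding loc_rat_def by blast
  have "poly_value p' a \<noteq> 0" using assms(1,4) q' by auto
  then show ?thesis
    by (intro loc_ratI[OF loc_open_Int[OF loc_openI[of q a S "{x. poly_value q x \<noteq> 0}"] loc_openI[of q' a S "{x. poly_value q' x \<noteq> 0}"]], where q = "q * p'" and p = "p * q'"])
      (use q q' in simp_all)
qed

text \<open>The product of the denominators is multiplied by a polynomial r that cuts out a
  neighbourhood inside T. The nonvanishing of one polynomial then guarantees both the membership in
  T and all the formulas.\<close>

lemma loc_rat_common_denominator:
  assumes "finite J" "\<And>j. j \<in> J \<Longrightarrow> loc_rat S a (f j)" "loc_open S a T"
  obtains p q where "poly_value q a \<noteq> 0" "\<And>x. x \<in> S \<Longrightarrow> poly_value q x \<noteq> 0 \<Longrightarrow> x \<in> T"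
    "\<And>x j. x \<in> S \<Longrightarrow> poly_value q x \<noteq> 0 \<Longrightarrow> j \<in> J \<Longrightarrow> poly_value (p j) x = poly_value q x * f j x"
proof -
  have "\<forall>j\<in>J. \<exists>p q. poly_value q a \<noteq> 0 \<and> (\<forall>x\<in>S. poly_value q x \<noteq> 0 \<longrightarrow> f j x = poly_value p x / poly_value q x)"
    using assms(2) unfolding loc_rat_def by blast
  then obtain p q where pq: "\<And>j. j \<in> J \<Longrightarrow> poly_value (q j) a \<noteq> 0"
      "\<And>j x. j \<in> J \<Longrightarrow> x \<in> S \<Longrightarrow> poly_value (q j) x \<noteq> 0 \<Longrightarrow> f j x = poly_value (p j) x / poly_value (q j) x"
    by metis
  obtain r where r: "poly_value r a \<noteq> 0" "\<forall>x\<in>S. poly_value r x \<noteq> 0 \<longrightarrow> x \<in> T"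
    using assms(3) unfolding loc_open_def by blast
  define Q where "Q = r * (\<Prod>j\<in>J. q j)"
  have Q: "poly_value r x \<noteq> 0 \<and> (\<forall>j\<in>J. poly_value (q j) x \<noteq> 0)" if "poly_value Q x \<noteq> 0" for x
    using that assms(1) by (simp add: Q_def prod_zero_iff)
  show thesis
  proof (rule that[of Q "\<lambda>j. r * p j * (\<Prod>i\<in>J - {j}. q i)"])
    show "poly_value Q a \<noteq> 0" using r(1) pq(1) assms(1) by (simp add: Q_def prod_zero_iff)
    show "x \<in> T" if "x \<in> S" "poly_value Q x \<noteq> 0" for x using Q[OF that(2)] r(2) that(1) by blast
    fix x j assume x: "x \<in> S" "poly_value Q x \<noteq> 0" and j: "j \<in> J"
    have "poly_value Q x = poly_value r x * (poly_value (q j) x * (\<Prod>i\<in>J - {j}. poly_value (q i) x))"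
      using prod.remove[OF assms(1) j, of "\<lambda>i. poly_value (q i) x"] by (simp add: Q_def)
    then show "poly_value (r * p j * (\<Prod>i\<in>J - {j}. q i)) x = poly_value Q x * f j x"
      using pq(2)[OF j x(1)] Q[OF x(2)] j by simp
  qed
qed

lemma zariski_open_loc:
  assumes "openin zariski N" "a \<in> N" shows "loc_open S a N"
proof -
  have "generate_topology_on {{x. poly_value p x \<noteq> 0} | p. True} N"
    using assms(1) unfolding zariski_def by (simp add: openin_topology_generated_by_iff)
  then show ?thesis using assms(2)
  proof (induction rule: generate_topology_on.induct)
    case (Int b c)
    then show ?case by (intro loc_open_Int) auto
  next
    case (UN K)
    then obtain k where k: "k \<in> K" "a \<in> k" by blast
    then have "loc_open S a k" using UN by blast
    then show ?case by (rule loc_open_mono) (use k in blast)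
  next
    case (Basis s)
    then obtain p where "s = {x. poly_value p x \<noteq> 0}" by blast
    then show ?case using Basis by (intro loc_openI[of p]) auto
  qed simp
qed

lemma zariski_openin_nonzero: "openin zariski {x. poly_value p x \<noteq> 0}"
  unfolding zariski_def by (rule topology_generated_by_Basis) blast

section \<open>Local behaviour of functions on quotients and on slices of products\<close>

context
  fixes \<pi> :: "('v \<Rightarrow> complex) \<Rightarrow> 'b" and S :: "('v \<Rightarrow> complex) set"
begin

abbreviation (input) QV where "QV \<equiv> quotient_fspace \<pi> (quasi_affine S)"

lemma points_quot: "points QV = \<pi> ` S"
  by (simp add: quotient_fspace_def quasi_affine_def)

lemma openin_quot: "openin (topo QV) U \<longleftrightarrow> U \<subseteq> \<pi> ` S \<and> openin (subtopology zariski S) {x \<in> S. \<pi> x \<in> U}"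
  by (simp add: quotient_fspace_def quasi_affine_def openin_quotient_topology)

lemma quot_open_loc:
  assumes "openin (topo QV) U" "a \<in> S" "\<pi> a \<in> U" shows "loc_open S a {x. \<pi> x \<in> U}"
proof -
  obtain N where N: "openin zariski N" "{x \<in> S. \<pi> x \<in> U} = N \<inter> S"
    using assms(1) unfolding openin_quot openin_subtopology by blast
  have "a \<in> N" using N(2) assms by blast
  from zariski_open_loc[OF N(1) this] show ?thesis by (rule loc_open_mono) (use N(2) in blast)
qed

lemma quot_regular_loc:
  assumes "openin (topo QV) U" "regular_on QV U f" "a \<in> S" "\<pi> a \<in> U"
  shows "loc_rat S a (\<lambda>x. f (\<pi> x))"
proof -
  let ?V = "{x \<in> S. \<pi> x \<in> U}"
  have "\<exists>p q N. openin zariski N \<and> a \<in> N \<and>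
      (\<forall>y\<in>N \<inter> ?V. poly_value q y \<noteq> 0 \<and> f (\<pi> y) = poly_value p y / poly_value q y)"
    using assms(2-4) by (simp add: quotient_fspace_def quasi_affine_def)
  then obtain p q N where N: "openin zariski N" "a \<in> N"
      "\<forall>y\<in>N \<inter> ?V. poly_value q y \<noteq> 0 \<and> f (\<pi> y) = poly_value p y / poly_value q y" by blast
  have a: "poly_value q a \<noteq> 0" using N assms(3,4) by blast
  show ?thesis
    by (rule loc_ratI[OF loc_open_Int[OF zariski_open_loc[OF N(1,2)] quot_open_loc[OF assms(1,3,4)]] a, where p = p])
      (use N(3) in blast)
qed

lemma quot_openI:
  assumes "U \<subseteq> \<pi> ` S" "\<And>x. x \<in> S \<Longrightarrow> \<pi> x \<in> U \<longleftrightarrow> poly_value q x \<noteq> 0"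
  shows "openin (topo QV) U"
proof -
  have "{x \<in> S. \<pi> x \<in> U} = {x. poly_value q x \<noteq> 0} \<inter> S" using assms(2) by blast
  then show ?thesis unfolding openin_quot openin_subtopology using assms(1) zariski_openin_nonzero by blast
qed

lemma quot_regularI:
  assumes "\<And>x. x \<in> S \<Longrightarrow> \<pi> x \<in> U \<Longrightarrow> poly_value q x \<noteq> 0 \<and> f (\<pi> x) = poly_value p x / poly_value q x"
  shows "regular_on QV U f"
proof -
  have "openin zariski (UNIV :: ('v \<Rightarrow> complex) set)" using openin_topspace[of zariski] by simp
  then have "\<exists>p q N. openin zariski N \<and> a \<in> N \<and>
      (\<forall>y\<in>N \<inter> {x \<in> S. \<pi> x \<in> U}. poly_value q y \<noteq> 0 \<and> f (\<pi> y) = poly_value p y / poly_value q y)" for a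
    using assms by (intro exI[of _ p] exI[of _ q] exI[of _ UNIV]) auto
  then show ?thesis by (simp add: quotient_fspace_def quasi_affine_def)
qed

context
  fixes Y :: "'c fspace"
begin

text \<open>On the slice with fixed second component y, the factors from Y are constants, so a
  tensor function becomes a linear combination of regular functions.\<close>

lemma tensor_loc:
  assumes U: "openin (topo QV) U" and a: "a \<in> S" "\<pi> a \<in> U" and h: "tensor_function QV Y U V h"
  shows "loc_rat S a (\<lambda>x. h (\<pi> x, y))"
proof -
  obtain k :: nat and f g where k: "\<forall>i<k. regular_on QV U (f i)" "h = (\<lambda>(x, y). \<Sum>i<k. f i x * g i y)"
    using h unfolding tensor_function_def by blast
  have "loc_rat S a (\<lambda>x. \<Sum>i<k. f i (\<pi> x) * g i y)"
    by (intro loc_rat_sum loc_rat_mult loc_rat_const quot_regular_loc[OF U _ a]) (use k(1) in simp)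
  then show ?thesis using k(2) by simp
qed

text \<open>Open sets of the product are only tested on slices, where the non-vanishing locus of a
  tensor function is that of a germ in the first variable.\<close>

lemma prod_open_loc:
  assumes "openin (topo (prod_fspace QV Y)) W" "a \<in> S" "(\<pi> a, y) \<in> W"
  shows "loc_open S a {x. (\<pi> x, y) \<in> W}"
proof -
  have "generate_topology_on {{z \<in> U \<times> V. h z \<noteq> 0} | U V h.
          openin (topo QV) U \<and> openin (topo Y) V \<and> tensor_function QV Y U V h} W"
    using assms(1) by (simp add: prod_fspace_def openin_topology_generated_by_iff)
  then show ?thesis using assms(3)
  proof (induction rule: generate_topology_on.induct)
    case (Int b c)
    then have "loc_open S a ({x. (\<pi> x, y) \<in> b} \<inter> {x. (\<pi> x, y) \<in> c})" by (intro loc_open_Int) auto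
    then show ?case by (rule loc_open_mono) blast
  next
    case (UN K)
    then obtain k where k: "k \<in> K" "(\<pi> a, y) \<in> k" by blast
    then have "loc_open S a {x. (\<pi> x, y) \<in> k}" using UN by blast
    then show ?case by (rule loc_open_mono) (use k in blast)
  next
    case (Basis s)
    then obtain U V h where s: "s = {z \<in> U \<times> V. h z \<noteq> 0}" "openin (topo QV) U" "tensor_function QV Y U V h"
      by blast
    have aU: "\<pi> a \<in> U" "y \<in> V" "h (\<pi> a, y) \<noteq> 0" using s(1) Basis by auto
    have "loc_open S a ({x. \<pi> x \<in> U} \<inter> {x. h (\<pi> x, y) \<noteq> 0})"
      by (intro loc_open_Int quot_open_loc[OF s(2) assms(2) aU(1)] loc_open_nonzero[OF assms(2)] aU
          tensor_loc[OF s(2) assms(2) aU(1) s(3)])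
    then show ?case by (rule loc_open_mono) (use aU(2) s(1) in blast)
  qed simp
qed

lemma prod_regular_loc:
  assumes W: "openin (topo (prod_fspace QV Y)) W" and r: "regular_on (prod_fspace QV Y) W r"
    and a: "a \<in> S" "(\<pi> a, y) \<in> W"
  shows "loc_rat S a (\<lambda>x. r (\<pi> x, y))"
proof -
  obtain U V g h where U: "openin (topo QV) U" and g: "tensor_function QV Y U V g" and h: "tensor_function QV Y U V h"
    and w: "(\<pi> a, y) \<in> U \<times> V" "h (\<pi> a, y) \<noteq> 0"
    and e: "\<forall>z \<in> W \<inter> (U \<times> V). h z \<noteq> 0 \<longrightarrow> r z = g z / h z"
    using r a(2) unfolding prod_fspace_def by auto
  have aU: "\<pi> a \<in> U" "y \<in> V" using w by auto
  note lg = tensor_loc[OF U a(1) aU(1) g, of y] and lh = tensor_loc[OF U a(1) aU(1) h, of y]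
  have "loc_rat S a (\<lambda>x. g (\<pi> x, y) / h (\<pi> x, y))" by (rule loc_rat_divide[OF a(1) lg lh w(2)])
  moreover have "loc_open S a ({x. (\<pi> x, y) \<in> W} \<inter> ({x. \<pi> x \<in> U} \<inter> {x. h (\<pi> x, y) \<noteq> 0}))"
    by (intro loc_open_Int prod_open_loc[OF W a] quot_open_loc[OF U a(1) aU(1)] loc_open_nonzero[OF a(1) lh w(2)])
  ultimately show ?thesis by (rule loc_rat_cong) (use e aU(2) in blast)
qed

end

lemma prod_open_rectangle:
  assumes "openin (topo QV) U" "openin (topo Y) V" "regular_on Y V (\<lambda>_. 1)"
  shows "openin (topo (prod_fspace QV Y)) (U \<times> V)"
proof -
  have "regular_on QV U (\<lambda>_. 1)" by (rule quot_regularI[of _ 1 _ 1]) simp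
  then have "tensor_function QV Y U V (\<lambda>_. 1)"
    using assms(3) unfolding tensor_function_def
    by (intro exI[of _ "1 :: nat"] exI[of _ "\<lambda>_ _. 1"]) (auto simp: fun_eq_iff)
  then have "\<exists>U' V' h. U \<times> V = {z \<in> U' \<times> V'. h z \<noteq> 0} \<and>
      openin (topo QV) U' \<and> openin (topo Y) V' \<and> tensor_function QV Y U' V' h"
    using assms(1,2) by (intro exI[of _ U] exI[of _ V] exI[of _ "\<lambda>_. 1"]) simp
  then show ?thesis
    unfolding prod_fspace_def by (simp add: topology_generated_by_Basis)
qed

lemma prod_regular_fst:
  assumes "openin (topo QV) U" "openin (topo Y) V" "regular_on Y V (\<lambda>_. 1)"
    and "regular_on QV U f" "W \<subseteq> U \<times> V"
  shows "regular_on (prod_fspace QV Y) W (\<lambda>z. f (fst z))"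
proof -
  have "regular_on QV U (\<lambda>_. 1)" by (rule quot_regularI[of _ 1 _ 1]) simp
  then have 1: "tensor_function QV Y U V (\<lambda>_. 1)"
    using assms(3) unfolding tensor_function_def
    by (intro exI[of _ "1 :: nat"] exI[of _ "\<lambda>_ _. 1"]) (auto simp: fun_eq_iff)
  have 2: "tensor_function QV Y U V (\<lambda>z. f (fst z))"
    using assms(3,4) unfolding tensor_function_def
    by (intro exI[of _ "1 :: nat"] exI[of _ "\<lambda>_. f"] exI[of _ "\<lambda>_ _. 1"]) (auto simp: fun_eq_iff)
  have "\<exists>U V g h. openin (topo QV) U \<and> openin (topo Y) V \<and>
        tensor_function QV Y U V g \<and> tensor_function QV Y U V h \<and>
        w \<in> U \<times> V \<and> h w \<noteq> 0 \<and> (\<forall>z \<in> W \<inter> (U \<times> V). h z \<noteq> 0 \<longrightarrow> f (fst z) = g z / h z)" if "w \<in> W" for w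
    by (intro exI[of _ U] exI[of _ V] exI[of _ "\<lambda>z. f (fst z)"] exI[of _ "\<lambda>_. 1"] conjI assms 1 2)
      (use that assms(5) in auto)
  then show ?thesis by (simp add: prod_fspace_def)
qed

end

section \<open>Polynomial maps from a birational equivalence\<close>

definition ray :: "('v \<Rightarrow> complex) \<Rightarrow> ('v \<Rightarrow> complex) set"
  where "ray x = {y. \<exists>c. c \<noteq> 0 \<and> y = (\<lambda>v. c * x v)}"

abbreviation punctured :: "'v set \<Rightarrow> ('v \<Rightarrow> complex) set"
  where "punctured V \<equiv> affine_space V - {\<lambda>_. 0}"

lemma proj_space_on_eq: "proj_space_on V = quotient_fspace ray (quasi_affine (punctured V))"
  by (simp add: proj_space_on_def ray_def [abs_def])

lemma ray_self: "x \<in> ray x"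
  unfolding ray_def by (auto intro: exI[of _ 1])

lemma ray_eqD: "ray x = ray y \<Longrightarrow> \<exists>c. c \<noteq> 0 \<and> y = (\<lambda>v. c * x v)"
  using ray_self[of y] unfolding ray_def by blast

lemma ray_subset_scale: assumes "c \<noteq> 0" shows "ray (\<lambda>v. c * x v) \<subseteq> ray x"
proof
  fix y assume "y \<in> ray (\<lambda>v. c * x v)"
  then obtain e where e: "e \<noteq> 0" "y = (\<lambda>v. e * (c * x v))" unfolding ray_def by blast
  have "e * c \<noteq> 0" "y = (\<lambda>v. (e * c) * x v)" using e assms by (simp_all add: mult.assoc)
  then show "y \<in> ray x" unfolding ray_def by blast
qed

lemma ray_scale: assumes "c \<noteq> 0" shows "ray (\<lambda>v. c * x v) = ray x"
proof
  have "(\<lambda>v. 1 / c * (c * x v)) = x" using assms by simp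
  then show "ray x \<subseteq> ray (\<lambda>v. c * x v)"
    using ray_subset_scale[of "1 / c" "\<lambda>v. c * x v"] assms by simp
qed (rule ray_subset_scale[OF assms])

definition ratio :: "'v \<Rightarrow> 'v \<Rightarrow> ('v \<Rightarrow> complex) set \<Rightarrow> complex"
  where "ratio l j E = (let x = (SOME x. x \<in> E) in x j / x l)"

lemma ratio_ray: "ratio l j (ray x) = x j / x l"
proof -
  have "(SOME z. z \<in> ray x) \<in> ray x" by (rule someI[of _ x]) (rule ray_self)
  then obtain c where "c \<noteq> 0" "(SOME z. z \<in> ray x) = (\<lambda>v. c * x v)" unfolding ray_def by blast
  then show ?thesis by (simp add: ratio_def)
qed

lemma double_cover_eq: "double_cover n d F = quotient_fspace (torus_orbit d) (quasi_affine (cover_cone n d F))"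
  by (simp add: double_cover_def cover_cone_def)

lemma torus_act_mult: "torus_act d l k (torus_act d l' k' x) = torus_act d (l * l') (k * k') x"
proof
  show "torus_act d l k (torus_act d l' k' x) c = torus_act d (l * l') (k * k') x c" for c
    by (cases c) (simp_all add: power_mult_distrib)
qed

lemma torus_act_1: "torus_act d 1 1 x = x"
proof
  show "torus_act d 1 1 x c = x c" for c by (cases c) simp_all
qed

lemma torus_orbit_self: "x \<in> torus_orbit d x"
  unfolding torus_orbit_def mem_Collect_eq by (intro exI[of _ 1] conjI) (simp_all add: torus_act_1)

lemma torus_orbit_eqD:
  assumes "torus_orbit d x = torus_orbit d y"
  obtains l k where "l \<noteq> 0" "k \<noteq> 0" "y = torus_act d l k x"
proof -
  have "y \<in> torus_orbit d x" unfolding assms by (rule torus_orbit_self)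
  then show ?thesis using that unfolding torus_orbit_def by blast
qed

lemma torus_act_cover_cone:
  assumes "x \<in> cover_cone n d F" "l \<noteq> 0" "k \<noteq> 0" shows "torus_act d l k x \<in> cover_cone n d F"
proof -
  have x: "x \<in> bundle_cone n" "(x WC)\<^sup>2 = form_value n (2 * d) 2 F x" using assms(1) by (auto simp: cover_cone_def)
  have "torus_act d l k x c = 0" if "c \<notin> XC ` {..<n} \<union> TC ` {..<2} \<union> {WC}" for c
  proof -
    have "x c = 0" using x(1) that unfolding bundle_cone_def affine_space_def by blast
    then show ?thesis by (cases c) simp_all
  qed
  then have "torus_act d l k x \<in> bundle_cone n"
    using x(1) assms(2,3) unfolding bundle_cone_def affine_space_def by simp
  moreover have "form_value n (2 * d) 2 F (torus_act d l k x) = (l ^ d * k)\<^sup>2 * form_value n (2 * d) 2 F x"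
    unfolding form_value_eq using bimonomials_sums by (simp add: biform_scale)
  then have "(torus_act d l k x WC)\<^sup>2 = form_value n (2 * d) 2 F (torus_act d l k x)"
    using x(2) by (simp add: power_mult_distrib)
  ultimately show ?thesis by (simp add: cover_cone_def)
qed

text \<open>The representative of a torus orbit with coordinates 1 at \<open>XC 1\<close> and
  \<open>TC 1\<close>. It is invariant under the torus, so its coordinates descend to the chart of
  the cover.\<close>

definition dehom :: "nat \<Rightarrow> (coord \<Rightarrow> complex) \<Rightarrow> coord \<Rightarrow> complex"
  where "dehom d x = torus_act d (1 / x (XC 1)) (1 / x (TC 1)) x"

lemma dehom_torus_act: "l \<noteq> 0 \<Longrightarrow> k \<noteq> 0 \<Longrightarrow> dehom d (torus_act d l k x) = dehom d x"
  by (simp add: dehom_def torus_act_mult)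

definition orbit_coord :: "nat \<Rightarrow> coord \<Rightarrow> (coord \<Rightarrow> complex) set \<Rightarrow> complex"
  where "orbit_coord d c D = dehom d (SOME x. x \<in> D) c"

lemma orbit_coord: "orbit_coord d c (torus_orbit d x) = dehom d x c"
proof -
  have "(SOME y. y \<in> torus_orbit d x) \<in> torus_orbit d x" by (rule someI[of _ x]) (rule torus_orbit_self)
  then obtain l k where "l \<noteq> 0" "k \<noteq> 0" "(SOME y. y \<in> torus_orbit d x) = torus_act d l k x"
    unfolding torus_orbit_def by blast
  then show ?thesis by (simp add: orbit_coord_def dehom_torus_act)
qed

definition pvar :: "'v \<Rightarrow> 'v Defs.polynomial"
  where "pvar v = Poly_Mapping.single (Poly_Mapping.single v 1) 1"

lemma poly_value_pvar [simp]: "poly_value (pvar v) x = x v"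
  unfolding pvar_def by (rule poly_value_var)

lemma dehom_rational:
  obtains p q where "\<And>x. x (XC 1) \<noteq> 0 \<Longrightarrow> x (TC 1) \<noteq> 0 \<Longrightarrow>
    poly_value q x \<noteq> 0 \<and> dehom d x c = poly_value p x / poly_value q x"
proof (cases c)
  case (XC i)
  show thesis by (rule that[of "pvar (XC 1)" "pvar (XC i)"]) (simp add: XC dehom_def)
next
  case (TC j)
  show thesis by (rule that[of "pvar (TC 1)" "pvar (TC j)"]) (simp add: TC dehom_def)
next
  case WC
  show thesis
    by (rule that[of "pvar (XC 1) ^ d * pvar (TC 1)" "pvar WC"]) (simp add: WC dehom_def power_one_over)
qed

lemma poly_value_compose:
  "poly_value (poly_eval (Poly_Mapping.single 0) \<Phi> p) x = poly_value p (\<lambda>j. poly_value (\<Phi> j) x)"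
proof -
  have "comm_ring_hom (\<lambda>p. poly_value p x)"
    unfolding poly_value_eq_poly_eval by (rule comm_ring_hom_poly_eval_id)
  from poly_eval_hom[OF this, of "Poly_Mapping.single 0" \<Phi> p] show ?thesis
    by (simp add: poly_value_eq_poly_eval[of p])
qed

lemma prod_regular_cong:
  assumes "regular_on (prod_fspace X Y) W r" "\<And>w. w \<in> W \<Longrightarrow> r w = r' w"
  shows "regular_on (prod_fspace X Y) W r'"
  using assms unfolding prod_fspace_def by simp

definition chart :: "nat \<Rightarrow> nat \<Rightarrow> (coord monomial \<Rightarrow> complex) \<Rightarrow> (coord \<Rightarrow> complex) set set"
  where "chart n d F = torus_orbit d ` {x \<in> cover_cone n d F. x (XC 1) \<noteq> 0 \<and> x (TC 1) \<noteq> 0}"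

lemma in_chart:
  assumes "x \<in> cover_cone n d F"
  shows "torus_orbit d x \<in> chart n d F \<longleftrightarrow> x (XC 1) \<noteq> 0 \<and> x (TC 1) \<noteq> 0"
proof
  assume "torus_orbit d x \<in> chart n d F"
  then obtain y where y: "torus_orbit d y = torus_orbit d x" "y (XC 1) \<noteq> 0" "y (TC 1) \<noteq> 0"
    unfolding chart_def by auto
  from y(1) obtain l k where "l \<noteq> 0" "k \<noteq> 0" "x = torus_act d l k y" by (rule torus_orbit_eqD)
  then show "x (XC 1) \<noteq> 0 \<and> x (TC 1) \<noteq> 0" using y(2,3) by simp
qed (use assms in \<open>auto simp: chart_def\<close>)

lemma openin_chart: "openin (topo (double_cover n d F)) (chart n d F)"
  unfolding double_cover_eq
proof (rule quot_openI[where q = "pvar (XC 1) * pvar (TC 1)"])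
  show "chart n d F \<subseteq> torus_orbit d ` cover_cone n d F" by (auto simp: chart_def)
qed (simp add: in_chart)

lemma chart_nonempty: assumes "n > 1" shows "chart n d F \<noteq> {}"
proof -
  define x where "x c = (case c of XC i \<Rightarrow> if i < n then 1 else 0 | TC j \<Rightarrow> if j < 2 then 1 else 0 | WC \<Rightarrow> (0::complex))" for c
  define y where "y = x(WC := csqrt (form_value n (2 * d) 2 F x))"
  have "form_value n (2 * d) 2 F y = form_value n (2 * d) 2 F x" by (simp add: form_value_eq y_def)
  moreover have "y \<in> bundle_cone n"
    using assms unfolding bundle_cone_def affine_space_def y_def x_def
    by (auto split: coord.split intro: exI[of _ "1 :: nat"])
  ultimately have "y \<in> cover_cone n d F" by (simp add: cover_cone_def y_def)
  moreover have "y (XC 1) \<noteq> 0" "y (TC 1) \<noteq> 0" using assms by (simp_all add: y_def x_def)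
  ultimately show ?thesis unfolding chart_def by blast
qed

lemma regular_orbit_coord: "regular_on (double_cover n d F) (chart n d F) (orbit_coord d c)"
proof -
  obtain p q where "\<And>x. x (XC 1) \<noteq> 0 \<Longrightarrow> x (TC 1) \<noteq> 0 \<Longrightarrow>
      poly_value q x \<noteq> 0 \<and> dehom d x c = poly_value p x / poly_value q x"
    by (rule dehom_rational[where c = c and d = d]) blast
  note pq = this
  show ?thesis
    unfolding double_cover_eq
  proof (rule quot_regularI[where q = q and p = p])
    fix x assume "x \<in> cover_cone n d F" "torus_orbit d x \<in> chart n d F"
    then have "x (XC 1) \<noteq> 0 \<and> x (TC 1) \<noteq> 0" using in_chart by blast
    then have "x (XC 1) \<noteq> 0" "x (TC 1) \<noteq> 0" by blast+
    from pq[OF this] show "poly_value q x \<noteq> 0 \<and> orbit_coord d c (torus_orbit d x) = poly_value p x / poly_value q x"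
      unfolding orbit_coord .
  qed
qed

text \<open>On a slice of the product with fixed second component, the birational map has a left
  inverse, namely its inverse followed by the first projection. Near a point both are given by
  rational functions. Clearing denominators changes homogeneous coordinates by a scalar or a torus
  factor only, and yields polynomial maps.\<close>

lemma stably_rational_parametrisation:
  assumes n1: "n > 1" and "stably_rational (double_cover n d F)"
  obtains N and \<Phi> :: "nat \<Rightarrow> coord Defs.polynomial" and \<Psi> :: "coord \<Rightarrow> nat Defs.polynomial"
    and P0 :: "coord Defs.polynomial" and Q0 :: "nat Defs.polynomial" and a0
  where "\<And>j. j > N \<Longrightarrow> \<Phi> j = 0"
    and "a0 \<in> cover_cone n d F" "poly_value P0 a0 \<noteq> 0" "a0 (XC 1) \<noteq> 0" "a0 (TC 1) \<noteq> 0"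
    and "\<And>y. y \<in> cover_cone n d F \<Longrightarrow> poly_value P0 y \<noteq> 0 \<Longrightarrow>
      (\<lambda>j. poly_value (\<Phi> j) y) \<noteq> (\<lambda>_. 0) \<and> poly_value Q0 (\<lambda>j. poly_value (\<Phi> j) y) \<noteq> 0 \<and>
      (\<lambda>c. poly_value (\<Psi> c) (\<lambda>j. poly_value (\<Phi> j) y)) \<in> torus_orbit d y"
    and "\<And>z. z \<in> affine_space {..N} \<Longrightarrow> z \<noteq> (\<lambda>_. 0) \<Longrightarrow> poly_value Q0 z \<noteq> 0 \<Longrightarrow>
      (\<lambda>c. poly_value (\<Psi> c) z) \<in> cover_cone n d F"
proof -
  define S where "S = cover_cone n d F"
  define X where "X = double_cover n d F"
  have X: "X = quotient_fspace (torus_orbit d) (quasi_affine S)" unfolding X_def S_def by (rule double_cover_eq)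
  obtain k m where "birational (prod_fspace X (proj_space m)) (proj_space (k + m))"
    using assms(2) unfolding stably_rational_def X_def by blast
  then obtain U V \<phi> where U: "openin (topo (prod_fspace X (proj_space m))) U"
    and dense: "topo (prod_fspace X (proj_space m)) closure_of U = points (prod_fspace X (proj_space m))"
    and V: "openin (topo (proj_space (k + m))) V"
    and iso: "fspace_iso (open_subspace (prod_fspace X (proj_space m)) U) (open_subspace (proj_space (k + m)) V) \<phi>"
    unfolding birational_def by blast
  define N where "N = k + m"
  define Y where "Y = proj_space m"
  define A where "A = prod_fspace X Y"
  define B where "B = proj_space N"
  define C where "C = punctured {..N}"
  have B: "B = quotient_fspace ray (quasi_affine C)" unfolding B_def C_def by (rule proj_space_on_eq)
  have Y: "Y = quotient_fspace ray (quasi_affine (punctured {..m}))" unfolding Y_def by (rule proj_space_on_eq)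
  have U: "openin (topo A) U" and dense: "topo A closure_of U = points A" and V: "openin (topo B) V"
    and homeo: "homeomorphic_map (subtopology (topo A) U) (subtopology (topo B) V) \<phi>"
    and reg: "\<And>W f. openin (subtopology (topo B) V) W \<Longrightarrow>
      regular_on B W f \<longleftrightarrow> regular_on A {x \<in> topspace (subtopology (topo A) U). \<phi> x \<in> W} (f \<circ> \<phi>)"
    using U dense V iso unfolding A_def B_def Y_def N_def fspace_iso_def open_subspace_def by simp_all
  have UA: "U \<subseteq> points A" and VB: "V \<subseteq> points B" using openin_subset[OF U] openin_subset[OF V] by auto
  have topU: "topspace (subtopology (topo A) U) = U" "topspace (subtopology (topo B) V) = V"
    using UA VB by (simp_all add: topspace_subtopology Int_absorb1)
  have im: "\<phi> ` U = V" and inj: "inj_on \<phi> U"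
    using homeomorphic_imp_surjective_map[OF homeo] homeomorphic_imp_injective_map[OF homeo]
    unfolding topU by blast+
  have regY: "regular_on Y (points Y) (\<lambda>_. 1)"
    unfolding Y by (rule quot_regularI[where q = 1 and p = 1]) simp
  have "(\<lambda>i. if i = (0::nat) then 1 else (0::complex)) \<in> punctured {..m}"
    by (auto simp: affine_space_def fun_eq_iff)
  then have Yne: "points Y \<noteq> {}" unfolding Y points_quot by blast
  define Ch where "Ch = chart n d F"
  have Oop: "openin (topo X) Ch" unfolding X_def Ch_def by (rule openin_chart)
  define R0 where "R0 = Ch \<times> points Y"
  have R0: "openin (topo A) R0"
    unfolding A_def R0_def X by (rule prod_open_rectangle) (use Oop regY in \<open>simp_all add: X\<close>)
  have "R0 \<noteq> {}" using Yne chart_nonempty[OF n1] unfolding R0_def Ch_def by simp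
  \<comment> \<open>Density of the domain provides a point of it whose first component lies in the
    chart. Its second component y fixes the slice.\<close>
  then have "U \<inter> R0 \<noteq> {}" using dense R0 dense_intersects_open[of "topo A" U] by blast
  then obtain D y where Dy: "(D, y) \<in> U" "D \<in> Ch" "y \<in> points Y" unfolding R0_def by blast
  obtain a0 where a0: "D = torus_orbit d a0" "a0 \<in> S" "a0 (XC 1) \<noteq> 0" "a0 (TC 1) \<noteq> 0"
    using Dy(2) unfolding Ch_def chart_def S_def by blast
  define W0 where "W0 = U \<inter> R0"
  have W0: "openin (topo A) W0" unfolding W0_def using U R0 by (rule openin_Int)
  have "\<phi> (D, y) \<in> points B" using Dy(1) im VB by blast
  then obtain z0 where z0: "\<phi> (D, y) = ray z0" "z0 \<in> C" unfolding B points_quot by blast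
  then have "z0 \<noteq> (\<lambda>_. 0)" "z0 \<in> affine_space {..N}" unfolding C_def by auto
  then obtain l where l: "z0 l \<noteq> 0" by auto
  define Wl where "Wl = V \<inter> ray ` {z \<in> C. z l \<noteq> 0}"
  have ray_l: "z l \<noteq> 0" if z: "z \<in> C" "ray z \<in> ray ` {z \<in> C. z l \<noteq> 0}" for z
  proof -
    obtain z' where "ray z' = ray z" "z' l \<noteq> 0" using z(2) by auto
    then show ?thesis using ray_eqD[of z' z] by auto
  qed
  have "openin (topo B) (ray ` {z \<in> C. z l \<noteq> 0})"
    unfolding B by (rule quot_openI[where q = "pvar l"]) (use ray_l in auto)
  then have Wl: "openin (subtopology (topo B) V) Wl" unfolding Wl_def by (auto simp: openin_subtopology)
  define U1 where "U1 = {x \<in> U. \<phi> x \<in> Wl}"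
  have "openin (subtopology (topo A) U) U1"
    using homeomorphic_imp_continuous_map[OF homeo] Wl unfolding U1_def continuous_map_def topU by blast
  then have U1: "openin (topo A) U1" using U by (metis openin_open_subtopology)
  have DyU1: "(torus_orbit d a0, y) \<in> U1"
    using Dy(1) im z0 l unfolding U1_def Wl_def a0(1)[symmetric] by blast
  have rat: "loc_rat S a0 (\<lambda>x. (ratio l j \<circ> \<phi>) (torus_orbit d x, y))" for j
  proof -
    have "regular_on B Wl (ratio l j)"
      unfolding B
    proof (rule quot_regularI[where q = "pvar l" and p = "pvar j"])
      fix z assume "z \<in> C" "ray z \<in> Wl"
      then show "poly_value (pvar l) z \<noteq> 0 \<and> ratio l j (ray z) = poly_value (pvar j) z / poly_value (pvar l) z"
        using ray_l[of z] unfolding Wl_def by (simp add: ratio_ray)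
    qed
    then have "regular_on A U1 (ratio l j \<circ> \<phi>)" unfolding reg[OF Wl] topU U1_def .
    from prod_regular_loc[OF U1[unfolded A_def X] this[unfolded A_def X] a0(2) DyU1] show ?thesis .
  qed
  have op: "loc_open S a0 {x. (torus_orbit d x, y) \<in> U1}"
    by (rule prod_open_loc[OF U1[unfolded A_def X] a0(2) DyU1])
  obtain p q1 where pq: "poly_value q1 a0 \<noteq> 0"
      "\<And>x. x \<in> S \<Longrightarrow> poly_value q1 x \<noteq> 0 \<Longrightarrow> x \<in> {x. (torus_orbit d x, y) \<in> U1}"
      "\<And>x j. x \<in> S \<Longrightarrow> poly_value q1 x \<noteq> 0 \<Longrightarrow> j \<in> {..N} \<Longrightarrow>
        poly_value (p j) x = poly_value q1 x * (ratio l j \<circ> \<phi>) (torus_orbit d x, y)"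
    by (rule loc_rat_common_denominator[OF finite_atMost rat op]) (rule that; assumption)
  define \<Phi> where "\<Phi> j = (if j \<le> N then p j else 0)" for j
  define Z where "Z x = (\<lambda>j. poly_value (\<Phi> j) x)" for x
  have Z: "Z x \<in> C \<and> (torus_orbit d x, y) \<in> U \<and> \<phi> (torus_orbit d x, y) = ray (Z x)"
    if x: "x \<in> S" "poly_value q1 x \<noteq> 0" for x
  proof -
    have xU: "(torus_orbit d x, y) \<in> U" "\<phi> (torus_orbit d x, y) \<in> Wl" using pq(2)[OF x] unfolding U1_def by auto
    then obtain z where z: "\<phi> (torus_orbit d x, y) = ray z" "z \<in> C" "z l \<noteq> 0" unfolding Wl_def by blast
    have "Z x = (\<lambda>j. (poly_value q1 x / z l) * z j)"
    proof
      fix j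
      have "z j = 0" if "\<not> j \<le> N" using z(2) that unfolding C_def affine_space_def by simp
      then show "Z x j = (poly_value q1 x / z l) * z j"
        using pq(3)[OF x, of j] z(1) by (cases "j \<le> N") (simp_all add: Z_def \<Phi>_def ratio_ray)
    qed
    moreover have "poly_value q1 x / z l \<noteq> 0" using x(2) z(3) by simp
    moreover have "(\<lambda>j. c * z j) \<in> C" if "c \<noteq> 0" for c
      using z(2,3) that unfolding C_def affine_space_def by (auto simp: fun_eq_iff)
    ultimately show ?thesis using xU(1) z(1) ray_scale by metis
  qed
  define \<psi> where "\<psi> = inv_into U \<phi>"
  have \<psi>: "\<psi> (\<phi> w) = w" if "w \<in> U" for w unfolding \<psi>_def using inj that by (rule inv_into_f_f)
  \<comment> \<open>The image of the part of the domain over the chart. On it the inverse map has a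
    first component with well-defined affine coordinates.\<close>
  define W2 where "W2 = \<phi> ` W0"
  have "openin (subtopology (topo A) U) W0" using W0 unfolding W0_def by (auto simp: openin_open_subtopology[OF U])
  then have W2: "openin (subtopology (topo B) V) W2"
    using homeomorphic_imp_open_map[OF homeo] unfolding W2_def open_map_def by blast
  then have W2B: "openin (topo B) W2" using V by (metis openin_open_subtopology)
  have W02: "{x \<in> U. \<phi> x \<in> W2} = W0"
    using inj unfolding W2_def W0_def by (auto dest: inj_onD)
  have Za0: "Z a0 \<in> C" "(torus_orbit d a0, y) \<in> U" "\<phi> (torus_orbit d a0, y) = ray (Z a0)"
    using Z[OF a0(2) pq(1)] by auto
  have "(torus_orbit d a0, y) \<in> W0"
    unfolding W0_def R0_def using Za0(2) Dy(2,3) a0(1) by auto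
  then have rZ: "ray (Z a0) \<in> W2" unfolding W2_def Za0(3)[symmetric] by (rule imageI)
  have rat2: "loc_rat C (Z a0) (\<lambda>z. (\<lambda>E. orbit_coord d c (fst (\<psi> E))) (ray z))" for c
  proof -
    have "regular_on (prod_fspace X Y) W0 (\<lambda>w. orbit_coord d c (fst w))"
      unfolding X
    proof (rule prod_regular_fst)
      show "openin (topo (quotient_fspace (torus_orbit d) (quasi_affine S))) Ch" using Oop unfolding X .
      show "regular_on (quotient_fspace (torus_orbit d) (quasi_affine S)) Ch (orbit_coord d c)"
        unfolding X[symmetric] X_def Ch_def by (rule regular_orbit_coord)
      show "W0 \<subseteq> Ch \<times> points Y" unfolding W0_def R0_def by blast
    qed (use regY in simp_all)
    then have "regular_on A W0 ((\<lambda>E. orbit_coord d c (fst (\<psi> E))) \<circ> \<phi>)"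
      unfolding A_def by (rule prod_regular_cong) (use \<psi> in \<open>simp add: W0_def\<close>)
    then have "regular_on B W2 (\<lambda>E. orbit_coord d c (fst (\<psi> E)))"
      unfolding reg[OF W2] topU W02 .
    from quot_regular_loc[OF W2B[unfolded B] this[unfolded B] Za0(1) rZ] show ?thesis .
  qed
  have op2: "loc_open C (Z a0) {z. ray z \<in> W2}"
    by (rule quot_open_loc[OF W2B[unfolded B] Za0(1) rZ])
  define J where "J = XC ` {..<n} \<union> TC ` {..<2} \<union> {WC}"
  have J: "finite J" by (simp add: J_def)
  obtain p2 q2 where pq2: "poly_value q2 (Z a0) \<noteq> 0"
      "\<And>z. z \<in> C \<Longrightarrow> poly_value q2 z \<noteq> 0 \<Longrightarrow> z \<in> {z. ray z \<in> W2}"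
      "\<And>z c. z \<in> C \<Longrightarrow> poly_value q2 z \<noteq> 0 \<Longrightarrow> c \<in> J \<Longrightarrow>
        poly_value (p2 c) z = poly_value q2 z * orbit_coord d c (fst (\<psi> (ray z)))"
    by (rule loc_rat_common_denominator[OF J rat2 op2]) (rule that; assumption)
  \<comment> \<open>Multiplying the affine coordinates by the common denominator should be the
    action of a torus element with both parameters proportional to \<open>q2\<close>. The coordinate
    \<open>WC\<close> has total weight d + 1 in these parameters, and \<open>p2 WC\<close> contains
    only one of the d + 1 factors.\<close>
  define \<Psi> where "\<Psi> c = (if c = WC then q2 ^ d * p2 WC else if c \<in> J then p2 c else 0)" for c
  have \<Psi>: "(\<lambda>c. poly_value (\<Psi> c) z) = torus_act d (poly_value q2 z / b (XC 1)) (poly_value q2 z / b (TC 1)) b"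
    if z: "z \<in> C" "poly_value q2 z \<noteq> 0" and b: "b \<in> S" "(torus_orbit d b, y') \<in> U" "\<phi> (torus_orbit d b, y') = ray z"
    for z b y'
  proof
    fix c
    have "fst (\<psi> (ray z)) = torus_orbit d b" using \<psi>[OF b(2)] unfolding b(3) by simp
    then have pz: "poly_value (p2 c) z = poly_value q2 z * dehom d b c" if "c \<in> J"
      using pq2(3)[OF z that] by (simp only: orbit_coord)
    have out: "b c = 0" if "c \<notin> J"
      using b(1) that unfolding S_def cover_cone_def bundle_cone_def affine_space_def J_def by blast
    show "poly_value (\<Psi> c) z = torus_act d (poly_value q2 z / b (XC 1)) (poly_value q2 z / b (TC 1)) b c"
    proof (cases "c = WC")
      case True
      then have "c \<in> J" by (simp add: J_def)
      then show ?thesis using pz True by (simp add: \<Psi>_def dehom_def power_divide)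
    next
      case False
      show ?thesis
      proof (cases "c \<in> J")
        case True
        then show ?thesis using pz False by (cases c) (simp_all add: \<Psi>_def dehom_def)
      next
        case F: False
        then show ?thesis using out False by (cases c) (simp_all add: \<Psi>_def)
      qed
    qed
  qed
  have nz: "b (XC 1) \<noteq> 0 \<and> b (TC 1) \<noteq> 0" if "b \<in> S" "(torus_orbit d b, y') \<in> W0" for b y'
    using that in_chart[of b n d F] unfolding S_def W0_def R0_def Ch_def by blast
  \<comment> \<open>Nonzero exactly where \<open>q1\<close> is nonzero at the point and
    \<open>q2\<close> at its image under \<Phi>, so that both maps are given by their
    formulas.\<close>
  define P0 where "P0 = q1 * poly_eval (Poly_Mapping.single 0) \<Phi> q2"
  have P0: "poly_value P0 x = poly_value q1 x * poly_value q2 (Z x)" for x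
    by (simp add: P0_def poly_value_compose Z_def)
  show thesis
  proof (rule that[of N \<Phi> a0 P0 q2 \<Psi>])
    show "\<Phi> j = 0" if "j > N" for j using that by (simp add: \<Phi>_def)
    show "a0 \<in> cover_cone n d F" "a0 (XC 1) \<noteq> 0" "a0 (TC 1) \<noteq> 0" using a0 by (simp_all add: S_def)
    show "poly_value P0 a0 \<noteq> 0" using pq(1) pq2(1) by (simp add: P0)
  next
    fix x assume "x \<in> cover_cone n d F" "poly_value P0 x \<noteq> 0"
    then have x: "x \<in> S" "poly_value q1 x \<noteq> 0" "poly_value q2 (Z x) \<noteq> 0" by (simp_all add: S_def P0)
    note Zx = Z[OF x(1,2)]
    have "ray (Z x) \<in> W2" using pq2(2)[of "Z x"] Zx x(3) by simp
    then have "(torus_orbit d x, y) \<in> W0" using Zx unfolding W02[symmetric] by simp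
    then have "poly_value q2 (Z x) / x (XC 1) \<noteq> 0" "poly_value q2 (Z x) / x (TC 1) \<noteq> 0"
      using nz[OF x(1)] x(3) by simp_all
    moreover have "(\<lambda>c. poly_value (\<Psi> c) (Z x)) =
        torus_act d (poly_value q2 (Z x) / x (XC 1)) (poly_value q2 (Z x) / x (TC 1)) x"
      by (rule \<Psi>[where y' = y]) (use Zx x in simp_all)
    ultimately have "(\<lambda>c. poly_value (\<Psi> c) (Z x)) \<in> torus_orbit d x"
      unfolding torus_orbit_def by blast
    moreover have "Z x \<noteq> (\<lambda>_. 0)" using Zx unfolding C_def by blast
    ultimately show "(\<lambda>j. poly_value (\<Phi> j) x) \<noteq> (\<lambda>_. 0) \<and> poly_value q2 (\<lambda>j. poly_value (\<Phi> j) x) \<noteq> 0 \<and>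
      (\<lambda>c. poly_value (\<Psi> c) (\<lambda>j. poly_value (\<Phi> j) x)) \<in> torus_orbit d x"
      using x(3) unfolding Z_def by blast
  next
    fix z assume "z \<in> affine_space {..N}" "z \<noteq> (\<lambda>_. 0)" and q2: "poly_value q2 z \<noteq> 0"
    then have zC: "z \<in> C" by (simp add: C_def)
    then have "ray z \<in> W2" using pq2(2) q2 by blast
    then obtain w where w: "w \<in> W0" "\<phi> w = ray z" unfolding W2_def by force
    obtain D' y' where Dy': "w = (D', y')" by (cases w)
    then have "D' \<in> Ch" using w(1) unfolding W0_def R0_def by blast
    then obtain b where b: "D' = torus_orbit d b" "b \<in> S" unfolding Ch_def chart_def S_def by blast
    have bW: "(torus_orbit d b, y') \<in> W0" using w(1) Dy' b(1) by simp
    then have bU: "(torus_orbit d b, y') \<in> U" unfolding W0_def by blast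
    have "\<phi> (torus_orbit d b, y') = ray z" using w(2) Dy' b(1) by simp
    from \<Psi>[OF zC q2 b(2) bU this]
    show "(\<lambda>c. poly_value (\<Psi> c) z) \<in> cover_cone n d F"
      using torus_act_cover_cone[of b n d F] b(2) nz[OF b(2) bW] q2 unfolding S_def by simp
  qed
qed

section \<open>Very general branch divisors\<close>

instance coord :: countable
  by countable_datatype

text \<open>This makes the integral polynomials countable, so that they define countably many closed
  conditions.\<close>

instance poly_mapping :: (countable, "{countable, zero}") countable
proof
  have "inj (\<lambda>p :: 'a \<Rightarrow>\<^sub>0 'b. (\<lambda>k. (k, Poly_Mapping.lookup p k)) ` Poly_Mapping.keys p)"
  proof (rule injI)
    fix p q :: "'a \<Rightarrow>\<^sub>0 'b"
    assume eq: "(\<lambda>k. (k, Poly_Mapping.lookup p k)) ` Poly_Mapping.keys p = (\<lambda>k. (k, Poly_Mapping.lookup q k)) ` Poly_Mapping.keys q"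
    have keys: "Poly_Mapping.keys r = fst ` (\<lambda>k. (k, Poly_Mapping.lookup r k)) ` Poly_Mapping.keys r" for r :: "'a \<Rightarrow>\<^sub>0 'b"
      by (simp add: image_image)
    have k: "Poly_Mapping.keys p = Poly_Mapping.keys q" using keys[of p] keys[of q] eq by simp
    show "p = q"
    proof (rule poly_mapping_eqI)
      fix k
      show "Poly_Mapping.lookup p k = Poly_Mapping.lookup q k"
      proof (cases "k \<in> Poly_Mapping.keys p")
        case True
        then have "(k, Poly_Mapping.lookup p k) \<in> (\<lambda>k. (k, Poly_Mapping.lookup q k)) ` Poly_Mapping.keys q"
          unfolding eq[symmetric] by blast
        then show ?thesis by auto
      next
        case False
        then show ?thesis using k by (metis in_keys_iff)
      qed
    qed
  qed
  moreover have "countable {A :: ('a \<times> 'b) set. finite A}" by (rule countable_Collect_finite)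
  then have "countable (range (\<lambda>p :: 'a \<Rightarrow>\<^sub>0 'b. (\<lambda>k. (k, Poly_Mapping.lookup p k)) ` Poly_Mapping.keys p))"
    by (rule countable_subset[rotated]) auto
  ultimately have "countable (UNIV :: ('a \<Rightarrow>\<^sub>0 'b) set)" by (rule countable_image_inj_on[rotated])
  then show "\<exists>f :: ('a \<Rightarrow>\<^sub>0 'b) \<Rightarrow> nat. inj f" unfolding countable_def by blast
qed

definition homogenise :: "'v \<Rightarrow> (('v \<Rightarrow>\<^sub>0 nat) \<Rightarrow>\<^sub>0 int) \<Rightarrow> 'v Defs.polynomial"
  where "homogenise v p =
    (let deg = \<lambda>m. \<Sum>k\<in>Poly_Mapping.keys m. Poly_Mapping.lookup m k;
         D = Suc (Max (insert 0 (deg ` Poly_Mapping.keys p)))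
     in \<Sum>m\<in>Poly_Mapping.keys p. Poly_Mapping.single (m + Poly_Mapping.single v (D - deg m)) (of_int (Poly_Mapping.lookup p m)))"

lemma poly_value_sum [simp]: "poly_value (\<Sum>i\<in>A. f i) x = (\<Sum>i\<in>A. poly_value (f i) x)"
  by (induction A rule: infinite_finite_induct) simp_all

text \<open>The degree exceeds that of \<open>p\<close>, so that the homogenisation also vanishes where \<open>F v = 0\<close>.\<close>

lemma homogenise_eq_0_iff:
  fixes p :: "('v \<Rightarrow>\<^sub>0 nat) \<Rightarrow>\<^sub>0 int"
  shows "poly_value (homogenise v p) F = 0 \<longleftrightarrow> F v = 0 \<or> poly_eval of_int (\<lambda>m. F m / F v) p = 0"
proof -
  define deg where "deg m = (\<Sum>k\<in>Poly_Mapping.keys m. Poly_Mapping.lookup m k)" for m :: "'v \<Rightarrow>\<^sub>0 nat"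
  define D where "D = Suc (Max (insert 0 (deg ` Poly_Mapping.keys p)))"
  have D: "deg m < D" if "m \<in> Poly_Mapping.keys p" for m
    unfolding D_def using that by (intro le_imp_less_Suc Max_ge) auto
  have h: "poly_value (homogenise v p) F =
      (\<Sum>m\<in>Poly_Mapping.keys p. of_int (Poly_Mapping.lookup p m) * (mon_eval m F * F v ^ (D - deg m)))"
    unfolding homogenise_def Let_def deg_def[symmetric] D_def[symmetric]
    by (simp add: poly_value_eq_poly_eval[of "Poly_Mapping.single _ _"] poly_eval_single mon_eval_add)
  show ?thesis
  proof (cases "F v = 0")
    case True
    have z: "F v ^ (D - deg m) = 0" if "m \<in> Poly_Mapping.keys p" for m using D[OF that] True by simp
    have "poly_value (homogenise v p) F = 0" unfolding h by (intro sum.neutral ballI) (simp only: z mult_zero_right)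
    then show ?thesis using True by simp
  next
    case False
    have "mon_eval m F * F v ^ (D - deg m) = F v ^ D * mon_eval m (\<lambda>m. F m / F v)" if "m \<in> Poly_Mapping.keys p" for m
    proof -
      have "mon_eval m F = F v ^ deg m * mon_eval m (\<lambda>m. F m / F v)"
        using False by (simp add: mon_eval_def deg_def power_sum prod.distrib[symmetric] power_divide)
      moreover have "F v ^ D = F v ^ deg m * F v ^ (D - deg m)" using D[OF that] by (simp flip: power_add)
      ultimately show ?thesis by simp
    qed
    then have "poly_value (homogenise v p) F = F v ^ D * poly_eval of_int (\<lambda>m. F m / F v) p"
      unfolding h poly_eval_def sum_distrib_left by (intro sum.cong) simp_all
    then show ?thesis using False by simp
  qed
qed

text \<open>A form outside a countable union of hypersurfaces with integral equations is a
  \<open>good_form\<close>, and no multiple of it can have a stably rational cover.\<close>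

theorem corollary1p3:
  fixes n d :: nat
  assumes "n \<ge> 3" and "2 * d \<ge> n"
  shows "for_very_general (divisor_space n (2 * d) 2)
           (\<lambda>D. \<forall>F\<in>D. \<not> stably_rational (double_cover n d F))"
proof -
  let ?I = "bimonomials n (2 * d) 2"
  let ?m0 = "lead_mon n d"
  define bad :: "((coord monomial \<Rightarrow>\<^sub>0 nat) \<Rightarrow>\<^sub>0 int) \<Rightarrow> (coord monomial \<Rightarrow> complex) \<Rightarrow> bool"
    where "bad p F \<longleftrightarrow> poly_value (homogenise ?m0 p) F = 0" for p F
  have bad_scale: "bad p (\<lambda>m. c * F m) \<longleftrightarrow> bad p F" if "c \<noteq> 0" for p c F
    using that unfolding bad_def homogenise_eq_0_iff by simp
  define Zs where "Zs p = ray ` {F \<in> punctured ?I. bad p F}" for p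
  define C where "C = Zs ` {p. odd (poly_eval (\<lambda>c. c) (target n d) p)}"
  have pts: "points (divisor_space n (2 * d) 2) = ray ` punctured ?I"
    unfolding proj_space_on_eq points_quot ..
  have inZ: "ray F \<in> Zs p \<longleftrightarrow> bad p F" if "F \<in> punctured ?I" for p F
  proof
    assume "ray F \<in> Zs p"
    then obtain G where G: "ray G = ray F" "bad p G" unfolding Zs_def by auto
    then obtain c where "c \<noteq> 0" "F = (\<lambda>m. c * G m)" using ray_eqD by blast
    then show "bad p F" using bad_scale G(2) by simp
  qed (use that in \<open>auto simp: Zs_def\<close>)
  have closed: "closedin (topo (divisor_space n (2 * d) 2)) (Zs p)" for p
  proof -
    have "openin (topo (divisor_space n (2 * d) 2)) (ray ` punctured ?I - Zs p)"
      unfolding proj_space_on_eq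
      by (rule quot_openI[where q = "homogenise ?m0 p"]) (use inZ in \<open>auto simp: bad_def\<close>)
    moreover have "Zs p \<subseteq> ray ` punctured ?I" unfolding Zs_def by blast
    ultimately show ?thesis unfolding closedin_def pts by simp
  qed
  \<comment> \<open>The integral form \<open>target\<close>, regarded over \<complex>, lies outside:
    there the equation takes an odd value, and an odd integer is not 0.\<close>
  have proper: "Zs p \<noteq> points (divisor_space n (2 * d) 2)" if p: "odd (poly_eval (\<lambda>c. c) (target n d) p)" for p
  proof
    assume eq: "Zs p = points (divisor_space n (2 * d) 2)"
    define F where "F m = (of_int (target n d m) :: complex)" for m
    have lead: "F ?m0 = 1" by (simp add: F_def target_lead)
    have "target n d m = 0" if "m \<notin> ?I" for m
    proof -
      have mem: "bimon n (exps n d j) a b \<in> ?I" if "j \<le> n" "a + b = 2" for j a b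
        using that sum_exps[OF assms] by (intro bimon_in_bimonomials) auto
      have "m \<noteq> bimon n (exps n d j) a b" if "j \<le> n" "a + b = 2" for j a b using mem[OF that] \<open>m \<notin> ?I\<close> by blast
      then show ?thesis by (simp add: target_def)
    qed
    then have "F \<in> affine_space ?I" unfolding affine_space_def F_def by simp
    then have FI: "F \<in> punctured ?I" using lead by (auto dest: fun_cong[of _ _ ?m0])
    have "ray F \<in> Zs p" unfolding eq pts using FI by (rule imageI)
    then have "poly_eval of_int (\<lambda>m. F m / F ?m0) p = 0"
      using inZ[OF FI] lead unfolding bad_def homogenise_eq_0_iff by simp
    moreover have "(\<lambda>m. F m / F ?m0) = (\<lambda>m. of_int (target n d m))" by (simp add: lead) (simp add: F_def)
    moreover have "poly_eval of_int (\<lambda>m. of_int (target n d m)) p = (of_int (poly_eval (\<lambda>c. c) (target n d) p) :: complex)"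
    proof -
      have "comm_ring_hom (of_int :: int \<Rightarrow> complex)" by unfold_locales auto
      from poly_eval_hom[OF this, of "\<lambda>c. c" "target n d" p] show ?thesis by simp
    qed
    ultimately have "poly_eval (\<lambda>c. c) (target n d) p = 0" by simp
    then show False using p by simp
  qed
  have "\<not> stably_rational (double_cover n d F)"
    if D: "D \<in> points (divisor_space n (2 * d) 2) - \<Union> C" and FD: "F \<in> D" for D F
  proof
    assume sr: "stably_rational (double_cover n d F)"
    obtain G where G: "D = ray G" "G \<in> punctured ?I" using D unfolding pts by blast
    have "\<not> bad p G" if "odd (poly_eval (\<lambda>c. c) (target n d) p)" for p
      using D that inZ[OF G(2)] unfolding C_def G(1) by blast
    moreover obtain c where "c \<noteq> 0" "F = (\<lambda>m. c * G m)" using FD unfolding G(1) ray_def by blast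
    ultimately have nb: "\<not> bad p F" if "odd (poly_eval (\<lambda>c. c) (target n d) p)" for p
      using that bad_scale by simp
    \<comment> \<open>The constant polynomial 1 is among the conditions. Its homogenisation is the
      leading variable itself, so this case says that the leading coefficient is not 0.\<close>
    have "odd (poly_eval (\<lambda>c. c) (target n d) (1 :: (coord monomial \<Rightarrow>\<^sub>0 nat) \<Rightarrow>\<^sub>0 int))"
      using poly_eval_single[of "\<lambda>c :: int. c" "target n d" 0 1] by simp
    from nb[OF this] have "F ?m0 \<noteq> 0" unfolding bad_def homogenise_eq_0_iff by blast
    then have good: "good_form n d F"
      using nb unfolding good_form_def bad_def homogenise_eq_0_iff by blast
    have n1: "n > 1" using assms(1) by simp
    from n1 sr show False
      by (rule stably_rational_parametrisation) (rule no_parametrisation[OF assms good])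
  qed
  moreover have "countable C" unfolding C_def by (intro countable_image) simp
  ultimately show ?thesis
    unfolding for_very_general_def
    by (intro exI[of _ C]) (use closed proper in \<open>auto simp: C_def\<close>)
qed

end
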